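(* Let $\mathbb{K}$ be a field, let $(S,\leq,\mathfrak{b})$ be a poset with bonds, let $A$ be the discrete LS algebra over $(S,\leq,\mathfrak{b})$ and let $X=\mathrm{Proj}(A)$. For a chain $\mathcal{C}$ in $S$ let $X_{\mathcal{C}}=\mathrm{Proj}(A_{\mathcal{C}})\subseteq X$. Then the subvarieties $X_{\mathcal{C}}$, as $\mathcal{C}$ runs over the set of maximal chains of $S$, are the irreducible components of $X$. They are projective (normal) toric varieties, and they intersect along (normal) toric subvarieties.
   Context: Poset with bonds: $(S,\leq)$ is a finite poset with a unique minimal element and a unique maximal element, and it is graded, i.e. all complete (saturated) chains with the same initial and final elements have the same number of elements. The element $\tau$ covers $\sigma$ if $\sigma<\tau$ and no element lies strictly between them. A set of bonds on $S$ is a map $\mathfrak{b}$ from pairs $(\sigma,\tau)$, with $\tau$ covering $\sigma$, to positive integers such that for any two complete chains $\sigma=\eta_{i,1}<\eta_{i,2}<\cdots<\eta_{i,r}=\tau$, $i=1,2$, from $\sigma$ to $\tau$ one has $\gcd_{1\leq k\leq r-1}\mathfrak{b}(\eta_{1,k},\eta_{1,k+1})=\gcd_{1\leq k\leq r-1}\mathfrak{b}(\eta_{2,k},\eta_{2,k+1})$. For any $\sigma<\tau$, $\mathfrak{b}(\sigma,\tau)$ denotes this common gcd along a complete chain from $\sigma$ to $\tau$. LS-paths: a function $\pi:S\to\mathbb{Q}$ is an LS-path of degree $r\in\mathbb{N}=\{0,1,2,\ldots\}$ if (1) $\pi(\sigma)\geq 0$ for all $\sigma$; (2) $\mathrm{supp}\,\pi=\{\sigma\mid\pi(\sigma)\neq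 0\}$ is totally ordered; (3) if $\mathrm{supp}\,\pi=\{\sigma_1<\cdots<\sigma_n\}$, then $\mathfrak{b}(\sigma_j,\sigma_{j+1})\sum_{i=1}^j\pi(\sigma_i)\in\mathbb{N}$ for $j=1,\ldots,n-1$ and $\sum_{i=1}^n\pi(\sigma_i)=r$. $\mathrm{LS}_1$ is the (finite) set of LS-paths of degree $1$. LS-paths have comparable supports if the union of their supports is contained in a chain; then their sum $\dotplus$ as functions on $S$ is an LS-path. Standard monomials: a formal commutative monomial $\pi_1\cdots\pi_r$ of degree $1$ LS-paths is standard if (up to reordering) $\max\mathrm{supp}\,\pi_h\leq\min\mathrm{supp}\,\pi_{h+1}$ for $h=1,\ldots,r-1$. Every LS-path of degree $r$ is uniquely a sum $\pi_{0,1}\dotplus\cdots\dotplus\pi_{0,r}$ with $\pi_{0,1}\cdots\pi_{0,r}$ standard. If $\pi_1,\ldots,\pi_r$ are of degree $1$ with comparable supports, the canonical form of $\pi_1\cdots\pi_r$ is the standard monomial $\pi_{0,1}\cdots\pi_{0,r}$ with $\pi_{0,1}\dotplus\cdots\dotplus\pi_{0,r}=\pi_1\dotplus\cdots\dotplus\pi_r$. Discrete LS algebra: $A\simeq R/I$, where $R=\mathbb{K}[x_\pi\mid\pi\in\mathrm{LS}_1]$ is the polynomial ring with the standard grading and $I$ is the ideal generated, as $\pi_1\pi_2$ runs over all non-standard monomials of degree $2$, by $x_{\pi_1}x_{\pi_2}-x_{\pi_{0,1}}x_{\pi_{0,2}}$ if $\pi_1,\pi_2$ have comparable supports and $\pi_{0,1}\pi_{0,2}$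 is the canonical form of $\pi_1\pi_2$, and by $x_{\pi_1}x_{\pi_2}$ if the supports of $\pi_1,\pi_2$ are not comparable. The subvarieties $X_{\mathcal{C}}$: for a chain $\mathcal{C}$ in $S$, let $I_{\mathcal{C}}$ be the ideal of $R$ generated by $I$ and by all $x_\pi$, $\pi\in\mathrm{LS}_1$, with $\mathrm{supp}\,\pi\not\subseteq\mathcal{C}$. Put $A_{\mathcal{C}}=R/I_{\mathcal{C}}$ (this is the discrete LS algebra of the totally ordered set $\mathcal{C}$ with the restricted bonds); the quotient map $A\to A_{\mathcal{C}}$ gives the closed inclusion $X_{\mathcal{C}}=\mathrm{Proj}(A_{\mathcal{C}})\subseteq X=\mathrm{Proj}(A)$. "Intersect along (normal) toric subvarieties" means that the intersection of two of these components is a closed subvariety which is itself a (normal) toric variety. *)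

theory Defs
  imports
    "HOL-Library.Multiset"
    "HOL-Library.Poly_Mapping"
    "HOL-Analysis.Abstract_Topology"
    "HOL-Algebra.QuotRing"
    "HOL-Algebra.Generated_Rings"
begin

section \<open>Algebras over a field\<close>

text \<open>
  A \<open>'k\<close>-algebra is a HOL-Algebra ring together with its structure map \<open>cst\<close> from the field
  \<open>'k\<close>. A grading is passed separately, as the family of its homogeneous components.
\<close>

record ('a, 'k) kalg = "'a ring" +
  cst :: "'k \<Rightarrow> 'a"

definition base_alg :: "('k::field, 'k) kalg" where
  "base_alg = \<lparr>carrier = UNIV, mult = (*), one = 1, zero = 0, add = (+), cst = (\<lambda>c. c)\<rparr>"

definition quot_alg :: "('a, 'k) kalg \<Rightarrow> 'a set \<Rightarrow> ('a set, 'k) kalg" where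
  "quot_alg R I = ring.extend (R Quot I) (kalg.fields (\<lambda>c. I +>\<^bsub>R\<^esub> cst R c))"

definition quot_grading :: "('a, 'k) kalg \<Rightarrow> (nat \<Rightarrow> 'a set) \<Rightarrow> 'a set \<Rightarrow> nat \<Rightarrow> 'a set set" where
  "quot_grading R G I d = (\<lambda>f. I +>\<^bsub>R\<^esub> f) ` G d"

text \<open>
  \<open>laurent n B\<close> is the algebra of Laurent polynomials in \<open>n\<close> variables over \<open>B\<close>, that is, the
  tensor product of \<open>B\<close> with the group algebra of \<open>\<int>\<^sup>n\<close>. The lattice \<open>\<int>\<^sup>n\<close> is encoded by the integer
  sequences that vanish from position \<open>n\<close> on. A grading of \<open>B\<close> extends by putting the Laurent
  variables in degree 0.
\<close>

definition int_lattice :: "nat \<Rightarrow> (nat \<Rightarrow> int) set" where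
  "int_lattice n = {m. \<forall>i\<ge>n. m i = 0}"

definition lconst :: "('a, 'k) kalg \<Rightarrow> 'a \<Rightarrow> (nat \<Rightarrow> int) \<Rightarrow> 'a" where
  "lconst B b = (\<lambda>m. if m = (\<lambda>_. 0) then b else \<zero>\<^bsub>B\<^esub>)"

definition laurent :: "nat \<Rightarrow> ('a, 'k) kalg \<Rightarrow> ((nat \<Rightarrow> int) \<Rightarrow> 'a, 'k) kalg" where
  "laurent n B =
    \<lparr>carrier = {f. (\<forall>m. f m \<in> carrier B) \<and> (\<forall>m. m \<notin> int_lattice n \<longrightarrow> f m = \<zero>\<^bsub>B\<^esub>)
                 \<and> finite {m. f m \<noteq> \<zero>\<^bsub>B\<^esub>}},
     mult = (\<lambda>f g m. finsum B (\<lambda>u. f u \<otimes>\<^bsub>B\<^esub> g (\<lambda>i. m i - u i)) {u. f u \<noteq> \<zero>\<^bsub>B\<^esub>}),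
     one = lconst B \<one>\<^bsub>B\<^esub>,
     zero = (\<lambda>_. \<zero>\<^bsub>B\<^esub>),
     add = (\<lambda>f g m. f m \<oplus>\<^bsub>B\<^esub> g m),
     cst = (\<lambda>c. lconst B (cst B c))\<rparr>"

definition laurent_grading ::
    "nat \<Rightarrow> ('a, 'k) kalg \<Rightarrow> (nat \<Rightarrow> 'a set) \<Rightarrow> nat \<Rightarrow> ((nat \<Rightarrow> int) \<Rightarrow> 'a) set" where
  "laurent_grading n B G d = {f \<in> carrier (laurent n B). \<forall>m. f m \<in> G d}"


section \<open>Rings of fractions\<close>

text \<open>
  Fractions \<open>a/s\<close> with \<open>(a, s)\<close> in a prescribed set \<open>F\<close>, where \<open>a/s = b/t\<close> iff
  \<open>u(at - bs) = 0\<close> for some \<open>u \<in> S\<close>.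
\<close>

definition frac_cls ::
    "('a, 'm) ring_scheme \<Rightarrow> ('a \<times> 'a) set \<Rightarrow> 'a set \<Rightarrow> 'a \<Rightarrow> 'a \<Rightarrow> ('a \<times> 'a) set" where
  "frac_cls B F S a s =
    {(b, t) \<in> F. \<exists>u\<in>S. u \<otimes>\<^bsub>B\<^esub> (a \<otimes>\<^bsub>B\<^esub> t \<ominus>\<^bsub>B\<^esub> b \<otimes>\<^bsub>B\<^esub> s) = \<zero>\<^bsub>B\<^esub>}"

definition frac_ring ::
    "('a, 'm) ring_scheme \<Rightarrow> ('a \<times> 'a) set \<Rightarrow> 'a set \<Rightarrow> ('a \<times> 'a) set ring" where
  "frac_ring B F S =
    \<lparr>carrier = {frac_cls B F S a s | a s. (a, s) \<in> F},
     mult = (\<lambda>x y. \<Union>(a, s)\<in>x. \<Union>(b, t)\<in>y. frac_cls B F S (a \<otimes>\<^bsub>B\<^esub> b) (s \<otimes>\<^bsub>B\<^esub> t)),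
     one = frac_cls B F S \<one>\<^bsub>B\<^esub> \<one>\<^bsub>B\<^esub>,
     zero = frac_cls B F S \<zero>\<^bsub>B\<^esub> \<one>\<^bsub>B\<^esub>,
     add = (\<lambda>x y. \<Union>(a, s)\<in>x. \<Union>(b, t)\<in>y.
              frac_cls B F S (a \<otimes>\<^bsub>B\<^esub> t \<oplus>\<^bsub>B\<^esub> b \<otimes>\<^bsub>B\<^esub> s) (s \<otimes>\<^bsub>B\<^esub> t))\<rparr>"

definition fraction_field :: "('a, 'm) ring_scheme \<Rightarrow> ('a \<times> 'a) set ring" where
  "fraction_field D =
    frac_ring D (carrier D \<times> (carrier D - {\<zero>\<^bsub>D\<^esub>})) (carrier D - {\<zero>\<^bsub>D\<^esub>})"

definition to_fraction_field :: "('a, 'm) ring_scheme \<Rightarrow> 'a \<Rightarrow> ('a \<times> 'a) set" where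
  "to_fraction_field D a =
    frac_cls D (carrier D \<times> (carrier D - {\<zero>\<^bsub>D\<^esub>})) (carrier D - {\<zero>\<^bsub>D\<^esub>}) a \<one>\<^bsub>D\<^esub>"

definition integrally_closed :: "('a, 'm) ring_scheme \<Rightarrow> bool" where
  "integrally_closed D \<longleftrightarrow> domain D \<and>
    (\<forall>x\<in>carrier (fraction_field D).
      (\<exists>n>0. \<exists>c. (\<forall>i<n. c i \<in> carrier D) \<and>
         x [^]\<^bsub>fraction_field D\<^esub> (n::nat) \<oplus>\<^bsub>fraction_field D\<^esub>
           finsum (fraction_field D)
             (\<lambda>i. to_fraction_field D (c i) \<otimes>\<^bsub>fraction_field D\<^esub> x [^]\<^bsub>fraction_field D\<^esub> i) {..<n}
         = \<zero>\<^bsub>fraction_field D\<^esub>)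
      \<longrightarrow> x \<in> to_fraction_field D ` carrier D)"


section \<open>Ringed spaces over a field and their morphisms\<close>

text \<open>
  A sheaf is represented as the sheaf of sections of its etale space: a ringed space over \<open>'k\<close>
  consists of a topology, a stalk at every point with the structure map from \<open>'k\<close>, and for every
  open set \<open>U\<close> the set of sections over \<open>U\<close>, which are functions (undefined off \<open>U\<close>) mapping a point
  of \<open>U\<close> to a germ at that point. Ring operations on sections are pointwise, and restriction maps
  are restrictions of functions.
\<close>

record ('p, 'g, 'k) kspace =
  pts :: "'p topology"
  stalk :: "'p \<Rightarrow> 'g ring"
  scal :: "'p \<Rightarrow> 'k \<Rightarrow> 'g"
  sect :: "'p set \<Rightarrow> ('p \<Rightarrow> 'g) set"

text \<open>
  A morphism \<open>X \<rightarrow> Y\<close> is a pair \<open>(f, \<phi>)\<close> of a continuous map and local homomorphisms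
  \<open>\<phi> x : O\<^bsub>Y,f x\<^esub> \<rightarrow> O\<^bsub>X,x\<^esub>\<close> of \<open>'k\<close>-algebras that pull back sections to sections.
\<close>

type_synonym ('p, 'g, 'q, 'h) mor = "('p \<Rightarrow> 'q) \<times> ('p \<Rightarrow> 'h \<Rightarrow> 'g)"

definition morphism ::
    "('p, 'g, 'k) kspace \<Rightarrow> ('q, 'h, 'k) kspace \<Rightarrow> ('p, 'g, 'q, 'h) mor \<Rightarrow> bool" where
  "morphism X Y = (\<lambda>(f, \<phi>).
     continuous_map (pts X) (pts Y) f \<and>
     (\<forall>x\<in>topspace (pts X).
        \<phi> x \<in> ring_hom (stalk Y (f x)) (stalk X x) \<and>
        (\<forall>z\<in>carrier (stalk Y (f x)). \<phi> x z \<in> Units (stalk X x) \<longrightarrow> z \<in> Units (stalk Y (f x))) \<and>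
        (\<forall>c. \<phi> x (scal Y (f x) c) = scal X x c)) \<and>
     (\<forall>V s. openin (pts Y) V \<and> s \<in> sect Y V \<longrightarrow>
        restrict (\<lambda>x. \<phi> x (s (f x))) {x \<in> topspace (pts X). f x \<in> V}
          \<in> sect X {x \<in> topspace (pts X). f x \<in> V}))"

definition mor_id :: "('p, 'g, 'p, 'g) mor" where
  "mor_id = (\<lambda>x. x, \<lambda>x z. z)"

definition mor_comp ::
    "('q, 'h, 'r, 'i) mor \<Rightarrow> ('p, 'g, 'q, 'h) mor \<Rightarrow> ('p, 'g, 'r, 'i) mor" (infixr "\<circ>\<^sub>m" 55) where
  "\<gamma> \<circ>\<^sub>m \<phi> = (\<lambda>x. fst \<gamma> (fst \<phi> x), \<lambda>x z. snd \<phi> x (snd \<gamma> (fst \<phi> x) z))"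

text \<open>Equality of morphisms, ignoring values outside the relevant carriers.\<close>

definition mor_eq ::
    "('p, 'g, 'k) kspace \<Rightarrow> ('q, 'h, 'k) kspace \<Rightarrow>
     ('p, 'g, 'q, 'h) mor \<Rightarrow> ('p, 'g, 'q, 'h) mor \<Rightarrow> bool" where
  "mor_eq X Y f g \<longleftrightarrow> (\<forall>x\<in>topspace (pts X). fst f x = fst g x \<and>
     (\<forall>z\<in>carrier (stalk Y (fst f x)). snd f x z = snd g x z))"

definition isomorphism ::
    "('p, 'g, 'k) kspace \<Rightarrow> ('q, 'h, 'k) kspace \<Rightarrow> ('p, 'g, 'q, 'h) mor \<Rightarrow> bool" where
  "isomorphism X Y f \<longleftrightarrow> morphism X Y f \<and>
     (\<exists>g. morphism Y X g \<and> mor_eq X X (g \<circ>\<^sub>m f) mor_id \<and> mor_eq Y Y (f \<circ>\<^sub>m g) mor_id)"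

definition open_subspace :: "('p, 'g, 'k) kspace \<Rightarrow> 'p set \<Rightarrow> ('p, 'g, 'k) kspace" where
  "open_subspace X U = X\<lparr>pts := subtopology (pts X) U\<rparr>"

definition open_immersion ::
    "('p, 'g, 'k) kspace \<Rightarrow> ('q, 'h, 'k) kspace \<Rightarrow> ('p, 'g, 'q, 'h) mor \<Rightarrow> bool" where
  "open_immersion X Y f \<longleftrightarrow>
     morphism X Y f \<and> (\<exists>U. openin (pts Y) U \<and> isomorphism X (open_subspace Y U) f)"

definition irreducible_set :: "'p topology \<Rightarrow> 'p set \<Rightarrow> bool" where
  "irreducible_set T Z \<longleftrightarrow> Z \<subseteq> topspace T \<and> Z \<noteq> {} \<and>
     (\<forall>V W. closedin T V \<and> closedin T W \<and> Z \<subseteq> V \<union> W \<longrightarrow> Z \<subseteq> V \<or> Z \<subseteq> W)"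

definition irreducible_components :: "'p topology \<Rightarrow> 'p set set" where
  "irreducible_components T =
     {Z. irreducible_set T Z \<and> (\<forall>Z'. irreducible_set T Z' \<and> Z \<subseteq> Z' \<longrightarrow> Z' = Z)}"


section \<open>Spec and Proj\<close>

definition zariski :: "('a, 'm) ring_scheme \<Rightarrow> 'a set set \<Rightarrow> 'a set topology" where
  "zariski B Q = topology (\<lambda>U. \<exists>E\<subseteq>carrier B. U = {p \<in> Q. \<not> E \<subseteq> p})"

text \<open>\<open>zariski\<close> is applied only to sets \<open>Q\<close> of prime ideals, where it is indeed a topology.\<close>

lemma istopology_zariski:
  assumes "\<And>p. p \<in> Q \<Longrightarrow> primeideal p B"
  shows "istopology (\<lambda>U. \<exists>E\<subseteq>carrier B. U = {p \<in> Q. \<not> E \<subseteq> p})"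
  unfolding istopology_def
proof (intro conjI allI impI)
  fix U V
  assume "\<exists>E\<subseteq>carrier B. U = {p \<in> Q. \<not> E \<subseteq> p}" "\<exists>E\<subseteq>carrier B. V = {p \<in> Q. \<not> E \<subseteq> p}"
  then obtain E E' where E: "E \<subseteq> carrier B" "U = {p \<in> Q. \<not> E \<subseteq> p}"
    and E': "E' \<subseteq> carrier B" "V = {p \<in> Q. \<not> E' \<subseteq> p}"
    by blast
  let ?F = "(\<lambda>(x, y). x \<otimes>\<^bsub>B\<^esub> y) ` (E \<times> E')"
  have *: "(\<not> ?F \<subseteq> p) \<longleftrightarrow> (\<not> E \<subseteq> p) \<and> (\<not> E' \<subseteq> p)" if "p \<in> Q" for p
  proof -
    interpret primeideal p B by (rule assms[OF that])
    show ?thesis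
    proof
      assume "\<not> ?F \<subseteq> p"
      then obtain x y where "x \<in> E" "y \<in> E'" "x \<otimes>\<^bsub>B\<^esub> y \<notin> p" by auto
      moreover have "x \<in> carrier B" "y \<in> carrier B"
        using calculation E(1) E'(1) by auto
      ultimately show "(\<not> E \<subseteq> p) \<and> (\<not> E' \<subseteq> p)"
        using I_l_closed I_r_closed by blast
    next
      assume "(\<not> E \<subseteq> p) \<and> (\<not> E' \<subseteq> p)"
      then obtain x y where xy: "x \<in> E" "y \<in> E'" "x \<notin> p" "y \<notin> p" by blast
      then have "x \<otimes>\<^bsub>B\<^esub> y \<notin> p"
        using I_prime E(1) E'(1) by blast
      with xy show "\<not> ?F \<subseteq> p" by force
    qed
  qed
  have "?F \<subseteq> carrier B" if "p \<in> Q" for p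
  proof -
    interpret primeideal p B by (rule assms[OF that])
    show ?thesis using E(1) E'(1) by auto
  qed
  moreover have "U \<inter> V = {p \<in> Q. \<not> ?F \<subseteq> p}"
    unfolding E(2) E'(2) using * by blast
  ultimately show "\<exists>E\<subseteq>carrier B. U \<inter> V = {p \<in> Q. \<not> E \<subseteq> p}"
    by (cases "Q = {}") blast+
next
  fix \<U>
  assume "\<forall>U\<in>\<U>. \<exists>E\<subseteq>carrier B. U = {p \<in> Q. \<not> E \<subseteq> p}"
  then obtain E where E: "\<And>U. U \<in> \<U> \<Longrightarrow> E U \<subseteq> carrier B \<and> U = {p \<in> Q. \<not> E U \<subseteq> p}"
    by metis
  have "\<Union>\<U> = {p \<in> Q. \<not> (\<Union>U\<in>\<U>. E U) \<subseteq> p}" using E by blast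
  moreover have "(\<Union>U\<in>\<U>. E U) \<subseteq> carrier B" using E by blast
  ultimately show "\<exists>E\<subseteq>carrier B. \<Union>\<U> = {p \<in> Q. \<not> E \<subseteq> p}" by blast
qed

text \<open>
  The ringed space on a set \<open>Q\<close> of prime ideals of \<open>B\<close> whose stalk at \<open>p\<close> consists of the fractions
  in \<open>F p\<close>, and whose sections are the functions that are locally given by a single fraction.
\<close>

definition fraction_space ::
    "('a, 'k) kalg \<Rightarrow> 'a set set \<Rightarrow> ('a set \<Rightarrow> ('a \<times> 'a) set) \<Rightarrow> ('a set \<Rightarrow> 'a set) \<Rightarrow>
     ('a set, ('a \<times> 'a) set, 'k) kspace" where
  "fraction_space B Q F S =
    \<lparr>pts = zariski B Q,
     stalk = (\<lambda>p. frac_ring B (F p) (S p)),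
     scal = (\<lambda>p c. frac_cls B (F p) (S p) (cst B c) \<one>\<^bsub>B\<^esub>),
     sect = (\<lambda>U. {s \<in> (\<Pi>\<^sub>E p\<in>U. carrier (frac_ring B (F p) (S p))).
               \<forall>p\<in>U. \<exists>W a t. openin (zariski B Q) W \<and> p \<in> W \<and> W \<subseteq> U \<and>
                 (\<forall>q\<in>W. (a, t) \<in> F q \<and> s q = frac_cls B (F q) (S q) a t)})\<rparr>"

definition Spec_pts :: "('a, 'k) kalg \<Rightarrow> 'a set set" where
  "Spec_pts B = {p. primeideal p B}"

definition Spec_fracs :: "('a, 'k) kalg \<Rightarrow> 'a set \<Rightarrow> ('a \<times> 'a) set" where
  "Spec_fracs B p = carrier B \<times> (carrier B - p)"

definition Spec_mult :: "('a, 'k) kalg \<Rightarrow> 'a set \<Rightarrow> 'a set" where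
  "Spec_mult B p = carrier B - p"

definition Spec :: "('a, 'k) kalg \<Rightarrow> ('a set, ('a \<times> 'a) set, 'k) kspace" where
  "Spec B = fraction_space B (Spec_pts B) (Spec_fracs B) (Spec_mult B)"

definition homogeneous_ideal :: "('a, 'k) kalg \<Rightarrow> (nat \<Rightarrow> 'a set) \<Rightarrow> 'a set \<Rightarrow> bool" where
  "homogeneous_ideal B G p \<longleftrightarrow> p = genideal B (p \<inter> (\<Union>d. G d))"

definition Proj_pts :: "('a, 'k) kalg \<Rightarrow> (nat \<Rightarrow> 'a set) \<Rightarrow> 'a set set" where
  "Proj_pts B G = {p. primeideal p B \<and> homogeneous_ideal B G p \<and> \<not> (\<Union>d\<in>{0<..}. G d) \<subseteq> p}"

definition Proj_fracs :: "(nat \<Rightarrow> 'a set) \<Rightarrow> 'a set \<Rightarrow> ('a \<times> 'a) set" where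
  "Proj_fracs G p = (\<Union>d. G d \<times> (G d - p))"

definition Proj_mult :: "(nat \<Rightarrow> 'a set) \<Rightarrow> 'a set \<Rightarrow> 'a set" where
  "Proj_mult G p = (\<Union>d. G d) - p"

definition Proj :: "('a, 'k) kalg \<Rightarrow> (nat \<Rightarrow> 'a set) \<Rightarrow> ('a set, ('a \<times> 'a) set, 'k) kspace" where
  "Proj B G = fraction_space B (Proj_pts B G) (Proj_fracs G) (Proj_mult G)"

text \<open>
  The morphism from \<open>Spec D\<close>, respectively from \<open>Proj (D, H)\<close>, that is induced by a homomorphism
  \<open>\<phi> : C \<rightarrow> D\<close>. The target is \<open>Spec C\<close>, or \<open>Proj C\<close> if \<open>\<phi>\<close> is graded and the preimage of no point
  contains the irrelevant ideal; for source \<open>Proj (D, H)\<close> and target \<open>Spec C\<close> the image of \<open>\<phi>\<close> has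
  to be of degree 0.
\<close>

definition induced ::
    "('c, 'k) kalg \<Rightarrow> ('c \<Rightarrow> 'd) \<Rightarrow> ('d, 'k) kalg \<Rightarrow>
     ('d set \<Rightarrow> ('d \<times> 'd) set) \<Rightarrow> ('d set \<Rightarrow> 'd set) \<Rightarrow>
     ('d set, ('d \<times> 'd) set, 'c set, ('c \<times> 'c) set) mor" where
  "induced C \<phi> D F S =
     (\<lambda>q. {x \<in> carrier C. \<phi> x \<in> q},
      \<lambda>q z. \<Union>(a, s)\<in>z. frac_cls D (F q) (S q) (\<phi> a) (\<phi> s))"

definition Spec_induced ::
    "('c, 'k) kalg \<Rightarrow> ('c \<Rightarrow> 'd) \<Rightarrow> ('d, 'k) kalg \<Rightarrow>
     ('d set, ('d \<times> 'd) set, 'c set, ('c \<times> 'c) set) mor" where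
  "Spec_induced C \<phi> D = induced C \<phi> D (Spec_fracs D) (Spec_mult D)"

definition Proj_induced ::
    "('c, 'k) kalg \<Rightarrow> ('c \<Rightarrow> 'd) \<Rightarrow> ('d, 'k) kalg \<Rightarrow> (nat \<Rightarrow> 'd set) \<Rightarrow>
     ('d set, ('d \<times> 'd) set, 'c set, ('c \<times> 'c) set) mor" where
  "Proj_induced C \<phi> D H = induced C \<phi> D (Proj_fracs H) (Proj_mult H)"


section \<open>Toric varieties\<close>

definition torus_alg :: "nat \<Rightarrow> ((nat \<Rightarrow> int) \<Rightarrow> 'k, 'k::field) kalg" where
  "torus_alg n = laurent n base_alg"

abbreviation torus ::
    "nat \<Rightarrow> (((nat \<Rightarrow> int) \<Rightarrow> 'k) set, (((nat \<Rightarrow> int) \<Rightarrow> 'k) \<times> ((nat \<Rightarrow> int) \<Rightarrow> 'k)) set, 'k::field) kspace"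
  where "torus n \<equiv> Spec (torus_alg n)"

text \<open>
  Let \<open>T\<close> be the torus of rank \<open>n\<close>. The product of \<open>T\<close> with \<open>Spec D\<close> (with \<open>Proj D\<close>) is the
  spectrum (Proj) of \<open>laurent n D\<close>. The following are the comorphisms of the projection to \<open>T\<close>, of the
  map \<open>(s, t, y) \<mapsto> s t\<close> from \<open>T \<times> T \<times> Y\<close> to \<open>T\<close>, and of the constant map from \<open>Y\<close> to the
  neutral element of \<open>T\<close>, where \<open>Y\<close> belongs to \<open>D\<close>. The comorphism of the projection to \<open>Y\<close> is
  \<open>lconst D\<close>.
\<close>

definition torus_proj_hom :: "('d, 'k) kalg \<Rightarrow> ((nat \<Rightarrow> int) \<Rightarrow> 'k) \<Rightarrow> (nat \<Rightarrow> int) \<Rightarrow> 'd" where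
  "torus_proj_hom D f = (\<lambda>m. cst D (f m))"

definition torus_mult_hom ::
    "('d, 'k) kalg \<Rightarrow> ((nat \<Rightarrow> int) \<Rightarrow> 'k) \<Rightarrow> (nat \<Rightarrow> int) \<Rightarrow> (nat \<Rightarrow> int) \<Rightarrow> 'd" where
  "torus_mult_hom D f = (\<lambda>u v. if u = v then cst D (f u) else \<zero>\<^bsub>D\<^esub>)"

definition torus_unit_hom :: "('d, 'k::field) kalg \<Rightarrow> ((nat \<Rightarrow> int) \<Rightarrow> 'k) \<Rightarrow> 'd" where
  "torus_unit_hom D f = cst D (\<Sum>m | f m \<noteq> 0. f m)"

text \<open>
  \<open>h\<close> is the morphism from \<open>W\<close> to the product of the torus and \<open>Proj (B, G)\<close> with components
  \<open>f\<close> and \<open>g\<close>.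
\<close>

definition is_pairing where
  "is_pairing n (B :: ('a, 'k::field) kalg) G W f g h \<longleftrightarrow>
     morphism W (Proj (laurent n B) (laurent_grading n B G)) h \<and>
     mor_eq W (torus n)
       (Proj_induced (torus_alg n) (torus_proj_hom B) (laurent n B) (laurent_grading n B G) \<circ>\<^sub>m h) f \<and>
     mor_eq W (Proj B G)
       (Proj_induced B (lconst B) (laurent n B) (laurent_grading n B G) \<circ>\<^sub>m h) g"

text \<open>\<open>act\<close> is an action of the torus of rank \<open>n\<close> on \<open>Proj (B, G)\<close>.\<close>

definition is_action where
  "is_action n (B :: ('a, 'k::field) kalg) G act \<longleftrightarrow>
    (let L = laurent n B; H = laurent_grading n B G;
         L2 = laurent n L; H2 = laurent_grading n L H;
         X = Proj B G; TX = Proj L H; TTX = Proj L2 H2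
     in morphism TX X act \<and>
        (\<exists>h. is_pairing n B G X (Proj_induced (torus_alg n) (torus_unit_hom B) B G) mor_id h \<and>
             mor_eq X X (act \<circ>\<^sub>m h) mor_id) \<and>
        (\<exists>h\<^sub>1 h\<^sub>2.
           is_pairing n B G TTX
             (Proj_induced (torus_alg n) (torus_proj_hom L) L2 H2)
             (act \<circ>\<^sub>m Proj_induced L (lconst L) L2 H2) h\<^sub>1 \<and>
           is_pairing n B G TTX
             (Proj_induced (torus_alg n) (torus_mult_hom B) L2 H2)
             (Proj_induced B (lconst B) L H \<circ>\<^sub>m Proj_induced L (lconst L) L2 H2) h\<^sub>2 \<and>
           mor_eq TTX X (act \<circ>\<^sub>m h\<^sub>1) (act \<circ>\<^sub>m h\<^sub>2)))"

text \<open>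
  \<open>act\<close> extends the action of the torus on itself by multiplication, along the immersion \<open>j\<close>:
  the square with \<open>id \<times> j : T \<times> T \<rightarrow> T \<times> X\<close> commutes.
\<close>

definition extends_mult where
  "extends_mult n (B :: ('a, 'k::field) kalg) G j act \<longleftrightarrow>
    (let A = (torus_alg n :: (_, 'k) kalg); A2 = laurent n A; TT = Spec A2
     in \<exists>h. is_pairing n B G TT
              (Spec_induced A (torus_proj_hom A) A2)
              (j \<circ>\<^sub>m Spec_induced A (lconst A) A2) h \<and>
            mor_eq TT (Proj B G) (act \<circ>\<^sub>m h) (j \<circ>\<^sub>m Spec_induced A (torus_mult_hom base_alg) A2))"

text \<open>
  For \<open>(B, G)\<close> satisfying \<open>standard_graded\<close>, \<open>Proj (B, G)\<close> is a closed subscheme of a projective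
  space, hence separated and of finite type over \<open>'k\<close>; it is then a normal variety iff it is
  irreducible and its stalks are integrally closed domains.
\<close>

definition standard_graded :: "('a, 'k) kalg \<Rightarrow> (nat \<Rightarrow> 'a set) \<Rightarrow> bool" where
  "standard_graded B G \<longleftrightarrow>
     (\<exists>E. finite E \<and> E \<subseteq> G 1 \<and> carrier B = generate_ring B (range (cst B) \<union> E))"

definition integral_normal :: "('p, 'g, 'k) kspace \<Rightarrow> bool" where
  "integral_normal X \<longleftrightarrow> irreducible_set (pts X) (topspace (pts X)) \<and>
     (\<forall>x\<in>topspace (pts X). integrally_closed (stalk X x))"

definition projective_normal_toric :: "('a, 'k::field) kalg \<Rightarrow> (nat \<Rightarrow> 'a set) \<Rightarrow> bool" where
  "projective_normal_toric B G \<longleftrightarrow>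
     standard_graded B G \<and> integral_normal (Proj B G) \<and>
     (\<exists>n j act. open_immersion (torus n) (Proj B G) j \<and>
        is_action n B G act \<and> extends_mult n B G j act)"


section \<open>Posets with bonds and LS-paths\<close>

definition covers :: "'s::order \<Rightarrow> 's \<Rightarrow> bool" where
  "covers \<sigma> \<tau> \<longleftrightarrow> \<sigma> < \<tau> \<and> \<not> (\<exists>\<eta>. \<sigma> < \<eta> \<and> \<eta> < \<tau>)"

definition complete_chain :: "'s::order \<Rightarrow> 's \<Rightarrow> 's list \<Rightarrow> bool" where
  "complete_chain \<sigma> \<tau> xs \<longleftrightarrow> xs \<noteq> [] \<and> hd xs = \<sigma> \<and> last xs = \<tau> \<and> successively covers xs"

definition chain_gcd :: "('s \<Rightarrow> 's \<Rightarrow> nat) \<Rightarrow> 's list \<Rightarrow> nat" where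
  "chain_gcd b xs = Gcd {b (xs ! k) (xs ! Suc k) | k. Suc k < length xs}"

text \<open>Only the values of the bonds on covering pairs matter.\<close>

definition poset_with_bonds :: "('s::{finite, order} \<Rightarrow> 's \<Rightarrow> nat) \<Rightarrow> bool" where
  "poset_with_bonds b \<longleftrightarrow>
     (\<exists>!\<sigma>::'s. \<forall>\<tau>. \<not> \<tau> < \<sigma>) \<and> (\<exists>!\<sigma>::'s. \<forall>\<tau>. \<not> \<sigma> < \<tau>) \<and>
     (\<forall>(\<sigma>::'s) \<tau> xs ys. complete_chain \<sigma> \<tau> xs \<and> complete_chain \<sigma> \<tau> ys \<longrightarrow> length xs = length ys) \<and>
     (\<forall>\<sigma> \<tau>. covers \<sigma> \<tau> \<longrightarrow> 0 < b \<sigma> \<tau>) \<and>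
     (\<forall>\<sigma> \<tau> xs ys. complete_chain \<sigma> \<tau> xs \<and> complete_chain \<sigma> \<tau> ys \<longrightarrow>
        chain_gcd b xs = chain_gcd b ys)"

definition bond :: "('s::order \<Rightarrow> 's \<Rightarrow> nat) \<Rightarrow> 's \<Rightarrow> 's \<Rightarrow> nat" where
  "bond b \<sigma> \<tau> = (THE g. \<exists>xs. complete_chain \<sigma> \<tau> xs \<and> g = chain_gcd b xs)"

abbreviation (input) is_chain :: "'s::order set \<Rightarrow> bool" where
  "is_chain \<equiv> Complete_Partial_Order.chain (\<le>)"

definition maximal_chain :: "'s::order set \<Rightarrow> bool" where
  "maximal_chain C \<longleftrightarrow> is_chain C \<and> (\<forall>D. is_chain D \<and> C \<subseteq> D \<longrightarrow> D = C)"

definition supp :: "('s \<Rightarrow> rat) \<Rightarrow> 's set" where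
  "supp \<pi> = {\<sigma>. \<pi> \<sigma> \<noteq> 0}"

definition LS_path :: "('s::order \<Rightarrow> 's \<Rightarrow> nat) \<Rightarrow> nat \<Rightarrow> ('s \<Rightarrow> rat) \<Rightarrow> bool" where
  "LS_path b r \<pi> \<longleftrightarrow>
     (\<forall>\<sigma>. 0 \<le> \<pi> \<sigma>) \<and> is_chain (supp \<pi>) \<and>
     (\<exists>xs. sorted_wrt (<) xs \<and> set xs = supp \<pi> \<and>
        (\<forall>j. Suc j < length xs \<longrightarrow>
           of_nat (bond b (xs ! j) (xs ! Suc j)) * (\<Sum>i\<le>j. \<pi> (xs ! i)) \<in> \<nat>) \<and>
        (\<Sum>i<length xs. \<pi> (xs ! i)) = of_nat r)"

definition LS1 :: "('s::order \<Rightarrow> 's \<Rightarrow> nat) \<Rightarrow> ('s \<Rightarrow> rat) set" where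
  "LS1 b = {\<pi>. LS_path b 1 \<pi>}"

definition comparable_supports :: "('s::order \<Rightarrow> rat) multiset \<Rightarrow> bool" where
  "comparable_supports M \<longleftrightarrow> is_chain (\<Union>\<pi>\<in>set_mset M. supp \<pi>)"

text \<open>
  Formal monomials in LS-paths are multisets. As supports are finite chains and nonempty in degree
  1, \<open>max supp \<pi> \<le> min supp \<rho>\<close> says that every element of \<open>supp \<pi>\<close> is below every element of
  \<open>supp \<rho>\<close>.
\<close>

definition standard :: "('s::order \<Rightarrow> rat) multiset \<Rightarrow> bool" where
  "standard M \<longleftrightarrow>
     (\<exists>\<pi>s. mset \<pi>s = M \<and> successively (\<lambda>\<pi> \<rho>. \<forall>\<sigma>\<in>supp \<pi>. \<forall>\<tau>\<in>supp \<rho>. \<sigma> \<le> \<tau>) \<pi>s)"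

definition canonical_form ::
    "('s::order \<Rightarrow> 's \<Rightarrow> nat) \<Rightarrow> ('s \<Rightarrow> rat) multiset \<Rightarrow> ('s \<Rightarrow> rat) multiset \<Rightarrow> bool" where
  "canonical_form b M N \<longleftrightarrow>
     set_mset N \<subseteq> LS1 b \<and> size N = size M \<and> standard N \<and>
     (\<forall>\<sigma>. (\<Sum>\<pi>\<in>#N. \<pi> \<sigma>) = (\<Sum>\<pi>\<in>#M. \<pi> \<sigma>))"


section \<open>The discrete LS algebra and the subvarieties of its Proj\<close>

type_synonym ('s, 'k) lspoly = "(('s \<Rightarrow> rat) \<Rightarrow>\<^sub>0 nat) \<Rightarrow>\<^sub>0 'k"

definition LS_var :: "('s \<Rightarrow> rat) \<Rightarrow> ('s, 'k::field) lspoly" where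
  "LS_var \<pi> = Poly_Mapping.single (Poly_Mapping.single \<pi> 1) 1"

text \<open>The polynomial ring in the variables \<open>LS_var \<pi>\<close> for \<open>\<pi>\<close> in \<open>LS1 b\<close>.\<close>

definition LS_ring :: "('s::order \<Rightarrow> 's \<Rightarrow> nat) \<Rightarrow> (('s, 'k::field) lspoly, 'k) kalg" where
  "LS_ring b =
    \<lparr>carrier = {f. \<forall>m\<in>Poly_Mapping.keys f. Poly_Mapping.keys m \<subseteq> LS1 b},
     mult = (*), one = 1, zero = 0, add = (+), cst = Poly_Mapping.single 0\<rparr>"

definition LS_grading :: "('s::order \<Rightarrow> 's \<Rightarrow> nat) \<Rightarrow> nat \<Rightarrow> ('s, 'k::field) lspoly set" where
  "LS_grading b d =
     {f \<in> carrier (LS_ring b). \<forall>m\<in>Poly_Mapping.keys f. (\<Sum>\<pi>\<in>Poly_Mapping.keys m. Poly_Mapping.lookup m \<pi>) = d}"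

definition LS_ideal :: "('s::order \<Rightarrow> 's \<Rightarrow> nat) \<Rightarrow> ('s, 'k::field) lspoly set" where
  "LS_ideal b = genideal (LS_ring b)
     ({LS_var \<pi>\<^sub>1 * LS_var \<pi>\<^sub>2 - LS_var \<rho>\<^sub>1 * LS_var \<rho>\<^sub>2 | \<pi>\<^sub>1 \<pi>\<^sub>2 \<rho>\<^sub>1 \<rho>\<^sub>2.
         \<pi>\<^sub>1 \<in> LS1 b \<and> \<pi>\<^sub>2 \<in> LS1 b \<and> \<not> standard {#\<pi>\<^sub>1, \<pi>\<^sub>2#} \<and> comparable_supports {#\<pi>\<^sub>1, \<pi>\<^sub>2#} \<and>
         canonical_form b {#\<pi>\<^sub>1, \<pi>\<^sub>2#} {#\<rho>\<^sub>1, \<rho>\<^sub>2#}} \<union>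
      {LS_var \<pi>\<^sub>1 * LS_var \<pi>\<^sub>2 | \<pi>\<^sub>1 \<pi>\<^sub>2.
         \<pi>\<^sub>1 \<in> LS1 b \<and> \<pi>\<^sub>2 \<in> LS1 b \<and> \<not> standard {#\<pi>\<^sub>1, \<pi>\<^sub>2#} \<and> \<not> comparable_supports {#\<pi>\<^sub>1, \<pi>\<^sub>2#}})"

definition chain_ideal :: "('s::order \<Rightarrow> 's \<Rightarrow> nat) \<Rightarrow> 's set \<Rightarrow> ('s, 'k::field) lspoly set" where
  "chain_ideal b C =
     genideal (LS_ring b) (LS_ideal b \<union> {LS_var \<pi> | \<pi>. \<pi> \<in> LS1 b \<and> \<not> supp \<pi> \<subseteq> C})"

definition LS_quot ::
    "('s::order \<Rightarrow> 's \<Rightarrow> nat) \<Rightarrow> ('s, 'k::field) lspoly set \<Rightarrow> (('s, 'k) lspoly set, 'k) kalg" where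
  "LS_quot b J = quot_alg (LS_ring b) J"

definition LS_quot_grading ::
    "('s::order \<Rightarrow> 's \<Rightarrow> nat) \<Rightarrow> ('s, 'k::field) lspoly set \<Rightarrow> nat \<Rightarrow> ('s, 'k) lspoly set set" where
  "LS_quot_grading b J = quot_grading (LS_ring b) (LS_grading b) J"

abbreviation LS_Proj where
  "LS_Proj b J \<equiv> Proj (LS_quot b J) (LS_quot_grading b J)"

text \<open>
  For a homogeneous ideal \<open>J\<close> containing \<open>LS_ideal b\<close>, the closed immersion of \<open>LS_Proj b J\<close> into
  \<open>LS_Proj b (LS_ideal b)\<close> is induced by the canonical map of quotients. The closed subset
  underlying the closed subscheme is its image.
\<close>

definition closed_incl where
  "closed_incl b J =
     Proj_induced (LS_quot b (LS_ideal b)) (\<lambda>x. \<Union>f\<in>x. J +>\<^bsub>LS_ring b\<^esub> f)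
       (LS_quot b J) (LS_quot_grading b J)"

definition closed_subset ::
    "('s::order \<Rightarrow> 's \<Rightarrow> nat) \<Rightarrow> ('s, 'k::field) lspoly set \<Rightarrow> ('s, 'k) lspoly set set set" where
  "closed_subset b J = fst (closed_incl b J) ` topspace (pts (LS_Proj b J))"

end

theory Submission
  imports Defs "HOL-Library.Function_Algebras" "HOL-Computational_Algebra.Fraction_Field"
begin

text \<open>
  The proof rests on a description of the algebra \<open>A\<^sub>C\<close> of a nonempty chain \<open>C\<close>, which need not be maximal. A path
  supported on \<open>C\<close> is given by its partial sums along \<open>C\<close>, each multiplied by the bond between the element where it
  stops and the next one; these are integers, and the inequalities that express that a function is nonnegative
  become linear. So the paths of all degrees on \<open>C\<close> are the lattice points of a rational cone, with the degree as
  last coordinate. The sum of two paths of degree 1 can be cut into two pieces of mass 1, and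
  the relations of \<open>A\<close> replace any product of two variables by the product of the pieces. Iterating, every monomial
  is congruent to one whose first factor is the first piece of its sum, hence monomials with equal sums are
  congruent (\<open>equal_exponents\<close>), and the ideal \<open>I\<^sub>C\<close> is the kernel of the map from variables to exponents
  (\<open>chain_ideal_eq_kernel\<close>). Thus \<open>A\<^sub>C\<close> is the semigroup algebra of the cone (\<open>toric_algebra_quot\<close>).

  Proj of such a semigroup algebra is a normal toric variety (\<open>projective_normal_toric_cone\<close>). The torus acts through
  the grading of the algebra by the other coordinates. It is embedded as the open set where the
  monomial of an interior point \<open>h\<close> of the cone does not vanish, because every exponent vector gets into the cone
  by adding a multiple of \<open>h\<close>. A homogeneous fraction that is integral over a stalk is, after multiplication by a
  denominator, a Laurent polynomial, as Laurent polynomials are completely integrally closed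
  (\<open>completely_integrally_closed\<close>), and its exponents lie in the cone, as the least value of a linear functional on
  exponents is a valuation (\<open>integral_weight\<close>).

  As \<open>A\<^sub>C\<close> is a domain, \<open>I\<^sub>C\<close> is a prime, the generic point of \<open>X\<^sub>C\<close>. A prime of \<open>A\<close> omits only variables whose supports are
  pairwise comparable, since the other products of two variables vanish; these supports lie in a maximal chain
  \<open>C\<close>, so the prime contains \<open>I\<^sub>C\<close>. Hence the \<open>X\<^sub>C\<close> cover \<open>X\<close>, and they are its components, since \<open>I\<^sub>D \<subseteq> I\<^sub>C\<close> forces
  \<open>C \<subseteq> D\<close>. Finally \<open>I\<^sub>C + I\<^sub>D\<close> is the ideal of \<open>C \<inter> D\<close> (\<open>chain_ideal_sum\<close>), which is not empty as it contains the least element,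
  so that intersections of components are again of the form treated first.

  Spec and Proj, and morphisms given by ring homomorphisms between them, are handled by one notion (\<open>gmor\<close>), which
  reduces equality of morphisms to equality of ring homomorphisms on homogeneous elements.
\<close>

section \<open>Rings of fractions\<close>

text \<open>
  Localizations at primes, their parts of degree 0 and fraction fields are all rings of fractions with
  restricted pairs \<open>(a, s)\<close>, so the restriction \<open>F\<close> is a parameter, assumed stable
  under the formulas for sums and products.
\<close>

locale fraction_data = cring B for B (structure) +
  fixes F :: "('a \<times> 'a) set" and S :: "'a set"
  assumes F_sub: "(a, s) \<in> F \<Longrightarrow> a \<in> carrier B \<and> s \<in> S"
    and S_sub: "S \<subseteq> carrier B"
    and S_one: "\<one> \<in> S"
    and S_mult: "s \<in> S \<Longrightarrow> t \<in> S \<Longrightarrow> s \<otimes> t \<in> S"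
    and F_zero: "(\<zero>, \<one>) \<in> F"
    and F_one: "(\<one>, \<one>) \<in> F"
    and F_mult: "(a, s) \<in> F \<Longrightarrow> (b, t) \<in> F \<Longrightarrow> (a \<otimes> b, s \<otimes> t) \<in> F"
    and F_add: "(a, s) \<in> F \<Longrightarrow> (b, t) \<in> F \<Longrightarrow> (a \<otimes> t \<oplus> b \<otimes> s, s \<otimes> t) \<in> F"
    and F_minus: "(a, s) \<in> F \<Longrightarrow> (\<ominus> a, s) \<in> F"
begin

abbreviation cls :: "'a \<Rightarrow> 'a \<Rightarrow> ('a \<times> 'a) set" where
  "cls a s \<equiv> frac_cls B F S a s"

lemma F_carr [dest]: "(a, s) \<in> F \<Longrightarrow> a \<in> carrier B \<and> s \<in> carrier B"
  using F_sub S_sub by blast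

lemma S_carr [dest]: "s \<in> S \<Longrightarrow> s \<in> carrier B"
  using S_sub by blast

lemma vanish_iff:
  assumes "u \<in> carrier B" "a \<in> carrier B" "b \<in> carrier B"
  shows "u \<otimes> (a \<ominus> b) = \<zero> \<longleftrightarrow> u \<otimes> a = u \<otimes> b"
proof -
  have "u \<otimes> (a \<ominus> b) = u \<otimes> a \<ominus> u \<otimes> b"
    using assms by algebra
  thus ?thesis
    using assms by (metis m_closed r_right_minus_eq)
qed

lemma in_cls_iff:
  assumes "(a, s) \<in> F"
  shows "(b, t) \<in> cls a s \<longleftrightarrow> (b, t) \<in> F \<and> (\<exists>u\<in>S. u \<otimes> (a \<otimes> t) = u \<otimes> (b \<otimes> s))"
proof (cases "(b, t) \<in> F")
  case True
  have "u \<otimes> (a \<otimes> t \<ominus> b \<otimes> s) = \<zero> \<longleftrightarrow> u \<otimes> (a \<otimes> t) = u \<otimes> (b \<otimes> s)" if "u \<in> S" for u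
    using F_carr[OF assms] F_carr[OF True] S_carr[OF that] by (intro vanish_iff) auto
  thus ?thesis
    unfolding frac_cls_def using True by blast
qed (simp add: frac_cls_def)

lemma in_cls_self: "(a, s) \<in> F \<Longrightarrow> (a, s) \<in> cls a s"
  using in_cls_iff S_one by blast

lemma cls_sub_F: "cls a s \<subseteq> F"
  unfolding frac_cls_def by blast

lemma cls_trans:
  assumes F: "(a, s) \<in> F" "(b, t) \<in> F" "(c, w) \<in> F"
    and "u \<in> S" "u \<otimes> (a \<otimes> t) = u \<otimes> (b \<otimes> s)"
    and "v \<in> S" "v \<otimes> (b \<otimes> w) = v \<otimes> (c \<otimes> t)"
  shows "(u \<otimes> v \<otimes> t) \<otimes> (a \<otimes> w) = (u \<otimes> v \<otimes> t) \<otimes> (c \<otimes> s)"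
proof -
  have c [simp]: "a \<in> carrier B" "b \<in> carrier B" "c \<in> carrier B" "s \<in> carrier B" "t \<in> carrier B"
    "w \<in> carrier B" "u \<in> carrier B" "v \<in> carrier B"
    using assms by auto
  have "(u \<otimes> v \<otimes> t) \<otimes> (a \<otimes> w) = (u \<otimes> (a \<otimes> t)) \<otimes> (v \<otimes> w)"
    using c by algebra
  also have "\<dots> = (u \<otimes> (b \<otimes> s)) \<otimes> (v \<otimes> w)"
    by (simp only: assms(5))
  also have "\<dots> = (v \<otimes> (b \<otimes> w)) \<otimes> (u \<otimes> s)"
    using c by algebra
  also have "\<dots> = (v \<otimes> (c \<otimes> t)) \<otimes> (u \<otimes> s)"
    by (simp only: assms(7))
  also have "\<dots> = (u \<otimes> v \<otimes> t) \<otimes> (c \<otimes> s)"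
    using c by algebra
  finally show ?thesis .
qed

lemma cls_eq_iff:
  assumes "(a, s) \<in> F" "(b, t) \<in> F"
  shows "cls a s = cls b t \<longleftrightarrow> (\<exists>u\<in>S. u \<otimes> (a \<otimes> t) = u \<otimes> (b \<otimes> s))" (is "_ \<longleftrightarrow> ?E")
proof
  assume "cls a s = cls b t"
  hence "(b, t) \<in> cls a s"
    using in_cls_self[OF assms(2)] by simp
  thus ?E
    using in_cls_iff[OF assms(1)] by blast
next
  have sub: "cls a s \<subseteq> cls b t"
    if F: "(a, s) \<in> F" "(b, t) \<in> F" and E: "\<exists>u\<in>S. u \<otimes> (a \<otimes> t) = u \<otimes> (b \<otimes> s)" for a s b t
  proof (rule subrelI)
    fix c w assume cw: "(c, w) \<in> cls a s"
    hence F': "(c, w) \<in> F" using cls_sub_F by blast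
    obtain u where u: "u \<in> S" "u \<otimes> (b \<otimes> s) = u \<otimes> (a \<otimes> t)" using E by metis
    obtain v where v: "v \<in> S" "v \<otimes> (a \<otimes> w) = v \<otimes> (c \<otimes> s)"
      using cw in_cls_iff[OF F(1)] by blast
    have "(u \<otimes> v \<otimes> s) \<otimes> (b \<otimes> w) = (u \<otimes> v \<otimes> s) \<otimes> (c \<otimes> t)"
      by (rule cls_trans[OF F(2) F(1) F' u v])
    moreover have "u \<otimes> v \<otimes> s \<in> S"
      using u v F(1) F_sub S_mult by blast
    ultimately show "(c, w) \<in> cls b t"
      using in_cls_iff[OF F(2)] F' by blast
  qed
  assume E: ?E
  hence E': "\<exists>u\<in>S. u \<otimes> (b \<otimes> s) = u \<otimes> (a \<otimes> t)" by metis
  show "cls a s = cls b t"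
    using sub[OF assms E] sub[OF assms(2) assms(1) E'] by blast
qed

lemma in_cls_imp_eq:
  assumes "(a, s) \<in> F" "(b, t) \<in> cls a s"
  shows "(b, t) \<in> F" "cls b t = cls a s"
proof -
  show "(b, t) \<in> F" using assms(2) cls_sub_F by blast
  thus "cls b t = cls a s"
    using assms in_cls_iff cls_eq_iff by metis
qed

lemma cls_eqI:
  assumes "(a, s) \<in> F" "(b, t) \<in> F" "a \<otimes> t = b \<otimes> s"
  shows "cls a s = cls b t"
  using assms cls_eq_iff S_one by auto

text \<open>Any function of a fraction that is invariant under change of representative is computed on one
  representative; the ring operations of \<open>frac_ring\<close> are unions of such values.\<close>

lemma UN_cls:
  assumes "(a, s) \<in> F" "\<And>b t. (b, t) \<in> F \<Longrightarrow> cls b t = cls a s \<Longrightarrow> f b t = f a s"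
  shows "(\<Union>(b, t)\<in>cls a s. f b t) = f a s"
proof -
  have "f b t = f a s" if "(b, t) \<in> cls a s" for b t
    using in_cls_imp_eq[OF assms(1) that] assms(2) by blast
  thus ?thesis
    using in_cls_self[OF assms(1)] by blast
qed

lemma mult_well_defined:
  assumes F: "(a, s) \<in> F" "(b, t) \<in> F" "(a', s') \<in> F" "(b', t') \<in> F"
    and eq: "cls a s = cls a' s'" "cls b t = cls b' t'"
  shows "cls (a \<otimes> b) (s \<otimes> t) = cls (a' \<otimes> b') (s' \<otimes> t')"
proof -
  have c: "a \<in> carrier B" "b \<in> carrier B" "a' \<in> carrier B" "b' \<in> carrier B"
    "s \<in> carrier B" "t \<in> carrier B" "s' \<in> carrier B" "t' \<in> carrier B"
    using F by auto
  obtain u v where u: "u \<in> S" "u \<otimes> (a \<otimes> s') = u \<otimes> (a' \<otimes> s)"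
    and v: "v \<in> S" "v \<otimes> (b \<otimes> t') = v \<otimes> (b' \<otimes> t)"
    using eq[unfolded cls_eq_iff[OF F(1) F(3)] cls_eq_iff[OF F(2) F(4)]] by blast
  have c': "u \<in> carrier B" "v \<in> carrier B" using u v by auto
  have "(u \<otimes> v) \<otimes> ((a \<otimes> b) \<otimes> (s' \<otimes> t')) = (u \<otimes> (a \<otimes> s')) \<otimes> (v \<otimes> (b \<otimes> t'))"
    using c c' by algebra
  also have "\<dots> = (u \<otimes> (a' \<otimes> s)) \<otimes> (v \<otimes> (b' \<otimes> t))"
    using u v by simp
  also have "\<dots> = (u \<otimes> v) \<otimes> ((a' \<otimes> b') \<otimes> (s \<otimes> t))"
    using c c' by algebra
  finally show ?thesis
    unfolding cls_eq_iff[OF F_mult[OF F(1,2)] F_mult[OF F(3,4)]]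
    by (rule bexI) (rule S_mult[OF u(1) v(1)])
qed

lemma add_well_defined:
  assumes F: "(a, s) \<in> F" "(b, t) \<in> F" "(a', s') \<in> F" "(b', t') \<in> F"
    and eq: "cls a s = cls a' s'" "cls b t = cls b' t'"
  shows "cls (a \<otimes> t \<oplus> b \<otimes> s) (s \<otimes> t) = cls (a' \<otimes> t' \<oplus> b' \<otimes> s') (s' \<otimes> t')"
proof -
  have c: "a \<in> carrier B" "b \<in> carrier B" "a' \<in> carrier B" "b' \<in> carrier B"
    "s \<in> carrier B" "t \<in> carrier B" "s' \<in> carrier B" "t' \<in> carrier B"
    using F by auto
  obtain u v where u: "u \<in> S" "u \<otimes> (a \<otimes> s') = u \<otimes> (a' \<otimes> s)"
    and v: "v \<in> S" "v \<otimes> (b \<otimes> t') = v \<otimes> (b' \<otimes> t)"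
    using eq[unfolded cls_eq_iff[OF F(1) F(3)] cls_eq_iff[OF F(2) F(4)]] by blast
  have c': "u \<in> carrier B" "v \<in> carrier B" using u v by auto
  have "(u \<otimes> v) \<otimes> ((a \<otimes> t \<oplus> b \<otimes> s) \<otimes> (s' \<otimes> t'))
      = (u \<otimes> (a \<otimes> s')) \<otimes> (v \<otimes> (t \<otimes> t')) \<oplus> (v \<otimes> (b \<otimes> t')) \<otimes> (u \<otimes> (s \<otimes> s'))"
    using c c' by algebra
  also have "\<dots> = (u \<otimes> (a' \<otimes> s)) \<otimes> (v \<otimes> (t \<otimes> t')) \<oplus> (v \<otimes> (b' \<otimes> t)) \<otimes> (u \<otimes> (s \<otimes> s'))"
    using u v by simp
  also have "\<dots> = (u \<otimes> v) \<otimes> ((a' \<otimes> t' \<oplus> b' \<otimes> s') \<otimes> (s \<otimes> t))"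
    using c c' by algebra
  finally show ?thesis
    unfolding cls_eq_iff[OF F_add[OF F(1,2)] F_add[OF F(3,4)]]
    by (rule bexI) (rule S_mult[OF u(1) v(1)])
qed

abbreviation FR where "FR \<equiv> frac_ring B F S"

lemma FR_one: "\<one>\<^bsub>FR\<^esub> = cls \<one> \<one>" and FR_zero: "\<zero>\<^bsub>FR\<^esub> = cls \<zero> \<one>"
  by (simp_all add: frac_ring_def)

lemma FR_carrier: "x \<in> carrier FR \<longleftrightarrow> (\<exists>a s. (a, s) \<in> F \<and> x = cls a s)"
  by (auto simp: frac_ring_def)

lemma FR_cases:
  assumes "x \<in> carrier FR"
  obtains a s where "x = cls a s" "(a, s) \<in> F"
  using assms FR_carrier by blast

lemma cls_carrier [intro]: "(a, s) \<in> F \<Longrightarrow> cls a s \<in> carrier FR"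
  using FR_carrier by blast

lemma FR_mult:
  assumes "(a, s) \<in> F" "(b, t) \<in> F"
  shows "cls a s \<otimes>\<^bsub>FR\<^esub> cls b t = cls (a \<otimes> b) (s \<otimes> t)"
proof -
  have "(\<Union>(b', t')\<in>cls b t. cls (a' \<otimes> b') (s' \<otimes> t')) = cls (a' \<otimes> b) (s' \<otimes> t)" if "(a', s') \<in> F" for a' s'
    by (rule UN_cls[OF assms(2)]) (rule mult_well_defined; use assms that in simp)
  hence "(\<Union>(a', s')\<in>cls a s. \<Union>(b', t')\<in>cls b t. cls (a' \<otimes> b') (s' \<otimes> t'))
      = (\<Union>(a', s')\<in>cls a s. cls (a' \<otimes> b) (s' \<otimes> t))"
    using cls_sub_F by fastforce
  also have "\<dots> = cls (a \<otimes> b) (s \<otimes> t)"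
    by (rule UN_cls[OF assms(1)]) (rule mult_well_defined; use assms in simp)
  finally show ?thesis
    by (simp add: frac_ring_def)
qed

lemma FR_add:
  assumes "(a, s) \<in> F" "(b, t) \<in> F"
  shows "cls a s \<oplus>\<^bsub>FR\<^esub> cls b t = cls (a \<otimes> t \<oplus> b \<otimes> s) (s \<otimes> t)"
proof -
  have "(\<Union>(b', t')\<in>cls b t. cls (a' \<otimes> t' \<oplus> b' \<otimes> s') (s' \<otimes> t')) = cls (a' \<otimes> t \<oplus> b \<otimes> s') (s' \<otimes> t)"
    if "(a', s') \<in> F" for a' s'
    by (rule UN_cls[OF assms(2)]) (rule add_well_defined; use assms that in simp)
  hence "(\<Union>(a', s')\<in>cls a s. \<Union>(b', t')\<in>cls b t. cls (a' \<otimes> t' \<oplus> b' \<otimes> s') (s' \<otimes> t'))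
      = (\<Union>(a', s')\<in>cls a s. cls (a' \<otimes> t \<oplus> b \<otimes> s') (s' \<otimes> t))"
    using cls_sub_F by fastforce
  also have "\<dots> = cls (a \<otimes> t \<oplus> b \<otimes> s) (s \<otimes> t)"
    by (rule UN_cls[OF assms(1)]) (rule add_well_defined; use assms in simp)
  finally show ?thesis
    by (simp add: frac_ring_def)
qed

lemma cring_FR: "cring FR"
proof (rule cringI)
  show "abelian_group FR"
  proof (rule abelian_groupI)
    fix x y assume "x \<in> carrier FR" "y \<in> carrier FR"
    then obtain a s b t where x: "x = cls a s" "(a, s) \<in> F" and y: "y = cls b t" "(b, t) \<in> F"
      using FR_carrier by auto
    show "x \<oplus>\<^bsub>FR\<^esub> y \<in> carrier FR"
      using x y FR_add F_add by auto
    have c: "a \<in> carrier B" "b \<in> carrier B" "s \<in> carrier B" "t \<in> carrier B"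
      using x y by auto
    have "cls (a \<otimes> t \<oplus> b \<otimes> s) (s \<otimes> t) = cls (b \<otimes> s \<oplus> a \<otimes> t) (t \<otimes> s)"
      using F_add x y by (intro cls_eqI) (auto, use c in algebra)
    thus "x \<oplus>\<^bsub>FR\<^esub> y = y \<oplus>\<^bsub>FR\<^esub> x"
      using x y FR_add by auto
    fix z assume "z \<in> carrier FR"
    then obtain d w where z: "z = cls d w" "(d, w) \<in> F"
      using FR_carrier by auto
    hence c': "d \<in> carrier B" "w \<in> carrier B" by auto
    have "cls ((a \<otimes> t \<oplus> b \<otimes> s) \<otimes> w \<oplus> d \<otimes> (s \<otimes> t)) (s \<otimes> t \<otimes> w)
      = cls (a \<otimes> (t \<otimes> w) \<oplus> (b \<otimes> w \<oplus> d \<otimes> t) \<otimes> s) (s \<otimes> (t \<otimes> w))"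
      using F_add x y z by (intro cls_eqI) (auto, use c c' in algebra)
    thus "x \<oplus>\<^bsub>FR\<^esub> y \<oplus>\<^bsub>FR\<^esub> z = x \<oplus>\<^bsub>FR\<^esub> (y \<oplus>\<^bsub>FR\<^esub> z)"
      using x y z by (simp add: FR_add F_add)
  next
    show "\<zero>\<^bsub>FR\<^esub> \<in> carrier FR" using FR_zero F_zero by auto
    fix x assume "x \<in> carrier FR"
    then obtain a s where x: "x = cls a s" "(a, s) \<in> F"
      using FR_carrier by auto
    hence c: "a \<in> carrier B" "s \<in> carrier B" by auto
    have "cls (\<zero> \<otimes> s \<oplus> a \<otimes> \<one>) (\<one> \<otimes> s) = cls a s"
      using c by simp
    thus "\<zero>\<^bsub>FR\<^esub> \<oplus>\<^bsub>FR\<^esub> x = x"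
      using x FR_add[OF F_zero x(2)] FR_zero by simp
    have "cls (\<ominus> a \<otimes> s \<oplus> a \<otimes> s) (s \<otimes> s) = cls \<zero> \<one>"
    proof (rule cls_eqI)
      show "(\<ominus> a \<otimes> s \<oplus> a \<otimes> s, s \<otimes> s) \<in> F"
        by (rule F_add[OF F_minus[OF x(2)] x(2)])
    qed (use F_zero c in \<open>auto simp: l_minus l_neg\<close>)
    hence "cls (\<ominus> a) s \<oplus>\<^bsub>FR\<^esub> x = \<zero>\<^bsub>FR\<^esub>"
      using x FR_add[OF F_minus[OF x(2)] x(2)] FR_zero by simp
    thus "\<exists>y\<in>carrier FR. y \<oplus>\<^bsub>FR\<^esub> x = \<zero>\<^bsub>FR\<^esub>"
      using F_minus[OF x(2)] by blast
  qed
next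
  show "comm_monoid FR"
  proof (rule comm_monoidI)
    fix x y assume "x \<in> carrier FR" "y \<in> carrier FR"
    then obtain a s b t where x: "x = cls a s" "(a, s) \<in> F" and y: "y = cls b t" "(b, t) \<in> F"
      using FR_carrier by auto
    hence c: "a \<in> carrier B" "b \<in> carrier B" "s \<in> carrier B" "t \<in> carrier B"
      by auto
    show "x \<otimes>\<^bsub>FR\<^esub> y \<in> carrier FR"
      using x y FR_mult F_mult by auto
    show "x \<otimes>\<^bsub>FR\<^esub> y = y \<otimes>\<^bsub>FR\<^esub> x"
      using x y c by (simp add: FR_mult m_comm)
    fix z assume "z \<in> carrier FR"
    then obtain d w where z: "z = cls d w" "(d, w) \<in> F"
      using FR_carrier by auto
    hence c': "d \<in> carrier B" "w \<in> carrier B" by auto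
    show "x \<otimes>\<^bsub>FR\<^esub> y \<otimes>\<^bsub>FR\<^esub> z = x \<otimes>\<^bsub>FR\<^esub> (y \<otimes>\<^bsub>FR\<^esub> z)"
      using x y z c c' by (simp add: FR_mult F_mult m_assoc)
  next
    show "\<one>\<^bsub>FR\<^esub> \<in> carrier FR" using FR_one F_one by auto
    fix x assume "x \<in> carrier FR"
    then obtain a s where x: "x = cls a s" "(a, s) \<in> F"
      using FR_carrier by auto
    thus "\<one>\<^bsub>FR\<^esub> \<otimes>\<^bsub>FR\<^esub> x = x"
      using FR_mult[OF F_one x(2)] F_carr[OF x(2)] FR_one by simp
  qed
next
  fix x y z assume "x \<in> carrier FR" "y \<in> carrier FR" "z \<in> carrier FR"
  then obtain a s b t d w where x: "x = cls a s" "(a, s) \<in> F" and y: "y = cls b t" "(b, t) \<in> F"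
    and z: "z = cls d w" "(d, w) \<in> F"
    using FR_carrier by auto
  hence c: "a \<in> carrier B" "b \<in> carrier B" "s \<in> carrier B" "t \<in> carrier B"
    "d \<in> carrier B" "w \<in> carrier B"
    by auto
  have "cls ((a \<otimes> t \<oplus> b \<otimes> s) \<otimes> d) (s \<otimes> t \<otimes> w)
      = cls ((a \<otimes> d) \<otimes> (t \<otimes> w) \<oplus> (b \<otimes> d) \<otimes> (s \<otimes> w)) ((s \<otimes> w) \<otimes> (t \<otimes> w))"
    using F_add F_mult x y z by (intro cls_eqI) (auto, use c in algebra)
  thus "(x \<oplus>\<^bsub>FR\<^esub> y) \<otimes>\<^bsub>FR\<^esub> z = x \<otimes>\<^bsub>FR\<^esub> z \<oplus>\<^bsub>FR\<^esub> y \<otimes>\<^bsub>FR\<^esub> z"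
    using x y z by (simp add: FR_add FR_mult F_add F_mult)
qed

lemma cls_unit_iff:
  assumes "(a, s) \<in> F"
  shows "cls a s \<in> Units FR \<longleftrightarrow> (\<exists>b t u. (b, t) \<in> F \<and> u \<in> S \<and> u \<otimes> (a \<otimes> b) = u \<otimes> (s \<otimes> t))"
    (is "_ \<longleftrightarrow> ?E")
proof
  assume "cls a s \<in> Units FR"
  then obtain x where "x \<in> carrier FR" "cls a s \<otimes>\<^bsub>FR\<^esub> x = \<one>\<^bsub>FR\<^esub>"
    unfolding Units_def by blast
  then obtain b t where bt: "(b, t) \<in> F" "cls (a \<otimes> b) (s \<otimes> t) = cls \<one> \<one>"
    using FR_carrier FR_mult[OF assms] FR_one by auto
  then obtain u where "u \<in> S" "u \<otimes> (a \<otimes> b \<otimes> \<one>) = u \<otimes> (\<one> \<otimes> (s \<otimes> t))"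
    using cls_eq_iff[OF F_mult[OF assms bt(1)] F_one] by blast
  moreover have "a \<otimes> b \<otimes> \<one> = a \<otimes> b" "\<one> \<otimes> (s \<otimes> t) = s \<otimes> t"
    using F_carr[OF assms] F_carr[OF bt(1)] by auto
  ultimately show ?E using bt by auto
next
  interpret FR: cring FR by (rule cring_FR)
  assume ?E
  then obtain b t u where bt: "(b, t) \<in> F" "u \<in> S" "u \<otimes> (a \<otimes> b) = u \<otimes> (s \<otimes> t)" by blast
  have c: "a \<otimes> b \<otimes> \<one> = a \<otimes> b" "\<one> \<otimes> (s \<otimes> t) = s \<otimes> t"
    using F_carr[OF assms] F_carr[OF bt(1)] by auto
  hence "cls (a \<otimes> b) (s \<otimes> t) = cls \<one> \<one>"
    using cls_eq_iff[OF F_mult[OF assms bt(1)] F_one] bt by auto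
  hence "cls a s \<otimes>\<^bsub>FR\<^esub> cls b t = \<one>\<^bsub>FR\<^esub>"
    using FR_mult[OF assms bt(1)] FR_one by simp
  moreover have "cls b t \<otimes>\<^bsub>FR\<^esub> cls a s = cls a s \<otimes>\<^bsub>FR\<^esub> cls b t"
    using assms bt(1) FR.m_comm by blast
  ultimately show "cls a s \<in> Units FR"
    unfolding Units_def using assms bt(1) by auto
qed

declare F_carr [rule del] S_carr [rule del] cls_carrier [rule del]

end

section \<open>Spaces of homogeneous fractions and their morphisms\<close>

text \<open>
  Spec and Proj are treated alike: both consist of fractions of homogeneous elements of equal degree,
  where all elements count as homogeneous of degree 0 in the case of Spec.
\<close>

definition hspace ::
    "('a, 'k) kalg \<Rightarrow> (nat \<Rightarrow> 'a set) \<Rightarrow> 'a set set \<Rightarrow> ('a set, ('a \<times> 'a) set, 'k) kspace" where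
  "hspace B G Q = fraction_space B Q (Proj_fracs G) (Proj_mult G)"

abbreviation hfrac where "hfrac B G p \<equiv> frac_cls B (Proj_fracs G p) (Proj_mult G p)"

definition trivial_grading :: "('a, 'k) kalg \<Rightarrow> nat \<Rightarrow> 'a set" where
  "trivial_grading B d = (if d = 0 then carrier B else {})"

lemma Union_trivial_grading [simp]: "(\<Union>d. trivial_grading B d) = carrier B"
  by (auto simp: trivial_grading_def split: if_splits)

lemma Proj_fracs_trivial: "Proj_fracs (trivial_grading B) = Spec_fracs B"
  by (rule ext) (auto simp: Proj_fracs_def Spec_fracs_def trivial_grading_def split: if_splits)

lemma Proj_mult_trivial: "Proj_mult (trivial_grading B) = Spec_mult B"
  by (rule ext) (simp add: Proj_mult_def Spec_mult_def)

lemma Spec_eq_hspace: "Spec B = hspace B (trivial_grading B) (Spec_pts B)"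
  by (simp add: Spec_def hspace_def Proj_fracs_trivial Proj_mult_trivial)

lemma Proj_eq_hspace: "Proj B G = hspace B G (Proj_pts B G)"
  by (simp add: Proj_def hspace_def)

text \<open>
  A direct sum decomposition is not part of these axioms, so that the trivial grading satisfies them.
\<close>

locale pregraded = cring B for B :: "('a, 'k) kalg" (structure) +
  fixes G :: "nat \<Rightarrow> 'a set"
  assumes G_sub: "G d \<subseteq> carrier B"
    and G_one: "\<one> \<in> G 0"
    and G_zero: "\<zero> \<in> G 0"
    and G_add: "a \<in> G d \<Longrightarrow> b \<in> G d \<Longrightarrow> a \<oplus> b \<in> G d"
    and G_minus: "a \<in> G d \<Longrightarrow> \<ominus> a \<in> G d"
    and G_mult: "a \<in> G d \<Longrightarrow> b \<in> G e \<Longrightarrow> a \<otimes> b \<in> G (d + e)"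
    and G_cst: "cst B c \<in> G 0"
begin

abbreviation hom :: "'a set" where "hom \<equiv> (\<Union>d. G d)"

lemma hom_carr: "a \<in> hom \<Longrightarrow> a \<in> carrier B" and G_carr: "a \<in> G d \<Longrightarrow> a \<in> carrier B"
  using G_sub by blast+

lemma fraction_data:
  assumes "primeideal p B"
  shows "fraction_data B (Proj_fracs G p) (Proj_mult G p)"
proof -
  interpret p: primeideal p B by fact
  have one: "\<one> \<notin> p" using p.I_notcarr p.one_imp_carrier by blast
  have nz: "a \<otimes> b \<notin> p" if "a \<in> G d" "b \<in> G e" "a \<notin> p" "b \<notin> p" for a b d e
    using that G_carr p.I_prime by blast
  have cm: "b \<otimes> s \<in> G (d + e)" if "b \<in> G e" "s \<in> G d" for b s d e
    using G_mult[OF that] by (simp add: add.commute)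
  have add: "a \<otimes> t \<oplus> b \<otimes> s \<in> G (d + e)" if "a \<in> G d" "s \<in> G d" "b \<in> G e" "t \<in> G e" for a s b t d e
    using that by (intro G_add G_mult cm)
  show ?thesis
  proof (unfold_locales, goal_cases)
    case (1 a s) thus ?case using G_carr by (auto simp: Proj_fracs_def Proj_mult_def)
  next
    case 2 thus ?case using G_carr by (auto simp: Proj_mult_def)
  next
    case 3 thus ?case using G_one one by (auto simp: Proj_mult_def)
  next
    case (4 s t)
    then obtain d e where "s \<in> G d" "s \<notin> p" "t \<in> G e" "t \<notin> p"
      by (auto simp: Proj_mult_def)
    hence "s \<otimes> t \<in> G (d + e) \<and> s \<otimes> t \<notin> p"
      using G_mult[of s d t e] nz[of s d t e] by simp
    thus ?case unfolding Proj_mult_def by blast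
  next
    case 5 thus ?case using G_one G_zero one by (auto simp: Proj_fracs_def)
  next
    case 6 thus ?case using G_one one by (auto simp: Proj_fracs_def)
  next
    case (7 a s b t)
    then obtain d e where "a \<in> G d" "s \<in> G d" "s \<notin> p" "b \<in> G e" "t \<in> G e" "t \<notin> p"
      by (auto simp: Proj_fracs_def)
    hence "(a \<otimes> b, s \<otimes> t) \<in> G (d + e) \<times> (G (d + e) - p)"
      using G_mult[of a d b e] G_mult[of s d t e] nz[of s d t e] by simp
    thus ?case unfolding Proj_fracs_def by blast
  next
    case (8 a s b t)
    then obtain d e where "a \<in> G d" "s \<in> G d" "s \<notin> p" "b \<in> G e" "t \<in> G e" "t \<notin> p"
      by (auto simp: Proj_fracs_def)
    hence "(a \<otimes> t \<oplus> b \<otimes> s, s \<otimes> t) \<in> G (d + e) \<times> (G (d + e) - p)"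
      using add[of a d s b e t] G_mult[of s d t e] nz[of s d t e] by simp
    thus ?case unfolding Proj_fracs_def by blast
  next
    case (9 a s) thus ?case using G_minus by (auto simp: Proj_fracs_def)
  qed
qed

end

locale hspace_data = pregraded +
  fixes Q
  assumes Q_prime: "p \<in> Q \<Longrightarrow> primeideal p B"
    and Q_hom: "p \<in> Q \<Longrightarrow> p = genideal B (p \<inter> hom)"
begin

lemma fracs: "p \<in> Q \<Longrightarrow> fraction_data B (Proj_fracs G p) (Proj_mult G p)"
  using Q_prime fraction_data by blast

lemma openin_zariski:
  "openin (zariski B Q) U \<longleftrightarrow> (\<exists>E\<subseteq>carrier B. U = {p \<in> Q. \<not> E \<subseteq> p})"
  unfolding zariski_def using topology_inverse'[OF istopology_zariski[OF Q_prime]] by simp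

lemma topspace_zariski [simp]: "topspace (zariski B Q) = Q"
proof -
  have "\<one> \<notin> p" if "p \<in> Q" for p
  proof -
    interpret primeideal p B by (rule Q_prime[OF that])
    show ?thesis using I_notcarr one_imp_carrier by blast
  qed
  hence "{p \<in> Q. \<not> {\<one>} \<subseteq> p} = Q"
    by blast
  hence "openin (zariski B Q) Q"
    unfolding openin_zariski by (intro exI[of _ "{\<one>}"]) auto
  moreover have "U \<subseteq> Q" if "openin (zariski B Q) U" for U
    using that openin_zariski by auto
  ultimately show ?thesis
    unfolding topspace_def by auto
qed

lemma Q_ext:
  assumes "p \<in> Q" "q \<in> Q" "\<And>x. x \<in> hom \<Longrightarrow> x \<in> p \<longleftrightarrow> x \<in> q"
  shows "p = q"
proof -
  have eq: "p \<inter> hom = q \<inter> hom" using assms(3) by blast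
  have "p = genideal B (p \<inter> hom)" by (rule Q_hom[OF assms(1)])
  also have "\<dots> = q" unfolding eq by (rule Q_hom[OF assms(2), symmetric])
  finally show ?thesis .
qed

lemma hspace_simps [simp]:
  "topspace (pts (hspace B G Q)) = Q"
  "pts (hspace B G Q) = zariski B Q"
  "stalk (hspace B G Q) p = frac_ring B (Proj_fracs G p) (Proj_mult G p)"
  "scal (hspace B G Q) p c = hfrac B G p (cst B c) \<one>"
  by (simp_all add: hspace_def fraction_space_def topspace_zariski)

lemma sect_hspace:
  "s \<in> sect (hspace B G Q) U \<longleftrightarrow>
     s \<in> (\<Pi>\<^sub>E p\<in>U. carrier (frac_ring B (Proj_fracs G p) (Proj_mult G p))) \<and>
     (\<forall>p\<in>U. \<exists>W a t. openin (zariski B Q) W \<and> p \<in> W \<and> W \<subseteq> U \<and>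
        (\<forall>q\<in>W. (a, t) \<in> Proj_fracs G q \<and> s q = hfrac B G q a t))"
  by (simp add: hspace_def fraction_space_def)

end

text \<open>
  \<open>gmor\<close> says that a pair \<open>m\<close> of maps is the morphism given by the ring homomorphism \<open>\<phi>\<close>. The
  point \<open>fst m q\<close> need not be the preimage of \<open>q\<close>: only its homogeneous elements are prescribed, which
  also covers dehomogenization, a map from Spec to Proj. The last condition, on arbitrary \<open>x\<close>, then has to be imposed
  for continuity.
\<close>

definition gmor where
  "gmor B G Q B' G' Q' \<phi> m \<longleftrightarrow>
     \<phi> \<in> ring_hom B' B \<and> (\<forall>c. \<phi> (cst B' c) = cst B c) \<and> (\<forall>d. \<exists>e. \<phi> ` G' d \<subseteq> G e) \<and>
     (\<forall>q\<in>Q. fst m q \<in> Q' \<and> (\<forall>x\<in>(\<Union>d. G' d). x \<in> fst m q \<longleftrightarrow> \<phi> x \<in> q) \<and>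
        (\<forall>a s. (a, s) \<in> Proj_fracs G' (fst m q) \<longrightarrow>
           snd m q (hfrac B' G' (fst m q) a s)
             = hfrac B G q (\<phi> a) (\<phi> s))) \<and>
     (\<forall>x\<in>carrier B'. \<exists>E\<subseteq>carrier B. \<forall>q\<in>Q. x \<in> fst m q \<longleftrightarrow> E \<subseteq> q)"

locale gmor_data = X: hspace_data B G Q + Y: hspace_data B' G' Q'
  for B :: "('a, 'k) kalg" and G Q and B' :: "('b, 'k) kalg" and G' Q' +
  fixes \<phi> m
  assumes gmor: "gmor B G Q B' G' Q' \<phi> m"
begin

lemmas gmor_parts = gmor[unfolded gmor_def]

lemma hom: "\<phi> \<in> ring_hom B' B"
  by (rule gmor_parts[THEN conjunct1])

lemma cst: "\<phi> (cst B' c) = cst B c"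
  by (rule gmor_parts[THEN conjunct2, THEN conjunct1, rule_format])

lemma degree: "\<exists>e. \<phi> ` G' d \<subseteq> G e"
  by (rule gmor_parts[THEN conjunct2, THEN conjunct2, THEN conjunct1, rule_format])

lemma vanish: "x \<in> carrier B' \<Longrightarrow> \<exists>E\<subseteq>carrier B. \<forall>q\<in>Q. x \<in> fst m q \<longleftrightarrow> E \<subseteq> q"
  by (rule gmor_parts[THEN conjunct2, THEN conjunct2, THEN conjunct2, THEN conjunct2, THEN bspec])

lemmas gmor_pointwise =
  bspec[OF gmor_parts[THEN conjunct2, THEN conjunct2, THEN conjunct2, THEN conjunct1]]

lemma pt: "q \<in> Q \<Longrightarrow> fst m q \<in> Q'"
  by (rule gmor_pointwise[THEN conjunct1])

lemma mem: "q \<in> Q \<Longrightarrow> x \<in> G' d \<Longrightarrow> x \<in> fst m q \<longleftrightarrow> \<phi> x \<in> q"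
  by (rule gmor_pointwise[THEN conjunct2, THEN conjunct1, THEN bspec]) blast+

lemma germ: "q \<in> Q \<Longrightarrow> (a, s) \<in> Proj_fracs G' (fst m q) \<Longrightarrow>
           snd m q (hfrac B' G' (fst m q) a s)
             = hfrac B G q (\<phi> a) (\<phi> s)"
  by (rule gmor_pointwise[THEN conjunct2, THEN conjunct2, rule_format])

sublocale h: ring_hom_ring B' B \<phi>
  by unfold_locales (rule hom)

lemma fracs:
  assumes "q \<in> Q" "(a, s) \<in> Proj_fracs G' (fst m q)"
  shows "(\<phi> a, \<phi> s) \<in> Proj_fracs G q"
proof -
  obtain d where d: "a \<in> G' d" "s \<in> G' d" "s \<notin> fst m q"
    using assms(2) by (auto simp: Proj_fracs_def)
  obtain e where e: "\<phi> ` G' d \<subseteq> G e" using degree by blast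
  have "(\<phi> a, \<phi> s) \<in> G e \<times> (G e - q)"
    using d e mem[OF assms(1) d(2)] by auto
  thus ?thesis by (auto simp: Proj_fracs_def)
qed

lemma continuous: "continuous_map (zariski B Q) (zariski B' Q') (fst m)"
proof -
  have "openin (zariski B Q) {q \<in> Q. fst m q \<in> U}" if U: "openin (zariski B' Q') U" for U
  proof -
    obtain E where E: "E \<subseteq> carrier B'" "U = {p \<in> Q'. \<not> E \<subseteq> p}"
      using U[unfolded Y.openin_zariski] by blast
    have "\<forall>x\<in>carrier B'. \<exists>E. E \<subseteq> carrier B \<and> (\<forall>q\<in>Q. x \<in> fst m q \<longleftrightarrow> E \<subseteq> q)"
      by (intro ballI) (rule vanish)
    from bchoice[OF this] obtain D where
      D: "\<And>x. x \<in> carrier B' \<Longrightarrow> D x \<subseteq> carrier B \<and> (\<forall>q\<in>Q. x \<in> fst m q \<longleftrightarrow> D x \<subseteq> q)"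
      by blast
    have "fst m q \<in> U \<longleftrightarrow> \<not> (\<Union>x\<in>E. D x) \<subseteq> q" if q: "q \<in> Q" for q
    proof -
      have "x \<in> fst m q \<longleftrightarrow> D x \<subseteq> q" if "x \<in> E" for x
        using D[of x] that q E(1) by auto
      hence "E \<subseteq> fst m q \<longleftrightarrow> (\<forall>x\<in>E. D x \<subseteq> q)" by auto
      thus ?thesis using pt[OF q] E(2) by auto
    qed
    hence "{q \<in> Q. fst m q \<in> U} = {q \<in> Q. \<not> (\<Union>x\<in>E. D x) \<subseteq> q}"
      by auto
    moreover have "(\<Union>x\<in>E. D x) \<subseteq> carrier B"
      using D E by blast
    ultimately show ?thesis
      using X.openin_zariski by blast
  qed
  thus ?thesis
    unfolding continuous_map_def X.topspace_zariski Y.topspace_zariski using pt by auto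
qed

lemma stalk_hom:
  assumes q: "q \<in> Q"
  shows "snd m q \<in> ring_hom (stalk (hspace B' G' Q') (fst m q)) (stalk (hspace B G Q) q)"
proof -
  interpret L: fraction_data B' "Proj_fracs G' (fst m q)" "Proj_mult G' (fst m q)"
    by (rule Y.fracs[OF pt[OF q]])
  interpret R: fraction_data B "Proj_fracs G q" "Proj_mult G q"
    by (rule X.fracs[OF q])
  note F = fracs[OF q] and g = germ[OF q]
  show ?thesis
    unfolding X.hspace_simps Y.hspace_simps
  proof (rule ring_hom_memI)
    fix x assume "x \<in> carrier L.FR"
    then obtain a s where x: "x = L.cls a s" "(a, s) \<in> Proj_fracs G' (fst m q)"
      by (rule L.FR_cases)
    thus "snd m q x \<in> carrier R.FR"
      using F g R.cls_carrier by auto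
    fix y assume "y \<in> carrier L.FR"
    then obtain b t where y: "y = L.cls b t" "(b, t) \<in> Proj_fracs G' (fst m q)"
      by (rule L.FR_cases)
    have c: "a \<in> carrier B'" "s \<in> carrier B'" "b \<in> carrier B'" "t \<in> carrier B'"
      using L.F_carr[OF x(2)] L.F_carr[OF y(2)] by auto
    show "snd m q (x \<otimes>\<^bsub>L.FR\<^esub> y) = snd m q x \<otimes>\<^bsub>R.FR\<^esub> snd m q y"
      using x y c by (simp add: g F L.FR_mult L.F_mult R.FR_mult R.F_mult)
    show "snd m q (x \<oplus>\<^bsub>L.FR\<^esub> y) = snd m q x \<oplus>\<^bsub>R.FR\<^esub> snd m q y"
      using x y c by (simp add: g F L.FR_add L.F_add R.FR_add R.F_add)
  next
    show "snd m q \<one>\<^bsub>L.FR\<^esub> = \<one>\<^bsub>R.FR\<^esub>"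
      by (simp add: L.FR_one R.FR_one g L.F_one)
  qed
qed

lemma stalk_local:
  assumes q: "q \<in> Q" and z: "z \<in> carrier (stalk (hspace B' G' Q') (fst m q))"
    and unit: "snd m q z \<in> Units (stalk (hspace B G Q) q)"
  shows "z \<in> Units (stalk (hspace B' G' Q') (fst m q))"
proof -
  interpret L: fraction_data B' "Proj_fracs G' (fst m q)" "Proj_mult G' (fst m q)"
    by (rule Y.fracs[OF pt[OF q]])
  interpret R: fraction_data B "Proj_fracs G q" "Proj_mult G q"
    by (rule X.fracs[OF q])
  interpret pq: primeideal q B by (rule X.Q_prime[OF q])
  obtain a s where as: "z = L.cls a s" "(a, s) \<in> Proj_fracs G' (fst m q)"
    using z[unfolded Y.hspace_simps] by (rule L.FR_cases)
  then obtain d where d: "a \<in> G' d" "s \<in> G' d" "s \<notin> fst m q"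
    by (auto simp: Proj_fracs_def)
  have F: "(\<phi> a, \<phi> s) \<in> Proj_fracs G q" using fracs[OF q as(2)] .
  have "R.cls (\<phi> a) (\<phi> s) \<in> Units R.FR"
    using unit as germ[OF q as(2)] by simp
  then obtain b t u where b: "(b, t) \<in> Proj_fracs G q" "u \<in> Proj_mult G q"
    and eq: "u \<otimes>\<^bsub>B\<^esub> (\<phi> a \<otimes>\<^bsub>B\<^esub> b) = u \<otimes>\<^bsub>B\<^esub> (\<phi> s \<otimes>\<^bsub>B\<^esub> t)"
    using R.cls_unit_iff[OF F] by blast
  have "u \<notin> q" "\<phi> s \<notin> q" "t \<notin> q"
    using b F by (auto simp: Proj_fracs_def Proj_mult_def)
  moreover have c: "u \<in> carrier B" "\<phi> s \<in> carrier B" "t \<in> carrier B" "\<phi> a \<in> carrier B" "b \<in> carrier B"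
    using R.F_carr[OF F] R.F_carr[OF b(1)] R.S_carr[OF b(2)] by auto
  ultimately have "u \<otimes>\<^bsub>B\<^esub> (\<phi> s \<otimes>\<^bsub>B\<^esub> t) \<notin> q"
    using pq.I_prime by (meson X.m_closed)
  hence "\<phi> a \<notin> q"
    using eq c pq.I_l_closed pq.I_r_closed by (metis X.m_closed)
  hence "a \<notin> fst m q" using mem[OF q d(1)] by simp
  hence sa: "(s, a) \<in> Proj_fracs G' (fst m q)"
    using d by (auto simp: Proj_fracs_def)
  have ca: "a \<in> carrier B'" "s \<in> carrier B'" using d Y.G_carr by auto
  have "L.cls a s \<in> Units L.FR"
    unfolding L.cls_unit_iff[OF as(2)]
    by (intro exI[of _ s] exI[of _ a] exI[of _ "\<one>\<^bsub>B'\<^esub>"]) (use sa L.S_one Y.m_comm[OF ca] in auto)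
  thus ?thesis using as by simp
qed

lemma stalk_scal:
  assumes q: "q \<in> Q"
  shows "snd m q (scal (hspace B' G' Q') (fst m q) c) = scal (hspace B G Q) q c"
proof -
  interpret p': primeideal "fst m q" B' by (rule Y.Q_prime[OF pt[OF q]])
  have "\<one>\<^bsub>B'\<^esub> \<notin> fst m q"
    using p'.I_notcarr p'.one_imp_carrier by blast
  hence "(cst B' c, \<one>\<^bsub>B'\<^esub>) \<in> Proj_fracs G' (fst m q)"
    using Y.G_cst Y.G_one by (auto simp: Proj_fracs_def)
  thus ?thesis
    by (simp add: germ[OF q] cst)
qed

lemma pull_sections:
  assumes V: "openin (zariski B' Q') V" and s: "s \<in> sect (hspace B' G' Q') V"
  shows "restrict (\<lambda>x. snd m x (s (fst m x))) {x \<in> Q. fst m x \<in> V}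
    \<in> sect (hspace B G Q) {x \<in> Q. fst m x \<in> V}"
proof -
  let ?U = "{x \<in> Q. fst m x \<in> V}" and ?r = "\<lambda>x. snd m x (s (fst m x))"
  have s1: "s p \<in> carrier (stalk (hspace B' G' Q') p)" if "p \<in> V" for p
    using s that unfolding Y.sect_hspace by auto
  have "?r x \<in> carrier (stalk (hspace B G Q) x)" if "x \<in> ?U" for x
    using that s1 stalk_hom ring_hom_closed by fastforce
  moreover have "\<exists>W a t. openin (zariski B Q) W \<and> x \<in> W \<and> W \<subseteq> ?U \<and>
      (\<forall>q\<in>W. (a, t) \<in> Proj_fracs G q \<and> restrict ?r ?U q = hfrac B G q a t)"
    if x: "x \<in> ?U" for x
  proof -
    obtain W a t where W: "openin (zariski B' Q') W" "fst m x \<in> W" "W \<subseteq> V"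
      and at: "\<And>p. p \<in> W \<Longrightarrow> (a, t) \<in> Proj_fracs G' p \<and>
          s p = hfrac B' G' p a t"
      using s[unfolded Y.sect_hspace, THEN conjunct2, THEN bspec, of "fst m x"] x by blast
    have W': "openin (zariski B Q) {q \<in> Q. fst m q \<in> W}"
      using continuous W(1) X.topspace_zariski unfolding continuous_map_def by auto
    have "(\<phi> a, \<phi> t) \<in> Proj_fracs G q \<and>
        ?r q = hfrac B G q (\<phi> a) (\<phi> t)"
      if "q \<in> Q" "fst m q \<in> W" for q
      using at[OF that(2)] fracs[OF that(1)] germ[OF that(1)] by auto
    thus ?thesis
      using W W' x by (intro exI[of _ "{q \<in> Q. fst m q \<in> W}"] exI[of _ "\<phi> a"] exI[of _ "\<phi> t"]) auto
  qed
  ultimately show ?thesis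
    unfolding X.sect_hspace by auto
qed

lemma morphism: "morphism (hspace B G Q) (hspace B' G' Q') m"
proof -
  obtain f g where m: "m = (f, g)" by (cases m)
  show ?thesis
    using continuous stalk_hom stalk_local stalk_scal pull_sections
    unfolding morphism_def m by auto
qed

end

lemma gmor_comp:
  assumes "hspace_data B G Q" "hspace_data B' G' Q'" "hspace_data B'' G'' Q''"
    and m1: "gmor B G Q B' G' Q' \<phi> m" and m2: "gmor B' G' Q' B'' G'' Q'' \<psi> n"
  shows "gmor B G Q B'' G'' Q'' (\<lambda>x. \<phi> (\<psi> x)) (n \<circ>\<^sub>m m)"
proof -
  interpret M: gmor_data B G Q B' G' Q' \<phi> m
    by (intro gmor_data.intro gmor_data_axioms.intro assms)
  interpret N: gmor_data B' G' Q' B'' G'' Q'' \<psi> n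
    by (intro gmor_data.intro gmor_data_axioms.intro assms)
  have deg: "\<exists>e. (\<lambda>x. \<phi> (\<psi> x)) ` G'' d \<subseteq> G e" for d
  proof -
    obtain e where "\<psi> ` G'' d \<subseteq> G' e" using N.degree by blast
    moreover obtain e' where "\<phi> ` G' e \<subseteq> G e'" using M.degree by blast
    ultimately show ?thesis by blast
  qed
  have pt: "fst n (fst m q) \<in> Q'' \<and> (\<forall>x\<in>(\<Union>d. G'' d). x \<in> fst n (fst m q) \<longleftrightarrow> \<phi> (\<psi> x) \<in> q)"
    if q: "q \<in> Q" for q
  proof (intro conjI ballI)
    show "fst n (fst m q) \<in> Q''" using M.pt N.pt q by blast
    fix x assume "x \<in> (\<Union>d. G'' d)"
    then obtain d where x: "x \<in> G'' d" by blast
    obtain e where "\<psi> ` G'' d \<subseteq> G' e" using N.degree by blast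
    hence "\<psi> x \<in> G' e" using x by blast
    thus "x \<in> fst n (fst m q) \<longleftrightarrow> \<phi> (\<psi> x) \<in> q"
      using M.mem[OF q] N.mem[OF M.pt[OF q] x] by simp
  qed
  have van: "\<exists>E\<subseteq>carrier B. \<forall>q\<in>Q. x \<in> fst n (fst m q) \<longleftrightarrow> E \<subseteq> q" if x: "x \<in> carrier B''" for x
  proof -
    obtain E where E: "E \<subseteq> carrier B'" "\<forall>q\<in>Q'. x \<in> fst n q \<longleftrightarrow> E \<subseteq> q"
      using N.vanish[OF x] by blast
    have "\<forall>y\<in>carrier B'. \<exists>E. E \<subseteq> carrier B \<and> (\<forall>q\<in>Q. y \<in> fst m q \<longleftrightarrow> E \<subseteq> q)"
      using M.vanish by blast
    then obtain D where D: "\<And>y. y \<in> carrier B' \<Longrightarrow> D y \<subseteq> carrier B \<and> (\<forall>q\<in>Q. y \<in> fst m q \<longleftrightarrow> D y \<subseteq> q)"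
      by metis
    have "(\<Union>y\<in>E. D y) \<subseteq> carrier B" using D E(1) by blast
    moreover have "\<forall>q\<in>Q. x \<in> fst n (fst m q) \<longleftrightarrow> (\<Union>y\<in>E. D y) \<subseteq> q"
    proof
      fix q assume q: "q \<in> Q"
      have "y \<in> fst m q \<longleftrightarrow> D y \<subseteq> q" if "y \<in> E" for y
        using D[of y] that q E(1) by auto
      hence "E \<subseteq> fst m q \<longleftrightarrow> (\<forall>y\<in>E. D y \<subseteq> q)" by auto
      thus "x \<in> fst n (fst m q) \<longleftrightarrow> (\<Union>y\<in>E. D y) \<subseteq> q"
        using E(2) M.pt[OF q] by auto
    qed
    ultimately show ?thesis by blast
  qed
  show ?thesis
    unfolding gmor_def mor_comp_def fst_conv snd_conv
    using ring_hom_trans[OF N.hom M.hom] N.cst M.cst deg pt van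
    by (auto simp: comp_def N.germ M.germ M.pt N.fracs)
qed

lemma gmor_id:
  assumes "hspace_data B G Q"
  shows "gmor B G Q B G Q (\<lambda>x. x) mor_id"
  unfolding gmor_def mor_id_def by (auto simp: ring_hom_def)

text \<open>
  Points are determined by their homogeneous elements, and germs are fractions of homogeneous elements.
\<close>

lemma gmor_eq:
  assumes XY: "hspace_data B G Q" "hspace_data B' G' Q'"
    and m: "gmor B G Q B' G' Q' \<phi> m" and n: "gmor B G Q B' G' Q' \<psi> n"
    and eq: "\<And>d x. x \<in> G' d \<Longrightarrow> \<phi> x = \<psi> x"
  shows "mor_eq (hspace B G Q) (hspace B' G' Q') m n"
proof -
  interpret M: gmor_data B G Q B' G' Q' \<phi> m
    by (intro gmor_data.intro gmor_data_axioms.intro assms)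
  interpret N: gmor_data B G Q B' G' Q' \<psi> n
    by (intro gmor_data.intro gmor_data_axioms.intro assms)
  have pt: "fst m q = fst n q" if q: "q \<in> Q" for q
  proof (rule M.Y.Q_ext)
    fix x assume "x \<in> M.Y.hom"
    then obtain d where "x \<in> G' d" by blast
    thus "x \<in> fst m q \<longleftrightarrow> x \<in> fst n q"
      using M.mem[OF q] N.mem[OF q] eq by auto
  qed (use q M.pt N.pt in auto)
  have "snd m q z = snd n q z"
    if q: "q \<in> Q" and z: "z \<in> carrier (stalk (hspace B' G' Q') (fst m q))" for q z
  proof -
    interpret L: fraction_data B' "Proj_fracs G' (fst m q)" "Proj_mult G' (fst m q)"
      by (rule M.Y.fracs[OF M.pt[OF q]])
    obtain a s where as: "z = L.cls a s" "(a, s) \<in> Proj_fracs G' (fst m q)"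
      using z[unfolded M.Y.hspace_simps] by (rule L.FR_cases)
    hence "\<phi> a = \<psi> a" "\<phi> s = \<psi> s"
      using eq by (auto simp: Proj_fracs_def)
    thus ?thesis
      using M.germ[OF q as(2)] N.germ[OF q] as pt[OF q] by simp
  qed
  thus ?thesis
    using pt unfolding mor_eq_def by simp
qed

text \<open>The standard way of producing a morphism from a ring homomorphism, on a given map \<open>f\<close> of points.\<close>

definition hinduced where
  "hinduced f \<phi> D H =
     (f, \<lambda>q z. \<Union>(a, s)\<in>z. hfrac D H q (\<phi> a) (\<phi> s))"

lemma Proj_induced_eq: "Proj_induced C \<phi> D H = hinduced (\<lambda>q. {x \<in> carrier C. \<phi> x \<in> q}) \<phi> D H"
  by (simp add: Proj_induced_def induced_def hinduced_def)

lemma Spec_induced_eq: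
  "Spec_induced C \<phi> D = hinduced (\<lambda>q. {x \<in> carrier C. \<phi> x \<in> q}) \<phi> D (trivial_grading D)"
  by (simp add: Spec_induced_def induced_def hinduced_def Proj_fracs_trivial Proj_mult_trivial)

lemma gmor_hinduced:
  assumes X: "hspace_data B G Q" and Y: "hspace_data B' G' Q'"
    and hom: "\<phi> \<in> ring_hom B' B" and cst: "\<And>c. \<phi> (cst B' c) = cst B c"
    and deg: "\<And>d. \<exists>e. \<phi> ` G' d \<subseteq> G e"
    and pt: "\<And>q. q \<in> Q \<Longrightarrow> f q \<in> Q'"
    and mem: "\<And>q x d. q \<in> Q \<Longrightarrow> x \<in> G' d \<Longrightarrow> x \<in> f q \<longleftrightarrow> \<phi> x \<in> q"
    and van: "\<And>x. x \<in> carrier B' \<Longrightarrow> \<exists>E\<subseteq>carrier B. \<forall>q\<in>Q. x \<in> f q \<longleftrightarrow> E \<subseteq> q"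
  shows "gmor B G Q B' G' Q' \<phi> (hinduced f \<phi> B G)"
proof -
  interpret X: hspace_data B G Q by fact
  interpret Y: hspace_data B' G' Q' by fact
  interpret h: ring_hom_ring B' B \<phi> by unfold_locales (rule hom)
  have "(\<Union>(a, s)\<in>hfrac B' G' (f q) a s.
          hfrac B G q (\<phi> a) (\<phi> s))
       = hfrac B G q (\<phi> a) (\<phi> s)"
    if q: "q \<in> Q" and as: "(a, s) \<in> Proj_fracs G' (f q)" for q a s
  proof -
    interpret L: fraction_data B' "Proj_fracs G' (f q)" "Proj_mult G' (f q)"
      by (rule Y.fracs[OF pt[OF q]])
    interpret R: fraction_data B "Proj_fracs G q" "Proj_mult G q"
      by (rule X.fracs[OF q])
    have F: "(\<phi> a, \<phi> s) \<in> Proj_fracs G q" if F': "(a, s) \<in> Proj_fracs G' (f q)" for a s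
    proof -
      obtain d where d: "a \<in> G' d" "s \<in> G' d" "s \<notin> f q"
        using F' by (auto simp: Proj_fracs_def)
      obtain e where "\<phi> ` G' d \<subseteq> G e" using deg by blast
      hence "(\<phi> a, \<phi> s) \<in> G e \<times> (G e - q)"
        using d mem[OF q d(2)] by auto
      thus ?thesis by (auto simp: Proj_fracs_def)
    qed
    show ?thesis
    proof (rule L.UN_cls[OF as])
      fix b t assume bt: "(b, t) \<in> Proj_fracs G' (f q)" "L.cls b t = L.cls a s"
      then obtain u where u: "u \<in> Proj_mult G' (f q)" "u \<otimes>\<^bsub>B'\<^esub> (b \<otimes>\<^bsub>B'\<^esub> s) = u \<otimes>\<^bsub>B'\<^esub> (a \<otimes>\<^bsub>B'\<^esub> t)"
        using L.cls_eq_iff[OF bt(1) as] by blast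
      have c: "u \<in> carrier B'" "a \<in> carrier B'" "b \<in> carrier B'" "s \<in> carrier B'" "t \<in> carrier B'"
        using L.S_carr[OF u(1)] L.F_carr[OF as] L.F_carr[OF bt(1)] by auto
      have "\<phi> u \<otimes>\<^bsub>B\<^esub> (\<phi> b \<otimes>\<^bsub>B\<^esub> \<phi> s) = \<phi> u \<otimes>\<^bsub>B\<^esub> (\<phi> a \<otimes>\<^bsub>B\<^esub> \<phi> t)"
        using arg_cong[OF u(2), of \<phi>] c by simp
      moreover have "\<phi> u \<in> Proj_mult G q"
      proof -
        obtain d where d: "u \<in> G' d" "u \<notin> f q"
          using u(1) by (auto simp: Proj_mult_def)
        obtain e where "\<phi> ` G' d \<subseteq> G e" using deg by blast
        thus ?thesis
          using d mem[OF q d(1)] by (auto simp: Proj_mult_def)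
      qed
      ultimately show "R.cls (\<phi> b) (\<phi> t) = R.cls (\<phi> a) (\<phi> s)"
        using R.cls_eq_iff[OF F[OF bt(1)] F[OF as]] by blast
    qed
  qed
  note germ = this
  show ?thesis
    unfolding gmor_def hinduced_def fst_conv snd_conv
  proof (intro conjI allI ballI impI)
    fix q x assume q: "q \<in> Q" and "x \<in> (\<Union>d. G' d)"
    then obtain d where "x \<in> G' d" by blast
    thus "x \<in> f q \<longleftrightarrow> \<phi> x \<in> q" using mem[OF q] by blast
  qed (fact hom cst deg pt van germ)+
qed

section \<open>Laurent polynomial algebras\<close>

lemma int_lattice_simps [simp]:
  "0 \<in> int_lattice n"
  "m \<in> int_lattice n \<Longrightarrow> m' \<in> int_lattice n \<Longrightarrow> m + m' \<in> int_lattice n"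
  "m \<in> int_lattice n \<Longrightarrow> m' \<in> int_lattice n \<Longrightarrow> m - m' \<in> int_lattice n"
  "m \<in> int_lattice n \<Longrightarrow> - m \<in> int_lattice n"
  by (auto simp: int_lattice_def)

definition lsing :: "('a, 'm) ring_scheme \<Rightarrow> (nat \<Rightarrow> int) \<Rightarrow> 'a \<Rightarrow> (nat \<Rightarrow> int) \<Rightarrow> 'a" where
  "lsing D m d = (\<lambda>u. if u = m then d else \<zero>\<^bsub>D\<^esub>)"

definition lsupp :: "('a, 'm) ring_scheme \<Rightarrow> ((nat \<Rightarrow> int) \<Rightarrow> 'a) \<Rightarrow> (nat \<Rightarrow> int) set" where
  "lsupp D f = {u. f u \<noteq> \<zero>\<^bsub>D\<^esub>}"

lemma lconst_eq_lsing: "lconst D b = lsing D 0 b"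
  by (simp add: lconst_def lsing_def zero_fun_def)

locale laurent_alg = cring D for D :: "('a, 'k) kalg" (structure) +
  fixes n :: nat
begin

abbreviation L where "L \<equiv> laurent n D"

lemma L_carrier:
  "f \<in> carrier L \<longleftrightarrow> (\<forall>m. f m \<in> carrier D) \<and> lsupp D f \<subseteq> int_lattice n \<and> finite (lsupp D f)"
  by (auto simp: laurent_def lsupp_def)

lemma L_val: "f \<in> carrier L \<Longrightarrow> f m \<in> carrier D"
  and L_fin [simp]: "f \<in> carrier L \<Longrightarrow> finite (lsupp D f)"
  unfolding L_carrier by simp_all

lemma L_sub: "f \<in> carrier L \<Longrightarrow> f m \<noteq> \<zero> \<Longrightarrow> m \<in> int_lattice n"
  using subsetD[of "lsupp D f" "int_lattice n" m] by (simp add: L_carrier lsupp_def)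

lemma L_add: "(f \<oplus>\<^bsub>L\<^esub> g) = (\<lambda>m. f m \<oplus> g m)" and L_zero: "\<zero>\<^bsub>L\<^esub> = (\<lambda>_. \<zero>)"
  and L_one: "\<one>\<^bsub>L\<^esub> = lsing D 0 \<one>"
  and L_cst: "cst L c = lsing D 0 (cst D c)"
  by (simp_all add: laurent_def lconst_eq_lsing)

lemma lsing_carrier [simp]: "m \<in> int_lattice n \<Longrightarrow> d \<in> carrier D \<Longrightarrow> lsing D m d \<in> carrier L"
proof -
  assume m: "m \<in> int_lattice n" "d \<in> carrier D"
  have "lsupp D (lsing D m d) \<subseteq> {m}"
    by (auto simp: lsupp_def lsing_def)
  hence "lsupp D (lsing D m d) \<subseteq> int_lattice n" "finite (lsupp D (lsing D m d))"
    using m by (auto intro: finite_subset[of _ "{m}"])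
  thus "lsing D m d \<in> carrier L"
    using m unfolding L_carrier by (simp add: lsing_def)
qed

lemma L_mult:
  assumes f: "f \<in> carrier L" and g: "g \<in> carrier L" and A: "finite A" "lsupp D f \<subseteq> A"
  shows "(f \<otimes>\<^bsub>L\<^esub> g) m = (\<Oplus>u\<in>A. f u \<otimes> g (m - u))"
proof -
  have "(f \<otimes>\<^bsub>L\<^esub> g) m = (\<Oplus>u\<in>lsupp D f. f u \<otimes> g (m - u))"
    by (simp add: laurent_def lsupp_def fun_diff_def)
  also have "\<dots> = (\<Oplus>u\<in>A. f u \<otimes> g (m - u))"
    using L_val[OF f] L_val[OF g] A by (intro add.finprod_mono_neutral_cong_left) (auto simp: lsupp_def)
  finally show ?thesis .
qed

lemma L_add_closed:
  assumes "f \<in> carrier L" "g \<in> carrier L"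
  shows "f \<oplus>\<^bsub>L\<^esub> g \<in> carrier L"
proof -
  have "lsupp D (f \<oplus>\<^bsub>L\<^esub> g) \<subseteq> lsupp D f \<union> lsupp D g"
    by (auto simp: L_add lsupp_def)
  moreover have "finite (lsupp D f \<union> lsupp D g)"
    "lsupp D f \<union> lsupp D g \<subseteq> int_lattice n"
    using assms unfolding L_carrier by auto
  ultimately show ?thesis
    using assms unfolding L_carrier by (auto simp: L_add intro: finite_subset)
qed

lemma abelian_group_L: "abelian_group L"
proof (rule abelian_groupI)
  fix f assume f: "f \<in> carrier L"
  have "(\<lambda>m. \<ominus> f m) \<in> carrier L"
  proof -
    have "lsupp D (\<lambda>m. \<ominus> f m) \<subseteq> lsupp D f"
      by (auto simp: lsupp_def)
    thus ?thesis
      using f unfolding L_carrier by (auto intro: finite_subset)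
  qed
  moreover have "(\<lambda>m. \<ominus> f m) \<oplus>\<^bsub>L\<^esub> f = \<zero>\<^bsub>L\<^esub>"
    using L_val[OF f] by (simp add: L_add L_zero l_neg)
  ultimately show "\<exists>y\<in>carrier L. y \<oplus>\<^bsub>L\<^esub> f = \<zero>\<^bsub>L\<^esub>" by blast
next
  show "\<zero>\<^bsub>L\<^esub> \<in> carrier L" unfolding L_carrier by (auto simp: L_zero lsupp_def)
  fix f g h assume f: "f \<in> carrier L" and g: "g \<in> carrier L" and h: "h \<in> carrier L"
  show "f \<oplus>\<^bsub>L\<^esub> g \<in> carrier L" using f g by (rule L_add_closed)
  show "f \<oplus>\<^bsub>L\<^esub> g \<oplus>\<^bsub>L\<^esub> h = f \<oplus>\<^bsub>L\<^esub> (g \<oplus>\<^bsub>L\<^esub> h)"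
    using L_val[OF f] L_val[OF g] L_val[OF h] by (simp add: L_add a_assoc)
  show "f \<oplus>\<^bsub>L\<^esub> g = g \<oplus>\<^bsub>L\<^esub> f" "\<zero>\<^bsub>L\<^esub> \<oplus>\<^bsub>L\<^esub> f = f"
    using L_val[OF f] L_val[OF g] by (simp_all add: L_add L_zero a_comm)
qed

lemma laurent_induct [consumes 1, case_names zero upd]:
  assumes "f \<in> carrier L"
    and zero: "P (\<lambda>_. \<zero>)"
    and upd: "\<And>g m d. g \<in> carrier L \<Longrightarrow> P g \<Longrightarrow> g m = \<zero> \<Longrightarrow> m \<in> int_lattice n \<Longrightarrow> d \<in> carrier D \<Longrightarrow>
                d \<noteq> \<zero> \<Longrightarrow> g \<oplus>\<^bsub>L\<^esub> lsing D m d = g(m := d) \<Longrightarrow> P (g(m := d))"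
  shows "P f"
  using assms(1)
proof (induction "card (lsupp D f)" arbitrary: f)
  case 0
  hence "lsupp D f = {}" by (metis L_fin card_0_eq)
  hence "f = (\<lambda>_. \<zero>)" by (auto simp: lsupp_def)
  thus ?case using zero by simp
next
  case (Suc k)
  hence fin: "finite (lsupp D f)" by simp
  obtain m where m: "m \<in> lsupp D f"
    using Suc.hyps(2) by (metis card.empty ex_in_conv nat.distinct(1))
  let ?g = "f(m := \<zero>)"
  have s: "lsupp D ?g = lsupp D f - {m}" by (auto simp: lsupp_def)
  have g: "?g \<in> carrier L"
    using Suc.prems unfolding L_carrier s by auto
  have "k = card (lsupp D ?g)"
    using Suc.hyps(2) m fin by (simp add: s)
  hence Pg: "P ?g" using Suc.hyps(1) g by blast
  have m': "m \<in> int_lattice n" "f m \<in> carrier D" "f m \<noteq> \<zero>"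
    using m Suc.prems by (auto simp: lsupp_def L_sub L_val[OF Suc.prems])
  have "?g \<oplus>\<^bsub>L\<^esub> lsing D m (f m) = ?g(m := f m)"
    using L_val[OF Suc.prems] by (auto simp: L_add lsing_def)
  hence "P (?g(m := f m))"
    using upd[OF g Pg _ m'] by simp
  thus ?case by simp
qed

lemma laurent_induct_add [consumes 1, case_names zero sing add]:
  assumes "f \<in> carrier L"
    and "P \<zero>\<^bsub>L\<^esub>"
    and "\<And>m d. m \<in> int_lattice n \<Longrightarrow> d \<in> carrier D \<Longrightarrow> P (lsing D m d)"
    and "\<And>f g. f \<in> carrier L \<Longrightarrow> g \<in> carrier L \<Longrightarrow> P f \<Longrightarrow> P g \<Longrightarrow> P (f \<oplus>\<^bsub>L\<^esub> g)"
  shows "P f"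
  using assms(1)
proof (induction rule: laurent_induct)
  case zero thus ?case using assms(2) by (simp add: L_zero)
next
  case (upd g m d)
  thus ?case using assms(3,4) lsing_carrier by metis
qed

lemma L_mult_closed:
  assumes f: "f \<in> carrier L" and g: "g \<in> carrier L"
  shows "f \<otimes>\<^bsub>L\<^esub> g \<in> carrier L"
proof -
  let ?S = "(\<lambda>(u, v). u + v) ` (lsupp D f \<times> lsupp D g)"
  have val: "(f \<otimes>\<^bsub>L\<^esub> g) m \<in> carrier D" for m
    unfolding L_mult[OF f g L_fin[OF f] subset_refl] using L_val[OF f] L_val[OF g] by (intro finsum_closed) auto
  have "(f \<otimes>\<^bsub>L\<^esub> g) m = \<zero>" if nS: "m \<notin> ?S" for m
  proof -
    have "f u \<otimes> g (m - u) = \<zero>" if u: "u \<in> lsupp D f" for u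
    proof -
      have "m - u \<notin> lsupp D g"
      proof
        assume "m - u \<in> lsupp D g"
        hence "(\<lambda>(u, v). u + v) (u, m - u) \<in> ?S" using u by blast
        thus False using nS by simp
      qed
      thus ?thesis using L_val[OF f] by (simp add: lsupp_def)
    qed
    thus ?thesis
      unfolding L_mult[OF f g L_fin[OF f] subset_refl] by (intro add.finprod_one_eqI) auto
  qed
  hence "lsupp D (f \<otimes>\<^bsub>L\<^esub> g) \<subseteq> ?S" by (auto simp: lsupp_def)
  moreover have "finite ?S" using f g by auto
  moreover have "?S \<subseteq> int_lattice n"
    using f g unfolding L_carrier by (auto intro!: int_lattice_simps(2))
  ultimately show ?thesis
    unfolding L_carrier using val by (meson finite_subset order_trans)
qed

lemma L_r_distr:
  assumes f: "f \<in> carrier L" and g: "g \<in> carrier L" and h: "h \<in> carrier L"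
  shows "f \<otimes>\<^bsub>L\<^esub> (g \<oplus>\<^bsub>L\<^esub> h) = f \<otimes>\<^bsub>L\<^esub> g \<oplus>\<^bsub>L\<^esub> f \<otimes>\<^bsub>L\<^esub> h"
proof
  fix m
  note M = L_mult[OF f _ L_fin[OF f] subset_refl]
  have "(f \<otimes>\<^bsub>L\<^esub> (g \<oplus>\<^bsub>L\<^esub> h)) m = (\<Oplus>u\<in>lsupp D f. f u \<otimes> g (m - u) \<oplus> f u \<otimes> h (m - u))"
    unfolding M[OF L_add_closed[OF g h]] unfolding L_add
    by (rule finsum_cong') (use L_val[OF f] L_val[OF g] L_val[OF h] in \<open>auto simp: r_distr\<close>)
  also have "\<dots> = (f \<otimes>\<^bsub>L\<^esub> g \<oplus>\<^bsub>L\<^esub> f \<otimes>\<^bsub>L\<^esub> h) m"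
    unfolding L_add M[OF g] M[OF h] using L_val[OF f] L_val[OF g] L_val[OF h] by (intro finsum_addf) auto
  finally show "(f \<otimes>\<^bsub>L\<^esub> (g \<oplus>\<^bsub>L\<^esub> h)) m = (f \<otimes>\<^bsub>L\<^esub> g \<oplus>\<^bsub>L\<^esub> f \<otimes>\<^bsub>L\<^esub> h) m" .
qed

lemma L_l_distr:
  assumes f: "f \<in> carrier L" and g: "g \<in> carrier L" and h: "h \<in> carrier L"
  shows "(f \<oplus>\<^bsub>L\<^esub> g) \<otimes>\<^bsub>L\<^esub> h = f \<otimes>\<^bsub>L\<^esub> h \<oplus>\<^bsub>L\<^esub> g \<otimes>\<^bsub>L\<^esub> h"
proof
  fix m
  let ?A = "lsupp D f \<union> lsupp D g"
  have "finite ?A" using f g by simp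
  moreover have "lsupp D f \<subseteq> ?A" "lsupp D g \<subseteq> ?A" "lsupp D (f \<oplus>\<^bsub>L\<^esub> g) \<subseteq> ?A"
    by (auto simp: lsupp_def L_add)
  ultimately have A: "finite ?A" "lsupp D f \<subseteq> ?A" "lsupp D g \<subseteq> ?A" "lsupp D (f \<oplus>\<^bsub>L\<^esub> g) \<subseteq> ?A"
    by blast+
  have "((f \<oplus>\<^bsub>L\<^esub> g) \<otimes>\<^bsub>L\<^esub> h) m = (\<Oplus>u\<in>?A. f u \<otimes> h (m - u) \<oplus> g u \<otimes> h (m - u))"
    unfolding L_mult[OF L_add_closed[OF f g] h A(1,4)] unfolding L_add
    by (rule finsum_cong') (use L_val[OF f] L_val[OF g] L_val[OF h] in \<open>auto simp: l_distr\<close>)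
  also have "\<dots> = (f \<otimes>\<^bsub>L\<^esub> h \<oplus>\<^bsub>L\<^esub> g \<otimes>\<^bsub>L\<^esub> h) m"
    unfolding L_add L_mult[OF f h A(1,2)] L_mult[OF g h A(1,3)]
    using L_val[OF f] L_val[OF g] L_val[OF h] by (intro finsum_addf) auto
  finally show "((f \<oplus>\<^bsub>L\<^esub> g) \<otimes>\<^bsub>L\<^esub> h) m = (f \<otimes>\<^bsub>L\<^esub> h \<oplus>\<^bsub>L\<^esub> g \<otimes>\<^bsub>L\<^esub> h) m" .
qed

lemma lsing_mult:
  assumes "m \<in> int_lattice n" "m' \<in> int_lattice n" "d \<in> carrier D" "d' \<in> carrier D"
  shows "lsing D m d \<otimes>\<^bsub>L\<^esub> lsing D m' d' = lsing D (m + m') (d \<otimes> d')"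
proof
  fix u
  have "(lsing D m d \<otimes>\<^bsub>L\<^esub> lsing D m' d') u = (\<Oplus>v\<in>{m}. lsing D m d v \<otimes> lsing D m' d' (u - v))"
    by (rule L_mult) (use assms in simp, use assms in simp, simp, auto simp: lsing_def lsupp_def)
  also have "\<dots> = d \<otimes> lsing D m' d' (u - m)"
    using assms by (simp add: lsing_def)
  also have "\<dots> = lsing D (m + m') (d \<otimes> d') u"
    using assms by (auto simp: lsing_def algebra_simps)
  finally show "(lsing D m d \<otimes>\<^bsub>L\<^esub> lsing D m' d') u = lsing D (m + m') (d \<otimes> d') u" .
qed

lemma L_zero_closed: "\<zero>\<^bsub>L\<^esub> \<in> carrier L"
  unfolding L_carrier by (auto simp: L_zero lsupp_def)

lemma L_zero_mult:
  assumes "f \<in> carrier L" shows "\<zero>\<^bsub>L\<^esub> \<otimes>\<^bsub>L\<^esub> f = \<zero>\<^bsub>L\<^esub>"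
proof
  fix m
  have "(\<zero>\<^bsub>L\<^esub> \<otimes>\<^bsub>L\<^esub> f) m = (\<Oplus>u\<in>{}. \<zero>\<^bsub>L\<^esub> u \<otimes> f (m - u))"
    by (rule L_mult[OF L_zero_closed assms]) (auto simp: L_zero lsupp_def)
  thus "(\<zero>\<^bsub>L\<^esub> \<otimes>\<^bsub>L\<^esub> f) m = \<zero>\<^bsub>L\<^esub> m" by (simp add: L_zero)
qed

lemma L_mult_zero:
  assumes "f \<in> carrier L" shows "f \<otimes>\<^bsub>L\<^esub> \<zero>\<^bsub>L\<^esub> = \<zero>\<^bsub>L\<^esub>"
proof
  fix m
  have "(f \<otimes>\<^bsub>L\<^esub> \<zero>\<^bsub>L\<^esub>) m = (\<Oplus>u\<in>lsupp D f. f u \<otimes> \<zero>\<^bsub>L\<^esub> (m - u))"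
    by (rule L_mult[OF assms L_zero_closed L_fin[OF assms] subset_refl])
  also have "\<dots> = \<zero>"
    using L_val[OF assms] by (intro add.finprod_one_eqI) (simp add: L_zero)
  finally show "(f \<otimes>\<^bsub>L\<^esub> \<zero>\<^bsub>L\<^esub>) m = \<zero>\<^bsub>L\<^esub> m" by (simp add: L_zero)
qed

lemma cring_L: "cring L"
proof -
  interpret A: abelian_group L by (rule abelian_group_L)
  have sing_assoc: "f \<otimes>\<^bsub>L\<^esub> g \<otimes>\<^bsub>L\<^esub> h = f \<otimes>\<^bsub>L\<^esub> (g \<otimes>\<^bsub>L\<^esub> h)"
    if f: "f \<in> carrier L" and g: "g \<in> carrier L" and h: "h \<in> carrier L" for f g h
    using f
  proof (induction rule: laurent_induct_add)
    case zero thus ?case using g h by (simp add: L_zero_mult L_mult_closed)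
  next
    case (add f f') thus ?case using g h by (simp add: L_l_distr L_mult_closed)
  next
    case (sing m d)
    note s = sing
    show ?case using g
    proof (induction rule: laurent_induct_add)
      case zero thus ?case using s h by (simp add: L_zero_mult L_mult_zero L_mult_closed)
    next
      case (add f f') thus ?case using s h by (simp add: L_l_distr L_r_distr L_mult_closed)
    next
      case (sing m' d')
      note s' = sing
      show ?case using h
      proof (induction rule: laurent_induct_add)
        case zero thus ?case using s s' by (simp add: L_mult_zero L_mult_closed)
      next
        case (add f f') thus ?case using s s' by (simp add: L_r_distr L_mult_closed)
      next
        case (sing m'' d'')
        thus ?case using s s' by (simp add: lsing_mult m_assoc add.assoc)
      qed
    qed
  qed
  have comm: "f \<otimes>\<^bsub>L\<^esub> g = g \<otimes>\<^bsub>L\<^esub> f" if f: "f \<in> carrier L" and g: "g \<in> carrier L" for f g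
    using f
  proof (induction rule: laurent_induct_add)
    case zero thus ?case using g by (simp add: L_zero_mult L_mult_zero)
  next
    case (add f f') thus ?case using g by (simp add: L_l_distr L_r_distr L_mult_closed)
  next
    case (sing m d)
    note s = sing
    show ?case using g
    proof (induction rule: laurent_induct_add)
      case zero thus ?case using s by (simp add: L_zero_mult L_mult_zero)
    next
      case (add f f') thus ?case using s by (simp add: L_l_distr L_r_distr L_mult_closed)
    next
      case (sing m' d') thus ?case using s by (simp add: lsing_mult m_comm add.commute)
    qed
  qed
  have one: "\<one>\<^bsub>L\<^esub> \<otimes>\<^bsub>L\<^esub> f = f" if f: "f \<in> carrier L" for f
    using f
  proof (induction rule: laurent_induct_add)
    case zero thus ?case by (simp add: L_one L_mult_zero)
  next
    case (add f f') thus ?case by (simp add: L_one L_r_distr)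
  next
    case (sing m d) thus ?case by (simp add: L_one lsing_mult)
  qed
  show ?thesis
  proof (rule cringI[OF abelian_group_L])
    show "comm_monoid L"
      by (rule comm_monoidI; (rule L_mult_closed sing_assoc comm one; assumption)?) (simp add: L_one)
  qed (rule L_l_distr)
qed

end

sublocale laurent_alg \<subseteq> L: cring L
  by (rule cring_L)

context laurent_alg begin

lemma finsum_L_apply:
  assumes "finite A" "\<And>a. a \<in> A \<Longrightarrow> f a \<in> carrier L"
  shows "finsum L f A u = (\<Oplus>a\<in>A. f a u)"
  using assms
proof (induction A rule: finite_induct)
  case empty thus ?case by (simp add: L_zero)
next
  case (insert a A)
  have v: "f b u \<in> carrier D" if "b \<in> insert a A" for b
    using insert.prems[OF that] by (rule L_val)
  have "finsum L f (insert a A) u = f a u \<oplus> finsum L f A u"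
    using insert by (subst L.finsum_insert) (auto simp: L_add)
  also have "\<dots> = (\<Oplus>b\<in>insert a A. f b u)"
    using insert v by (subst finsum_insert) auto
  finally show ?case .
qed

text \<open>An additive map on Laurent polynomials is multiplicative as soon as it is on monomials.\<close>

lemma laurent_ring_homI:
  assumes "cring R"
    and cl: "\<And>f. f \<in> carrier L \<Longrightarrow> \<phi> f \<in> carrier R"
    and ad: "\<And>f g. f \<in> carrier L \<Longrightarrow> g \<in> carrier L \<Longrightarrow> \<phi> (f \<oplus>\<^bsub>L\<^esub> g) = \<phi> f \<oplus>\<^bsub>R\<^esub> \<phi> g"
    and one: "\<phi> \<one>\<^bsub>L\<^esub> = \<one>\<^bsub>R\<^esub>"
    and sing: "\<And>m d m' d'. m \<in> int_lattice n \<Longrightarrow> m' \<in> int_lattice n \<Longrightarrow> d \<in> carrier D \<Longrightarrow> d' \<in> carrier D \<Longrightarrow>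
       \<phi> (lsing D (m + m') (d \<otimes> d')) = \<phi> (lsing D m d) \<otimes>\<^bsub>R\<^esub> \<phi> (lsing D m' d')"
  shows "\<phi> \<in> ring_hom L R"
proof -
  interpret R: cring R by fact
  have z: "\<phi> \<zero>\<^bsub>L\<^esub> = \<zero>\<^bsub>R\<^esub>"
    using ad[of "\<zero>\<^bsub>L\<^esub>" "\<zero>\<^bsub>L\<^esub>"] cl[of "\<zero>\<^bsub>L\<^esub>"]
    by (metis L.add.one_closed L.l_zero R.add.r_cancel_one')
  have "\<phi> (f \<otimes>\<^bsub>L\<^esub> g) = \<phi> f \<otimes>\<^bsub>R\<^esub> \<phi> g" if f: "f \<in> carrier L" and g: "g \<in> carrier L" for f g
    using f
  proof (induction rule: laurent_induct_add)
    case zero thus ?case using g by (simp add: z cl)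
  next
    case (add f f') thus ?case using g by (simp add: L_l_distr ad cl R.l_distr)
  next
    case (sing m d)
    note s = sing
    show ?case using g
    proof (induction rule: laurent_induct_add)
      case zero thus ?case using s by (simp add: z cl)
    next
      case (add f f') thus ?case using s by (simp add: L_r_distr ad cl R.r_distr)
    next
      case (sing m' d') thus ?case using s by (simp add: lsing_mult assms(5))
    qed
  qed
  thus ?thesis
    using cl ad one by (intro ring_hom_memI) auto
qed

lemma lsing_add: "m \<in> int_lattice n \<Longrightarrow> d \<in> carrier D \<Longrightarrow> d' \<in> carrier D \<Longrightarrow>
  lsing D m (d \<oplus> d') = lsing D m d \<oplus>\<^bsub>L\<^esub> lsing D m d'"
  unfolding L_add lsing_def by (rule ext) auto

lemma lconst_ring_hom: "lconst D \<in> ring_hom D L"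
  unfolding lconst_eq_lsing
  by (intro ring_hom_memI) (auto simp: lsing_mult lsing_add L_one)

text \<open>
  Substitution of 1 for the variables: the comorphism of the neutral element of the torus.
\<close>

definition augment :: "((nat \<Rightarrow> int) \<Rightarrow> 'a) \<Rightarrow> 'a" where
  "augment f = (\<Oplus>u\<in>lsupp D f. f u)"

lemma augment_eq:
  assumes "f \<in> carrier L" "finite A" "lsupp D f \<subseteq> A"
  shows "augment f = (\<Oplus>u\<in>A. f u)"
  unfolding augment_def
  by (rule add.finprod_mono_neutral_cong_left) (use assms L_val[OF assms(1)] in \<open>auto simp: lsupp_def\<close>)

lemma augment_lsing: "m \<in> int_lattice n \<Longrightarrow> d \<in> carrier D \<Longrightarrow> augment (lsing D m d) = d"
  by (subst augment_eq[of _ "{m}"]) (simp, simp, auto simp: lsing_def lsupp_def)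

lemma augment_ring_hom: "augment \<in> ring_hom L D"
proof (rule laurent_ring_homI)
  show "cring D" by unfold_locales
  fix f g assume f: "f \<in> carrier L" and g: "g \<in> carrier L"
  show "augment f \<in> carrier D"
    unfolding augment_def using L_val[OF f] by (intro finsum_closed) auto
  let ?A = "lsupp D f \<union> lsupp D g"
  have "finite ?A" using f g by simp
  moreover have "lsupp D f \<subseteq> ?A" "lsupp D g \<subseteq> ?A" "lsupp D (f \<oplus>\<^bsub>L\<^esub> g) \<subseteq> ?A"
    by (auto simp: lsupp_def L_add)
  ultimately have A: "finite ?A" "lsupp D f \<subseteq> ?A" "lsupp D g \<subseteq> ?A" "lsupp D (f \<oplus>\<^bsub>L\<^esub> g) \<subseteq> ?A"
    by blast+
  show "augment (f \<oplus>\<^bsub>L\<^esub> g) = augment f \<oplus> augment g"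
    unfolding augment_eq[OF f A(1,2)] augment_eq[OF g A(1,3)] augment_eq[OF L_add_closed[OF f g] A(1,4)]
    unfolding L_add using L_val[OF f] L_val[OF g] by (intro finsum_addf) auto
qed (simp_all add: augment_lsing L_one)

end

definition lmap :: "('a \<Rightarrow> 'b) \<Rightarrow> ((nat \<Rightarrow> int) \<Rightarrow> 'a) \<Rightarrow> (nat \<Rightarrow> int) \<Rightarrow> 'b" where
  "lmap \<phi> f = (\<lambda>u. \<phi> (f u))"

lemma lmap_ring_hom:
  assumes D: "cring D" and E: "cring E" and \<phi>: "\<phi> \<in> ring_hom D E"
  shows "lmap \<phi> \<in> ring_hom (laurent n D) (laurent n E)"
proof -
  interpret D: laurent_alg D n using D by (simp add: laurent_alg_def)
  interpret E: laurent_alg E n using E by (simp add: laurent_alg_def)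
  interpret h: ring_hom_ring D E \<phi> by unfold_locales (rule \<phi>)
  have sing: "lmap \<phi> (lsing D m d) = lsing E m (\<phi> d)" for m d
    by (auto simp: lmap_def lsing_def)
  show ?thesis
  proof (rule D.laurent_ring_homI)
    show "cring (laurent n E)" by (rule E.cring_L)
    fix f assume f: "f \<in> carrier (laurent n D)"
    have "lsupp E (lmap \<phi> f) \<subseteq> lsupp D f"
      by (auto simp: lmap_def lsupp_def)
    thus "lmap \<phi> f \<in> carrier (laurent n E)"
      using f h.hom_closed unfolding D.L_carrier E.L_carrier by (auto simp: lmap_def intro: finite_subset)
    fix g assume g: "g \<in> carrier (laurent n D)"
    show "lmap \<phi> (f \<oplus>\<^bsub>D.L\<^esub> g) = lmap \<phi> f \<oplus>\<^bsub>E.L\<^esub> lmap \<phi> g"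
      using D.L_val[OF f] D.L_val[OF g] by (simp add: lmap_def D.L_add E.L_add)
  qed (simp_all add: sing D.L_one E.L_one E.lsing_mult)
qed

context laurent_alg begin

text \<open>
  The comorphism of the multiplication of the torus, which sends a character \<open>t\<^sup>u\<close> to
  \<open>s\<^sup>u t\<^sup>u\<close>.
\<close>

definition diag :: "((nat \<Rightarrow> int) \<Rightarrow> 'a) \<Rightarrow> (nat \<Rightarrow> int) \<Rightarrow> (nat \<Rightarrow> int) \<Rightarrow> 'a" where
  "diag f = (\<lambda>u v. if u = v then f u else \<zero>)"

lemma diag_eq: "diag f = (\<lambda>u. lsing D u (f u))"
  by (auto simp: diag_def lsing_def intro!: ext)

lemma diag_ring_hom: "diag \<in> ring_hom L (laurent n L)"
proof -
  interpret LL: laurent_alg L n using cring_L by (simp add: laurent_alg_def)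
  have sing: "diag (lsing D m d) = lsing L m (lsing D m d)" for m d
    by (auto simp: diag_def lsing_def L_zero intro!: ext)
  show ?thesis
  proof (rule laurent_ring_homI)
    show "cring (laurent n L)" by (rule LL.cring_L)
    fix f assume f: "f \<in> carrier L"
    have sub: "lsupp L (diag f) \<subseteq> lsupp D f"
      by (auto simp: diag_def lsupp_def L_zero fun_eq_iff split: if_splits)
    have "diag f u \<in> carrier L" for u
    proof (cases "f u = \<zero>")
      case True
      hence "diag f u = \<zero>\<^bsub>L\<^esub>" by (auto simp: diag_def L_zero)
      thus ?thesis by simp
    next
      case False
      thus ?thesis using L_val[OF f] L_sub[OF f] by (simp add: diag_eq)
    qed
    thus "diag f \<in> carrier (laurent n L)"
      using f sub unfolding LL.L_carrier L_carrier by (auto intro: finite_subset)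
  next
    fix f g assume f: "f \<in> carrier L" "g \<in> carrier L"
    show "diag (f \<oplus>\<^bsub>L\<^esub> g) = diag f \<oplus>\<^bsub>laurent n L\<^esub> diag g"
      by (auto simp: LL.L_add L_add diag_def intro!: ext)
  qed (auto simp: sing L_one LL.L_one LL.lsing_mult lsing_mult)
qed

end

section \<open>Graded algebras\<close>

lemma (in ideal) finsum_in:
  assumes "finite A" "\<And>a. a \<in> A \<Longrightarrow> f a \<in> I"
  shows "finsum R f A \<in> I"
  using assms
proof (induction A rule: finite_induct)
  case empty thus ?case using zero_closed by simp
next
  case (insert a A)
  hence "f b \<in> carrier R" if "b \<in> insert a A" for b
    using that Icarr by blast
  hence "finsum R f (insert a A) = f a \<oplus> finsum R f A"
    using insert by (intro finsum_insert) auto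
  thus ?case using insert a_closed by simp
qed

lemma (in ideal) finsum_in_rest:
  assumes "finite A" "a \<in> A" "\<And>b. b \<in> A \<Longrightarrow> f b \<in> carrier R" "\<And>b. b \<in> A \<Longrightarrow> b \<noteq> a \<Longrightarrow> f b \<in> I"
    and "finsum R f A \<in> I"
  shows "f a \<in> I"
proof -
  have A: "A = insert a (A - {a})" using assms(2) by blast
  have rest: "finsum R f (A - {a}) \<in> I"
    using assms by (intro finsum_in) auto
  have "finsum R f A = f a \<oplus> finsum R f (A - {a})"
    using assms by (subst A, intro finsum_insert) auto
  hence "f a = finsum R f A \<ominus> finsum R f (A - {a})"
    using assms(2,3) Icarr[OF rest] by (simp add: a_minus_def add.inv_solve_right)
  thus ?thesis
    using assms(5) rest by (simp add: a_minus_def a_inv_closed a_closed)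
qed

lemma base_alg_simps [simp]:
  "carrier base_alg = UNIV" "a \<otimes>\<^bsub>base_alg\<^esub> b = a * b" "\<one>\<^bsub>base_alg\<^esub> = 1" "\<zero>\<^bsub>base_alg\<^esub> = 0"
  "a \<oplus>\<^bsub>base_alg\<^esub> b = a + b" "cst base_alg c = c"
  by (simp_all add: base_alg_def)

lemma cring_base_alg: "cring (base_alg :: ('k::field, 'k) kalg)"
proof (rule cringI)
  show "abelian_group (base_alg :: ('k, 'k) kalg)"
    by (rule abelian_groupI) (auto simp: algebra_simps intro: exI[of _ "- _"] left_minus)
  show "comm_monoid (base_alg :: ('k, 'k) kalg)"
    by (rule comm_monoidI) (auto simp: algebra_simps)
qed (auto simp: algebra_simps)

locale kalgebra = cring B for B :: "('a, 'k::field) kalg" (structure) +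
  assumes cst_hom: "cst B \<in> ring_hom base_alg B"
begin

lemma cst_simps [simp]:
  "cst B c \<in> carrier B" "cst B 1 = \<one>" "cst B 0 = \<zero>"
  "cst B (c + c') = cst B c \<oplus> cst B c'" "cst B (c * c') = cst B c \<otimes> cst B c'"
proof -
  interpret K: cring "base_alg :: ('k, 'k) kalg" by (rule cring_base_alg)
  interpret h: ring_hom_ring base_alg B "cst B"
    by unfold_locales (rule cst_hom)
  show "cst B c \<in> carrier B" "cst B 1 = \<one>" "cst B 0 = \<zero>"
    "cst B (c + c') = cst B c \<oplus> cst B c'" "cst B (c * c') = cst B c \<otimes> cst B c'"
    using h.hom_closed[of c] h.hom_one h.hom_zero h.hom_add[of c c'] h.hom_mult[of c c'] by simp_all
qed

lemma cst_sum: "finite A \<Longrightarrow> cst B (\<Sum>a\<in>A. f a) = (\<Oplus>a\<in>A. cst B (f a))"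
  by (induction A rule: finite_induct) auto

lemma pregraded_trivial: "pregraded B (trivial_grading B)"
  by unfold_locales (auto simp: trivial_grading_def split: if_splits)

lemma hspace_data_Spec: "hspace_data B (trivial_grading B) (Spec_pts B)"
proof -
  interpret T: pregraded B "trivial_grading B" by (rule pregraded_trivial)
  show ?thesis
  proof (intro hspace_data.intro hspace_data_axioms.intro pregraded_trivial)
    fix p assume "p \<in> Spec_pts B"
    thus "primeideal p B" by (simp add: Spec_pts_def)
    then interpret p: primeideal p B .
    have sub: "p \<subseteq> carrier B" using p.Icarr by blast
    hence "p \<inter> T.hom = p" by auto
    moreover have "genideal B p = p"
      using genideal_minimal[OF p.ideal_axioms subset_refl] genideal_self[OF sub] by blast
    ultimately show "p = genideal B (p \<inter> T.hom)" by simp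
  qed
qed

end

lemma kalgebra_base_alg: "kalgebra (base_alg :: ('k::field, 'k) kalg)"
proof -
  interpret K: cring "base_alg :: ('k, 'k) kalg" by (rule cring_base_alg)
  show ?thesis
    by unfold_locales (auto simp: ring_hom_def)
qed

lemma kalgebra_laurent:
  assumes "kalgebra D"
  shows "kalgebra (laurent n D)"
proof -
  interpret D: kalgebra D by fact
  interpret L: laurent_alg D n by unfold_locales
  show ?thesis
    by unfold_locales
      (use D.cst_hom L.lconst_ring_hom in \<open>auto simp: ring_hom_def L.L_cst lconst_eq_lsing[symmetric]\<close>)
qed

text \<open>
  The projections \<open>cmp d\<close> to the components are part of the data, as they are explicit in all
  instances.
\<close>

locale graded = kalgebra B + pregraded B G
  for B :: "('a, 'k::field) kalg" (structure) and G +
  fixes cmp :: "nat \<Rightarrow> 'a \<Rightarrow> 'a"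
  assumes cmp_G: "x \<in> carrier B \<Longrightarrow> cmp d x \<in> G d"
    and cmp_add: "x \<in> carrier B \<Longrightarrow> y \<in> carrier B \<Longrightarrow> cmp d (x \<oplus> y) = cmp d x \<oplus> cmp d y"
    and cmp_hom: "x \<in> G d \<Longrightarrow> cmp e x = (if e = d then x else \<zero>)"
    and cmp_sum: "x \<in> carrier B \<Longrightarrow> \<exists>N. (\<forall>d\<ge>N. cmp d x = \<zero>) \<and> x = (\<Oplus>d\<in>{..<N}. cmp d x)"
begin

lemma cmp_carr [simp]: "x \<in> carrier B \<Longrightarrow> cmp d x \<in> carrier B"
  using cmp_G G_carr by blast

lemma cmp_zero [simp]: "cmp d \<zero> = \<zero>"
  using cmp_hom[OF G_zero] by simp

lemma zero_G [simp]: "\<zero> \<in> G d"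
  using cmp_G[of \<zero> d] by simp

lemma finsum_G:
  assumes "finite A" "\<And>a. a \<in> A \<Longrightarrow> f a \<in> G d"
  shows "finsum B f A \<in> G d"
  using assms
proof (induction A rule: finite_induct)
  case (insert a A)
  thus ?case using G_carr G_add by (subst finsum_insert) (auto simp: Pi_def)
qed simp

lemma graded_induct [consumes 1, case_names hom add]:
  assumes x: "x \<in> carrier B"
    and hom: "\<And>d x. x \<in> G d \<Longrightarrow> P x"
    and add: "\<And>x y. x \<in> carrier B \<Longrightarrow> y \<in> carrier B \<Longrightarrow> P x \<Longrightarrow> P y \<Longrightarrow> P (x \<oplus> y)"
  shows "P x"
proof -
  have *: "P (\<Oplus>d\<in>{..<N}. cmp d x)" for N :: nat
  proof (induction N)
    case 0 thus ?case using hom[OF G_zero] by simp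
  next
    case (Suc N)
    have "(\<Oplus>d\<in>{..<Suc N}. cmp d x) = cmp N x \<oplus> (\<Oplus>d\<in>{..<N}. cmp d x)"
      using x by (subst lessThan_Suc, intro finsum_insert) auto
    thus ?case using Suc x hom[OF cmp_G[OF x]] by (auto intro!: add)
  qed
  obtain N where "x = (\<Oplus>d\<in>{..<N}. cmp d x)" using cmp_sum[OF x] by blast
  with *[of N] show ?thesis by simp
qed

lemma cmp_mult:
  assumes x: "x \<in> carrier B" and y: "y \<in> carrier B"
  shows "cmp d (x \<otimes> y) = (\<Oplus>i\<in>{..d}. cmp i x \<otimes> cmp (d - i) y)"
  using x
proof (induction rule: graded_induct)
  case (add x x')
  thus ?case using y by (simp add: l_distr cmp_add finsum_addf)
next
  case (hom i x)
  note X = hom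
  hence xc: "x \<in> carrier B" using G_carr by blast
  show ?case using y
  proof (induction rule: graded_induct)
    case (add y y')
    thus ?case using xc by (simp add: r_distr cmp_add finsum_addf)
  next
    case (hom j y)
    hence yc: "y \<in> carrier B" using G_carr by blast
    have t: "cmp k x \<otimes> cmp (d - k) y = (if k = i then (if d - i = j then x \<otimes> y else \<zero>) else \<zero>)" for k
      using xc yc by (simp add: cmp_hom[OF X] cmp_hom[OF hom])
    have "(\<Oplus>k\<in>{..d}. cmp k x \<otimes> cmp (d - k) y) = (if i \<le> d \<and> d - i = j then x \<otimes> y else \<zero>)"
    proof (cases "i \<le> d")
      case True
      hence "(\<Oplus>k\<in>{..d}. if k = i then (if d - i = j then x \<otimes> y else \<zero>) else \<zero>)
          = (if d - i = j then x \<otimes> y else \<zero>)"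
        using xc yc by (subst finsum_cong'[OF refl _ refl], simp)
           (use add.finprod_singleton_swap[of i "{..d}" "\<lambda>_. if d - i = j then x \<otimes> y else \<zero>"] in auto)
      thus ?thesis using True by (simp add: t)
    next
      case False
      thus ?thesis unfolding t by (auto intro!: add.finprod_one_eqI)
    qed
    also have "\<dots> = cmp d (x \<otimes> y)"
      using cmp_hom[OF G_mult[OF X hom]] by auto
    finally show ?case by simp
  qed
qed

lemma eventually_zero: "x \<in> carrier B \<Longrightarrow> \<exists>N. \<forall>d\<ge>N. cmp d x = \<zero>"
  using cmp_sum by blast

lemma ideal_cmpI:
  assumes "ideal p B" "x \<in> carrier B" "\<And>d. cmp d x \<in> p"
  shows "x \<in> p"
proof -
  interpret p: ideal p B by fact
  obtain N where "x = (\<Oplus>d\<in>{..<N}. cmp d x)" using cmp_sum[OF assms(2)] by blast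
  moreover have "(\<Oplus>d\<in>{..<N}. cmp d x) \<in> p"
    using assms(3) by (intro p.finsum_in) auto
  ultimately show ?thesis by metis
qed

text \<open>
  The largest homogeneous ideal that is contained in the preimage of an ideal \<open>q\<close>.
\<close>

definition ghull :: "('a \<Rightarrow> 'c) \<Rightarrow> 'c set \<Rightarrow> 'a set" where
  "ghull \<phi> q = {x \<in> carrier B. \<forall>d. \<phi> (cmp d x) \<in> q}"

lemma hull_ideal:
  assumes "cring C" "\<phi> \<in> ring_hom B C" "ideal q C"
  shows "ideal (ghull \<phi> q) B"
proof -
  interpret C: cring C by fact
  interpret h: ring_hom_ring B C \<phi> by unfold_locales (rule assms)
  interpret q: ideal q C by fact
  have mult: "y \<otimes> x \<in> ghull \<phi> q" if x: "x \<in> ghull \<phi> q" and y: "y \<in> carrier B" for x y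
  proof -
    have xc: "x \<in> carrier B" using x by (simp add: ghull_def)
    have "\<phi> (cmp d (y \<otimes> x)) \<in> q" for d
    proof -
      have "\<phi> (cmp d (y \<otimes> x)) = (\<Oplus>\<^bsub>C\<^esub>i\<in>{..d}. \<phi> (cmp i y \<otimes> cmp (d - i) x))"
        unfolding cmp_mult[OF y xc] using y xc by (subst h.hom_finsum) (auto simp: comp_def)
      also have "\<dots> \<in> q"
      proof (rule q.finsum_in)
        fix i
        have "\<phi> (cmp (d - i) x) \<in> q" using x by (simp add: ghull_def)
        thus "\<phi> (cmp i y \<otimes> cmp (d - i) x) \<in> q"
          using y xc q.I_l_closed[of "\<phi> (cmp (d - i) x)" "\<phi> (cmp i y)"] by simp
      qed simp
      finally show ?thesis .
    qed
    thus ?thesis using y xc by (simp add: ghull_def)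
  qed
  show ?thesis
  proof (rule idealI)
    show "ring B" by unfold_locales
    show "subgroup (ghull \<phi> q) (add_monoid B)"
    proof (rule add.subgroupI)
      show "ghull \<phi> q \<subseteq> carrier B" by (auto simp: ghull_def)
      show "ghull \<phi> q \<noteq> {}"
        using q.zero_closed by (auto simp: ghull_def intro!: exI[of _ \<zero>])
    next
      fix x y assume x: "x \<in> ghull \<phi> q" and y: "y \<in> ghull \<phi> q"
      hence c: "x \<in> carrier B" "y \<in> carrier B" by (auto simp: ghull_def)
      have "\<ominus> x = \<ominus> \<one> \<otimes> x" using c by (simp add: l_minus)
      thus "\<ominus> x \<in> ghull \<phi> q" using mult[OF x, of "\<ominus> \<one>"] by simp
      show "x \<oplus> y \<in> ghull \<phi> q"
        using x y c q.a_closed by (simp add: ghull_def cmp_add)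
    qed
  next
    fix x y assume x: "x \<in> ghull \<phi> q" and y: "y \<in> carrier B"
    hence c: "x \<in> carrier B" by (simp add: ghull_def)
    show "y \<otimes> x \<in> ghull \<phi> q" using mult[OF x y] .
    thus "x \<otimes> y \<in> ghull \<phi> q" using m_comm[OF c y] by simp
  qed
qed

text \<open>
  Of two elements outside the hull, take the components of largest degree whose images avoid \<open>q\<close>; their
  product is, modulo \<open>q\<close>, a component of the product.
\<close>

lemma hull_prime:
  assumes C: "cring C" and \<phi>: "\<phi> \<in> ring_hom B C" and q: "primeideal q C"
  shows "primeideal (ghull \<phi> q) B"
proof -
  interpret C: cring C by fact
  interpret h: ring_hom_ring B C \<phi> by unfold_locales (rule assms)
  interpret q: primeideal q C by fact
  have "\<one>\<^bsub>C\<^esub> \<notin> q" using q.I_notcarr q.one_imp_carrier by blast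
  hence "\<phi> (cmp 0 \<one>) \<notin> q" using cmp_hom[OF G_one, of 0] by simp
  hence "\<one> \<notin> ghull \<phi> q" by (auto simp: ghull_def)
  hence ne: "carrier B \<noteq> ghull \<phi> q" by auto
  have top: "\<exists>i. \<phi> (cmp i x) \<notin> q \<and> (\<forall>k>i. \<phi> (cmp k x) \<in> q)"
    if x: "x \<in> carrier B" "x \<notin> ghull \<phi> q" for x
  proof -
    obtain N where N: "\<forall>d\<ge>N. cmp d x = \<zero>" using eventually_zero[OF x(1)] by blast
    let ?S = "{i. \<phi> (cmp i x) \<notin> q}"
    have "?S \<subseteq> {..<N}"
    proof
      fix i assume "i \<in> ?S"
      thus "i \<in> {..<N}"
        using N q.zero_closed by (cases "N \<le> i") auto
    qed
    hence fin: "finite ?S" using finite_subset by blast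
    have "?S \<noteq> {}" using x by (auto simp: ghull_def)
    hence "Max ?S \<in> ?S" using fin by (rule Max_in[rotated])
    moreover have "\<phi> (cmp k x) \<in> q" if "k > Max ?S" for k
      using Max_ge[OF fin, of k] that by (cases "k \<in> ?S") auto
    ultimately show ?thesis by blast
  qed
  show ?thesis
  proof (rule primeidealI)
    show "ideal (ghull \<phi> q) B" by (rule hull_ideal[OF C \<phi> q.ideal_axioms])
    show "cring B" by unfold_locales
    show "carrier B \<noteq> ghull \<phi> q" by (rule ne)
    fix x y assume x: "x \<in> carrier B" and y: "y \<in> carrier B" and xy: "x \<otimes> y \<in> ghull \<phi> q"
    show "x \<in> ghull \<phi> q \<or> y \<in> ghull \<phi> q"
    proof (rule ccontr)
      assume "\<not> ?thesis"
      then obtain i j where i: "\<phi> (cmp i x) \<notin> q" "\<And>k. k > i \<Longrightarrow> \<phi> (cmp k x) \<in> q"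
        and j: "\<phi> (cmp j y) \<notin> q" "\<And>k. k > j \<Longrightarrow> \<phi> (cmp k y) \<in> q"
        using top x y by meson
      let ?f = "\<lambda>k. \<phi> (cmp k x \<otimes> cmp (i + j - k) y)"
      have "\<phi> (cmp (i + j) (x \<otimes> y)) = (\<Oplus>\<^bsub>C\<^esub>k\<in>{..i+j}. ?f k)"
        unfolding cmp_mult[OF x y] using x y by (subst h.hom_finsum) (auto simp: comp_def)
      moreover have "\<phi> (cmp (i + j) (x \<otimes> y)) \<in> q" using xy unfolding ghull_def by blast
      ultimately have sum: "(\<Oplus>\<^bsub>C\<^esub>k\<in>{..i+j}. ?f k) \<in> q" by simp
      have "?f k \<in> q" if k: "k \<in> {..i+j}" "k \<noteq> i" for k
      proof (cases "k > i")
        case True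
        thus ?thesis
          using x y q.I_r_closed[OF i(2)[OF True], of "\<phi> (cmp (i + j - k) y)"] by simp
      next
        case False
        hence "i + j - k > j" using k by simp
        thus ?thesis
          using x y q.I_l_closed[OF j(2), of "i + j - k" "\<phi> (cmp k x)"] by simp
      qed
      hence "?f i \<in> q"
        using x y sum by (intro q.finsum_in_rest[of "{..i+j}" i ?f]) auto
      hence "\<phi> (cmp i x) \<otimes>\<^bsub>C\<^esub> \<phi> (cmp j y) \<in> q" using x y by simp
      thus False using q.I_prime[of "\<phi> (cmp i x)" "\<phi> (cmp j y)"] x y i(1) j(1) by simp
    qed
  qed
qed

lemma hull_mem_hom:
  assumes "cring C" "\<phi> \<in> ring_hom B C" "ideal q C" "x \<in> G d"
  shows "x \<in> ghull \<phi> q \<longleftrightarrow> \<phi> x \<in> q"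
proof -
  interpret C: cring C by fact
  interpret h: ring_hom_ring B C \<phi> by unfold_locales (rule assms)
  interpret q: ideal q C by fact
  show ?thesis
    using cmp_hom[OF assms(4)] G_carr[OF assms(4)] q.zero_closed by (auto simp: ghull_def)
qed

lemma hull_cmp: "x \<in> ghull \<phi> q \<Longrightarrow> \<phi> \<zero> \<in> q \<Longrightarrow> cmp d x \<in> ghull \<phi> q"
  using cmp_hom[OF cmp_G] by (auto simp: ghull_def)

lemma homogeneousI:
  assumes p: "ideal p B" and c: "\<And>x d. x \<in> p \<Longrightarrow> cmp d x \<in> p"
  shows "homogeneous_ideal B G p"
  unfolding homogeneous_ideal_def
proof
  interpret p: ideal p B by fact
  have sub: "p \<inter> hom \<subseteq> carrier B" using p.Icarr by blast
  show "p \<subseteq> genideal B (p \<inter> hom)"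
  proof
    fix x assume x: "x \<in> p"
    hence xc: "x \<in> carrier B" using p.Icarr by blast
    show "x \<in> genideal B (p \<inter> hom)"
    proof (rule ideal_cmpI[OF genideal_ideal[OF sub] xc])
      fix d
      have "cmp d x \<in> p \<inter> hom" using c[OF x] cmp_G[OF xc] by blast
      thus "cmp d x \<in> genideal B (p \<inter> hom)" using genideal_self[OF sub] by blast
    qed
  qed
  show "genideal B (p \<inter> hom) \<subseteq> p"
    by (rule genideal_minimal[OF p]) blast
qed

lemma homogeneousD:
  assumes p: "ideal p B" and h: "homogeneous_ideal B G p" and x: "x \<in> p"
  shows "cmp d x \<in> p"
proof -
  interpret p: ideal p B by fact
  have id: "(\<lambda>x. x) \<in> ring_hom B B" by (simp add: ring_hom_def)
  have cr: "cring B" by unfold_locales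
  have "p \<inter> hom \<subseteq> ghull (\<lambda>x. x) p"
  proof
    fix y assume "y \<in> p \<inter> hom"
    then obtain e where "y \<in> p" "y \<in> G e" by blast
    thus "y \<in> ghull (\<lambda>x. x) p" using hull_mem_hom[OF cr id p] by simp
  qed
  hence "genideal B (p \<inter> hom) \<subseteq> ghull (\<lambda>x. x) p"
    by (rule genideal_minimal[OF hull_ideal[OF cr id p]])
  thus ?thesis
    using x h unfolding homogeneous_ideal_def ghull_def by blast
qed

lemma Proj_pts_iff:
  "p \<in> Proj_pts B G \<longleftrightarrow>
     primeideal p B \<and> (\<forall>x\<in>p. \<forall>d. cmp d x \<in> p) \<and> (\<exists>d>0. \<exists>x\<in>G d. x \<notin> p)"
proof -
  have "homogeneous_ideal B G p \<longleftrightarrow> (\<forall>x\<in>p. \<forall>d. cmp d x \<in> p)" if "primeideal p B"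
    using homogeneousI homogeneousD primeideal.axioms(1)[OF that] by blast
  thus ?thesis unfolding Proj_pts_def by auto
qed

lemma hspace_data_Proj: "hspace_data B G (Proj_pts B G)"
proof (intro hspace_data.intro hspace_data_axioms.intro)
  show "pregraded B G" by unfold_locales
qed (simp_all add: Proj_pts_def homogeneous_ideal_def)

end

lemma graded_hom_cmp:
  assumes "graded B G cmp" "graded B' G' cmp'" "\<phi> \<in> ring_hom B' B" "\<And>d. \<phi> ` G' d \<subseteq> G d"
    and "x \<in> carrier B'"
  shows "\<phi> (cmp' d x) = cmp d (\<phi> x)"
proof -
  interpret X: graded B G cmp by fact
  interpret Y: graded B' G' cmp' by fact
  interpret h: ring_hom_ring B' B \<phi> by unfold_locales (rule assms)
  show ?thesis
    using assms(5)
  proof (induction rule: Y.graded_induct)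
    case (hom e x)
    hence "\<phi> x \<in> G e" using assms(4) by blast
    thus ?case using X.cmp_hom Y.cmp_hom[OF hom] by simp
  next
    case (add x y)
    thus ?case by (simp add: X.cmp_add Y.cmp_add)
  qed
qed

lemma gmor_Proj_Proj:
  assumes X: "graded B G cmp" and Y: "graded B' G' cmp'" and \<phi>: "\<phi> \<in> ring_hom B' B"
    and cst: "\<And>c. \<phi> (cst B' c) = cst B c" and deg: "\<And>d. \<phi> ` G' d \<subseteq> G d"
    and valid: "\<And>q. q \<in> Proj_pts B G \<Longrightarrow> \<exists>d>0. \<exists>x\<in>G' d. \<phi> x \<notin> q"
  shows "gmor B G (Proj_pts B G) B' G' (Proj_pts B' G') \<phi> (Proj_induced B' \<phi> B G)"
  unfolding Proj_induced_eq
proof (rule gmor_hinduced)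
  interpret X: graded B G cmp by fact
  interpret Y: graded B' G' cmp' by fact
  interpret h: ring_hom_ring B' B \<phi> by unfold_locales (rule assms)
  show "hspace_data B G (Proj_pts B G)" by (rule X.hspace_data_Proj)
  show "hspace_data B' G' (Proj_pts B' G')" by (rule Y.hspace_data_Proj)
  fix q assume q: "q \<in> Proj_pts B G"
  hence qp: "primeideal q B" and qc: "\<And>x d. x \<in> q \<Longrightarrow> cmp d x \<in> q"
    using X.Proj_pts_iff by blast+
  have "primeideal {x \<in> carrier B'. \<phi> x \<in> q} B'"
    by (rule h.primeideal_vimage[OF Y.is_cring qp])
  moreover have "cmp' d x \<in> {x \<in> carrier B'. \<phi> x \<in> q}" if "x \<in> {x \<in> carrier B'. \<phi> x \<in> q}" for x d
    using that graded_hom_cmp[OF X Y \<phi> deg] qc by auto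
  moreover have "\<exists>d>0. \<exists>x\<in>G' d. x \<notin> {x \<in> carrier B'. \<phi> x \<in> q}"
    using valid[OF q] by blast
  ultimately show "{x \<in> carrier B'. \<phi> x \<in> q} \<in> Proj_pts B' G'"
    unfolding Y.Proj_pts_iff by blast
next
  fix d show "\<exists>e. \<phi> ` G' d \<subseteq> G e" using deg by blast
next
  interpret Y: graded B' G' cmp' by fact
  fix q x d assume "x \<in> G' d"
  thus "x \<in> {x \<in> carrier B'. \<phi> x \<in> q} \<longleftrightarrow> \<phi> x \<in> q" using Y.G_carr by blast
next
  fix x assume x: "x \<in> carrier B'"
  hence "{\<phi> x} \<subseteq> carrier B" using \<phi> ring_hom_closed by fastforce
  thus "\<exists>E\<subseteq>carrier B. \<forall>q\<in>Proj_pts B G. x \<in> {x \<in> carrier B'. \<phi> x \<in> q} \<longleftrightarrow> E \<subseteq> q"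
    using x by (intro exI[of _ "{\<phi> x}"]) auto
qed (fact \<phi> cst)+

lemma gmor_to_Spec:
  assumes X: "hspace_data B G Q" and C: "kalgebra C" and \<phi>: "\<phi> \<in> ring_hom C B"
    and cst: "\<And>c. \<phi> (cst C c) = cst B c" and deg: "\<phi> ` carrier C \<subseteq> G 0"
  shows "gmor B G Q C (trivial_grading C) (Spec_pts C) \<phi> (hinduced (\<lambda>q. {x \<in> carrier C. \<phi> x \<in> q}) \<phi> B G)"
proof (rule gmor_hinduced[OF X])
  interpret X: hspace_data B G Q by fact
  interpret C: kalgebra C by fact
  interpret h: ring_hom_ring C B \<phi> by unfold_locales (rule assms)
  show "hspace_data C (trivial_grading C) (Spec_pts C)" by (rule C.hspace_data_Spec)
  fix q assume q: "q \<in> Q"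
  show "{x \<in> carrier C. \<phi> x \<in> q} \<in> Spec_pts C"
    using h.primeideal_vimage[OF C.is_cring X.Q_prime[OF q]] by (simp add: Spec_pts_def)
next
  fix d show "\<exists>e. \<phi> ` trivial_grading C d \<subseteq> G e"
    using deg by (cases "d = 0") (auto simp: trivial_grading_def)
next
  fix q x d assume "x \<in> trivial_grading C d"
  thus "x \<in> {x \<in> carrier C. \<phi> x \<in> q} \<longleftrightarrow> \<phi> x \<in> q"
    by (auto simp: trivial_grading_def split: if_splits)
next
  fix x assume x: "x \<in> carrier C"
  hence "{\<phi> x} \<subseteq> carrier B" using \<phi> ring_hom_closed by fastforce
  thus "\<exists>E\<subseteq>carrier B. \<forall>q\<in>Q. x \<in> {x \<in> carrier C. \<phi> x \<in> q} \<longleftrightarrow> E \<subseteq> q"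
    using x by (intro exI[of _ "{\<phi> x}"]) auto
qed (fact \<phi> cst)+

lemma gmor_Proj_Spec:
  assumes X: "graded B G cmp" and C: "kalgebra C" and \<phi>: "\<phi> \<in> ring_hom C B"
    and cst: "\<And>c. \<phi> (cst C c) = cst B c" and deg: "\<phi> ` carrier C \<subseteq> G 0"
  shows "gmor B G (Proj_pts B G) C (trivial_grading C) (Spec_pts C) \<phi> (Proj_induced C \<phi> B G)"
  unfolding Proj_induced_eq by (rule gmor_to_Spec[OF graded.hspace_data_Proj[OF X] C \<phi> cst deg])

lemma gmor_Spec_Spec:
  assumes X: "kalgebra B" and C: "kalgebra C" and \<phi>: "\<phi> \<in> ring_hom C B"
    and cst: "\<And>c. \<phi> (cst C c) = cst B c"
  shows "gmor B (trivial_grading B) (Spec_pts B) C (trivial_grading C) (Spec_pts C) \<phi> (Spec_induced C \<phi> B)"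
  unfolding Spec_induced_eq
  using \<phi> by (intro gmor_to_Spec[OF kalgebra.hspace_data_Spec[OF X] C \<phi> cst])
    (auto simp: trivial_grading_def ring_hom_def)

lemma gmor_Spec_Proj:
  assumes X: "kalgebra C" and Y: "graded B G cmp" and \<phi>: "\<phi> \<in> ring_hom B C"
    and cst: "\<And>c. \<phi> (cst B c) = cst C c"
    and valid: "\<And>q. q \<in> Spec_pts C \<Longrightarrow> \<exists>d>0. \<exists>x\<in>G d. \<phi> x \<notin> q"
  shows "gmor C (trivial_grading C) (Spec_pts C) B G (Proj_pts B G) \<phi>
           (hinduced (graded.ghull B cmp \<phi>) \<phi> C (trivial_grading C))"
proof (rule gmor_hinduced)
  interpret X: kalgebra C by fact
  interpret Y: graded B G cmp by fact
  interpret h: ring_hom_ring B C \<phi> by unfold_locales (rule assms)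
  show "hspace_data C (trivial_grading C) (Spec_pts C)" by (rule X.hspace_data_Spec)
  show "hspace_data B G (Proj_pts B G)" by (rule Y.hspace_data_Proj)
  have p0: "\<phi> \<zero>\<^bsub>B\<^esub> \<in> q" if "q \<in> Spec_pts C" for q
    using that by (auto simp: Spec_pts_def primeideal_def ideal_def intro: additive_subgroup.zero_closed)
  show mem: "x \<in> Y.ghull \<phi> q \<longleftrightarrow> \<phi> x \<in> q" if "q \<in> Spec_pts C" "x \<in> G d" for q x d
    using that Y.hull_mem_hom[OF X.is_cring \<phi>] by (auto simp: Spec_pts_def primeideal_def)
  fix q assume q: "q \<in> Spec_pts C"
  hence "primeideal (Y.ghull \<phi> q) B"
    using Y.hull_prime[OF X.is_cring \<phi>] by (simp add: Spec_pts_def)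
  moreover have "\<exists>d>0. \<exists>x\<in>G d. x \<notin> Y.ghull \<phi> q"
    using valid[OF q] mem[OF q] by blast
  ultimately show "Y.ghull \<phi> q \<in> Proj_pts B G"
    unfolding Y.Proj_pts_iff using Y.hull_cmp p0[OF q] by blast
next
  interpret Y: graded B G cmp by fact
  fix d show "\<exists>e. \<phi> ` G d \<subseteq> trivial_grading C e"
    using \<phi> Y.G_carr by (intro exI[of _ 0]) (auto simp: trivial_grading_def ring_hom_def)
next
  interpret Y: graded B G cmp by fact
  fix x assume x: "x \<in> carrier B"
  hence "range (\<lambda>d. \<phi> (cmp d x)) \<subseteq> carrier C"
    using \<phi> by (auto simp: ring_hom_def)
  thus "\<exists>E\<subseteq>carrier C. \<forall>q\<in>Spec_pts C. x \<in> Y.ghull \<phi> q \<longleftrightarrow> E \<subseteq> q"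
    using x by (intro exI[of _ "range (\<lambda>d. \<phi> (cmp d x))"]) (auto simp: Y.ghull_def)
qed (fact \<phi> cst)+

lemma graded_laurent:
  assumes "graded B G cmp"
  shows "graded (laurent n B) (laurent_grading n B G) (\<lambda>d f u. cmp d (f u))"
proof -
  interpret B: graded B G cmp by fact
  interpret L: laurent_alg B n by unfold_locales
  interpret K: kalgebra "laurent n B" by (rule kalgebra_laurent) unfold_locales
  let ?H = "laurent_grading n B G"
  have H: "f \<in> ?H d \<longleftrightarrow> f \<in> carrier L.L \<and> (\<forall>m. f m \<in> G d)" for f d
    by (simp add: laurent_grading_def)
  have sing: "lsing B m x \<in> ?H d" if "m \<in> int_lattice n" "x \<in> G d" for m x d
    using that B.G_carr unfolding H by (auto simp: lsing_def[of B m x] L.lsing_carrier[unfolded lsing_def])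
  have cl: "(\<lambda>u. cmp d (f u)) \<in> carrier L.L" if f: "f \<in> carrier L.L" for f d
  proof -
    have "lsupp B (\<lambda>u. cmp d (f u)) \<subseteq> lsupp B f" by (auto simp: lsupp_def)
    thus ?thesis
      using f L.L_val[OF f] unfolding L.L_carrier by (auto intro: finite_subset)
  qed
  have zeroL: "\<zero>\<^bsub>L.L\<^esub> \<in> ?H d" for d
    by (simp add: H L.L_zero_closed) (simp add: L.L_zero)
  show ?thesis
  proof (unfold_locales, goal_cases)
    case (1 d) thus ?case by (auto simp: H)
  next
    case 2 thus ?case by (simp add: L.L_one sing B.G_one)
  next
    case 3 thus ?case by (rule zeroL)
  next
    case (4 f d g) thus ?case by (simp add: H) (simp add: L.L_add B.G_add)
  next
    case (5 f d)
    hence f: "f \<in> carrier L.L" by (simp add: H)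
    have g: "(\<lambda>u. \<ominus>\<^bsub>B\<^esub> f u) \<in> carrier L.L"
    proof -
      have "lsupp B (\<lambda>u. \<ominus>\<^bsub>B\<^esub> f u) \<subseteq> lsupp B f" by (auto simp: lsupp_def)
      thus ?thesis
        using f L.L_val[OF f] unfolding L.L_carrier by (auto intro: finite_subset)
    qed
    have "(\<lambda>u. \<ominus>\<^bsub>B\<^esub> f u) \<oplus>\<^bsub>L.L\<^esub> f = \<zero>\<^bsub>L.L\<^esub>"
      using L.L_val[OF f] by (simp add: L.L_add L.L_zero B.l_neg)
    hence "\<ominus>\<^bsub>L.L\<^esub> f = (\<lambda>u. \<ominus>\<^bsub>B\<^esub> f u)"
      using f g by (metis L.L.minus_equality)
    thus ?case using 5 g B.G_minus by (simp add: H)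
  next
    case (6 f d g e)
    hence f: "f \<in> carrier L.L" "\<And>m. f m \<in> G d" and g: "g \<in> carrier L.L" "\<And>m. g m \<in> G e"
      by (auto simp: H)
    have "(f \<otimes>\<^bsub>L.L\<^esub> g) m \<in> G (d + e)" for m
      unfolding L.L_mult[OF f(1) g(1) L.L_fin[OF f(1)] subset_refl]
      using f g by (intro B.finsum_G B.G_mult) auto
    thus ?case using f g by (simp add: H)
  next
    case (7 c) thus ?case by (simp add: L.L_cst sing B.G_cst)
  next
    case (8 f d) thus ?case using cl L.L_val B.cmp_G by (simp add: H)
  next
    case (9 f g d)
    thus ?case using L.L_val[OF 9(1)] L.L_val[OF 9(2)] by (simp add: L.L_add B.cmp_add)
  next
    case (10 f d e)
    hence fG: "f u \<in> G d" for u by (simp add: H)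
    show ?case using B.cmp_hom[OF fG] by (auto simp: L.L_zero fun_eq_iff)
  next
    case (11 f)
    have "\<forall>u. \<exists>N. (\<forall>d\<ge>N. cmp d (f u) = \<zero>\<^bsub>B\<^esub>) \<and> f u = (\<Oplus>\<^bsub>B\<^esub>d\<in>{..<N}. cmp d (f u))"
      using B.cmp_sum L.L_val[OF 11] by blast
    then obtain N where N: "\<And>u d. d \<ge> N u \<Longrightarrow> cmp d (f u) = \<zero>\<^bsub>B\<^esub>"
      "\<And>u. f u = (\<Oplus>\<^bsub>B\<^esub>d\<in>{..<N u}. cmp d (f u))" by metis
    let ?M = "Max (insert 0 (N ` lsupp B f))"
    have M: "N u \<le> ?M" if "u \<in> lsupp B f" for u
      using that L.L_fin[OF 11] by (intro Max_ge) auto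
    have z: "cmp d (f u) = \<zero>\<^bsub>B\<^esub>" if "d \<ge> ?M" for u d
    proof (cases "u \<in> lsupp B f")
      case True thus ?thesis using N(1)[of u d] M[of u] that by simp
    next
      case False thus ?thesis by (simp add: lsupp_def)
    qed
    have "f u = (\<Oplus>\<^bsub>B\<^esub>d\<in>{..<?M}. cmp d (f u))" for u
    proof (cases "u \<in> lsupp B f")
      case True
      have "(\<Oplus>\<^bsub>B\<^esub>d\<in>{..<N u}. cmp d (f u)) = (\<Oplus>\<^bsub>B\<^esub>d\<in>{..<?M}. cmp d (f u))"
        using M[OF True] N(1)[of u] L.L_val[OF 11, of u]
        by (intro B.add.finprod_mono_neutral_cong_left) auto
      thus ?thesis using N(2)[of u] by simp
    next
      case False
      thus ?thesis by (simp add: lsupp_def B.add.finprod_one_eqI)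
    qed
    hence "f = (\<Oplus>\<^bsub>L.L\<^esub>d\<in>{..<?M}. (\<lambda>u. cmp d (f u)))"
      using cl[OF 11] by (intro ext) (subst L.finsum_L_apply, auto)
    thus ?case using z by (intro exI[of _ ?M]) (auto simp: L.L_zero)
  qed
qed

text \<open>The projection from the product with a torus is defined everywhere.\<close>

lemma lconst_valid:
  assumes "graded B G cmp" and q: "q \<in> Proj_pts (laurent n B) (laurent_grading n B G)"
  shows "\<exists>d>0. \<exists>x\<in>G d. lconst B x \<notin> q"
proof (rule ccontr)
  assume neg: "\<not> ?thesis"
  interpret B: graded B G cmp by fact
  interpret L: laurent_alg B n by unfold_locales
  interpret GL: graded "laurent n B" "laurent_grading n B G" "\<lambda>d f u. cmp d (f u)"
    by (rule graded_laurent[OF assms(1)])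
  obtain d f where d: "d > 0" "f \<in> laurent_grading n B G d" "f \<notin> q" and p: "primeideal q L.L"
    using q GL.Proj_pts_iff by blast
  interpret q: primeideal q L.L by fact
  have f: "f \<in> carrier L.L" "\<And>m. f m \<in> G d" using d by (auto simp: laurent_grading_def)
  have "(\<forall>m. f m \<in> G d) \<longrightarrow> f \<in> q"
    using f(1)
  proof (induction rule: L.laurent_induct)
    case zero thus ?case using q.zero_closed by (simp add: L.L_zero)
  next
    case (upd g m c)
    show ?case
    proof
      assume *: "\<forall>u. (g(m := c)) u \<in> G d"
      have "g u \<in> G d" for u
        using *[THEN spec, of u] upd by (cases "u = m") auto
      hence gq: "g \<in> q" using upd by blast
      have c: "c \<in> G d" using *[THEN spec, of m] by simp
      hence "lconst B c \<in> q" using neg d by blast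
      hence "lsing B m \<one>\<^bsub>B\<^esub> \<otimes>\<^bsub>L.L\<^esub> lsing B 0 c \<in> q"
        using upd by (intro q.I_l_closed) (auto simp: lconst_eq_lsing)
      hence "lsing B m c \<in> q" using upd by (simp add: L.lsing_mult)
      thus "g(m := c) \<in> q" using gq upd q.a_closed by metis
    qed
  qed
  thus False using f d by blast
qed

section \<open>Divisibility of Laurent polynomials\<close>

text \<open>
  Here Laurent polynomials in countably many variables are finitely supported maps on exponent vectors, so
  that they form a type of class \<open>idom\<close>.
\<close>

type_synonym 'k lpoly = "(nat \<Rightarrow>\<^sub>0 int) \<Rightarrow>\<^sub>0 'k"

abbreviation lookup :: "('v \<Rightarrow>\<^sub>0 'k::zero) \<Rightarrow> 'v \<Rightarrow> 'k" where
  "lookup \<equiv> Poly_Mapping.lookup"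

abbreviation keys :: "('v \<Rightarrow>\<^sub>0 'k::zero) \<Rightarrow> 'v set" where "keys \<equiv> Poly_Mapping.keys"

abbreviation single :: "'v \<Rightarrow> 'k \<Rightarrow> 'v \<Rightarrow>\<^sub>0 'k::zero" where "single \<equiv> Poly_Mapping.single"

definition restr :: "'v set \<Rightarrow> ('v \<Rightarrow>\<^sub>0 'k::comm_monoid_add) \<Rightarrow> 'v \<Rightarrow>\<^sub>0 'k" where
  "restr A f = (\<Sum>v\<in>keys f \<inter> A. single v (lookup f v))"

lemma lookup_restr: "lookup (restr A f) v = (if v \<in> A then lookup f v else 0)"
proof -
  have "lookup (restr A f) v = (\<Sum>u\<in>keys f \<inter> A. if u = v then lookup f v else 0)"
    unfolding restr_def lookup_sum by (rule sum.cong) (auto simp: lookup_single when_def)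
  also have "\<dots> = (if v \<in> A then lookup f v else 0)"
    by (simp add: in_keys_iff)
  finally show ?thesis .
qed

lemma keys_restr: "keys (restr A f) = keys f \<inter> A"
  by (auto simp: in_keys_iff lookup_restr split: if_splits)

lemma sum_single: "f = (\<Sum>v\<in>keys f. single v (lookup f v))"
proof -
  have "restr UNIV f = f" by (rule poly_mapping_eqI) (simp add: lookup_restr)
  thus ?thesis by (simp add: restr_def)
qed

lemma mult_sum_single:
  fixes f g :: "'v::monoid_add \<Rightarrow>\<^sub>0 'k::semiring_0"
  shows "f * g = (\<Sum>u\<in>keys f. \<Sum>v\<in>keys g.
           single (u + v) (lookup f u * lookup g v))"
proof -
  have "f * g = (\<Sum>u\<in>keys f. single u (lookup f u)) *
      (\<Sum>v\<in>keys g. single v (lookup g v))"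
    using sum_single[of f] sum_single[of g] by simp
  thus ?thesis by (simp add: sum_product mult_single)
qed

lemma lookup_mult_sum:
  fixes f g :: "'v::monoid_add \<Rightarrow>\<^sub>0 'k::semiring_0"
  shows "lookup (f * g) w = (\<Sum>u\<in>keys f. \<Sum>v\<in>keys g.
           if u + v = w then lookup f u * lookup g v else 0)"
  by (subst mult_sum_single) (simp add: lookup_sum lookup_single when_def)

definition additive :: "('v::monoid_add \<Rightarrow> 'w::monoid_add) \<Rightarrow> bool" where
  "additive w \<longleftrightarrow> (\<forall>u v. w (u + v) = w u + w v)"

lemma additive_zero: "additive (w :: 'v::monoid_add \<Rightarrow> 'w::group_add) \<Longrightarrow> w 0 = 0"
  unfolding additive_def by (metis add.right_neutral add_left_cancel)

text \<open>For an additive weight \<open>w\<close>, the least weight of the exponents is a valuation.\<close>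

definition wmin :: "('v \<Rightarrow> 'w::linorder) \<Rightarrow> ('v \<Rightarrow>\<^sub>0 'k::zero) \<Rightarrow> 'w" where
  "wmin w f = Min (w ` keys f)"

lemma wmin_le: "v \<in> keys f \<Longrightarrow> wmin w f \<le> w v"
  unfolding wmin_def by simp

lemma wmin_attained:
  assumes "f \<noteq> 0"
  obtains v where "v \<in> keys f" "w v = wmin w f"
proof -
  have "keys f \<noteq> {}" using assms by auto
  hence "wmin w f \<in> w ` keys f"
    unfolding wmin_def by (intro Min_in) auto
  thus ?thesis using that by auto
qed

lemma wmin_ge: "f \<noteq> 0 \<Longrightarrow> (\<And>v. v \<in> keys f \<Longrightarrow> l \<le> w v) \<Longrightarrow> l \<le> wmin w f"
  using wmin_attained by metis

lemma wmin_mult: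
  fixes f g :: "'k::field lpoly" and w :: "(nat \<Rightarrow>\<^sub>0 int) \<Rightarrow> 'w::linordered_ab_group_add"
  assumes w: "additive w" and f: "f \<noteq> 0" and g: "g \<noteq> 0"
  shows "wmin w (f * g) = wmin w f + wmin w g"
proof -
  \<comment> \<open>ties between exponents of least weight are broken by the linear order on exponents\<close>
  have first: "\<exists>u. u \<in> keys f \<and> w u = wmin w f \<and>
      (\<forall>u'\<in>keys f. w u' = wmin w f \<longrightarrow> u \<le> u')"
    if f: "f \<noteq> 0" for f :: "'k lpoly"
  proof -
    let ?S = "{u \<in> keys f. w u = wmin w f}"
    have "?S \<noteq> {}" using wmin_attained[OF f, of w] by blast
    hence "Min ?S \<in> ?S" by (intro Min_in) auto
    thus ?thesis by (intro exI[of _ "Min ?S"]) auto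
  qed
  obtain u where u: "u \<in> keys f" "w u = wmin w f"
    "\<And>u'. u' \<in> keys f \<Longrightarrow> w u' = wmin w f \<Longrightarrow> u \<le> u'"
    using first[OF f] by blast
  obtain v where v: "v \<in> keys g" "w v = wmin w g"
    "\<And>v'. v' \<in> keys g \<Longrightarrow> w v' = wmin w g \<Longrightarrow> v \<le> v'"
    using first[OF g] by blast
  have uniq: "u' = u \<and> v' = v"
    if "u' \<in> keys f" "v' \<in> keys g" "u' + v' = u + v" for u' v'
  proof -
    have "w u' + w v' = wmin w f + wmin w g"
      using w that(3) u v unfolding additive_def by metis
    moreover have "wmin w f \<le> w u'" "wmin w g \<le> w v'"
      using that by (auto intro: wmin_le)
    ultimately have "w u' = wmin w f" "w v' = wmin w g"
      by (metis add_le_cancel_left add_le_cancel_right add_mono antisym order_refl)+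
    hence "u \<le> u'" "v \<le> v'" using u v that by auto
    thus ?thesis
      using that(3) by (metis add_le_cancel_left add_le_cancel_right add_mono antisym order_refl)
  qed
  have "lookup (f * g) (u + v) = (\<Sum>u'\<in>keys f. \<Sum>v'\<in>keys g.
           if u' + v' = u + v then lookup f u' * lookup g v' else 0)"
    by (rule lookup_mult_sum)
  also have "\<dots> = (\<Sum>u'\<in>keys f. \<Sum>v'\<in>keys g.
           if u' = u then (if v' = v then lookup f u * lookup g v else 0) else 0)"
    by (intro sum.cong refl) (use uniq in auto)
  also have "\<dots> = (\<Sum>u'\<in>keys f. if u' = u then lookup f u * lookup g v else 0)"
    by (intro sum.cong refl) (use v in auto)
  also have "\<dots> = lookup f u * lookup g v" using u by simp
  finally have "u + v \<in> keys (f * g)"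
    using u v by (simp add: in_keys_iff)
  moreover have wuv: "w (u + v) = wmin w f + wmin w g"
    using w u v unfolding additive_def by simp
  ultimately have "wmin w (f * g) \<le> wmin w f + wmin w g"
    using wmin_le[of "u + v" "f * g" w] by simp
  moreover have "wmin w f + wmin w g \<le> wmin w (f * g)"
  proof (rule wmin_ge)
    show "f * g \<noteq> 0" using f g by simp
    fix x assume "x \<in> keys (f * g)"
    then obtain a b where "a \<in> keys f" "b \<in> keys g" "x = a + b"
      using keys_mult[of f g] by blast
    thus "wmin w f + wmin w g \<le> w x"
      using w wmin_le unfolding additive_def by (metis add_mono)
  qed
  ultimately show ?thesis by simp
qed

lemma wmin_power:
  fixes f :: "'k::field lpoly" and w :: "(nat \<Rightarrow>\<^sub>0 int) \<Rightarrow> 'w::linordered_idom"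
  assumes w: "additive w" and f: "f \<noteq> 0"
  shows "wmin w (f ^ m) = of_nat m * wmin w f"
proof (induction m)
  case 0
  thus ?case using additive_zero[OF w] by (simp add: wmin_def)
next
  case (Suc m)
  thus ?case using wmin_mult[OF w f, of "f ^ m"] f by (simp add: algebra_simps)
qed

lemma wmin_neg:
  fixes w :: "'v \<Rightarrow> 'w::linordered_ab_group_add"
  assumes "f \<noteq> 0"
  shows "wmin w f + wmin (\<lambda>v. - w v) f \<le> 0"
proof -
  obtain v where v: "v \<in> keys f" "w v = wmin w f" using wmin_attained[OF assms] .
  hence "wmin (\<lambda>v. - w v) f \<le> - wmin w f" using wmin_le[OF v(1), of "\<lambda>v. - w v"] by simp
  hence "wmin w f + wmin (\<lambda>v. - w v) f \<le> wmin w f + (- wmin w f)" by (rule add_left_mono)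
  thus ?thesis by simp
qed

text \<open>
  A factor of a product that has constant weight has constant weight.
\<close>

lemma factor_constant_weight:
  fixes f g :: "'k::field lpoly" and w :: "(nat \<Rightarrow>\<^sub>0 int) \<Rightarrow> 'w::linordered_ab_group_add"
  assumes w: "additive w" and f: "f \<noteq> 0" and g: "g \<noteq> 0"
    and fg: "\<And>v. v \<in> keys (f * g) \<Longrightarrow> w v = c"
    and g': "\<And>v. v \<in> keys g \<Longrightarrow> w v = d"
    and v: "v \<in> keys f"
  shows "w v = c - d"
proof -
  have w': "additive (\<lambda>v. - w v)" using w by (simp add: additive_def)
  have const: "wmin w' h = e" if "h \<noteq> 0" "\<And>v. v \<in> keys h \<Longrightarrow> w' v = e"
    for h :: "'k lpoly" and w' :: "(nat \<Rightarrow>\<^sub>0 int) \<Rightarrow> 'w" and e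
    using wmin_attained[OF that(1)] that(2) by metis
  have fg0: "f * g \<noteq> 0" using f g by simp
  have "wmin w f + d = c"
    using wmin_mult[OF w f g] const[OF fg0 fg] const[OF g g'] by simp
  moreover have "wmin (\<lambda>v. - w v) f + (- d) = - c"
  proof -
    have "wmin (\<lambda>v. - w v) (f * g) = - c" by (rule const[OF fg0]) (simp add: fg)
    moreover have "wmin (\<lambda>v. - w v) g = - d" by (rule const[OF g]) (simp add: g')
    ultimately show ?thesis using wmin_mult[OF w' f g] by simp
  qed
  ultimately have "wmin w f = c - d" "wmin (\<lambda>v. - w v) f = - (c - d)"
    by (simp_all add: algebra_simps)
  hence "c - d \<le> w v" "- (c - d) \<le> - w v"
    using wmin_le[OF v, of w] wmin_le[OF v, of "\<lambda>v. - w v"] by simp_all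
  thus ?thesis unfolding neg_le_iff_le by (rule antisym[rotated])
qed

text \<open>
  Pseudo-division by a Laurent polynomial \<open>b\<close> of weights from \<open>-e\<close> to \<open>0\<close>: multiplication by the leading
  coefficient \<open>restr {v. w v = 0} b\<close> allows to cancel the part of highest weight.
\<close>

lemma pseudo_division:
  fixes b a :: "'k::field lpoly" and w :: "(nat \<Rightarrow>\<^sub>0 int) \<Rightarrow> int"
  assumes w: "additive w" and b: "\<And>v. v \<in> keys b \<Longrightarrow> - e \<le> w v \<and> w v \<le> 0"
    and a: "\<And>v. v \<in> keys a \<Longrightarrow> l \<le> w v \<and> w v < l + e + int N"
    and e: "e \<ge> 0"
  shows "\<exists>k q r. restr {v. w v = 0} b ^ k * a = b * q + r \<and>
           (\<forall>v\<in>keys r. l \<le> w v \<and> w v < l + e)"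
  using a
proof (induction N arbitrary: a)
  case 0
  thus ?case by (intro exI[of _ 0] exI[of _ 0] exI[of _ a]) auto
next
  case (Suc N)
  let ?\<beta> = "restr {v. w v = 0} b" and ?s = "l + e + int N"
  let ?\<alpha> = "restr {v. w v = ?s} a"
  define a' where "a' = ?\<beta> * (a - ?\<alpha>) - ?\<alpha> * (b - ?\<beta>)"
  have a': "a' = ?\<beta> * a - ?\<alpha> * b" by (simp add: a'_def algebra_simps)
  have k1: "l \<le> w v \<and> w v < ?s" if "v \<in> keys (a - ?\<alpha>)" for v
  proof -
    have "v \<in> keys a" "w v \<noteq> ?s"
      using that by (auto simp: in_keys_iff lookup_minus lookup_restr split: if_splits)
    thus ?thesis using Suc.prems[of v] by simp
  qed
  have k2: "- e \<le> w v \<and> w v < 0" if "v \<in> keys (b - ?\<beta>)" for v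
  proof -
    have "v \<in> keys b" "w v \<noteq> 0"
      using that by (auto simp: in_keys_iff lookup_minus lookup_restr split: if_splits)
    thus ?thesis using b[of v] by simp
  qed
  have "l \<le> w v \<and> w v < ?s" if v: "v \<in> keys a'" for v
  proof -
    have "v \<in> keys (?\<beta> * (a - ?\<alpha>)) \<union> keys (?\<alpha> * (b - ?\<beta>))"
      using v keys_diff[of "?\<beta> * (a - ?\<alpha>)" "?\<alpha> * (b - ?\<beta>)"]
      by (auto simp: a'_def in_keys_iff lookup_minus)
    then consider x y where "x \<in> keys ?\<beta>" "y \<in> keys (a - ?\<alpha>)" "v = x + y"
      | x y where "x \<in> keys ?\<alpha>" "y \<in> keys (b - ?\<beta>)" "v = x + y"
      using keys_mult[of ?\<beta> "a - ?\<alpha>"] keys_mult[of ?\<alpha> "b - ?\<beta>"] by blast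
    thus ?thesis
    proof cases
      case 1
      thus ?thesis using k1[of y] w by (simp add: keys_restr additive_def)
    next
      case 2
      thus ?thesis using k2[of y] w by (simp add: keys_restr additive_def)
    qed
  qed
  then obtain k q r where kqr: "?\<beta> ^ k * a' = b * q + r"
    "\<forall>v\<in>keys r. l \<le> w v \<and> w v < l + e"
    using Suc.IH[of a'] by blast
  have "?\<beta> ^ Suc k * a = ?\<beta> ^ k * a' + b * (?\<beta> ^ k * ?\<alpha>)"
    by (simp add: a' algebra_simps)
  also have "\<dots> = b * (q + ?\<beta> ^ k * ?\<alpha>) + r"
    using kqr(1) by (simp add: algebra_simps)
  finally show ?case using kqr(2) by blast
qed

text \<open>
  By the binomial theorem, a common denominator of the powers of \<open>a/b\<close> is also one of the
  powers of \<open>(d a - b q)/b\<close>.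
\<close>

lemma dvd_power_comb:
  fixes b :: "'a::comm_ring_1"
  assumes "\<And>m. b ^ m dvd c * a ^ m"
  shows "b ^ m dvd c * (d * a - b * q) ^ m"
proof -
  have "c * (d * a + b * (- q)) ^ m
      = (\<Sum>k\<le>m. (c * a ^ k * b ^ (m - k)) * (of_nat (m choose k) * (d ^ k * (- q) ^ (m - k))))"
    unfolding binomial_ring sum_distrib_left power_mult_distrib
    by (intro sum.cong refl) (simp only: mult_ac)
  moreover have "b ^ m dvd (c * a ^ k * b ^ (m - k)) * (of_nat (m choose k) * (d ^ k * (- q) ^ (m - k)))"
    if "k \<le> m" for k
  proof -
    have "b ^ k * b ^ (m - k) dvd (c * a ^ k) * (b ^ (m - k))"
      using assms[of k] by (rule mult_dvd_mono) simp
    moreover have "b ^ k * b ^ (m - k) = b ^ m"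
      using that by (simp flip: power_add)
    ultimately show ?thesis by (metis dvd_mult2)
  qed
  ultimately have "b ^ m dvd c * (d * a + b * (- q)) ^ m"
    by (metis (no_types, lifting) dvd_sum atMost_iff)
  thus ?thesis by simp
qed

definition lmonom :: "(nat \<Rightarrow>\<^sub>0 int) \<Rightarrow> 'k::field lpoly" where
  "lmonom v = single v 1"

lemma lmonom_inverse: "lmonom v * lmonom (- v) = 1"
  by (simp add: lmonom_def mult_single)

lemma lmonom_nonzero: "lmonom v \<noteq> 0"
  unfolding lmonom_def by (metis lookup_single_eq lookup_zero zero_neq_one)

lemma keys_lmonom [simp]: "keys (lmonom v) = {v}"
  by (simp add: lmonom_def)

lemma lookup_lmonom: "lookup (lmonom v) u = (if v = u then 1 else 0)"
  by (simp add: lmonom_def lookup_single when_def)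

lemma keys_lmonom_mult:
  fixes b :: "'k::field lpoly"
  shows "keys (lmonom u * b) = (\<lambda>v. u + v) ` keys b"
proof -
  have "lookup (lmonom u * b) x = lookup b (x - u)" for x
  proof -
    have "lookup (lmonom u * b) x = (\<Sum>v\<in>keys b. if u + v = x then lookup b v else 0)"
      unfolding lookup_mult_sum keys_lmonom by (simp add: lookup_lmonom cong: if_cong)
    also have "\<dots> = (\<Sum>v\<in>keys b. if v = x - u then lookup b v else 0)"
      by (intro sum.cong refl) (auto simp: algebra_simps)
    also have "\<dots> = lookup b (x - u)" by (simp add: in_keys_iff)
    finally show ?thesis .
  qed
  thus ?thesis
    by (auto simp: in_keys_iff image_iff intro!: bexI[of _ "_ - u"])
qed

text \<open>
  If all powers of \<open>a/b\<close> have a common denominator \<open>c\<close>, then \<open>b\<close> divides \<open>a\<close>. By induction on the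
  variables of \<open>b\<close>: the remainder \<open>r\<close> of a pseudo-division by \<open>b\<close> has the same property as \<open>a\<close>, so it vanishes
  for reasons of degree. Hence \<open>d * a = b * q\<close>, where \<open>d\<close> is a power of the leading coefficient of \<open>b\<close>; then
  all powers of \<open>q/d\<close> have the common denominator \<open>c\<close>, and \<open>d\<close> has fewer variables than \<open>b\<close>.
\<close>

lemma completely_integrally_closed:
  fixes a b c :: "'k::field lpoly"
  assumes "finite V" "b \<noteq> 0" "\<And>v. v \<in> keys b \<Longrightarrow> keys v \<subseteq> V"
    and "c \<noteq> 0" "\<And>m. b ^ m dvd c * a ^ m"
  shows "b dvd a"
  using assms
proof (induction V arbitrary: a b rule: finite_induct)
  case empty
  hence "keys b \<subseteq> {0}" by auto
  hence "b = single 0 (lookup b 0)"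
    by (intro poly_mapping_eqI) (auto simp: lookup_single when_def in_keys_iff)
  moreover have "lookup b 0 \<noteq> 0" using calculation empty(1) by (metis single_zero)
  ultimately have "b * single 0 (inverse (lookup b 0)) = 1"
    by (metis mult_single add.right_neutral right_inverse single_one)
  thus ?case by (metis dvd_mult_left dvd_triv_left one_dvd dvd_trans)
next
  case (insert t V)
  define w :: "(nat \<Rightarrow>\<^sub>0 int) \<Rightarrow> int" where "w v = lookup v t" for v
  have w: "additive w" by (simp add: additive_def w_def lookup_add)
  have w': "additive (\<lambda>v. - w v)" using w by (simp add: additive_def)
  \<comment> \<open>a monomial factor makes the largest exponent of the variable in the divisor zero\<close>
  define h where "h = - wmin (\<lambda>v. - w v) b"
  define u :: "nat \<Rightarrow>\<^sub>0 int" where "u = single t (- h)"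
  define b' where "b' = lmonom u * b"
  have wu: "w u = - h" by (simp add: w_def u_def)
  have b'0: "b' \<noteq> 0"
    using insert.prems(1) lmonom_nonzero[of u] by (simp add: b'_def)
  have kb': "keys b' = (\<lambda>v. u + v) ` keys b"
    unfolding b'_def by (rule keys_lmonom_mult)
  have bb': "b = lmonom (- u) * b'"
  proof -
    have "lmonom (- u) * b' = (lmonom u * lmonom (- u)) * b" by (simp only: b'_def mult_ac)
    thus ?thesis by (simp add: lmonom_inverse)
  qed
  have b'm: "b' ^ m dvd c * a ^ m" for m
  proof -
    have "b ^ m = lmonom (- u) ^ m * b' ^ m" by (subst bb') (simp add: power_mult_distrib)
    thus ?thesis using insert.prems(4)[of m] by (metis dvd_mult_right)
  qed
  define e where "e = - wmin w b'"
  have hi: "w v \<le> 0" if vb: "v \<in> keys b'" for v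
  proof -
    obtain x where x: "x \<in> keys b" "v = u + x" using vb unfolding kb' by blast
    have "w x \<le> h" using wmin_le[OF x(1), of "\<lambda>v. - w v"] by (simp add: h_def)
    thus ?thesis using w wu x by (simp add: additive_def)
  qed
  have lo: "- e \<le> w v" if "v \<in> keys b'" for v
    using wmin_le[OF that, of w] by (simp add: e_def)
  have "wmin (\<lambda>v. - w v) b' = 0"
  proof (rule antisym)
    obtain x where x: "x \<in> keys b" "- w x = wmin (\<lambda>v. - w v) b"
      using wmin_attained[OF insert.prems(1)] .
    hence "u + x \<in> keys b'" "w (u + x) = 0"
      using kb' w wu by (auto simp: additive_def h_def)
    thus "wmin (\<lambda>v. - w v) b' \<le> 0" using wmin_le[of "u + x" b' "\<lambda>v. - w v"] by simp
    show "0 \<le> wmin (\<lambda>v. - w v) b'" by (rule wmin_ge[OF b'0]) (use hi in auto)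
  qed
  note top = this
  obtain v0 where v0: "v0 \<in> keys b'" using b'0 by (metis keys_eq_empty ex_in_conv)
  have e0: "e \<ge> 0" using hi[OF v0] lo[OF v0] by linarith
  let ?\<beta> = "restr {v. w v = 0} b'"
  have \<beta>0: "?\<beta> \<noteq> 0"
  proof -
    obtain x where "x \<in> keys b'" "- w x = wmin (\<lambda>v. - w v) b'"
      using wmin_attained[OF b'0] .
    hence "x \<in> keys ?\<beta>" using top by (simp add: keys_restr)
    thus ?thesis by auto
  qed
  have \<beta>V: "keys v \<subseteq> V" if "v \<in> keys (?\<beta> ^ k)" for v k
    using that
  proof (induction k arbitrary: v)
    case 0 thus ?case by (auto simp: in_keys_iff lookup_one when_def split: if_splits)
  next
    case (Suc k)
    then obtain x y where xy: "x \<in> keys ?\<beta>" "y \<in> keys (?\<beta> ^ k)" "v = x + y"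
      using keys_mult[of ?\<beta> "?\<beta> ^ k"] by auto
    have x: "x \<in> keys b'" "w x = 0" using xy(1) by (auto simp: keys_restr)
    then obtain z where z: "z \<in> keys b" "x = u + z" using kb' by blast
    have "keys x \<subseteq> insert t V"
      using keys_add[of u z] keys_single[of t "- h"] insert.prems(2)[OF z(1)] z(2) by (auto simp: u_def split: if_splits)
    moreover have "t \<notin> keys x" using x(2) by (simp add: w_def in_keys_iff)
    ultimately have "keys x \<subseteq> V" by blast
    thus ?case using Suc.IH[OF xy(2)] keys_add[of x y] xy(3) by blast
  qed
  define l where "l = (if a = 0 then 0 else wmin w a)"
  define N where "N = nat (if a = 0 then 0 else - wmin (\<lambda>v. - w v) a - l + 1)"
  have "l \<le> w v \<and> w v < l + e + int N" if v: "v \<in> keys a" for v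
  proof -
    have "a \<noteq> 0" using v by auto
    thus ?thesis
      using wmin_le[OF v, of w] wmin_le[OF v, of "\<lambda>v. - w v"] e0 by (simp add: l_def N_def)
  qed
  then obtain k q r where kqr: "?\<beta> ^ k * a = b' * q + r"
    "\<And>v. v \<in> keys r \<Longrightarrow> l \<le> w v \<and> w v < l + e"
    using pseudo_division[OF w, of b' e a l N] hi lo e0 by blast
  have r: "r = ?\<beta> ^ k * a - b' * q" using kqr(1) by simp
  \<comment> \<open>the spread of the weights of \<open>r\<close> is less than \<open>e\<close>, that of \<open>b'\<close> is \<open>e\<close>; for large \<open>m\<close> this contradicts \<open>b' ^ m dvd c * r ^ m\<close>\<close>
  have r0: "r = 0"
  proof (rule ccontr)
    assume rn: "r \<noteq> 0"
    define C where "C = wmin w c + wmin (\<lambda>v. - w v) c"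
    define m where "m = nat (1 - C)"
    have "b' ^ m dvd c * r ^ m" unfolding r by (rule dvd_power_comb) (rule b'm)
    then obtain g where g: "c * r ^ m = b' ^ m * g" by (rule dvdE)
    have g0: "g \<noteq> 0" using g insert.prems(3) rn by auto
    have nz: "b' ^ m \<noteq> 0" "r ^ m \<noteq> 0" using b'0 rn by auto
    have A: "wmin w c + int m * wmin w r = int m * (- e) + wmin w g"
      using arg_cong[OF g, of "wmin w"] wmin_mult[OF w insert.prems(3) nz(2)] wmin_mult[OF w nz(1) g0]
        wmin_power[OF w rn] wmin_power[OF w b'0] by (simp add: e_def)
    have B: "wmin (\<lambda>v. - w v) c + int m * wmin (\<lambda>v. - w v) r = wmin (\<lambda>v. - w v) g"
      using arg_cong[OF g, of "wmin (\<lambda>v. - w v)"] wmin_mult[OF w' insert.prems(3) nz(2)]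
        wmin_mult[OF w' nz(1) g0] wmin_power[OF w' rn] wmin_power[OF w' b'0] top by simp
    have "l \<le> wmin w r" by (rule wmin_ge[OF rn]) (use kqr(2) in auto)
    moreover have "- (l + e - 1) \<le> wmin (\<lambda>v. - w v) r"
      by (rule wmin_ge[OF rn]) (use kqr(2) in fastforce)
    ultimately have "1 - e \<le> wmin w r + wmin (\<lambda>v. - w v) r" by linarith
    hence "int m * (1 - e) \<le> int m * (wmin w r + wmin (\<lambda>v. - w v) r)"
      by (rule mult_left_mono) simp
    moreover have "wmin w g + wmin (\<lambda>v. - w v) g \<le> 0" by (rule wmin_neg[OF g0])
    ultimately have "C + int m * (1 - e) \<le> - (int m * e)"
      using A B by (simp add: C_def algebra_simps)
    hence "C + int m \<le> 0" by (simp add: algebra_simps)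
    moreover have "1 - C \<le> int m" by (simp add: m_def)
    ultimately show False by linarith
  qed
  hence eq: "?\<beta> ^ k * a = b' * q" using kqr(1) by simp
  have "?\<beta> ^ k dvd q"
  proof (rule insert.IH)
    show "?\<beta> ^ k \<noteq> 0" using \<beta>0 by simp
    show "keys v \<subseteq> V" if "v \<in> keys (?\<beta> ^ k)" for v
      using \<beta>V[OF that] .
    show "c \<noteq> 0" by fact
    show "(?\<beta> ^ k) ^ m dvd c * q ^ m" for m
    proof -
      obtain g where g: "c * a ^ m = b' ^ m * g" using b'm by (rule dvdE)
      have "b' ^ m * (c * q ^ m) = c * (b' * q) ^ m" by (simp only: power_mult_distrib mult_ac)
      also have "\<dots> = c * (?\<beta> ^ k * a) ^ m" by (simp only: eq)
      also have "\<dots> = (?\<beta> ^ k) ^ m * (c * a ^ m)" by (simp only: power_mult_distrib mult_ac)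
      also have "\<dots> = b' ^ m * ((?\<beta> ^ k) ^ m * g)" by (simp only: g mult_ac)
      finally have "b' ^ m * (c * q ^ m) = b' ^ m * ((?\<beta> ^ k) ^ m * g)" .
      hence "c * q ^ m = (?\<beta> ^ k) ^ m * g" using b'0 by simp
      thus ?thesis by simp
    qed
  qed
  then obtain q' where "q = ?\<beta> ^ k * q'" by (rule dvdE)
  hence "?\<beta> ^ k * a = ?\<beta> ^ k * (b' * q')" using eq by (simp add: mult_ac)
  hence "a = b' * q'" using \<beta>0 by simp
  hence "a = b * (lmonom u * q')" by (simp add: b'_def mult_ac)
  thus ?case by simp
qed

text \<open>
  Repeated substitution of the integral equation shows that \<open>b ^ n\<close> is a common denominator of
  all powers of \<open>a/b\<close>.
\<close>

lemma integral_imp_dvd: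
  fixes a b :: "'k::field lpoly"
  assumes b: "b \<noteq> 0" and eq: "a ^ n = (\<Sum>i<n. g i * a ^ i * b ^ (n - i))"
  shows "b dvd a"
proof -
  have "b ^ m dvd b ^ n * a ^ m" for m
  proof (induction m rule: less_induct)
    case (less m)
    show ?case
    proof (cases "m \<le> n")
      case True
      thus ?thesis by (simp add: le_imp_power_dvd)
    next
      case False
      hence "b ^ n * a ^ m = b ^ n * (a ^ n * a ^ (m - n))"
        by (simp flip: power_add)
      also have "\<dots> = (\<Sum>i<n. g i * (b ^ (n - i) * (b ^ n * a ^ (i + (m - n)))))"
        unfolding eq by (simp add: sum_distrib_left sum_distrib_right power_add mult_ac)
      also have "b ^ m dvd \<dots>"
      proof (rule dvd_sum)
        fix i assume i: "i \<in> {..<n}"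
        hence "b ^ (i + (m - n)) dvd b ^ n * a ^ (i + (m - n))"
          using False by (intro less) auto
        hence "b ^ (n - i) * b ^ (i + (m - n)) dvd b ^ (n - i) * (b ^ n * a ^ (i + (m - n)))"
          by (intro mult_dvd_mono) auto
        moreover have "b ^ (n - i) * b ^ (i + (m - n)) = b ^ m"
          using i False by (simp flip: power_add)
        ultimately show "b ^ m dvd g i * (b ^ (n - i) * (b ^ n * a ^ (i + (m - n))))"
          by (simp add: dvd_mult)
      qed
      finally show ?thesis .
    qed
  qed
  moreover have "finite (\<Union>v\<in>keys b. keys v)" by simp
  ultimately show ?thesis
    using b by (intro completely_integrally_closed[of "\<Union>v\<in>keys b. keys v" b "b ^ n" a]) auto
qed

text \<open>
  If the least weight of \<open>y\<close> were negative, then that of \<open>y ^ n\<close> would be smaller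
  than all weights on the other side.
\<close>

lemma integral_weight:
  fixes y :: "'k::field lpoly" and w :: "(nat \<Rightarrow>\<^sub>0 int) \<Rightarrow> 'w::linordered_idom"
  assumes w: "additive w" and eq: "y ^ n = (\<Sum>i<n. g i * y ^ i)"
    and g: "\<And>i v. i < n \<Longrightarrow> v \<in> keys (g i) \<Longrightarrow> 0 \<le> w v"
    and v: "v \<in> keys y"
  shows "0 \<le> w v"
proof (rule ccontr)
  assume neg: "\<not> ?thesis"
  have y: "y \<noteq> 0" using v by auto
  hence mu: "wmin w y < 0" using wmin_le[OF v, of w] neg by simp
  obtain x where x: "x \<in> keys (y ^ n)" "w x = wmin w (y ^ n)"
    using wmin_attained[of "y ^ n"] y by auto
  have "\<exists>i<n. x \<in> keys (g i * y ^ i)"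
  proof (rule ccontr)
    assume "\<not> ?thesis"
    hence "lookup (y ^ n) x = 0"
      unfolding eq lookup_sum by (intro sum.neutral) (auto simp: in_keys_iff)
    thus False using x(1) by (simp add: in_keys_iff)
  qed
  then obtain i p q where i: "i < n" "p \<in> keys (g i)" "q \<in> keys (y ^ i)" "x = p + q"
    using keys_mult by blast
  have "of_nat i * wmin w y \<le> w q"
    using wmin_le[OF i(3), of w] wmin_power[OF w y] by simp
  hence "of_nat i * wmin w y \<le> w x"
    using w g[OF i(1,2)] i(4) by (simp add: additive_def)
  also have "\<dots> = of_nat n * wmin w y" using x(2) wmin_power[OF w y] by simp
  finally show False
    using mu i(1) by (simp add: mult_le_cancel_right)
qed

section \<open>Isomorphisms onto open subspaces\<close>

lemma gmor_morphism:
  assumes "hspace_data B G Q" "hspace_data B' G' Q'" "gmor B G Q B' G' Q' \<phi> m"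
  shows "morphism (hspace B G Q) (hspace B' G' Q') m"
proof -
  interpret gmor_data B G Q B' G' Q' \<phi> m
    by (intro gmor_data.intro gmor_data_axioms.intro assms)
  show ?thesis by (rule morphism)
qed

text \<open>
  The assumptions \<open>inj\<close> and \<open>lift\<close> make the stalk maps bijective. The lift of a
  fraction must not depend on the point, as the inverse has to map sections, which are locally given by one
  fraction, to sections.
\<close>

lemma (in gmor_data) isomorphism_onto_open:
  assumes U: "openin (zariski B' Q') U" and bij: "bij_betw (fst m) Q U"
    and op: "\<And>W. openin (zariski B Q) W \<Longrightarrow> openin (zariski B' Q') (fst m ` W)"
    and inj: "\<And>q x y x' y'. q \<in> Q \<Longrightarrow> (x, y) \<in> Proj_fracs G' (fst m q) \<Longrightarrow>
        (x', y') \<in> Proj_fracs G' (fst m q) \<Longrightarrow>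
        hfrac B G q (\<phi> x) (\<phi> y)
          = hfrac B G q (\<phi> x') (\<phi> y') \<Longrightarrow>
        hfrac B' G' (fst m q) x y
          = hfrac B' G' (fst m q) x' y'"
    and lift: "\<And>a s. a \<in> carrier B \<Longrightarrow> s \<in> carrier B \<Longrightarrow> \<exists>x y. \<forall>q\<in>Q. (a, s) \<in> Proj_fracs G q \<longrightarrow>
        (x, y) \<in> Proj_fracs G' (fst m q) \<and>
        hfrac B G q (\<phi> x) (\<phi> y)
          = hfrac B G q a s"
  shows "isomorphism (hspace B G Q) (open_subspace (hspace B' G' Q') U) m"
proof -
  let ?X = "hspace B G Q" and ?Y = "hspace B' G' Q'"
  let ?YU = "open_subspace ?Y U"
  let ?sX = "\<lambda>q. frac_ring B (Proj_fracs G q) (Proj_mult G q)"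
  let ?sY = "\<lambda>p. frac_ring B' (Proj_fracs G' p) (Proj_mult G' p)"
  have UQ: "U \<subseteq> Q'" using openin_subset[OF U] by simp
  have YU: "pts ?YU = subtopology (zariski B' Q') U" "stalk ?YU = stalk ?Y" "scal ?YU = scal ?Y"
    "sect ?YU = sect ?Y"
    by (simp_all add: open_subspace_def)
  have tsU: "topspace (subtopology (zariski B' Q') U) = U"
    using UQ by auto
  have opU: "openin (subtopology (zariski B' Q') U) V \<longleftrightarrow> openin (zariski B' Q') V \<and> V \<subseteq> U" for V
    using U by (metis openin_open_subtopology)
  have mU: "fst m q \<in> U" if "q \<in> Q" for q
    using bij that by (auto simp: bij_betw_def)
  \<comment> \<open>the stalk maps are bijective\<close>
  have st: "snd m q \<in> ring_iso (?sY (fst m q)) (?sX q)" if q: "q \<in> Q" for q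
  proof -
    interpret L: fraction_data B' "Proj_fracs G' (fst m q)" "Proj_mult G' (fst m q)"
      by (rule Y.fracs[OF pt[OF q]])
    interpret R: fraction_data B "Proj_fracs G q" "Proj_mult G q"
      by (rule X.fracs[OF q])
    have "inj_on (snd m q) (carrier L.FR)"
    proof (rule inj_onI)
      fix y z assume yz: "y \<in> carrier L.FR" "z \<in> carrier L.FR" and eq: "snd m q y = snd m q z"
      obtain a s where y: "y = L.cls a s" "(a, s) \<in> Proj_fracs G' (fst m q)"
        using yz(1) by (rule L.FR_cases)
      obtain b t where z: "z = L.cls b t" "(b, t) \<in> Proj_fracs G' (fst m q)"
        using yz(2) by (rule L.FR_cases)
      show "y = z"
        unfolding y z by (rule inj[OF q y(2) z(2)]) (use eq y z germ[OF q] in simp)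
    qed
    moreover have "snd m q ` carrier L.FR = carrier R.FR"
    proof
      show "snd m q ` carrier L.FR \<subseteq> carrier R.FR"
        using stalk_hom[OF q] ring_hom_closed by fastforce
      show "carrier R.FR \<subseteq> snd m q ` carrier L.FR"
      proof
        fix z assume "z \<in> carrier R.FR"
        then obtain a s where z: "z = R.cls a s" "(a, s) \<in> Proj_fracs G q" by (rule R.FR_cases)
        obtain x y where "\<forall>q\<in>Q. (a, s) \<in> Proj_fracs G q \<longrightarrow> (x, y) \<in> Proj_fracs G' (fst m q) \<and>
            hfrac B G q (\<phi> x) (\<phi> y)
              = hfrac B G q a s"
          using lift R.F_carr[OF z(2)] by meson
        hence xy: "(x, y) \<in> Proj_fracs G' (fst m q)" "R.cls (\<phi> x) (\<phi> y) = R.cls a s"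
          using q z(2) by blast+
        hence "z = snd m q (L.cls x y)" using germ[OF q xy(1)] z by simp
        thus "z \<in> snd m q ` carrier L.FR" using L.cls_carrier[OF xy(1)] by blast
      qed
    qed
    ultimately show ?thesis
      using stalk_hom[OF q] by (simp add: ring_iso_def bij_betw_def)
  qed
  have ringY: "ring (?sY p)" if "p \<in> Q'" for p
    using fraction_data.cring_FR[OF Y.fracs[OF that]] by (rule cring.axioms(1))
  define g where "g = the_inv_into Q (fst m)"
  define \<gamma> where "\<gamma> = (\<lambda>p. inv_into (carrier (?sY p)) (snd m (g p)))"
  have gU: "g p \<in> Q" "fst m (g p) = p" if "p \<in> U" for p
    using that bij f_the_inv_into_f_bij_betw[OF bij, of p]
      bij_betwE[OF bij_betw_the_inv_into[OF bij]] by (auto simp: g_def)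
  have gm: "g (fst m q) = q" if "q \<in> Q" for q
    using that bij unfolding g_def bij_betw_def by (simp add: the_inv_into_f_f)
  have iso: "snd m (g p) \<in> ring_iso (?sY p) (?sX (g p))" if "p \<in> U" for p
    using st[OF gU(1)[OF that]] gU(2)[OF that] by simp
  have \<gamma>: "\<gamma> p \<in> ring_iso (?sX (g p)) (?sY p)" if "p \<in> U" for p
    unfolding \<gamma>_def using ring_iso_set_sym[OF ringY iso[OF that]] UQ that by blast
  have m\<gamma>: "snd m (g p) (\<gamma> p z) = z" if "p \<in> U" "z \<in> carrier (?sX (g p))" for p z
    using iso[OF that(1)] that(2) unfolding \<gamma>_def
    by (intro f_inv_into_f) (simp add: ring_iso_def bij_betw_def)
  have \<gamma>m: "\<gamma> p (snd m (g p) y) = y" if "p \<in> U" "y \<in> carrier (?sY p)" for p y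
    using iso[OF that(1)] that(2) unfolding \<gamma>_def
    by (intro inv_into_f_f) (simp_all add: ring_iso_def bij_betw_def)
  have mor1: "morphism ?X ?YU m"
  proof -
    obtain f0 f1 where m: "m = (f0, f1)" by (cases m)
    have M: "morphism ?X ?Y m" by (rule morphism)
    have "continuous_map (zariski B Q) (subtopology (zariski B' Q') U) f0"
      using M mU unfolding morphism_def m by (auto simp: continuous_map_in_subtopology)
    thus ?thesis
      using M unfolding morphism_def m YU by (auto simp: opU)
  qed
  have mor2: "morphism ?YU ?X (g, \<gamma>)"
    unfolding morphism_def prod.case YU X.hspace_simps Y.hspace_simps tsU
  proof (intro conjI ballI allI impI)
    show "continuous_map (subtopology (zariski B' Q') U) (zariski B Q) g"
      unfolding continuous_map_def tsU
    proof (intro conjI allI impI)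
      show "g \<in> U \<rightarrow> topspace (zariski B Q)" using gU by auto
      fix W assume W: "openin (zariski B Q) W"
      hence WQ: "W \<subseteq> Q" using openin_subset by force
      have "{p \<in> U. g p \<in> W} = fst m ` W"
      proof
        show "{p \<in> U. g p \<in> W} \<subseteq> fst m ` W"
        proof
          fix p assume "p \<in> {p \<in> U. g p \<in> W}"
          hence "g p \<in> W" "fst m (g p) = p" using gU by auto
          thus "p \<in> fst m ` W" by (metis imageI)
        qed
        show "fst m ` W \<subseteq> {p \<in> U. g p \<in> W}"
          using WQ gm mU by auto
      qed
      thus "openin (subtopology (zariski B' Q') U) {p \<in> U. g p \<in> W}"
        using op[OF W] by (metis (no_types, lifting) mem_Collect_eq opU subsetI)
    qed
  next
    fix p assume p: "p \<in> U"
    show hom: "\<gamma> p \<in> ring_hom (?sX (g p)) (?sY p)" using \<gamma>[OF p] by (simp add: ring_iso_def)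
    have inv: "snd m (g p) \<in> ring_hom (?sY p) (?sX (g p))" using iso[OF p] by (simp add: ring_iso_def)
    show "z \<in> Units (?sX (g p))" if z: "z \<in> carrier (?sX (g p))" "\<gamma> p z \<in> Units (?sY p)" for z
    proof -
      obtain y where y: "y \<in> carrier (?sY p)" "\<gamma> p z \<otimes>\<^bsub>?sY p\<^esub> y = \<one>\<^bsub>?sY p\<^esub>"
        "y \<otimes>\<^bsub>?sY p\<^esub> \<gamma> p z = \<one>\<^bsub>?sY p\<^esub>"
        using z(2) unfolding Units_def by blast
      have c: "\<gamma> p z \<in> carrier (?sY p)" by (rule ring_hom_closed[OF hom z(1)])
      have "z \<otimes>\<^bsub>?sX (g p)\<^esub> snd m (g p) y = \<one>\<^bsub>?sX (g p)\<^esub>"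
        "snd m (g p) y \<otimes>\<^bsub>?sX (g p)\<^esub> z = \<one>\<^bsub>?sX (g p)\<^esub>"
        using ring_hom_mult[OF inv c y(1)] ring_hom_mult[OF inv y(1) c] ring_hom_one[OF inv]
          y m\<gamma>[OF p z(1)] by simp_all
      thus ?thesis
        unfolding Units_def using z(1) ring_hom_closed[OF inv y(1)] by blast
    qed
    fix c
    interpret L: fraction_data B' "Proj_fracs G' p" "Proj_mult G' p"
      using p UQ by (intro Y.fracs) auto
    have "p \<in> Q'" using p UQ by blast
    hence "\<one>\<^bsub>B'\<^esub> \<notin> p"
      using Y.Q_prime primeideal.I_notcarr ideal.one_imp_carrier primeideal.axioms(1) by blast
    hence "(cst B' c, \<one>\<^bsub>B'\<^esub>) \<in> Proj_fracs G' p"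
      using Y.G_cst Y.G_one by (auto simp: Proj_fracs_def)
    hence "L.cls (cst B' c) \<one>\<^bsub>B'\<^esub> \<in> carrier L.FR" by (rule L.cls_carrier)
    hence "\<gamma> p (snd m (g p) (L.cls (cst B' c) \<one>\<^bsub>B'\<^esub>)) = L.cls (cst B' c) \<one>\<^bsub>B'\<^esub>"
      by (rule \<gamma>m[OF p])
    moreover have "snd m (g p) (L.cls (cst B' c) \<one>\<^bsub>B'\<^esub>)
        = hfrac B G (g p) (cst B c) \<one>\<^bsub>B\<^esub>"
      using stalk_scal[OF gU(1)[OF p], of c] gU(2)[OF p] by simp
    ultimately show "\<gamma> p (hfrac B G (g p) (cst B c) \<one>\<^bsub>B\<^esub>)
        = hfrac B' G' p (cst B' c) \<one>\<^bsub>B'\<^esub>"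
      by simp
  next
    fix V s assume Vs: "openin (zariski B Q) V \<and> s \<in> sect ?X V"
    hence V: "openin (zariski B Q) V" and s: "s \<in> sect ?X V" by auto
    have VQ: "V \<subseteq> Q" using openin_subset[OF V] by simp
    let ?V = "{p \<in> U. g p \<in> V}" and ?r = "\<lambda>p. \<gamma> p (s (g p))"
    have s1: "s q \<in> carrier (?sX q)" if "q \<in> V" for q
      using s that unfolding X.sect_hspace by auto
    have r1: "?r p \<in> carrier (?sY p)" if p: "p \<in> ?V" for p
    proof -
      have "\<gamma> p \<in> ring_hom (?sX (g p)) (?sY p)" using \<gamma>[of p] p by (simp add: ring_iso_def)
      thus ?thesis using s1[of "g p"] p by (auto intro: ring_hom_closed)
    qed
    have r2: "\<exists>W a t. openin (zariski B' Q') W \<and> p \<in> W \<and> W \<subseteq> ?V \<and>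
      (\<forall>p'\<in>W. (a, t) \<in> Proj_fracs G' p' \<and> restrict ?r ?V p' = frac_cls B' (Proj_fracs G' p') (Proj_mult G' p') a t)"
      if p: "p \<in> ?V" for p
    proof -
      obtain W a t where W: "openin (zariski B Q) W" "g p \<in> W" "W \<subseteq> V"
        and at: "\<And>q. q \<in> W \<Longrightarrow> (a, t) \<in> Proj_fracs G q \<and> s q = hfrac B G q a t"
        using s[unfolded X.sect_hspace, THEN conjunct2, THEN bspec, of "g p"] p by blast
      have gp: "g p \<in> Q" using p gU by blast
      interpret R: fraction_data B "Proj_fracs G (g p)" "Proj_mult G (g p)" by (rule X.fracs[OF gp])
      have "a \<in> carrier B" "t \<in> carrier B" using R.F_carr at[OF W(2)] by blast+
      then obtain x y where xy: "\<And>q. q \<in> Q \<Longrightarrow> (a, t) \<in> Proj_fracs G q \<Longrightarrow> (x, y) \<in> Proj_fracs G' (fst m q) \<and>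
            hfrac B G q (\<phi> x) (\<phi> y)
              = hfrac B G q a t"
        using lift by meson
      have "(x, y) \<in> Proj_fracs G' p' \<and> ?r p' = frac_cls B' (Proj_fracs G' p') (Proj_mult G' p') x y"
        if p': "p' \<in> fst m ` W" for p'
      proof -
        obtain q where q: "q \<in> W" "p' = fst m q" using p' by blast
        hence qQ: "q \<in> Q" using W(3) VQ by blast
        have p'U: "p' \<in> U" and gq: "g p' = q" using q qQ mU gm by auto
        have f: "(x, y) \<in> Proj_fracs G' p'" using xy[OF qQ] at[OF q(1)] q(2) by blast
        interpret L: fraction_data B' "Proj_fracs G' p'" "Proj_mult G' p'"
          using p'U UQ by (intro Y.fracs) auto
        have "s q = snd m q (L.cls x y)"
          using germ[OF qQ, of x y] f xy[OF qQ] at[OF q(1)] q(2) by simp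
        hence "?r p' = L.cls x y"
          using \<gamma>m[OF p'U L.cls_carrier[OF f]] gq by simp
        thus ?thesis using f by simp
      qed
      moreover have "fst m ` W \<subseteq> ?V"
        using W(3) VQ mU gm by force
      moreover have "p \<in> fst m ` W" using W(2) gU[of p] p by force
      ultimately show ?thesis
        using op[OF W(1)] by (intro exI[of _ "fst m ` W"] exI[of _ x] exI[of _ y]) auto
    qed
    show "restrict ?r ?V \<in> sect ?Y ?V"
      unfolding Y.sect_hspace using r1 r2 by auto
  qed
  have eq1: "mor_eq ?X ?X ((g, \<gamma>) \<circ>\<^sub>m m) mor_id"
    unfolding mor_eq_def mor_comp_def mor_id_def fst_conv snd_conv X.hspace_simps X.topspace_zariski
  proof (intro ballI conjI)
    fix q assume q: "q \<in> Q"
    show "g (fst m q) = q" using gm[OF q] .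
    fix z assume "z \<in> carrier (?sX (g (fst m q)))"
    thus "snd m q (\<gamma> (fst m q) z) = z"
      using m\<gamma>[OF mU[OF q]] gm[OF q] by simp
  qed
  have eq2: "mor_eq ?YU ?YU (m \<circ>\<^sub>m (g, \<gamma>)) mor_id"
    unfolding mor_eq_def mor_comp_def mor_id_def fst_conv snd_conv YU Y.hspace_simps tsU
  proof (intro ballI conjI)
    fix p assume p: "p \<in> U"
    show "fst m (g p) = p" using gU[OF p] by blast
    fix z assume "z \<in> carrier (?sY (fst m (g p)))"
    thus "\<gamma> p (snd m (g p) z) = z"
      using \<gamma>m[OF p] gU[OF p] by simp
  qed
  show ?thesis
    unfolding isomorphism_def using mor1 mor2 eq1 eq2 by blast
qed

section \<open>Torus actions from coactions\<close>

lemma kalgebra_torus: "kalgebra (torus_alg n :: (_, 'k::field) kalg)"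
  unfolding torus_alg_def by (rule kalgebra_laurent[OF kalgebra_base_alg])

lemma torus_proj_hom_eq: "torus_proj_hom D = lmap (cst D)"
  by (auto simp: torus_proj_hom_def lmap_def)

lemma torus_proj_hom_cst: "kalgebra D \<Longrightarrow> torus_proj_hom D (cst (torus_alg n) c) = cst (laurent n D) c"
proof -
  assume "kalgebra D"
  then interpret D: kalgebra D .
  show ?thesis
    by (auto simp: torus_proj_hom_def torus_alg_def laurent_def lconst_def)
qed

lemma gmor_torus_proj:
  assumes "graded D G cmp"
  shows "gmor (laurent n D) (laurent_grading n D G) (Proj_pts (laurent n D) (laurent_grading n D G))
    (torus_alg n) (trivial_grading (torus_alg n)) (Spec_pts (torus_alg n))
    (torus_proj_hom D) (Proj_induced (torus_alg n) (torus_proj_hom D) (laurent n D) (laurent_grading n D G))"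
proof (rule gmor_Proj_Spec[OF graded_laurent[OF assms] kalgebra_torus])
  interpret D: graded D G cmp by fact
  show hom: "torus_proj_hom D \<in> ring_hom (torus_alg n) (laurent n D)"
    unfolding torus_proj_hom_eq torus_alg_def
    by (rule lmap_ring_hom[OF cring_base_alg D.is_cring D.cst_hom])
  show "torus_proj_hom D (cst (torus_alg n) c) = cst (laurent n D) c" for c
    by (rule torus_proj_hom_cst) unfold_locales
  show "torus_proj_hom D ` carrier (torus_alg n) \<subseteq> laurent_grading n D G 0"
    using ring_hom_closed[OF hom] D.G_cst by (auto simp: laurent_grading_def torus_proj_hom_def)
qed

lemma gmor_lconst:
  assumes "graded D G cmp"
  shows "gmor (laurent n D) (laurent_grading n D G) (Proj_pts (laurent n D) (laurent_grading n D G))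
    D G (Proj_pts D G) (lconst D) (Proj_induced D (lconst D) (laurent n D) (laurent_grading n D G))"
proof (rule gmor_Proj_Proj[OF graded_laurent[OF assms] assms])
  interpret D: graded D G cmp by fact
  interpret L: laurent_alg D n by unfold_locales
  show hom: "lconst D \<in> ring_hom D (laurent n D)" by (rule L.lconst_ring_hom)
  show "lconst D (cst D c) = cst (laurent n D) c" for c
    by (simp add: laurent_def)
  show "lconst D ` G d \<subseteq> laurent_grading n D G d" for d
    using ring_hom_closed[OF hom] D.G_carr by (auto simp: laurent_grading_def lconst_def)
  show "\<exists>d>0. \<exists>x\<in>G d. lconst D x \<notin> q" if "q \<in> Proj_pts (laurent n D) (laurent_grading n D G)" for q
    by (rule lconst_valid[OF assms that])
qed

lemma is_pairingI:
  assumes W: "hspace_data W GW QW" and B: "graded B G cmp"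
    and h: "gmor W GW QW (laurent n B) (laurent_grading n B G)
          (Proj_pts (laurent n B) (laurent_grading n B G)) \<chi> h"
    and f: "gmor W GW QW (torus_alg n) (trivial_grading (torus_alg n)) (Spec_pts (torus_alg n)) \<xi> f"
    and g: "gmor W GW QW B G (Proj_pts B G) \<eta> g"
    and 1: "\<And>x. x \<in> carrier (torus_alg n) \<Longrightarrow> \<chi> (torus_proj_hom B x) = \<xi> x"
    and 2: "\<And>d x. x \<in> G d \<Longrightarrow> \<chi> (lconst B x) = \<eta> x"
  shows "is_pairing n B G (hspace W GW QW) f g h"
proof -
  interpret B: graded B G cmp by fact
  interpret L: graded "laurent n B" "laurent_grading n B G" "\<lambda>d f u. cmp d (f u)"
    by (rule graded_laurent[OF B])
  note LP = L.hspace_data_Proj and BP = B.hspace_data_Proj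
  have T: "hspace_data (torus_alg n) (trivial_grading (torus_alg n)) (Spec_pts (torus_alg n :: (_, 'b) kalg))"
    by (rule kalgebra.hspace_data_Spec[OF kalgebra_torus])
  have M: "morphism (hspace W GW QW) (Proj (laurent n B) (laurent_grading n B G)) h"
    unfolding Proj_eq_hspace
    by (rule gmor_morphism[OF W LP h])
  have E1: "mor_eq (hspace W GW QW) (torus n)
      (Proj_induced (torus_alg n) (torus_proj_hom B) (laurent n B) (laurent_grading n B G) \<circ>\<^sub>m h) f"
    unfolding Spec_eq_hspace
    by (rule gmor_eq[OF W T gmor_comp[OF W LP T h gmor_torus_proj[OF B]] f])
      (use 1 in \<open>auto simp: trivial_grading_def split: if_splits\<close>)
  have E2: "mor_eq (hspace W GW QW) (Proj B G)
      (Proj_induced B (lconst B) (laurent n B) (laurent_grading n B G) \<circ>\<^sub>m h) g"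
    unfolding Proj_eq_hspace
    by (rule gmor_eq[OF W BP gmor_comp[OF W LP BP h gmor_lconst[OF B]] g]) (use 2 in auto)
  show ?thesis
    unfolding is_pairing_def using M E1 E2 by blast
qed

text \<open>
  An action of the torus of rank \<open>n\<close> amounts to a grading by \<open>\<int>\<^sup>n\<close>:
  \<open>coact x\<close> is the sum of the \<open>x\<^sub>u t\<^sup>u\<close>, and the last two assumptions
  say that the \<open>x\<^sub>u\<close> are the components of \<open>x\<close>.
\<close>

locale coaction = graded B G cmp for B :: "('a, 'k::field) kalg" (structure) and G cmp +
  fixes n :: nat and coact :: "'a \<Rightarrow> (nat \<Rightarrow> int) \<Rightarrow> 'a"
  assumes coact_hom: "coact \<in> ring_hom B (laurent n B)"
    and coact_cst: "coact (cst B c) = lconst B (cst B c)"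
    and coact_G: "x \<in> G d \<Longrightarrow> coact x u \<in> G d"
    and coact_idem: "x \<in> carrier B \<Longrightarrow> coact (coact x u) = lsing B u (coact x u)"
    and coact_sum: "x \<in> carrier B \<Longrightarrow> (\<Oplus>u\<in>lsupp B (coact x). coact x u) = x"
begin

sublocale L: laurent_alg B n by unfold_locales

abbreviation "H \<equiv> laurent_grading n B G"
abbreviation "L2 \<equiv> laurent n L.L"
abbreviation "H2 \<equiv> laurent_grading n L.L H"

sublocale GL: graded L.L H "\<lambda>d f u. cmp d (f u)"
  by (rule graded_laurent) unfold_locales

sublocale LL: laurent_alg L.L n by unfold_locales

sublocale GL2: graded L2 H2 "\<lambda>d f u w. cmp d (f u w)"
  using graded_laurent[OF GL.graded_axioms] by simp

lemma coact_carr: "x \<in> carrier B \<Longrightarrow> coact x \<in> carrier L.L"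
  by (rule ring_hom_closed[OF coact_hom])

lemma coact_valid:
  assumes q: "q \<in> Proj_pts L.L H"
  shows "\<exists>d>0. \<exists>x\<in>G d. coact x \<notin> q"
proof (rule ccontr)
  assume neg: "\<not> ?thesis"
  obtain d x where d: "d > 0" "x \<in> G d" "lconst B x \<notin> q"
    using lconst_valid[OF graded_axioms q] by blast
  interpret q: primeideal q L.L using q GL.Proj_pts_iff by blast
  interpret c: ring_hom_ring B L.L "lconst B" by unfold_locales (rule L.lconst_ring_hom)
  have x: "x \<in> carrier B" using d G_carr by blast
  have v: "coact x u \<in> carrier B" for u using L.L_val[OF coact_carr[OF x]] .
  have "lconst B (coact x u) \<in> q" if u: "u \<in> lsupp B (coact x)" for u
  proof -
    have ul: "u \<in> int_lattice n" using u coact_carr[OF x] unfolding L.L_carrier by blast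
    have "coact (coact x u) \<in> q" using neg d(1) coact_G[OF d(2)] by blast
    hence "lsing B (- u) \<one> \<otimes>\<^bsub>L.L\<^esub> lsing B u (coact x u) \<in> q"
      using coact_idem[OF x] ul by (intro q.I_l_closed) auto
    thus ?thesis using ul v by (simp add: L.lsing_mult lconst_eq_lsing)
  qed
  hence "(\<Oplus>\<^bsub>L.L\<^esub>u\<in>lsupp B (coact x). lconst B (coact x u)) \<in> q"
    using L.L_fin[OF coact_carr[OF x]] by (intro q.finsum_in) auto
  moreover have "lconst B (\<Oplus>u\<in>lsupp B (coact x). coact x u)
      = (\<Oplus>\<^bsub>L.L\<^esub>u\<in>lsupp B (coact x). lconst B (coact x u))"
    using v by (subst c.hom_finsum) (auto simp: comp_def)
  ultimately show False using d(3) coact_sum[OF x] by simp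
qed

abbreviation "act \<equiv> Proj_induced B coact L.L H"

lemma gmor_act: "gmor L.L H (Proj_pts L.L H) B G (Proj_pts B G) coact act"
proof (rule gmor_Proj_Proj[OF GL.graded_axioms graded_axioms coact_hom])
  show "coact (cst B c) = cst L.L c" for c
    by (simp add: coact_cst laurent_def)
  show "coact ` G d \<subseteq> H d" for d
    using coact_G coact_carr G_carr by (auto simp: laurent_grading_def)
qed (rule coact_valid)

lemma H_grading: "f \<in> H d \<longleftrightarrow> f \<in> carrier L.L \<and> (\<forall>u. f u \<in> G d)"
  by (simp add: laurent_grading_def)

lemma H2_grading: "f \<in> H2 d \<longleftrightarrow> f \<in> carrier L2 \<and> (\<forall>u. f u \<in> H d)"
  by (simp add: laurent_grading_def)

lemma lconst_H: "x \<in> G d \<Longrightarrow> lconst B x \<in> H d"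
  using ring_hom_closed[OF L.lconst_ring_hom] G_carr by (auto simp: H_grading lconst_def)

text \<open>The neutral element acts trivially: \<open>x \<mapsto> (1, x)\<close> is given by the augmentation.\<close>

lemma augment_coact: "x \<in> carrier B \<Longrightarrow> L.augment (coact x) = x"
  by (simp add: L.augment_def coact_sum)

lemma augment_lconst: "x \<in> carrier B \<Longrightarrow> L.augment (lconst B x) = x"
  by (simp add: lconst_eq_lsing L.augment_lsing)

lemma gmor_augment:
  "gmor B G (Proj_pts B G) L.L H (Proj_pts L.L H) L.augment (Proj_induced L.L L.augment B G)"
proof (rule gmor_Proj_Proj[OF graded_axioms GL.graded_axioms L.augment_ring_hom])
  show "L.augment (cst L.L c) = cst B c" for c
    by (simp add: L.L_cst L.augment_lsing)
  show "L.augment ` H d \<subseteq> G d" for d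
    by (auto simp: H_grading L.augment_def intro!: finsum_G)
  fix q assume "q \<in> Proj_pts B G"
  then obtain d x where "d > 0" "x \<in> G d" "x \<notin> q" using Proj_pts_iff by blast
  thus "\<exists>d>0. \<exists>x\<in>H d. L.augment x \<notin> q"
    using lconst_H augment_lconst G_carr by metis
qed

lemma torus_unit_hom_eq:
  assumes f: "f \<in> carrier (torus_alg n)"
  shows "L.augment (torus_proj_hom B f) = torus_unit_hom B f"
proof -
  have f': "finite {m. f m \<noteq> 0}"
    using f by (simp add: torus_alg_def laurent_def)
  have p: "torus_proj_hom B f \<in> carrier L.L"
    unfolding torus_proj_hom_eq
    by (rule ring_hom_closed[OF lmap_ring_hom[OF cring_base_alg is_cring cst_hom] f[unfolded torus_alg_def]])
  have "L.augment (torus_proj_hom B f) = (\<Oplus>u\<in>{m. f m \<noteq> 0}. torus_proj_hom B f u)"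
    by (rule L.augment_eq[OF p f']) (auto simp: lsupp_def torus_proj_hom_def)
  thus ?thesis
    by (simp add: torus_proj_hom_def torus_unit_hom_def cst_sum[OF f'])
qed

lemma unit_pairing:
  "is_pairing n B G (Proj B G) (Proj_induced (torus_alg n) (torus_unit_hom B) B G) mor_id
     (Proj_induced L.L L.augment B G)"
  unfolding Proj_eq_hspace
proof (rule is_pairingI[OF hspace_data_Proj graded_axioms gmor_augment _ gmor_id[OF hspace_data_Proj]])
  interpret T: kalgebra "torus_alg n :: (_, 'k) kalg" by (rule kalgebra_torus)
  show "gmor B G (Proj_pts B G) (torus_alg n) (trivial_grading (torus_alg n)) (Spec_pts (torus_alg n))
    (torus_unit_hom B) (Proj_induced (torus_alg n) (torus_unit_hom B) B G)"
  proof (rule gmor_Proj_Spec[OF graded_axioms kalgebra_torus])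
    have tp: "torus_proj_hom B \<in> ring_hom (torus_alg n) L.L"
      unfolding torus_proj_hom_eq torus_alg_def by (rule lmap_ring_hom[OF cring_base_alg is_cring cst_hom])
    have c: "(\<lambda>x. L.augment (torus_proj_hom B x)) \<in> ring_hom (torus_alg n) B"
      using ring_hom_trans[OF tp L.augment_ring_hom] by (simp add: comp_def)
    show "torus_unit_hom B \<in> ring_hom (torus_alg n) B"
    proof (rule ring_hom_memI)
      fix x y :: "(nat \<Rightarrow> int) \<Rightarrow> 'k" assume x: "x \<in> carrier (torus_alg n)" and y: "y \<in> carrier (torus_alg n)"
      show "torus_unit_hom B x \<in> carrier B"
        using ring_hom_closed[OF c x] torus_unit_hom_eq[OF x] by simp
      show "torus_unit_hom B (x \<otimes>\<^bsub>torus_alg n\<^esub> y) = torus_unit_hom B x \<otimes> torus_unit_hom B y"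
        using ring_hom_mult[OF c x y]
        by (simp add: torus_unit_hom_eq[OF x] torus_unit_hom_eq[OF y] torus_unit_hom_eq[OF T.m_closed[OF x y]])
      show "torus_unit_hom B (x \<oplus>\<^bsub>torus_alg n\<^esub> y) = torus_unit_hom B x \<oplus> torus_unit_hom B y"
        using ring_hom_add[OF c x y]
        by (simp add: torus_unit_hom_eq[OF x] torus_unit_hom_eq[OF y] torus_unit_hom_eq[OF T.a_closed[OF x y]])
    next
      show "torus_unit_hom B \<one>\<^bsub>torus_alg n\<^esub> = \<one>"
        using ring_hom_one[OF c] by (simp add: torus_unit_hom_eq[OF T.one_closed])
    qed
    show "torus_unit_hom B (cst (torus_alg n) c) = cst B c" for c
      using T.cst_simps(1)[of c] kalgebra_axioms
      by (simp add: torus_unit_hom_eq[symmetric] torus_proj_hom_cst L.L_cst L.augment_lsing)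
    show "torus_unit_hom B ` carrier (torus_alg n) \<subseteq> G 0"
      by (auto simp: torus_unit_hom_def G_cst)
  qed
qed (auto simp: torus_unit_hom_eq augment_lconst G_carr)

lemma unit_acts: "mor_eq (Proj B G) (Proj B G) (act \<circ>\<^sub>m Proj_induced L.L L.augment B G) mor_id"
  unfolding Proj_eq_hspace
  by (rule gmor_eq[OF hspace_data_Proj hspace_data_Proj
      gmor_comp[OF hspace_data_Proj GL.hspace_data_Proj hspace_data_Proj gmor_augment gmor_act]
      gmor_id[OF hspace_data_Proj]])
    (simp add: augment_coact G_carr)

text \<open>Associativity: \<open>(s, t, x) \<mapsto> (s, t x)\<close> and \<open>(s, t, x) \<mapsto> (s t, x)\<close>.\<close>

lemma lmap_coact_hom: "lmap coact \<in> ring_hom L.L L2"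
  by (rule lmap_ring_hom[OF is_cring L.cring_L coact_hom])

lemma lmap_coact_lconst:
  assumes "x \<in> carrier B"
  shows "lmap coact (lconst B x) = lconst L.L (coact x)"
proof -
  interpret h: ring_hom_ring B L.L coact by unfold_locales (rule coact_hom)
  show ?thesis by (auto simp: lmap_def lconst_def)
qed

lemma lconst_L_valid:
  assumes q: "q \<in> Proj_pts L2 H2"
  shows "\<exists>d>0. \<exists>x\<in>G d. lconst L.L (coact x) \<notin> q" "\<exists>d>0. \<exists>x\<in>G d. lconst L.L (lconst B x) \<notin> q"
proof -
  interpret M: gmor_data L2 H2 "Proj_pts L2 H2" L.L H "Proj_pts L.L H" "lconst L.L"
      "Proj_induced L.L (lconst L.L) L2 H2"
    by (intro gmor_data.intro gmor_data_axioms.intro GL2.hspace_data_Proj GL.hspace_data_Proj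
        gmor_lconst[OF GL.graded_axioms])
  note p = M.pt[OF q]
  have mem: "f \<in> H d \<Longrightarrow> f \<notin> fst (Proj_induced L.L (lconst L.L) L2 H2) q \<Longrightarrow> lconst L.L f \<notin> q" for f d
    using M.mem[OF q] by blast
  show "\<exists>d>0. \<exists>x\<in>G d. lconst L.L (coact x) \<notin> q"
  proof -
    obtain d x where x: "d > 0" "x \<in> G d" "coact x \<notin> fst (Proj_induced L.L (lconst L.L) L2 H2) q"
      using coact_valid[OF p] by blast
    moreover have "coact x \<in> H d" using x(2) coact_G coact_carr G_carr by (auto simp: H_grading)
    ultimately show ?thesis using mem by blast
  qed
  show "\<exists>d>0. \<exists>x\<in>G d. lconst L.L (lconst B x) \<notin> q"
    using lconst_valid[OF graded_axioms p] mem lconst_H by blast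
qed

lemma gmor_h1:
  "gmor L2 H2 (Proj_pts L2 H2) L.L H (Proj_pts L.L H) (lmap coact) (Proj_induced L.L (lmap coact) L2 H2)"
proof (rule gmor_Proj_Proj[OF GL2.graded_axioms GL.graded_axioms lmap_coact_hom])
  show "lmap coact (cst L.L c) = cst L2 c" for c
    using lmap_coact_lconst[of "cst B c"] by (simp add: laurent_def[of n L.L] coact_cst) (simp add: laurent_def coact_cst)
  show "lmap coact ` H d \<subseteq> H2 d" for d
  proof
    fix g assume "g \<in> lmap coact ` H d"
    then obtain f where f: "f \<in> H d" "g = lmap coact f" by blast
    hence "g \<in> carrier L2" using ring_hom_closed[OF lmap_coact_hom] by (auto simp: H_grading)
    moreover have "g u \<in> H d" for u
    proof -
      have fu: "f u \<in> G d" using f by (simp add: H_grading)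
      thus ?thesis
        using coact_G[OF fu] coact_carr[OF G_carr[OF fu]] f(2) by (simp add: lmap_def H_grading)
    qed
    ultimately show "g \<in> H2 d" by (simp add: H2_grading)
  qed
  fix q assume q: "q \<in> Proj_pts L2 H2"
  obtain d x where x: "d > 0" "x \<in> G d" "lconst L.L (coact x) \<notin> q"
    using lconst_L_valid(1)[OF q] by blast
  thus "\<exists>d>0. \<exists>f\<in>H d. lmap coact f \<notin> q"
    using lmap_coact_lconst[OF G_carr[OF x(2)]] lconst_H by metis
qed

lemma gmor_h2:
  "gmor L2 H2 (Proj_pts L2 H2) L.L H (Proj_pts L.L H) L.diag (Proj_induced L.L L.diag L2 H2)"
proof (rule gmor_Proj_Proj[OF GL2.graded_axioms GL.graded_axioms L.diag_ring_hom])
  have dl: "L.diag (lconst B x) = lconst L.L (lconst B x)" if "x \<in> carrier B" for x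
    by (auto simp: L.diag_def lconst_def L.L_zero intro!: ext)
  show "L.diag (cst L.L c) = cst L2 c" for c
    using dl[of "cst B c"] by (simp add: laurent_def[of n L.L]) (simp add: laurent_def)
  show "L.diag ` H d \<subseteq> H2 d" for d
  proof
    fix g assume "g \<in> L.diag ` H d"
    then obtain f where f: "f \<in> H d" "g = L.diag f" by blast
    hence g: "g \<in> carrier L2" using ring_hom_closed[OF L.diag_ring_hom] by (auto simp: H_grading)
    hence "g u \<in> carrier L.L" for u by (rule LL.L_val)
    moreover have "g u v \<in> G d" for u v using f by (simp add: L.diag_def H_grading)
    ultimately show "g \<in> H2 d" using g by (simp add: H2_grading H_grading)
  qed
  fix q assume q: "q \<in> Proj_pts L2 H2"
  obtain d x where x: "d > 0" "x \<in> G d" "lconst L.L (lconst B x) \<notin> q"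
    using lconst_L_valid(2)[OF q] by blast
  thus "\<exists>d>0. \<exists>f\<in>H d. L.diag f \<notin> q"
    using dl[OF G_carr[OF x(2)]] lconst_H by metis
qed

lemma torus_mult_hom_eq: "torus_mult_hom B f = L.diag (torus_proj_hom B f)"
  by (auto simp: torus_mult_hom_def L.diag_def torus_proj_hom_def intro!: ext)

lemma pairing_1:
  "is_pairing n B G (Proj L2 H2)
     (Proj_induced (torus_alg n) (torus_proj_hom L.L) L2 H2)
     (act \<circ>\<^sub>m Proj_induced L.L (lconst L.L) L2 H2)
     (Proj_induced L.L (lmap coact) L2 H2)"
  unfolding Proj_eq_hspace
proof (rule is_pairingI[OF GL2.hspace_data_Proj graded_axioms gmor_h1 gmor_torus_proj[OF GL.graded_axioms]
      gmor_comp[OF GL2.hspace_data_Proj GL.hspace_data_Proj hspace_data_Proj gmor_lconst[OF GL.graded_axioms] gmor_act]])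
  show "lmap coact (torus_proj_hom B f) = torus_proj_hom L.L f" for f
    by (auto simp: lmap_def torus_proj_hom_def coact_cst L.L_cst lconst_eq_lsing intro!: ext)
  show "lmap coact (lconst B x) = lconst L.L (coact x)" if "x \<in> G d" for x d
    using that G_carr by (intro lmap_coact_lconst) blast
qed

lemma pairing_2:
  "is_pairing n B G (Proj L2 H2)
     (Proj_induced (torus_alg n) (torus_mult_hom B) L2 H2)
     (Proj_induced B (lconst B) L.L H \<circ>\<^sub>m Proj_induced L.L (lconst L.L) L2 H2)
     (Proj_induced L.L L.diag L2 H2)"
  unfolding Proj_eq_hspace
proof (rule is_pairingI[OF GL2.hspace_data_Proj graded_axioms gmor_h2 _
      gmor_comp[OF GL2.hspace_data_Proj GL.hspace_data_Proj hspace_data_Proj gmor_lconst[OF GL.graded_axioms]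
        gmor_lconst[OF graded_axioms]]])
  interpret T: kalgebra "torus_alg n :: (_, 'k) kalg" by (rule kalgebra_torus)
  show "gmor L2 H2 (Proj_pts L2 H2) (torus_alg n) (trivial_grading (torus_alg n)) (Spec_pts (torus_alg n))
     (torus_mult_hom B) (Proj_induced (torus_alg n) (torus_mult_hom B) L2 H2)"
  proof (rule gmor_Proj_Spec[OF GL2.graded_axioms kalgebra_torus])
    have tp: "torus_proj_hom B \<in> ring_hom (torus_alg n) L.L"
      unfolding torus_proj_hom_eq torus_alg_def by (rule lmap_ring_hom[OF cring_base_alg is_cring cst_hom])
    have e: "torus_mult_hom B = L.diag \<circ> torus_proj_hom B" by (rule ext) (simp add: torus_mult_hom_eq)
    show hom: "torus_mult_hom B \<in> ring_hom (torus_alg n) L2"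
      unfolding e by (rule ring_hom_trans[OF tp L.diag_ring_hom])
    interpret d: ring_hom_ring L.L L2 L.diag by unfold_locales (rule L.diag_ring_hom)
    show "torus_mult_hom B (cst (torus_alg n) c) = cst L2 c" for c
      using kalgebra_axioms by (simp add: torus_mult_hom_eq torus_proj_hom_cst)
        (auto simp: L.L_cst LL.L_cst L.diag_def lsing_def L.L_zero intro!: ext)
    show "torus_mult_hom B ` carrier (torus_alg n) \<subseteq> H2 0"
    proof
      fix g assume "g \<in> torus_mult_hom B ` carrier (torus_alg n)"
      then obtain f where f: "f \<in> carrier (torus_alg n)" "g = torus_mult_hom B f" by blast
      hence g: "g \<in> carrier L2" using ring_hom_closed[OF hom] by blast
      hence "g u \<in> carrier L.L" for u by (rule LL.L_val)
      moreover have "g u v \<in> G 0" for u v using f G_cst by (simp add: torus_mult_hom_def)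
      ultimately show "g \<in> H2 0" using g by (simp add: H2_grading H_grading)
    qed
  qed
  show "L.diag (torus_proj_hom B f) = torus_mult_hom B f" for f
    by (simp add: torus_mult_hom_eq)
  show "L.diag (lconst B x) = lconst L.L (lconst B x)" for x
    by (auto simp: L.diag_def lconst_def L.L_zero intro!: ext)
qed

lemma assoc:
  "mor_eq (Proj L2 H2) (Proj B G) (act \<circ>\<^sub>m Proj_induced L.L (lmap coact) L2 H2)
     (act \<circ>\<^sub>m Proj_induced L.L L.diag L2 H2)"
  unfolding Proj_eq_hspace
proof (rule gmor_eq[OF GL2.hspace_data_Proj hspace_data_Proj
      gmor_comp[OF GL2.hspace_data_Proj GL.hspace_data_Proj hspace_data_Proj gmor_h1 gmor_act]
      gmor_comp[OF GL2.hspace_data_Proj GL.hspace_data_Proj hspace_data_Proj gmor_h2 gmor_act]])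
  fix d x assume "x \<in> G d"
  hence "x \<in> carrier B" using G_carr by blast
  thus "lmap coact (coact x) = L.diag (coact x)"
    by (auto simp: lmap_def L.diag_eq coact_idem)
qed

theorem is_action_act: "is_action n B G act"
proof -
  have "morphism (Proj L.L H) (Proj B G) act"
    unfolding Proj_eq_hspace
    by (rule gmor_morphism[OF GL.hspace_data_Proj hspace_data_Proj gmor_act])
  thus ?thesis
    unfolding is_action_def Let_def
    using unit_pairing unit_acts pairing_1 pairing_2 assoc by blast
qed

end

section \<open>Semigroup algebras of cones\<close>

lemma restr_add: "restr A (f + g) = restr A f + restr A g"
  by (rule poly_mapping_eqI) (simp add: lookup_restr lookup_add)

lemma restr_id: "keys f \<subseteq> A \<Longrightarrow> restr A f = f"
  by (rule poly_mapping_eqI) (auto simp: lookup_restr in_keys_iff)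

lemma restr_none: "keys f \<inter> A = {} \<Longrightarrow> restr A f = 0"
  by (rule poly_mapping_eqI) (auto simp: lookup_restr in_keys_iff)

lemma restr_zero [simp]: "restr A 0 = 0"
  by (rule restr_none) simp

lemma restr_sum: "restr A (\<Sum>i\<in>I. f i) = (\<Sum>i\<in>I. restr A (f i))"
  by (induction I rule: infinite_finite_induct) (simp_all add: restr_add)

lemma restr_restr: "restr A (restr B f) = restr (A \<inter> B) f"
  by (rule poly_mapping_eqI) (simp add: lookup_restr)

lemma sum_restr_fibres:
  assumes "finite I" "w ` keys f \<subseteq> I"
  shows "(\<Sum>a\<in>I. restr {v. w v = a} f) = f"
proof (rule poly_mapping_eqI)
  fix v
  have "lookup (\<Sum>a\<in>I. restr {v. w v = a} f) v = (\<Sum>a\<in>I. if w v = a then lookup f v else 0)"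
    by (simp add: lookup_sum lookup_restr)
  also have "\<dots> = lookup f v"
    using assms by (cases "v \<in> keys f") (auto simp: in_keys_iff)
  finally show "lookup (\<Sum>a\<in>I. restr {v. w v = a} f) v = lookup f v" .
qed

lemma restr_mult_weight:
  fixes f g :: "'v::monoid_add \<Rightarrow>\<^sub>0 'k::comm_ring_1" and w :: "'v \<Rightarrow> 'w::ab_group_add"
  assumes w: "additive w" and I: "finite I" "w ` keys f \<subseteq> I"
  shows "restr {v. w v = u} (f * g) = (\<Sum>a\<in>I. restr {v. w v = a} f * restr {v. w v = u - a} g)"
proof -
  have *: "restr {v. w v = u} (restr {v. w v = a} f * g) = restr {v. w v = a} f * restr {v. w v = u - a} g" for a
  proof -
    let ?p = "restr {v. w v = a} f" and ?g = "restr {v. w v = u - a} g"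
    let ?r = "restr {v. w v \<noteq> u - a} g"
    have g: "g = ?g + ?r"
      by (rule poly_mapping_eqI) (simp add: lookup_restr lookup_add)
    have "keys (?p * ?g) \<subseteq> {v. w v = u}"
      using keys_mult[of ?p ?g] w by (fastforce simp: keys_restr additive_def)
    moreover have "keys (?p * ?r) \<inter> {v. w v = u} = {}"
    proof -
      have "w (x + y) \<noteq> u" if "w x = a" "w y \<noteq> u - a" for x y
        using that w by (auto simp: additive_def algebra_simps)
      thus ?thesis using keys_mult[of ?p ?r] by (fastforce simp: keys_restr)
    qed
    ultimately have "restr {v. w v = u} (?p * ?g + ?p * ?r) = ?p * ?g"
      by (simp add: restr_add restr_id restr_none)
    thus ?thesis using g by (metis distrib_left)
  qed
  have "f * g = (\<Sum>a\<in>I. restr {v. w v = a} f * g)"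
    using sum_restr_fibres[OF I] by (simp flip: sum_distrib_right)
  thus ?thesis by (simp add: restr_sum *)
qed

text \<open>Evaluation at the point with all coordinates 1.\<close>

definition ev :: "('v \<Rightarrow>\<^sub>0 'k::comm_monoid_add) \<Rightarrow> 'k" where
  "ev f = (\<Sum>v\<in>keys f. lookup f v)"

lemma ev_superset: "finite A \<Longrightarrow> keys f \<subseteq> A \<Longrightarrow> ev f = (\<Sum>v\<in>A. lookup f v)"
  unfolding ev_def by (rule sum.mono_neutral_left) (auto simp: in_keys_iff)

lemma ev_add: "ev (f + g) = ev f + ev g"
proof -
  let ?A = "keys f \<union> keys g"
  have "ev (f + g) = (\<Sum>v\<in>?A. lookup (f + g) v)"
    by (rule ev_superset) (use keys_add[of f g] in auto)
  also have "\<dots> = (\<Sum>v\<in>?A. lookup f v) + (\<Sum>v\<in>?A. lookup g v)"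
    by (simp add: lookup_add sum.distrib)
  also have "\<dots> = ev f + ev g"
    using ev_superset[of ?A f] ev_superset[of ?A g] by simp
  finally show ?thesis .
qed

lemma ev_zero [simp]: "ev 0 = 0" and ev_single [simp]: "ev (single v c) = c"
  by (simp_all add: ev_def)

lemma ev_sum: "ev (\<Sum>i\<in>I. f i) = (\<Sum>i\<in>I. ev (f i))"
  by (induction I rule: infinite_finite_induct) (simp_all add: ev_add)

lemma ev_mult:
  fixes f g :: "'v::monoid_add \<Rightarrow>\<^sub>0 'k::semiring_0"
  shows "ev (f * g) = ev f * ev g"
  by (subst mult_sum_single) (simp add: ev_sum, simp add: ev_def sum_product)

lemma ev_subset_single: "keys f \<subseteq> {v} \<Longrightarrow> ev f = lookup f v"
  using ev_superset[of "{v}" f] by simp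

text \<open>
  The degree with respect to the torus: the last coordinate of an exponent, which is the degree in the
  grading of the algebra, is dropped.
\<close>

definition wt :: "nat \<Rightarrow> (nat \<Rightarrow>\<^sub>0 int) \<Rightarrow> nat \<Rightarrow> int" where
  "wt n v = (\<lambda>i. if i < n then lookup v i else 0)"

lemma wt_add: "wt n (u + v) = wt n u + wt n v"
  by (auto simp: wt_def lookup_add plus_fun_def)

lemma additive_wt: "additive (wt n)"
  by (simp add: additive_def wt_add)

lemma wt_zero [simp]: "wt n 0 = 0"
  by (auto simp: wt_def zero_fun_def)

lemma wt_lattice [simp]: "wt n v \<in> int_lattice n"
  by (simp add: wt_def int_lattice_def)

definition vec :: "nat \<Rightarrow> (nat \<Rightarrow> int) \<Rightarrow> int \<Rightarrow> (nat \<Rightarrow>\<^sub>0 int)" where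
  "vec n u d = (\<Sum>i<n. single i (u i)) + single n d"

lemma lookup_vec: "lookup (vec n u d) i = (if i < n then u i else if i = n then d else 0)"
proof -
  have "(\<Sum>j<n. lookup (single j (u j)) i) = (\<Sum>j<n. if j = i then u i else 0)"
    by (intro sum.cong) (auto simp: lookup_single when_def)
  thus ?thesis
    by (auto simp: vec_def lookup_add lookup_sum lookup_single when_def)
qed

lemma keys_vec: "keys (vec n u d) \<subseteq> {..n}"
  by (auto simp: in_keys_iff lookup_vec split: if_splits)

lemma wt_vec: "u \<in> int_lattice n \<Longrightarrow> wt n (vec n u d) = u"
  by (auto simp: wt_def lookup_vec int_lattice_def)

lemma exponent_eqI:
  assumes "keys v \<subseteq> {..n}" "keys v' \<subseteq> {..n}"
    and "wt n v = wt n v'" "lookup v n = lookup v' n"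
  shows "v = v'"
proof (rule poly_mapping_eqI)
  fix i
  consider "i < n" | "i = n" | "i > n" by linarith
  thus "lookup v i = lookup v' i"
  proof cases
    case 1 thus ?thesis using fun_cong[OF assms(3), of i] by (simp add: wt_def)
  next
    case 3
    hence "i \<notin> keys v" "i \<notin> keys v'" using assms(1,2) by auto
    thus ?thesis by (simp add: in_keys_iff)
  qed (simp add: assms)
qed

definition cone :: "nat \<Rightarrow> 'j set \<Rightarrow> ('j \<Rightarrow> (nat \<Rightarrow>\<^sub>0 int) \<Rightarrow> rat) \<Rightarrow> (nat \<Rightarrow>\<^sub>0 int) set" where
  "cone n J ell = {v. keys v \<subseteq> {..n} \<and> 0 \<le> lookup v n \<and> (\<forall>j\<in>J. 0 \<le> ell j v)}"

text \<open>
  \<open>B\<close> is the semigroup algebra of the lattice points of a full-dimensional rational cone in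
  \<open>\<int>\<^sup>n\<^sup>+\<^sup>1\<close>, graded by the last coordinate; \<open>\<Psi>\<close> is the identification. The vector \<open>h\<close> lies in the interior
  of the cone.
\<close>

locale toric_algebra = kalgebra B for B :: "('a, 'k::field) kalg" (structure) +
  fixes G :: "nat \<Rightarrow> 'a set" and \<Psi> :: "'a \<Rightarrow> 'k lpoly" and n :: nat
    and J :: "'j set" and ell :: "'j \<Rightarrow> (nat \<Rightarrow>\<^sub>0 int) \<Rightarrow> rat" and h :: "nat \<Rightarrow>\<^sub>0 int"
  assumes \<Psi>_one: "\<Psi> \<one> = 1"
    and \<Psi>_add: "x \<in> carrier B \<Longrightarrow> y \<in> carrier B \<Longrightarrow> \<Psi> (x \<oplus> y) = \<Psi> x + \<Psi> y"
    and \<Psi>_mult: "x \<in> carrier B \<Longrightarrow> y \<in> carrier B \<Longrightarrow> \<Psi> (x \<otimes> y) = \<Psi> x * \<Psi> y"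
    and \<Psi>_cst: "\<Psi> (cst B c) = single 0 c"
    and \<Psi>_inj: "inj_on \<Psi> (carrier B)"
    and \<Psi>_image: "\<Psi> ` carrier B = {f. keys f \<subseteq> cone n J ell}"
    and G_eq: "G d = {x \<in> carrier B. \<forall>v\<in>keys (\<Psi> x). lookup v n = int d}"
    and J_fin: "finite J"
    and ell_additive: "j \<in> J \<Longrightarrow> additive (ell j)"
    and h_keys: "keys h \<subseteq> {..n}"
    and h_pos: "0 < lookup h n" "j \<in> J \<Longrightarrow> 0 < ell j h"
begin

abbreviation M where "M \<equiv> cone n J ell"

lemma M_keys: "v \<in> M \<Longrightarrow> keys v \<subseteq> {..n}" and M_deg: "v \<in> M \<Longrightarrow> 0 \<le> lookup v n"
  by (auto simp: cone_def)

lemma M_zero: "0 \<in> M"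
  using ell_additive by (auto simp: cone_def additive_zero)

lemma M_add: "u \<in> M \<Longrightarrow> v \<in> M \<Longrightarrow> u + v \<in> M"
  using keys_add[of u v] ell_additive by (fastforce simp: cone_def additive_def lookup_add)

lemma h_M: "h \<in> M"
  using h_keys h_pos by (auto simp: cone_def less_imp_le)

definition el :: "'k lpoly \<Rightarrow> 'a" where "el f = inv_into (carrier B) \<Psi> f"

lemma el_carr: "keys f \<subseteq> M \<Longrightarrow> el f \<in> carrier B"
  and \<Psi>_el: "keys f \<subseteq> M \<Longrightarrow> \<Psi> (el f) = f"
  unfolding el_def using \<Psi>_image by (auto intro: inv_into_into f_inv_into_f)

lemma \<Psi>_keys: "x \<in> carrier B \<Longrightarrow> keys (\<Psi> x) \<subseteq> M"
  using \<Psi>_image by blast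

lemma \<Psi>_eqI: "x \<in> carrier B \<Longrightarrow> y \<in> carrier B \<Longrightarrow> \<Psi> x = \<Psi> y \<Longrightarrow> x = y"
  using \<Psi>_inj by (rule inj_onD)

lemma el_\<Psi>: "x \<in> carrier B \<Longrightarrow> el (\<Psi> x) = x"
  by (rule \<Psi>_eqI) (simp_all add: el_carr \<Psi>_el \<Psi>_keys)

lemma \<Psi>_zero: "\<Psi> \<zero> = 0"
  using \<Psi>_add[of \<zero> \<zero>] by (metis add_cancel_left_right l_zero zero_closed)

lemma el_zero: "el 0 = \<zero>"
  using el_\<Psi>[of \<zero>] by (simp add: \<Psi>_zero)

lemma \<Psi>_minus: "x \<in> carrier B \<Longrightarrow> \<Psi> (\<ominus> x) = - \<Psi> x"
  using \<Psi>_add[of x "\<ominus> x"] by (simp add: r_neg \<Psi>_zero eq_neg_iff_add_eq_0 add.commute)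

lemma \<Psi>_finsum:
  "finite A \<Longrightarrow> (\<And>a. a \<in> A \<Longrightarrow> f a \<in> carrier B) \<Longrightarrow> \<Psi> (finsum B f A) = (\<Sum>a\<in>A. \<Psi> (f a))"
  by (induction A rule: finite_induct) (auto simp: \<Psi>_zero \<Psi>_add Pi_def)

lemma restr_M: "x \<in> carrier B \<Longrightarrow> keys (restr A (\<Psi> x)) \<subseteq> M"
  using \<Psi>_keys[of x] by (auto simp: keys_restr)

definition cmpt :: "nat \<Rightarrow> 'a \<Rightarrow> 'a" where
  "cmpt d x = el (restr {v. lookup v n = int d} (\<Psi> x))"

lemma cmpt_carr: "x \<in> carrier B \<Longrightarrow> cmpt d x \<in> carrier B"
  and \<Psi>_cmpt: "x \<in> carrier B \<Longrightarrow> \<Psi> (cmpt d x) = restr {v. lookup v n = int d} (\<Psi> x)"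
  unfolding cmpt_def by (simp_all add: el_carr \<Psi>_el restr_M)

lemma G_iff: "x \<in> G d \<longleftrightarrow> x \<in> carrier B \<and> (\<forall>v\<in>keys (\<Psi> x). lookup v n = int d)"
  by (simp add: G_eq)

sublocale graded B G cmpt
proof (unfold_locales, goal_cases)
  case (1 d) thus ?case by (auto simp: G_iff)
next
  case 2 thus ?case by (auto simp: G_iff \<Psi>_one in_keys_iff lookup_one when_def)
next
  case 3 thus ?case by (auto simp: G_iff \<Psi>_zero)
next
  case (4 x d y)
  thus ?case using keys_add[of "\<Psi> x" "\<Psi> y"] by (auto simp: G_iff \<Psi>_add)
next
  case (5 x d) thus ?case by (auto simp: G_iff \<Psi>_minus in_keys_iff)
next
  case (6 x d y e)
  show ?case unfolding G_iff
  proof (intro conjI ballI)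
    show "x \<otimes> y \<in> carrier B" using 6 by (simp add: G_iff)
    fix v assume "v \<in> keys (\<Psi> (x \<otimes> y))"
    hence "v \<in> keys (\<Psi> x * \<Psi> y)" using 6 by (simp add: G_iff \<Psi>_mult)
    then obtain a b where "a \<in> keys (\<Psi> x)" "b \<in> keys (\<Psi> y)" "v = a + b"
      using keys_mult[of "\<Psi> x" "\<Psi> y"] by blast
    thus "lookup v n = int (d + e)" using 6 by (simp add: G_iff lookup_add)
  qed
next
  case (7 c) thus ?case by (auto simp: G_iff \<Psi>_cst)
next
  case (8 x d) thus ?case by (auto simp: G_iff cmpt_carr \<Psi>_cmpt keys_restr)
next
  case (9 x y d)
  thus ?case by (intro \<Psi>_eqI) (simp_all add: cmpt_carr \<Psi>_cmpt \<Psi>_add restr_add)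
next
  case (10 x d e)
  hence x: "x \<in> carrier B" and k: "\<And>v. v \<in> keys (\<Psi> x) \<Longrightarrow> lookup v n = int d"
    by (auto simp: G_iff)
  have "restr {v. lookup v n = int e} (\<Psi> x) = (if e = d then \<Psi> x else 0)"
    using k by (auto intro: restr_id restr_none)
  thus ?case using x by (auto simp: cmpt_def el_\<Psi> el_zero)
next
  case (11 x)
  let ?N = "Suc (Max (insert 0 ((\<lambda>v. nat (lookup v n)) ` keys (\<Psi> x))))"
  have N: "nat (lookup v n) < ?N" "0 \<le> lookup v n" if "v \<in> keys (\<Psi> x)" for v
    using that \<Psi>_keys[OF 11] M_deg by (auto simp: less_Suc_eq_le)
  have z: "cmpt d x = \<zero>" if "?N \<le> d" for d
  proof -
    have "restr {v. lookup v n = int d} (\<Psi> x) = 0"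
      using N that by (intro restr_none) force
    thus ?thesis by (simp add: cmpt_def el_zero)
  qed
  have "\<Psi> (\<Oplus>d\<in>{..<?N}. cmpt d x) = (\<Sum>d\<in>{..<?N}. restr {v. nat (lookup v n) = d} (\<Psi> x))"
  proof -
    have "restr {v. lookup v n = int d} (\<Psi> x) = restr {v. nat (lookup v n) = d} (\<Psi> x)" for d
    proof (rule poly_mapping_eqI)
      fix v show "lookup (restr {v. lookup v n = int d} (\<Psi> x)) v = lookup (restr {v. nat (lookup v n) = d} (\<Psi> x)) v"
      proof (cases "v \<in> keys (\<Psi> x)")
        case True
        hence "lookup v n = int d \<longleftrightarrow> nat (lookup v n) = d" using N(2)[of v] by auto
        thus ?thesis by (simp add: lookup_restr)
      qed (simp add: lookup_restr in_keys_iff)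
    qed
    thus ?thesis using 11 by (subst \<Psi>_finsum) (auto simp: cmpt_carr \<Psi>_cmpt)
  qed
  also have "\<dots> = \<Psi> x"
    by (rule sum_restr_fibres) (use N(1) in auto)
  finally have "x = (\<Oplus>d\<in>{..<?N}. cmpt d x)"
    using 11 by (intro \<Psi>_eqI) (auto simp: cmpt_carr)
  thus ?case using z by blast
qed

definition coact :: "'a \<Rightarrow> (nat \<Rightarrow> int) \<Rightarrow> 'a" where
  "coact x = (\<lambda>u. el (restr {v. wt n v = u} (\<Psi> x)))"

lemma coact_val: "x \<in> carrier B \<Longrightarrow> coact x u \<in> carrier B"
  and \<Psi>_coact: "x \<in> carrier B \<Longrightarrow> \<Psi> (coact x u) = restr {v. wt n v = u} (\<Psi> x)"
  unfolding coact_def by (simp_all add: el_carr \<Psi>_el restr_M)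

lemma lsupp_coact: "x \<in> carrier B \<Longrightarrow> lsupp B (coact x) = wt n ` keys (\<Psi> x)"
proof -
  assume x: "x \<in> carrier B"
  have "coact x u = \<zero> \<longleftrightarrow> restr {v. wt n v = u} (\<Psi> x) = 0" for u
    using \<Psi>_eqI[OF coact_val[OF x], of \<zero> u] \<Psi>_coact[OF x, of u] \<Psi>_zero by auto
  hence "coact x u = \<zero> \<longleftrightarrow> keys (\<Psi> x) \<inter> {v. wt n v = u} = {}" for u
    by (metis keys_eq_empty keys_restr)
  thus ?thesis by (auto simp: lsupp_def)
qed

lemma coact_L: "x \<in> carrier B \<Longrightarrow> coact x \<in> carrier (laurent n B)"
proof -
  assume x: "x \<in> carrier B"
  interpret L0: laurent_alg B n by unfold_locales
  show ?thesis unfolding L0.L_carrier using x by (auto simp: coact_val lsupp_coact)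
qed

sublocale coaction B G cmpt n coact
proof
  interpret L0: laurent_alg B n by unfold_locales
  show "coact \<in> ring_hom B (laurent n B)"
  proof (rule ring_hom_memI)
    fix x y assume x: "x \<in> carrier B" and y: "y \<in> carrier B"
    show "coact x \<in> carrier L0.L" by (rule coact_L[OF x])
    show "coact (x \<otimes> y) = coact x \<otimes>\<^bsub>L0.L\<^esub> coact y"
    proof
      fix u
      let ?A = "wt n ` keys (\<Psi> x)"
      have eq: "(coact x \<otimes>\<^bsub>L0.L\<^esub> coact y) u = (\<Oplus>a\<in>?A. coact x a \<otimes> coact y (u - a))"
        by (rule L0.L_mult[OF coact_L[OF x] coact_L[OF y]]) (auto simp: lsupp_coact[OF x])
      have "\<Psi> (\<Oplus>a\<in>?A. coact x a \<otimes> coact y (u - a))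
          = (\<Sum>a\<in>?A. restr {v. wt n v = a} (\<Psi> x) * restr {v. wt n v = u - a} (\<Psi> y))"
        using coact_val[OF x] coact_val[OF y]
        by (subst \<Psi>_finsum) (auto simp: \<Psi>_mult \<Psi>_coact[OF x] \<Psi>_coact[OF y])
      also have "\<dots> = restr {v. wt n v = u} (\<Psi> x * \<Psi> y)"
        by (rule restr_mult_weight[OF additive_wt, symmetric]) auto
      also have "\<dots> = \<Psi> (coact (x \<otimes> y) u)"
        using x y by (simp add: \<Psi>_coact \<Psi>_mult)
      finally have "\<Psi> (coact (x \<otimes> y) u) = \<Psi> (\<Oplus>a\<in>?A. coact x a \<otimes> coact y (u - a))" ..
      thus "coact (x \<otimes> y) u = (coact x \<otimes>\<^bsub>L0.L\<^esub> coact y) u"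
        unfolding eq using x y coact_val[OF x] coact_val[OF y]
        by (intro \<Psi>_eqI) (auto intro!: coact_val finsum_closed)
    qed
    show "coact (x \<oplus> y) = coact x \<oplus>\<^bsub>L0.L\<^esub> coact y"
    proof
      fix u show "coact (x \<oplus> y) u = (coact x \<oplus>\<^bsub>L0.L\<^esub> coact y) u"
        unfolding L0.L_add using x y
        by (intro \<Psi>_eqI) (simp_all add: coact_val \<Psi>_coact \<Psi>_add restr_add)
    qed
  next
    show "coact \<one> = \<one>\<^bsub>L0.L\<^esub>"
    proof
      fix u
      have "restr {v. wt n v = u} (1 :: 'k lpoly) = (if u = 0 then 1 else 0)"
        by (auto intro: restr_id restr_none)
      thus "coact \<one> u = \<one>\<^bsub>L0.L\<^esub> u"
        using el_\<Psi>[of \<one>] by (auto simp: coact_def \<Psi>_one L0.L_one lsing_def el_zero)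
    qed
  qed
  show "coact (cst B c) = lconst B (cst B c)" for c
  proof
    fix u
    have "restr {v. wt n v = u} (single 0 c :: 'k lpoly) = (if u = 0 then single 0 c else 0)"
      by (auto intro: restr_id restr_none split: if_splits)
    thus "coact (cst B c) u = lconst B (cst B c) u"
      using el_\<Psi>[of "cst B c"] by (auto simp: coact_def \<Psi>_cst lconst_eq_lsing lsing_def el_zero)
  qed
  show "coact x u \<in> G d" if "x \<in> G d" for x d u
    using that by (auto simp: G_iff coact_val \<Psi>_coact keys_restr)
  show "coact (coact x u) = lsing B u (coact x u)" if x: "x \<in> carrier B" for x u
  proof
    fix u'
    have "{v. wt n v = u'} \<inter> {v. wt n v = u} = (if u' = u then {v. wt n v = u} else {})" by auto
    thus "coact (coact x u) u' = lsing B u (coact x u) u'"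
      using x by (intro \<Psi>_eqI) (auto simp: coact_val \<Psi>_coact lsing_def restr_restr \<Psi>_zero restr_none)
  qed
  show "(\<Oplus>u\<in>lsupp B (coact x). coact x u) = x" if x: "x \<in> carrier B" for x
  proof (rule \<Psi>_eqI[OF _ x])
    show "(\<Oplus>u\<in>lsupp B (coact x). coact x u) \<in> carrier B"
      using coact_val[OF x] by (auto intro: finsum_closed)
    show "\<Psi> (\<Oplus>u\<in>lsupp B (coact x). coact x u) = \<Psi> x"
      unfolding lsupp_coact[OF x]
      by (subst \<Psi>_finsum) (auto simp: \<Psi>_coact[OF x] coact_val[OF x] intro: sum_restr_fibres)
  qed
qed

text \<open>Setting the grading variable to 1 gives the coordinate ring of the torus.\<close>

abbreviation "A \<equiv> (torus_alg n :: (_, 'k) kalg)"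

sublocale A: laurent_alg "base_alg :: ('k, 'k) kalg" n
  rewrites "laurent n (base_alg :: ('k, 'k) kalg) = A"
proof -
  show "laurent_alg (base_alg :: ('k, 'k) kalg)"
    using cring_base_alg by (simp add: laurent_alg_def)
  show "laurent n base_alg = A" by (simp add: torus_alg_def)
qed

sublocale KA: kalgebra A by (rule kalgebra_torus)

definition dehom :: "'a \<Rightarrow> (nat \<Rightarrow> int) \<Rightarrow> 'k" where
  "dehom x = lmap (\<lambda>y. ev (\<Psi> y)) (coact x)"

abbreviation tmon :: "(nat \<Rightarrow> int) \<Rightarrow> (nat \<Rightarrow> int) \<Rightarrow> 'k" where
  "tmon u \<equiv> lsing (base_alg :: ('k, 'k) kalg) u 1"

lemma ev_hom: "(\<lambda>y. ev (\<Psi> y)) \<in> ring_hom B base_alg"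
  by (rule ring_hom_memI) (auto simp: \<Psi>_one \<Psi>_mult \<Psi>_add ev_mult ev_add simp flip: single_one)

lemma dehom_hom: "dehom \<in> ring_hom B A"
proof -
  have "lmap (\<lambda>y. ev (\<Psi> y)) \<in> ring_hom L.L A"
    unfolding torus_alg_def by (rule lmap_ring_hom[OF is_cring cring_base_alg ev_hom])
  from ring_hom_trans[OF coact_hom this] show ?thesis
    by (simp add: dehom_def[abs_def] comp_def)
qed

sublocale D: ring_hom_ring B A dehom
  by unfold_locales (rule dehom_hom)

lemma dehom_apply: "x \<in> carrier B \<Longrightarrow> dehom x u = ev (restr {v. wt n v = u} (\<Psi> x))"
  by (simp add: dehom_def lmap_def \<Psi>_coact)

lemma dehom_cst: "dehom (cst B c) = cst A c"
proof
  fix u show "dehom (cst B c) u = cst A c u"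
    by (simp add: dehom_def lmap_def coact_cst lconst_eq_lsing lsing_def \<Psi>_cst \<Psi>_zero A.L_cst)
qed

lemma dehom_coeff:
  assumes "x \<in> G d" "keys v \<subseteq> {..n}" "lookup v n = int d"
  shows "dehom x (wt n v) = lookup (\<Psi> x) v"
proof -
  have x: "x \<in> carrier B" using assms(1) G_carr by blast
  have "keys (restr {v'. wt n v' = wt n v} (\<Psi> x)) \<subseteq> {v}"
    using assms \<Psi>_keys[OF x] M_keys by (auto simp: keys_restr G_iff intro!: exponent_eqI)
  thus ?thesis
    by (simp add: dehom_apply[OF x] ev_subset_single lookup_restr)
qed

lemma dehom_inj:
  assumes "x \<in> G d" "y \<in> G d" "dehom x = dehom y"
  shows "x = y"
proof (rule \<Psi>_eqI)
  show x: "x \<in> carrier B" and y: "y \<in> carrier B" using assms G_carr by auto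
  show "\<Psi> x = \<Psi> y"
  proof (rule poly_mapping_eqI)
    fix v show "lookup (\<Psi> x) v = lookup (\<Psi> y) v"
    proof (cases "v \<in> keys (\<Psi> x) \<union> keys (\<Psi> y)")
      case True
      hence "keys v \<subseteq> {..n}" "lookup v n = int d"
        using assms(1,2) \<Psi>_keys[OF x] \<Psi>_keys[OF y] M_keys by (auto simp: G_iff)
      thus ?thesis using dehom_coeff assms by metis
    qed (simp add: in_keys_iff)
  qed
qed

definition mon :: "(nat \<Rightarrow>\<^sub>0 int) \<Rightarrow> 'a" where "mon v = el (lmonom v)"

lemma mon_carr: "v \<in> M \<Longrightarrow> mon v \<in> carrier B" and \<Psi>_mon: "v \<in> M \<Longrightarrow> \<Psi> (mon v) = lmonom v"
  unfolding mon_def by (simp_all add: el_carr \<Psi>_el)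

lemma mon_G: "v \<in> M \<Longrightarrow> mon v \<in> G (nat (lookup v n))"
  using M_deg[of v] by (simp add: G_iff mon_carr \<Psi>_mon)

lemma mon_add: "u \<in> M \<Longrightarrow> v \<in> M \<Longrightarrow> mon (u + v) = mon u \<otimes> mon v"
  by (rule \<Psi>_eqI) (simp_all add: mon_carr \<Psi>_mon M_add \<Psi>_mult lmonom_def mult_single)

lemma mon_zero: "mon 0 = \<one>"
  by (rule \<Psi>_eqI) (simp_all add: mon_carr \<Psi>_mon M_zero \<Psi>_one lmonom_def)

lemma dehom_el_single:
  assumes "v \<in> M"
  shows "dehom (el (single v c)) = lsing base_alg (wt n v) c"
proof
  fix u
  have k: "keys (single v c) \<subseteq> M" using assms by simp
  show "dehom (el (single v c)) u = lsing base_alg (wt n v) c u"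
  proof (cases "wt n v = u")
    case True
    hence "restr {v. wt n v = u} (single v c) = single v c"
      by (intro restr_id) auto
    thus ?thesis using True by (simp add: dehom_apply el_carr[OF k] \<Psi>_el[OF k] lsing_def)
  next
    case False
    hence "restr {v. wt n v = u} (single v c) = 0"
      by (intro restr_none) auto
    thus ?thesis using False by (simp add: dehom_apply el_carr[OF k] \<Psi>_el[OF k] lsing_def)
  qed
qed

lemma dehom_mon: "v \<in> M \<Longrightarrow> dehom (mon v) = tmon (wt n v)"
  unfolding mon_def lmonom_def by (rule dehom_el_single)

lemma tmon_carr [simp]: "u \<in> int_lattice n \<Longrightarrow> tmon u \<in> carrier A"
  by (rule A.lsing_carrier) simp_all

lemma tmon_mult: "u \<in> int_lattice n \<Longrightarrow> v \<in> int_lattice n \<Longrightarrow> tmon u \<otimes>\<^bsub>A\<^esub> tmon v = tmon (u + v)"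
  by (simp add: A.lsing_mult)

lemma tmon_zero: "tmon 0 = \<one>\<^bsub>A\<^esub>"
  by (simp add: A.L_one)

lemma tmon_inv: "u \<in> int_lattice n \<Longrightarrow> tmon (- u) \<otimes>\<^bsub>A\<^esub> tmon u = \<one>\<^bsub>A\<^esub>"
  by (simp add: tmon_mult tmon_zero)

lemma tmon_in_ideal:
  assumes q: "ideal q A" and u: "u \<in> int_lattice n" and F: "F \<in> carrier A"
  shows "tmon u \<otimes>\<^bsub>A\<^esub> F \<in> q \<longleftrightarrow> F \<in> q"
proof
  interpret q: ideal q A by fact
  assume "tmon u \<otimes>\<^bsub>A\<^esub> F \<in> q"
  hence "tmon (- u) \<otimes>\<^bsub>A\<^esub> (tmon u \<otimes>\<^bsub>A\<^esub> F) \<in> q" by (rule q.I_l_closed) (simp add: u)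
  moreover have "tmon (- u) \<otimes>\<^bsub>A\<^esub> (tmon u \<otimes>\<^bsub>A\<^esub> F) = (tmon (- u) \<otimes>\<^bsub>A\<^esub> tmon u) \<otimes>\<^bsub>A\<^esub> F"
    using u F by (intro A.L.m_assoc[symmetric]) simp_all
  ultimately show "F \<in> q"
    using F by (simp only: tmon_inv[OF u] A.L.l_one)
next
  interpret q: ideal q A by fact
  assume "F \<in> q" thus "tmon u \<otimes>\<^bsub>A\<^esub> F \<in> q" using u by (intro q.I_l_closed) auto
qed

text \<open>Every exponent vector moves into the cone when a large multiple of \<open>h\<close> is added.\<close>

definition nh :: "nat \<Rightarrow> (nat \<Rightarrow>\<^sub>0 int)" where "nh N = (\<Sum>i<N. h)"

lemma nh_simps: "nh 0 = 0" "nh (Suc N) = nh N + h"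
  by (simp_all add: nh_def del: sum_constant)

lemma nh_M: "nh N \<in> M"
  by (induction N) (simp_all add: nh_simps M_zero M_add h_M)

lemma lookup_nh: "lookup (nh N) i = int N * lookup h i"
  by (induction N) (simp_all add: nh_simps lookup_add algebra_simps)

lemma ell_nh: "j \<in> J \<Longrightarrow> ell j (nh N) = of_nat N * ell j h"
  using ell_additive[of j] by (induction N) (simp_all add: nh_simps additive_zero additive_def algebra_simps)

lemma eventually_nonneg:
  fixes c d :: "'x::archimedean_field"
  assumes "0 < c"
  shows "\<forall>\<^sub>F N in sequentially. 0 \<le> of_nat N * c + d"
proof -
  obtain N0 where N0: "- d < of_nat N0 * c" using ex_less_of_nat_mult[OF assms] by blast
  have "0 \<le> of_nat N * c + d" if "N \<ge> N0" for N
  proof -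
    have "of_nat N0 * c \<le> of_nat N * c" using that assms by (intro mult_right_mono) auto
    thus ?thesis using N0 by linarith
  qed
  thus ?thesis unfolding eventually_sequentially by blast
qed

lemma eventually_M:
  assumes "keys v \<subseteq> {..n}"
  shows "\<forall>\<^sub>F N in sequentially. nh N + v \<in> M"
proof -
  have "\<forall>\<^sub>F N in sequentially. 0 \<le> of_nat N * (of_int (lookup h n) :: rat) + of_int (lookup v n)"
    using h_pos(1) by (intro eventually_nonneg) simp
  moreover have "\<forall>\<^sub>F N in sequentially. \<forall>j\<in>J. 0 \<le> of_nat N * ell j h + ell j v"
    using J_fin h_pos(2) by (intro eventually_ball_finite ballI eventually_nonneg) auto
  ultimately show ?thesis
  proof eventually_elim
    case (elim N)
    have "0 \<le> (of_int (int N * lookup h n + lookup v n) :: rat)" using elim(1) by simp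
    hence "0 \<le> int N * lookup h n + lookup v n" by (simp only: of_int_0_le_iff)
    moreover have "keys (nh N + v) \<subseteq> {..n}"
      using keys_add[of "nh N" v] M_keys[OF nh_M] assms by blast
    moreover have "0 \<le> ell j (nh N + v)" if "j \<in> J" for j
      using elim(2) ell_additive[OF that] that by (simp add: additive_def ell_nh)
    ultimately show ?case by (simp add: cone_def lookup_add lookup_nh)
  qed
qed

definition dh :: "nat \<Rightarrow> nat" where "dh N = nat (lookup (nh N) n)"

lemma int_dh: "int (dh N) = lookup (nh N) n"
  using M_deg[OF nh_M] by (simp add: dh_def)

lemma eventually_lift:
  assumes "F \<in> carrier A"
  shows "\<forall>\<^sub>F N in sequentially. \<exists>x\<in>G (dh N). dehom x = tmon (wt n (nh N)) \<otimes>\<^bsub>A\<^esub> F"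
  using assms
proof (induction rule: A.laurent_induct_add)
  case zero
  have "dehom \<zero> = tmon (wt n (nh N)) \<otimes>\<^bsub>A\<^esub> \<zero>\<^bsub>A\<^esub>" for N by simp
  thus ?case by (intro always_eventually allI bexI[of _ \<zero>]) auto
next
  case (sing m c)
  have "\<forall>\<^sub>F N in sequentially. nh N + vec n m 0 \<in> M"
    by (rule eventually_M[OF keys_vec])
  thus ?case
  proof eventually_elim
    case (elim N)
    let ?x = "el (single (nh N + vec n m 0) c)"
    have k: "keys (single (nh N + vec n m 0) c) \<subseteq> M" using elim by simp
    have "?x \<in> G (dh N)"
      by (auto simp: G_iff el_carr[OF k] \<Psi>_el[OF k] lookup_add lookup_vec int_dh)
    moreover have "dehom ?x = tmon (wt n (nh N)) \<otimes>\<^bsub>A\<^esub> lsing base_alg m c"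
      using sing by (simp add: dehom_el_single[OF elim] wt_add wt_vec A.lsing_mult)
    ultimately show ?case by blast
  qed
next
  case (add F F')
  from add.IH(1) add.IH(2) show ?case
  proof eventually_elim
    case (elim N)
    then obtain x y where xy: "x \<in> G (dh N)" "dehom x = tmon (wt n (nh N)) \<otimes>\<^bsub>A\<^esub> F"
      "y \<in> G (dh N)" "dehom y = tmon (wt n (nh N)) \<otimes>\<^bsub>A\<^esub> F'" by blast
    hence "dehom (x \<oplus> y) = tmon (wt n (nh N)) \<otimes>\<^bsub>A\<^esub> (F \<oplus>\<^bsub>A\<^esub> F')"
      using add.hyps G_carr by (simp add: A.L.r_distr)
    thus ?case using G_add[OF xy(1,3)] by blast
  qed
qed

lemma lift_pair:
  assumes "F \<in> carrier A" "F' \<in> carrier A"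
  obtains N x y where "x \<in> G (dh N)" "dehom x = tmon (wt n (nh N)) \<otimes>\<^bsub>A\<^esub> F"
    "y \<in> G (dh N)" "dehom y = tmon (wt n (nh N)) \<otimes>\<^bsub>A\<^esub> F'"
proof -
  have "\<forall>\<^sub>F N in sequentially. (\<exists>x\<in>G (dh N). dehom x = tmon (wt n (nh N)) \<otimes>\<^bsub>A\<^esub> F)
      \<and> (\<exists>y\<in>G (dh N). dehom y = tmon (wt n (nh N)) \<otimes>\<^bsub>A\<^esub> F')"
    using eventually_lift[OF assms(1)] eventually_lift[OF assms(2)] by (rule eventually_conj)
  then obtain N where "(\<exists>x\<in>G (dh N). dehom x = tmon (wt n (nh N)) \<otimes>\<^bsub>A\<^esub> F)
      \<and> (\<exists>y\<in>G (dh N). dehom y = tmon (wt n (nh N)) \<otimes>\<^bsub>A\<^esub> F')"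
    unfolding eventually_sequentially by blast
  thus thesis using that by blast
qed

text \<open>Homogeneous elements of different degrees with the same dehomogenization differ by monomials.\<close>

lemma dehom_eq_imp:
  assumes x: "x \<in> G d" and y: "y \<in> G e" and eq: "dehom x = dehom y"
  obtains a b where "a \<in> M" "b \<in> M" "mon a \<otimes> x = mon b \<otimes> y"
proof -
  have "\<forall>\<^sub>F N in sequentially. nh N + vec n 0 (int e) \<in> M \<and> nh N + vec n 0 (int d) \<in> M"
    by (intro eventually_conj eventually_M keys_vec)
  then obtain N where N: "nh N + vec n 0 (int e) \<in> M" "nh N + vec n 0 (int d) \<in> M"
    unfolding eventually_sequentially by blast
  let ?a = "nh N + vec n 0 (int e)" and ?b = "nh N + vec n 0 (int d)"
  have "mon ?a \<otimes> x \<in> G (nat (lookup ?a n) + d)" "mon ?b \<otimes> y \<in> G (nat (lookup ?b n) + e)"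
    using N x y by (auto intro!: G_mult mon_G)
  moreover have "nat (lookup ?a n) + d = nat (lookup ?b n) + e"
    using M_deg[OF nh_M[of N]] by (simp add: lookup_add lookup_vec nat_add_distrib)
  moreover have "dehom (mon ?a \<otimes> x) = dehom (mon ?b \<otimes> y)"
    using N x y eq G_carr by (simp add: mon_carr dehom_mon wt_add wt_vec)
  ultimately have "mon ?a \<otimes> x = mon ?b \<otimes> y" using dehom_inj by metis
  thus thesis using that N by blast
qed

text \<open>The torus is the open set where the monomial of an interior point does not vanish.\<close>

definition U where "U = {p \<in> Proj_pts B G. mon h \<notin> p}"

lemma mon_notin:
  assumes p: "p \<in> U" and v: "v \<in> M"
  shows "mon v \<notin> p"
proof
  interpret p: primeideal p B using p Proj_pts_iff by (auto simp: U_def)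
  have nh: "mon (nh N) \<notin> p" for N
  proof (induction N)
    case 0 thus ?case
      using p.I_notcarr p.one_imp_carrier by (auto simp: nh_simps mon_zero)
  next
    case (Suc N) thus ?case
      using p.I_prime[of "mon (nh N)" "mon h"] p nh_M h_M
      by (auto simp: nh_simps mon_add mon_carr U_def)
  qed
  assume vp: "mon v \<in> p"
  have "keys (- v) \<subseteq> {..n}" using M_keys[OF v] by (auto simp: in_keys_iff)
  hence "\<forall>\<^sub>F N in sequentially. nh N + (- v) \<in> M" by (rule eventually_M)
  then obtain N where N: "nh N + (- v) \<in> M" unfolding eventually_sequentially by blast
  have "mon (nh N + (- v)) \<otimes> mon v = mon (nh N)"
    using mon_add[OF N v] by simp
  moreover have "mon (nh N + (- v)) \<otimes> mon v \<in> p" using vp N by (intro p.I_l_closed mon_carr)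
  ultimately show False using nh by simp
qed

definition jmor where
  "jmor = hinduced (ghull dehom) dehom A (trivial_grading A)"

lemma tmon_notin:
  assumes "primeideal q A" "u \<in> int_lattice n"
  shows "tmon u \<notin> q"
proof
  interpret q: primeideal q A by fact
  assume "tmon u \<in> q"
  hence "\<one>\<^bsub>A\<^esub> \<in> q" using q.I_l_closed[of "tmon u" "tmon (- u)"] tmon_inv[OF assms(2)] assms(2) by simp
  thus False using q.I_notcarr q.one_imp_carrier by blast
qed

lemma gmor_jmor:
  "gmor A (trivial_grading A) (Spec_pts A) B G (Proj_pts B G) dehom jmor"
  unfolding jmor_def
proof (rule gmor_Spec_Proj[OF kalgebra_torus graded_axioms dehom_hom dehom_cst])
  fix q assume "q \<in> Spec_pts A"
  hence "dehom (mon h) \<notin> q"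
    using tmon_notin dehom_mon[OF h_M] by (auto simp: Spec_pts_def)
  thus "\<exists>d>0. \<exists>x\<in>G d. dehom x \<notin> q"
    using mon_G[OF h_M] h_pos(1) by (intro exI[of _ "nat (lookup h n)"]) auto
qed

sublocale Jm: gmor_data A "trivial_grading A" "Spec_pts A" B G "Proj_pts B G" dehom jmor
  by (intro gmor_data.intro gmor_data_axioms.intro KA.hspace_data_Spec hspace_data_Proj gmor_jmor)

lemma jmor_mem:
  assumes q: "q \<in> Spec_pts A" and x: "x \<in> G d" and F: "F \<in> carrier A" and u: "u \<in> int_lattice n"
    and eq: "dehom x = tmon u \<otimes>\<^bsub>A\<^esub> F"
  shows "x \<in> fst jmor q \<longleftrightarrow> F \<in> q"
proof -
  have "ideal q A" using q by (simp add: Spec_pts_def primeideal_def)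
  from tmon_in_ideal[OF this u F] Jm.mem[OF q x] eq show ?thesis by simp
qed

lemma jmor_U:
  assumes q: "q \<in> Spec_pts A"
  shows "fst jmor q \<in> U"
proof -
  have "dehom (mon h) \<notin> q"
    using q tmon_notin dehom_mon[OF h_M] by (auto simp: Spec_pts_def)
  thus ?thesis
    using Jm.pt[OF q] Jm.mem[OF q mon_G[OF h_M]] by (simp add: U_def)
qed

lemma jmor_inj:
  assumes q: "q \<in> Spec_pts A" "q' \<in> Spec_pts A" and eq: "fst jmor q = fst jmor q'"
  shows "q = q'"
proof -
  have "F \<in> q \<longleftrightarrow> F \<in> q'" if F: "F \<in> carrier A" for F
  proof -
    obtain N x where x: "x \<in> G (dh N)" "dehom x = tmon (wt n (nh N)) \<otimes>\<^bsub>A\<^esub> F"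
      by (rule lift_pair[OF F F])
    show ?thesis
      using jmor_mem[OF q(1) x(1) F wt_lattice x(2)] jmor_mem[OF q(2) x(1) F wt_lattice x(2)] eq by simp
  qed
  moreover have "q \<subseteq> carrier A" "q' \<subseteq> carrier A"
    using q by (auto simp: Spec_pts_def primeideal_def ideal_def additive_subgroup_def dest: subgroup.mem_carrier)
  ultimately show ?thesis by blast
qed

text \<open>
  The inverse of \<open>jmor\<close> on points: a prime of the Laurent polynomials is recovered from the
  homogeneous elements whose dehomogenization it contains, up to a monomial factor.
\<close>

definition dept :: "'a set \<Rightarrow> ((nat \<Rightarrow> int) \<Rightarrow> 'k) set" where
  "dept p = {F \<in> carrier A. \<exists>x\<in>p. \<exists>d v. x \<in> G d \<and> v \<in> M \<and> dehom x = tmon (wt n v) \<otimes>\<^bsub>A\<^esub> F}"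

lemma dept_iff:
  assumes p: "p \<in> U" and y: "y \<in> G e" and w: "w \<in> M" and F: "F \<in> carrier A"
    and eq: "dehom y = tmon (wt n w) \<otimes>\<^bsub>A\<^esub> F"
  shows "F \<in> dept p \<longleftrightarrow> y \<in> p"
proof
  interpret p: primeideal p B using p Proj_pts_iff by (auto simp: U_def)
  have yc: "y \<in> carrier B" using y G_carr by blast
  assume "F \<in> dept p"
  then obtain x d v where x: "x \<in> p" "x \<in> G d" "v \<in> M" "dehom x = tmon (wt n v) \<otimes>\<^bsub>A\<^esub> F"
    by (auto simp: dept_def)
  hence xc: "x \<in> carrier B" using G_carr by blast
  have "dehom (mon w \<otimes> x) = tmon (wt n w) \<otimes>\<^bsub>A\<^esub> (tmon (wt n v) \<otimes>\<^bsub>A\<^esub> F)"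
    using w xc x(4) by (simp add: mon_carr dehom_mon)
  also have "\<dots> = tmon (wt n v) \<otimes>\<^bsub>A\<^esub> (tmon (wt n w) \<otimes>\<^bsub>A\<^esub> F)"
    using F by (simp add: A.L.m_lcomm)
  also have "\<dots> = dehom (mon v \<otimes> y)"
    using x(3) yc eq by (simp add: mon_carr dehom_mon)
  finally obtain a b where ab: "a \<in> M" "b \<in> M" "mon a \<otimes> (mon w \<otimes> x) = mon b \<otimes> (mon v \<otimes> y)"
    by (rule dehom_eq_imp[OF G_mult[OF mon_G[OF w] x(2)] G_mult[OF mon_G[OF x(3)] y]])
  have "mon a \<otimes> (mon w \<otimes> x) \<in> p"
    using ab w x(1) by (intro p.I_l_closed mon_carr)
  hence "mon b \<otimes> (mon v \<otimes> y) \<in> p" using ab(3) by simp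
  hence "mon v \<otimes> y \<in> p"
    using p.I_prime[OF mon_carr[OF ab(2)], of "mon v \<otimes> y"] mon_notin[OF p ab(2)] mon_carr[OF x(3)] yc by auto
  thus "y \<in> p"
    using p.I_prime[OF mon_carr[OF x(3)] yc] mon_notin[OF p x(3)] by blast
next
  assume "y \<in> p" thus "F \<in> dept p" using y w F eq by (auto simp: dept_def)
qed

lemma dept_prime:
  assumes p: "p \<in> U"
  shows "primeideal (dept p) A"
proof -
  interpret p: primeideal p B using p Proj_pts_iff by (auto simp: U_def)
  note I = dept_iff[OF p _ nh_M]
  have mult: "F' \<otimes>\<^bsub>A\<^esub> F \<in> dept p" if F: "F \<in> dept p" "F' \<in> carrier A" for F F'
  proof -
    have Fc: "F \<in> carrier A" using F by (simp add: dept_def)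
    obtain N x y where xy: "x \<in> G (dh N)" "dehom x = tmon (wt n (nh N)) \<otimes>\<^bsub>A\<^esub> F"
      "y \<in> G (dh N)" "dehom y = tmon (wt n (nh N)) \<otimes>\<^bsub>A\<^esub> F'"
      by (rule lift_pair[OF Fc F(2)])
    have c: "x \<in> carrier B" "y \<in> carrier B" using xy G_carr by auto
    obtain K where K: "wt n K = wt n (nh N) + wt n (nh N)" "K \<in> M"
      using wt_add M_add[OF nh_M nh_M] by blast
    have "x \<in> p" using I[OF xy(1) Fc xy(2)] F(1) by simp
    hence "y \<otimes> x \<in> p" using c by (intro p.I_l_closed)
    moreover have "dehom (y \<otimes> x) = tmon (wt n K) \<otimes>\<^bsub>A\<^esub> (F' \<otimes>\<^bsub>A\<^esub> F)"
      unfolding K(1) tmon_mult[OF wt_lattice wt_lattice, symmetric]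
      using xy c Fc F(2) by (simp add: A.L.m_ac)
    ultimately show ?thesis
      using dept_iff[OF p G_mult[OF xy(3,1)] K(2)] Fc F(2) by simp
  qed
  have one: "\<one>\<^bsub>A\<^esub> \<notin> dept p"
    using dept_iff[OF p G_one M_zero A.L.one_closed] p.I_notcarr p.one_imp_carrier
    by (auto simp: tmon_zero)
  show ?thesis
  proof (rule primeidealI)
    show "ideal (dept p) A"
    proof (rule idealI)
      show "ring A" by unfold_locales
      show "subgroup (dept p) (add_monoid A)"
      proof (rule A.L.add.subgroupI)
        show "dept p \<subseteq> carrier A" by (auto simp: dept_def)
        have "\<zero>\<^bsub>A\<^esub> \<in> dept p"
          using dept_iff[OF p G_zero M_zero A.L.zero_closed] p.zero_closed by simp
        thus "dept p \<noteq> {}" by blast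
      next
        fix F assume F: "F \<in> dept p"
        hence Fc: "F \<in> carrier A" by (simp add: dept_def)
        have "\<ominus>\<^bsub>A\<^esub> F = (\<ominus>\<^bsub>A\<^esub> \<one>\<^bsub>A\<^esub>) \<otimes>\<^bsub>A\<^esub> F" using Fc by (simp add: A.L.l_minus)
        thus "\<ominus>\<^bsub>A\<^esub> F \<in> dept p" using mult[OF F, of "\<ominus>\<^bsub>A\<^esub> \<one>\<^bsub>A\<^esub>"] by simp
        fix F' assume F': "F' \<in> dept p"
        hence F'c: "F' \<in> carrier A" by (simp add: dept_def)
        obtain N x y where xy: "x \<in> G (dh N)" "dehom x = tmon (wt n (nh N)) \<otimes>\<^bsub>A\<^esub> F"
          "y \<in> G (dh N)" "dehom y = tmon (wt n (nh N)) \<otimes>\<^bsub>A\<^esub> F'"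
          by (rule lift_pair[OF Fc F'c])
        have "x \<in> p" "y \<in> p" using I[OF xy(1) Fc xy(2)] I[OF xy(3) F'c xy(4)] F F' by auto
        hence "x \<oplus> y \<in> p" by (rule p.a_closed)
        moreover have "dehom (x \<oplus> y) = tmon (wt n (nh N)) \<otimes>\<^bsub>A\<^esub> (F \<oplus>\<^bsub>A\<^esub> F')"
          using xy Fc F'c G_carr by (simp add: A.L.r_distr)
        ultimately show "F \<oplus>\<^bsub>A\<^esub> F' \<in> dept p"
          using I[OF G_add[OF xy(1,3)]] Fc F'c by simp
      qed
    next
      fix F F' assume F: "F \<in> dept p" "F' \<in> carrier A"
      hence Fc: "F \<in> carrier A" by (simp add: dept_def)
      show "F' \<otimes>\<^bsub>A\<^esub> F \<in> dept p" by (rule mult[OF F])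
      thus "F \<otimes>\<^bsub>A\<^esub> F' \<in> dept p" using A.L.m_comm[OF Fc F(2)] by simp
    qed
    show "cring A" by unfold_locales
    show "carrier A \<noteq> dept p" using one by auto
    fix F F' assume Fc: "F \<in> carrier A" and F'c: "F' \<in> carrier A" and FF': "F \<otimes>\<^bsub>A\<^esub> F' \<in> dept p"
    obtain N x y where xy: "x \<in> G (dh N)" "dehom x = tmon (wt n (nh N)) \<otimes>\<^bsub>A\<^esub> F"
      "y \<in> G (dh N)" "dehom y = tmon (wt n (nh N)) \<otimes>\<^bsub>A\<^esub> F'"
      by (rule lift_pair[OF Fc F'c])
    have c: "x \<in> carrier B" "y \<in> carrier B" using xy G_carr by auto
    obtain K where K: "wt n K = wt n (nh N) + wt n (nh N)" "K \<in> M"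
      using wt_add M_add[OF nh_M nh_M] by blast
    have "dehom (x \<otimes> y) = tmon (wt n K) \<otimes>\<^bsub>A\<^esub> (F \<otimes>\<^bsub>A\<^esub> F')"
      unfolding K(1) tmon_mult[OF wt_lattice wt_lattice, symmetric]
      using xy c Fc F'c by (simp add: A.L.m_ac)
    hence "x \<otimes> y \<in> p"
      using dept_iff[OF p G_mult[OF xy(1,3)] K(2)] FF' Fc F'c by simp
    hence "x \<in> p \<or> y \<in> p" using c p.I_prime by blast
    thus "F \<in> dept p \<or> F' \<in> dept p"
      using I[OF xy(1) Fc xy(2)] I[OF xy(3) F'c xy(4)] by auto
  qed
qed

lemma jmor_dept:
  assumes p: "p \<in> U"
  shows "dept p \<in> Spec_pts A" "fst jmor (dept p) = p"
proof -
  show q: "dept p \<in> Spec_pts A" using dept_prime[OF p] by (simp add: Spec_pts_def)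
  show "fst jmor (dept p) = p"
  proof (rule Jm.Y.Q_ext)
    show "fst jmor (dept p) \<in> Proj_pts B G" by (rule Jm.pt[OF q])
    show "p \<in> Proj_pts B G" using p by (simp add: U_def)
    fix x assume "x \<in> hom"
    then obtain d where x: "x \<in> G d" by blast
    hence "dehom x \<in> dept p \<longleftrightarrow> x \<in> p"
      using G_carr by (intro dept_iff[OF p x M_zero]) (auto simp: tmon_zero)
    thus "x \<in> fst jmor (dept p) \<longleftrightarrow> x \<in> p"
      using Jm.mem[OF q x] by simp
  qed
qed

lemma jmor_bij: "bij_betw (fst jmor) (Spec_pts A) U"
  unfolding bij_betw_def
proof
  show "inj_on (fst jmor) (Spec_pts A)" using jmor_inj by (rule inj_onI)
  show "fst jmor ` Spec_pts A = U"
  proof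
    show "fst jmor ` Spec_pts A \<subseteq> U" using jmor_U by blast
    show "U \<subseteq> fst jmor ` Spec_pts A"
    proof
      fix p assume "p \<in> U"
      from jmor_dept[OF this] show "p \<in> fst jmor ` Spec_pts A" by (metis imageI)
    qed
  qed
qed

lemma U_open: "openin (zariski B (Proj_pts B G)) U"
  unfolding Jm.Y.openin_zariski U_def using mon_carr[OF h_M] by (intro exI[of _ "{mon h}"]) auto

lemma jmor_open_map:
  assumes W: "openin (zariski A (Spec_pts A)) W"
  shows "openin (zariski B (Proj_pts B G)) (fst jmor ` W)"
proof -
  obtain E where E: "E \<subseteq> carrier A" "W = {q \<in> Spec_pts A. \<not> E \<subseteq> q}"
    using W[unfolded Jm.X.openin_zariski] by blast
  have "\<exists>x N. x \<in> G (dh N) \<and> dehom x = tmon (wt n (nh N)) \<otimes>\<^bsub>A\<^esub> F" if "F \<in> E" for F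
  proof -
    have "F \<in> carrier A" using that E by blast
    thus ?thesis using lift_pair by metis
  qed
  then obtain X N where X: "\<And>F. F \<in> E \<Longrightarrow> X F \<in> G (dh (N F))"
    "\<And>F. F \<in> E \<Longrightarrow> dehom (X F) = tmon (wt n (nh (N F))) \<otimes>\<^bsub>A\<^esub> F"
    by metis
  have XE: "F \<in> q \<longleftrightarrow> X F \<in> fst jmor q" if "F \<in> E" "q \<in> Spec_pts A" for F q
    using jmor_mem[OF that(2) X(1)[OF that(1)] _ _ X(2)[OF that(1)]] E(1) that(1) by auto
  have "fst jmor ` W = U \<inter> {p \<in> Proj_pts B G. \<not> X ` E \<subseteq> p}"
  proof
    show "fst jmor ` W \<subseteq> U \<inter> {p \<in> Proj_pts B G. \<not> X ` E \<subseteq> p}"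
    proof
      fix p assume "p \<in> fst jmor ` W"
      then obtain q where q: "q \<in> W" "p = fst jmor q" by blast
      hence qS: "q \<in> Spec_pts A" and "\<not> E \<subseteq> q" using E(2) by auto
      then obtain F where F: "F \<in> E" "F \<notin> q" by blast
      hence "X F \<notin> p" using XE[OF F(1) qS] q by simp
      thus "p \<in> U \<inter> {p \<in> Proj_pts B G. \<not> X ` E \<subseteq> p}"
        using F(1) q jmor_U[OF qS] Jm.pt[OF qS] by auto
    qed
    show "U \<inter> {p \<in> Proj_pts B G. \<not> X ` E \<subseteq> p} \<subseteq> fst jmor ` W"
    proof
      fix p assume p: "p \<in> U \<inter> {p \<in> Proj_pts B G. \<not> X ` E \<subseteq> p}"
      hence pU: "p \<in> U" by simp
      obtain F where F: "F \<in> E" "X F \<notin> p" using p by blast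
      hence "F \<notin> dept p"
        using XE[OF F(1) jmor_dept(1)[OF pU]] jmor_dept(2)[OF pU] by simp
      hence "dept p \<in> W"
        using jmor_dept(1)[OF pU] F(1) E(2) by auto
      hence "fst jmor (dept p) \<in> fst jmor ` W" by (rule imageI)
      thus "p \<in> fst jmor ` W" by (simp only: jmor_dept(2)[OF pU])
    qed
  qed
  moreover have "openin (zariski B (Proj_pts B G)) {p \<in> Proj_pts B G. \<not> X ` E \<subseteq> p}"
    unfolding Jm.Y.openin_zariski using X(1) G_carr by (intro exI[of _ "X ` E"]) auto
  ultimately show ?thesis using U_open by auto
qed

lemma trivial_fracs: "Proj_fracs (trivial_grading C) q = carrier C \<times> (carrier C - q)"
  by (simp add: Proj_fracs_trivial Spec_fracs_def)

lemma trivial_mult: "Proj_mult (trivial_grading C) q = carrier C - q"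
  by (simp add: Proj_mult_trivial Spec_mult_def)

lemma jmor_isomorphism:
  "isomorphism (torus n) (open_subspace (Proj B G) U) jmor"
  unfolding Spec_eq_hspace Proj_eq_hspace
proof (rule Jm.isomorphism_onto_open[OF U_open jmor_bij jmor_open_map])
  fix q x y x' y' assume q: "q \<in> Spec_pts A" and xy: "(x, y) \<in> Proj_fracs G (fst jmor q)"
    and xy': "(x', y') \<in> Proj_fracs G (fst jmor q)"
    and eq: "hfrac A (trivial_grading A) q (dehom x) (dehom y)
      = hfrac A (trivial_grading A) q (dehom x') (dehom y')"
  interpret L: fraction_data B "Proj_fracs G (fst jmor q)" "Proj_mult G (fst jmor q)"
    by (rule Jm.Y.fracs[OF Jm.pt[OF q]])
  interpret R: fraction_data A "Proj_fracs (trivial_grading A) q" "Proj_mult (trivial_grading A) q"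
    by (rule Jm.X.fracs[OF q])
  obtain d where d: "x \<in> G d" "y \<in> G d" using xy by (auto simp: Proj_fracs_def)
  obtain e where e: "x' \<in> G e" "y' \<in> G e" using xy' by (auto simp: Proj_fracs_def)
  have c: "x \<in> carrier B" "y \<in> carrier B" "x' \<in> carrier B" "y' \<in> carrier B" using d e G_carr by auto
  have "\<exists>u\<in>carrier A - q. u \<otimes>\<^bsub>A\<^esub> (dehom x \<otimes>\<^bsub>A\<^esub> dehom y') = u \<otimes>\<^bsub>A\<^esub> (dehom x' \<otimes>\<^bsub>A\<^esub> dehom y)"
    using iffD1[OF R.cls_eq_iff[OF Jm.fracs[OF q xy] Jm.fracs[OF q xy']] eq] unfolding trivial_mult .
  then obtain u where u: "u \<in> carrier A" "u \<notin> q"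
    "u \<otimes>\<^bsub>A\<^esub> (dehom x \<otimes>\<^bsub>A\<^esub> dehom y') = u \<otimes>\<^bsub>A\<^esub> (dehom x' \<otimes>\<^bsub>A\<^esub> dehom y)"
    by (elim bexE DiffE)
  obtain N w where w: "w \<in> G (dh N)" "dehom w = tmon (wt n (nh N)) \<otimes>\<^bsub>A\<^esub> u"
    by (rule lift_pair[OF u(1) u(1)])
  have wc: "w \<in> carrier B" using w G_carr by blast
  have "w \<notin> fst jmor q" using jmor_mem[OF q w(1) u(1) _ w(2)] u(2) by simp
  hence wm: "w \<in> Proj_mult G (fst jmor q)" using w(1) by (auto simp: Proj_mult_def)
  have "dehom (w \<otimes> (x \<otimes> y')) = dehom (w \<otimes> (x' \<otimes> y))"
    using c wc u(1,3) by (simp add: w(2) A.L.m_assoc)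
  moreover have "w \<otimes> (x \<otimes> y') \<in> G (dh N + (d + e))" using w d e by (intro G_mult)
  moreover have "w \<otimes> (x' \<otimes> y) \<in> G (dh N + (e + d))" using w d e by (intro G_mult)
  ultimately have "w \<otimes> (x \<otimes> y') = w \<otimes> (x' \<otimes> y)" using dehom_inj by (metis add.commute)
  thus "L.cls x y = L.cls x' y'" using L.cls_eq_iff[OF xy xy'] wm by blast
next
  fix F S assume F: "F \<in> carrier A" and S: "S \<in> carrier A"
  obtain N x y where xy: "x \<in> G (dh N)" "dehom x = tmon (wt n (nh N)) \<otimes>\<^bsub>A\<^esub> F"
    "y \<in> G (dh N)" "dehom y = tmon (wt n (nh N)) \<otimes>\<^bsub>A\<^esub> S"
    by (rule lift_pair[OF F S])
  have "(x, y) \<in> Proj_fracs G (fst jmor q) \<and>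
      hfrac A (trivial_grading A) q (dehom x) (dehom y)
      = hfrac A (trivial_grading A) q F S"
    if q: "q \<in> Spec_pts A" and FS: "(F, S) \<in> Proj_fracs (trivial_grading A) q" for q
  proof
    interpret R: fraction_data A "Proj_fracs (trivial_grading A) q" "Proj_mult (trivial_grading A) q"
      by (rule Jm.X.fracs[OF q])
    have "S \<notin> q" using FS by (simp add: trivial_fracs)
    hence "y \<notin> fst jmor q" using jmor_mem[OF q xy(3) S _ xy(4)] by simp
    thus f: "(x, y) \<in> Proj_fracs G (fst jmor q)" using xy by (auto simp: Proj_fracs_def)
    show "R.cls (dehom x) (dehom y) = R.cls F S"
    proof (rule R.cls_eqI[OF Jm.fracs[OF q f] FS])
      show "dehom x \<otimes>\<^bsub>A\<^esub> S = F \<otimes>\<^bsub>A\<^esub> dehom y"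
        unfolding xy(2,4) A.L.m_lcomm[OF F tmon_carr[OF wt_lattice] S]
        by (rule A.L.m_assoc[OF tmon_carr[OF wt_lattice] F S])
    qed
  qed
  thus "\<exists>x y. \<forall>q\<in>Spec_pts A. (F, S) \<in> Proj_fracs (trivial_grading A) q \<longrightarrow>
      (x, y) \<in> Proj_fracs G (fst jmor q) \<and>
      hfrac A (trivial_grading A) q (dehom x) (dehom y)
      = hfrac A (trivial_grading A) q F S"
    by blast
qed

lemma jmor_open_immersion: "open_immersion (torus n) (Proj B G) jmor"
  unfolding open_immersion_def
proof
  show "morphism (torus n) (Proj B G) jmor"
    unfolding Spec_eq_hspace Proj_eq_hspace by (rule Jm.morphism)
  show "\<exists>U. openin (pts (Proj B G)) U \<and> isomorphism (torus n) (open_subspace (Proj B G) U) jmor"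
    using U_open jmor_isomorphism by (intro exI[of _ U]) (simp add: Proj_eq_hspace)
qed

text \<open>On the torus itself, the action is multiplication: both are given by \<open>mon v \<mapsto> s\<^sup>v t\<^sup>v\<close>.\<close>

abbreviation "A2 \<equiv> laurent n A"

sublocale AA: laurent_alg A n by unfold_locales

lemma kalgebra_A2: "kalgebra A2" by (rule kalgebra_laurent) unfold_locales

lemma lmap_dehom_hom: "lmap dehom \<in> ring_hom L.L A2"
  by (rule lmap_ring_hom[OF is_cring A.L.is_cring dehom_hom])

lemma lmap_dehom_lconst: "x \<in> carrier B \<Longrightarrow> lmap dehom (lconst B x) = lconst A (dehom x)"
  by (auto simp: lmap_def lconst_def)

definition hmor where
  "hmor = hinduced (GL.ghull (lmap dehom)) (lmap dehom) A2 (trivial_grading A2)"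

lemma gmor_hmor: "gmor A2 (trivial_grading A2) (Spec_pts A2) L.L H (Proj_pts L.L H) (lmap dehom) hmor"
  unfolding hmor_def
proof (rule gmor_Spec_Proj[OF kalgebra_A2 GL.graded_axioms lmap_dehom_hom])
  show "lmap dehom (cst L.L c) = cst A2 c" for c
    using lmap_dehom_lconst[of "cst B c"]
    by (simp add: L.L_cst AA.L_cst lconst_eq_lsing dehom_cst)
  fix q assume "q \<in> Spec_pts A2"
  then interpret q: primeideal q A2 by (simp add: Spec_pts_def)
  interpret c: ring_hom_ring A A2 "lconst A" by unfold_locales (rule AA.lconst_ring_hom)
  have "lconst A (tmon (wt n h)) \<notin> q"
  proof
    assume *: "lconst A (tmon (wt n h)) \<in> q"
    have "lconst A (tmon (- wt n h)) \<otimes>\<^bsub>A2\<^esub> lconst A (tmon (wt n h)) \<in> q"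
      using * by (intro q.I_l_closed) auto
    moreover have "lconst A (tmon (- wt n h)) \<otimes>\<^bsub>A2\<^esub> lconst A (tmon (wt n h)) = \<one>\<^bsub>A2\<^esub>"
      using c.hom_mult[of "tmon (- wt n h)" "tmon (wt n h)"] tmon_inv[of "wt n h"] by simp
    ultimately show False using q.I_notcarr q.one_imp_carrier by simp
  qed
  hence "lmap dehom (lconst B (mon h)) \<notin> q"
    by (simp add: lmap_dehom_lconst mon_carr h_M dehom_mon)
  thus "\<exists>d>0. \<exists>f\<in>H d. lmap dehom f \<notin> q"
    using lconst_H[OF mon_G[OF h_M]] h_pos(1) by (intro exI[of _ "nat (lookup h n)"]) auto
qed

lemma torus_mult_hom_base: "torus_mult_hom base_alg = A.diag"
  by (auto simp: torus_mult_hom_def A.diag_def intro!: ext)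

lemma extends_mult_act: "extends_mult n B G jmor act"
  unfolding extends_mult_def Let_def
proof (intro exI conjI)
  interpret A2: kalgebra A2 by (rule kalgebra_A2)
  note S2 = A2.hspace_data_Spec and S1 = KA.hspace_data_Spec
  have g_lconst: "gmor A2 (trivial_grading A2) (Spec_pts A2) A (trivial_grading A) (Spec_pts A)
      (lconst A) (Spec_induced A (lconst A) A2)"
    by (rule gmor_Spec_Spec[OF kalgebra_A2 kalgebra_torus AA.lconst_ring_hom])
      (simp add: AA.L_cst lconst_eq_lsing)
  have g_proj: "gmor A2 (trivial_grading A2) (Spec_pts A2) A (trivial_grading A) (Spec_pts A)
      (torus_proj_hom A) (Spec_induced A (torus_proj_hom A) A2)"
  proof (rule gmor_Spec_Spec[OF kalgebra_A2 kalgebra_torus])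
    show "torus_proj_hom A \<in> ring_hom A A2"
      unfolding torus_proj_hom_eq
      using lmap_ring_hom[OF cring_base_alg A.L.is_cring KA.cst_hom, of n] by (simp add: torus_alg_def[of n])
  qed (rule torus_proj_hom_cst[OF kalgebra_torus])
  have g_mult: "gmor A2 (trivial_grading A2) (Spec_pts A2) A (trivial_grading A) (Spec_pts A)
      (torus_mult_hom base_alg) (Spec_induced A (torus_mult_hom base_alg) A2)"
    unfolding torus_mult_hom_base
    by (rule gmor_Spec_Spec[OF kalgebra_A2 kalgebra_torus A.diag_ring_hom])
      (auto simp: A.L_cst AA.L_cst A.diag_def lsing_def A.L_zero intro!: ext)
  show "is_pairing n B G (Spec A2) (Spec_induced A (torus_proj_hom A) A2)
      (jmor \<circ>\<^sub>m Spec_induced A (lconst A) A2) hmor"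
    unfolding Spec_eq_hspace
  proof (rule is_pairingI[OF S2 graded_axioms gmor_hmor g_proj
        gmor_comp[OF S2 S1 hspace_data_Proj g_lconst gmor_jmor]])
    show "lmap dehom (torus_proj_hom B f) = torus_proj_hom A f" for f
      by (auto simp: lmap_def torus_proj_hom_def dehom_cst)
    show "lmap dehom (lconst B x) = lconst A (dehom x)" if "x \<in> G d" for x d
      using that G_carr by (intro lmap_dehom_lconst) blast
  qed
  show "mor_eq (Spec A2) (Proj B G) (act \<circ>\<^sub>m hmor) (jmor \<circ>\<^sub>m Spec_induced A (torus_mult_hom base_alg) A2)"
    unfolding Spec_eq_hspace Proj_eq_hspace
  proof (rule gmor_eq[OF S2 hspace_data_Proj
        gmor_comp[OF S2 GL.hspace_data_Proj hspace_data_Proj gmor_hmor gmor_act]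
        gmor_comp[OF S2 S1 hspace_data_Proj g_mult gmor_jmor]])
    fix d x assume "x \<in> G d"
    hence x: "x \<in> carrier B" using G_carr by blast
    have "dehom (coact x u) v = (if u = v then dehom x u else 0)" for u v
    proof -
      have "{w. wt n w = v} \<inter> {w. wt n w = u} = (if u = v then {w. wt n w = u} else {})" by auto
      thus ?thesis
        using x by (auto simp: dehom_apply coact_val \<Psi>_coact restr_restr restr_none)
    qed
    thus "lmap dehom (coact x) = torus_mult_hom base_alg (dehom x)"
      by (auto simp: lmap_def torus_mult_hom_def intro!: ext)
  qed
qed

end

section \<open>Normality\<close>

text \<open>
  Equations in a ring of fractions are verified in a field that contains the ring.
\<close>

locale field_embedding = cring R for R :: "('a, 'm) ring_scheme" (structure) +
  fixes \<theta> :: "'a \<Rightarrow> 'f::field"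
  assumes \<theta>_add: "x \<in> carrier R \<Longrightarrow> y \<in> carrier R \<Longrightarrow> \<theta> (x \<oplus> y) = \<theta> x + \<theta> y"
    and \<theta>_mult: "x \<in> carrier R \<Longrightarrow> y \<in> carrier R \<Longrightarrow> \<theta> (x \<otimes> y) = \<theta> x * \<theta> y"
    and \<theta>_one: "\<theta> \<one> = 1"
    and \<theta>_inj: "x \<in> carrier R \<Longrightarrow> y \<in> carrier R \<Longrightarrow> \<theta> x = \<theta> y \<Longrightarrow> x = y"
begin

lemma \<theta>_zero: "\<theta> \<zero> = 0"
  using \<theta>_add[of \<zero> \<zero>] by (metis add_cancel_left_right l_zero zero_closed)

lemma \<theta>_eq_0_iff: "x \<in> carrier R \<Longrightarrow> \<theta> x = 0 \<longleftrightarrow> x = \<zero>"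
  using \<theta>_inj[of x \<zero>] \<theta>_zero by auto

lemma \<theta>_pow: "x \<in> carrier R \<Longrightarrow> \<theta> (x [^] (n::nat)) = \<theta> x ^ n"
  by (induction n) (simp_all add: \<theta>_one \<theta>_mult)

lemma \<theta>_finsum:
  "finite A \<Longrightarrow> (\<And>a. a \<in> A \<Longrightarrow> f a \<in> carrier R) \<Longrightarrow> \<theta> (finsum R f A) = (\<Sum>a\<in>A. \<theta> (f a))"
  by (induction A rule: finite_induct) (auto simp: \<theta>_zero \<theta>_add Pi_def)

lemma domain_R: "domain R"
proof
  show "\<one> \<noteq> \<zero>" using \<theta>_one \<theta>_zero by (metis zero_neq_one)
  fix a b assume ab: "a \<otimes> b = \<zero>" "a \<in> carrier R" "b \<in> carrier R"
  hence "\<theta> a * \<theta> b = 0" using \<theta>_mult \<theta>_zero by metis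
  thus "a = \<zero> \<or> b = \<zero>" using ab \<theta>_eq_0_iff by auto
qed

end

lemma (in fraction_data) embed_fractions:
  assumes "field_embedding B \<theta>" and nz: "\<zero> \<notin> S"
  shows "\<exists>\<Theta>. field_embedding FR \<Theta> \<and> (\<forall>(a, s)\<in>F. \<Theta> (cls a s) = \<theta> a / \<theta> s)"
proof -
  interpret E: field_embedding B \<theta> by fact
  have s0: "\<theta> s \<noteq> 0" if "(a, s) \<in> F" for a s
    using that nz F_sub[OF that] F_carr[OF that] E.\<theta>_eq_0_iff by auto
  have eq_iff: "cls a s = cls b t \<longleftrightarrow> \<theta> a / \<theta> s = \<theta> b / \<theta> t" if F: "(a, s) \<in> F" "(b, t) \<in> F" for a s b t
  proof -
    have c: "a \<in> carrier B" "s \<in> carrier B" "b \<in> carrier B" "t \<in> carrier B"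
      using F_carr[OF F(1)] F_carr[OF F(2)] by auto
    have "u \<otimes> (a \<otimes> t) = u \<otimes> (b \<otimes> s) \<longleftrightarrow> \<theta> a * \<theta> t = \<theta> b * \<theta> s" if u: "u \<in> S" for u
    proof -
      have uc: "u \<in> carrier B" "\<theta> u \<noteq> 0" using S_carr[OF u] nz u E.\<theta>_eq_0_iff by auto
      have "u \<otimes> (a \<otimes> t) = u \<otimes> (b \<otimes> s) \<longleftrightarrow> \<theta> (u \<otimes> (a \<otimes> t)) = \<theta> (u \<otimes> (b \<otimes> s))"
        using uc c E.\<theta>_inj[of "u \<otimes> (a \<otimes> t)" "u \<otimes> (b \<otimes> s)"] by auto
      also have "\<dots> \<longleftrightarrow> \<theta> a * \<theta> t = \<theta> b * \<theta> s"
        using uc c by (simp add: E.\<theta>_mult)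
      finally show ?thesis .
    qed
    hence "cls a s = cls b t \<longleftrightarrow> \<theta> a * \<theta> t = \<theta> b * \<theta> s"
      unfolding cls_eq_iff[OF F] using S_one by blast
    thus ?thesis using s0[OF F(1)] s0[OF F(2)] by (simp add: field_simps)
  qed
  define \<Theta> where "\<Theta> z = (SOME w. \<exists>a s. (a, s) \<in> F \<and> z = cls a s \<and> w = \<theta> a / \<theta> s)" for z
  have \<Theta>: "\<Theta> (cls a s) = \<theta> a / \<theta> s" if F: "(a, s) \<in> F" for a s
  proof -
    have "\<exists>w a' s'. (a', s') \<in> F \<and> cls a s = cls a' s' \<and> w = \<theta> a' / \<theta> s'" using F by blast
    hence "\<exists>a' s'. (a', s') \<in> F \<and> cls a s = cls a' s' \<and> \<Theta> (cls a s) = \<theta> a' / \<theta> s'"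
      unfolding \<Theta>_def by (rule someI_ex)
    then obtain a' s' where "(a', s') \<in> F" "cls a s = cls a' s'" "\<Theta> (cls a s) = \<theta> a' / \<theta> s'"
      by blast
    thus ?thesis using eq_iff[OF F, of a' s'] by simp
  qed
  have "field_embedding FR \<Theta>"
  proof (intro field_embedding.intro field_embedding_axioms.intro cring_FR)
    fix x y assume xc: "x \<in> carrier FR" and yc: "y \<in> carrier FR"
    obtain a s where x: "x = cls a s" "(a, s) \<in> F" using xc by (rule FR_cases)
    obtain b t where y: "y = cls b t" "(b, t) \<in> F" using yc by (rule FR_cases)
    have c: "a \<in> carrier B" "s \<in> carrier B" "b \<in> carrier B" "t \<in> carrier B"
      using F_carr[OF x(2)] F_carr[OF y(2)] by auto
    show "\<Theta> (x \<otimes>\<^bsub>FR\<^esub> y) = \<Theta> x * \<Theta> y"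
      using x y c by (simp add: FR_mult \<Theta> F_mult E.\<theta>_mult)
    show "\<Theta> (x \<oplus>\<^bsub>FR\<^esub> y) = \<Theta> x + \<Theta> y"
      using x y c s0[OF x(2)] s0[OF y(2)]
      by (simp add: FR_add \<Theta> F_add E.\<theta>_mult E.\<theta>_add field_simps)
    show "\<Theta> x = \<Theta> y \<Longrightarrow> x = y"
      using x y eq_iff[OF x(2) y(2)] by (simp add: \<Theta>)
  next
    show "\<Theta> \<one>\<^bsub>FR\<^esub> = 1" by (simp add: FR_one \<Theta> F_one E.\<theta>_one)
  qed
  thus ?thesis using \<Theta> by blast
qed

lemma (in domain) fraction_data_domain:
  "fraction_data R (carrier R \<times> (carrier R - {\<zero>})) (carrier R - {\<zero>})"
  by unfold_locales (auto simp: integral_iff)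

definition to_fract :: "'a::idom \<Rightarrow> 'a fract" where "to_fract f = Fract f 1"

lemma to_fract_simps:
  fixes f g :: "'a::idom"
  shows "to_fract (f + g) = to_fract f + to_fract g" "to_fract (f * g) = to_fract f * to_fract g"
    "to_fract (1 :: 'a) = 1" "to_fract (0 :: 'a) = 0" "to_fract f = to_fract g \<longleftrightarrow> f = g"
    "to_fract (- f) = - to_fract f" "to_fract (f ^ m) = to_fract f ^ m"
proof -
  show m: "to_fract (f * g) = to_fract f * to_fract g" for f g :: 'a by (simp add: to_fract_def)
  show o: "to_fract (1 :: 'a) = 1" by (simp add: to_fract_def One_fract_def)
  show "to_fract (f + g) = to_fract f + to_fract g" "to_fract (0 :: 'a) = 0"
    "to_fract f = to_fract g \<longleftrightarrow> f = g" "to_fract (- f) = - to_fract f"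
    by (simp_all add: to_fract_def Zero_fract_def eq_fract)
  show "to_fract (f ^ m) = to_fract f ^ m" by (induction m) (simp_all add: o m)
qed

lemma to_fract_sum: "to_fract (\<Sum>i\<in>I. f i) = (\<Sum>i\<in>I. to_fract (f i))"
  by (induction I rule: infinite_finite_induct) (simp_all add: to_fract_simps)

context toric_algebra begin

lemma embed_B: "field_embedding B (\<lambda>x. to_fract (\<Psi> x))"
  by unfold_locales
    (simp_all add: to_fract_simps \<Psi>_add \<Psi>_mult \<Psi>_one \<Psi>_eqI)

lemma zero_prime: "{\<zero>} \<in> Proj_pts B G"
  unfolding Proj_pts_iff
proof (intro conjI)
  interpret Bd: domain B by (rule field_embedding.domain_R[OF embed_B])
  show "primeideal {\<zero>} B" by (rule Bd.zeroprimeideal)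
  have "mon h \<noteq> \<zero>"
    using \<Psi>_mon[OF h_M] \<Psi>_zero lmonom_nonzero[where 'a = 'k, of h] by auto
  thus "\<exists>d>0. \<exists>x\<in>G d. x \<notin> {\<zero>}"
    using mon_G[OF h_M] h_pos(1) by (intro exI[of _ "nat (lookup h n)"]) auto
qed simp

text \<open>The zero ideal is the generic point.\<close>

lemma irreducible_Proj: "irreducible_set (pts (Proj B G)) (topspace (pts (Proj B G)))"
  unfolding irreducible_set_def Proj_eq_hspace Jm.Y.hspace_simps
proof (intro conjI allI impI)
  show "topspace (zariski B (Proj_pts B G)) \<noteq> {}" using zero_prime by auto
  have closed: "V = Proj_pts B G" if V: "closedin (zariski B (Proj_pts B G)) V" "{\<zero>} \<in> V" for V
  proof -
    obtain E where E: "E \<subseteq> carrier B" "Proj_pts B G - V = {p \<in> Proj_pts B G. \<not> E \<subseteq> p}"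
      using V(1) unfolding closedin_def Jm.Y.openin_zariski by auto
    have "E \<subseteq> {\<zero>}" using E(2) V(2) zero_prime by blast
    hence "E \<subseteq> p" if "p \<in> Proj_pts B G" for p
    proof -
      interpret p: primeideal p B using that Proj_pts_iff by blast
      show ?thesis using \<open>E \<subseteq> {\<zero>}\<close> p.zero_closed by blast
    qed
    hence "Proj_pts B G - V = {}" using E(2) by auto
    moreover have "V \<subseteq> Proj_pts B G" using closedin_subset[OF V(1)] by simp
    ultimately show ?thesis by blast
  qed
  fix V W
  assume *: "closedin (zariski B (Proj_pts B G)) V \<and> closedin (zariski B (Proj_pts B G)) W \<and>
    topspace (zariski B (Proj_pts B G)) \<subseteq> V \<union> W"
  hence "{\<zero>} \<in> V \<or> {\<zero>} \<in> W" using zero_prime by auto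
  thus "topspace (zariski B (Proj_pts B G)) \<subseteq> V \<or> topspace (zariski B (Proj_pts B G)) \<subseteq> W"
    using closed * by auto
qed simp

lemma \<Psi>_pow: "x \<in> carrier B \<Longrightarrow> \<Psi> (x [^] (m::nat)) = \<Psi> x ^ m"
  by (induction m) (simp_all add: \<Psi>_one \<Psi>_mult)

text \<open>
  A fraction of homogeneous elements of equal degree that is integral over the homogeneous localization lies in
  it: after clearing denominators, it is a Laurent polynomial whose exponents lie in the cone.
\<close>

lemma integral_fraction:
  assumes ab: "a \<in> G d" "b \<in> G d" "b \<noteq> \<zero>" and s: "s \<in> G e" "s \<noteq> \<zero>"
    and g: "\<And>i. i < m \<Longrightarrow> g i \<in> G e" and m: "0 < m"
    and eq: "X ^ m + (\<Sum>i<m. to_fract (\<Psi> (g i)) / to_fract (\<Psi> s) * X ^ i) = 0"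
    and X: "X = to_fract (\<Psi> a) / to_fract (\<Psi> b)"
  shows "\<exists>y\<in>G e. X = to_fract (\<Psi> y) / to_fract (\<Psi> s)"
proof -
  have c: "a \<in> carrier B" "b \<in> carrier B" "s \<in> carrier B" "\<And>i. i < m \<Longrightarrow> g i \<in> carrier B"
    using ab s g G_carr by auto
  have nz: "\<Psi> b \<noteq> 0" "\<Psi> s \<noteq> 0"
    using ab(3) s(2) c \<Psi>_eqI[of _ \<zero>] \<Psi>_zero by auto
  hence nz': "to_fract (\<Psi> b) \<noteq> 0" "to_fract (\<Psi> s) \<noteq> 0" by (metis to_fract_simps(4,5))+
  define q where "q i = \<ominus> (s [^] (m - Suc i) \<otimes> g i)" for i
  have qc: "q i \<in> carrier B" if "i < m" for i using c that by (simp add: q_def)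
  have \<Psi>q: "\<Psi> (q i) = - (\<Psi> s ^ (m - Suc i) * \<Psi> (g i))" if "i < m" for i
    using c that by (simp add: q_def \<Psi>_minus \<Psi>_mult \<Psi>_pow)
  \<comment> \<open>\<open>s X\<close> satisfies a monic equation with coefficients in \<open>B\<close>, so that \<open>b\<close> divides \<open>s a\<close>\<close>
  let ?a = "\<Psi> s * \<Psi> a"
  have aX: "to_fract ?a = to_fract (\<Psi> s) * (to_fract (\<Psi> b) * X)" using nz' X by (simp add: to_fract_simps)
  have "to_fract (?a ^ m) = to_fract (\<Psi> s) ^ m * to_fract (\<Psi> b) ^ m * X ^ m"
    unfolding to_fract_simps(7) aX by (simp add: power_mult_distrib)
  also have "\<dots> = to_fract (\<Psi> s) ^ m * to_fract (\<Psi> b) ^ m * - (\<Sum>i<m. to_fract (\<Psi> (g i)) / to_fract (\<Psi> s) * X ^ i)"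
    using eq by (simp only: eq_neg_iff_add_eq_0[symmetric])
  also have "\<dots> = (\<Sum>i<m. to_fract (\<Psi> (q i) * ?a ^ i * \<Psi> b ^ (m - i)))"
    unfolding sum_negf[symmetric] sum_distrib_left
  proof (rule sum.cong[OF refl])
    fix i assume "i \<in> {..<m}"
    hence i: "i < m" by simp
    have p1: "to_fract (\<Psi> s) ^ m = to_fract (\<Psi> s) ^ (m - Suc i) * to_fract (\<Psi> s) ^ i * to_fract (\<Psi> s)"
      using i by (simp flip: power_add power_Suc2)
    have p2: "to_fract (\<Psi> b) ^ m = to_fract (\<Psi> b) ^ i * to_fract (\<Psi> b) ^ (m - i)"
      using i by (simp flip: power_add)
    have "to_fract (\<Psi> (q i) * ?a ^ i * \<Psi> b ^ (m - i))
        = - (to_fract (\<Psi> s) ^ (m - Suc i) * to_fract (\<Psi> (g i))) * to_fract ?a ^ i * to_fract (\<Psi> b) ^ (m - i)"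
      by (simp only: to_fract_simps \<Psi>q[OF i])
    also have "\<dots> = to_fract (\<Psi> s) ^ m * to_fract (\<Psi> b) ^ m * - (to_fract (\<Psi> (g i)) / to_fract (\<Psi> s) * X ^ i)"
      unfolding p1 p2 aX using nz' by (simp add: power_mult_distrib)
    finally show "to_fract (\<Psi> s) ^ m * to_fract (\<Psi> b) ^ m * - (to_fract (\<Psi> (g i)) / to_fract (\<Psi> s) * X ^ i)
        = to_fract (\<Psi> (q i) * ?a ^ i * \<Psi> b ^ (m - i))" ..
  qed
  also have "\<dots> = to_fract (\<Sum>i<m. \<Psi> (q i) * ?a ^ i * \<Psi> b ^ (m - i))" by (rule to_fract_sum[symmetric])
  finally have int: "?a ^ m = (\<Sum>i<m. \<Psi> (q i) * ?a ^ i * \<Psi> b ^ (m - i))" by (simp only: to_fract_simps(5))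
  then obtain y where y: "?a = \<Psi> b * y"
    using integral_imp_dvd[OF nz(1), of ?a m "\<lambda>i. \<Psi> (q i)"] by (auto elim: dvdE)
  have "\<Psi> b ^ m * y ^ m = \<Psi> b ^ m * (\<Sum>i<m. \<Psi> (q i) * y ^ i)"
  proof -
    have "\<Psi> (q i) * (\<Psi> b * y) ^ i * \<Psi> b ^ (m - i) = \<Psi> b ^ m * (\<Psi> (q i) * y ^ i)" if i: "i < m" for i
    proof -
      have "\<Psi> b ^ m = \<Psi> b ^ i * \<Psi> b ^ (m - i)" using i by (simp flip: power_add)
      thus ?thesis by (simp add: power_mult_distrib mult_ac)
    qed
    hence "(\<Sum>i<m. \<Psi> (q i) * (\<Psi> b * y) ^ i * \<Psi> b ^ (m - i))
        = (\<Sum>i<m. \<Psi> b ^ m * (\<Psi> (q i) * y ^ i))"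
      by (intro sum.cong) auto
    thus ?thesis
      using int[unfolded y] by (simp only: power_mult_distrib[symmetric] sum_distrib_left)
  qed
  hence yint: "y ^ m = (\<Sum>i<m. \<Psi> (q i) * y ^ i)" using nz by simp
  \<comment> \<open>support and degree of \<open>y\<close> follow from \<open>s a = b y\<close>, the cone inequalities from integrality of \<open>y\<close>\<close>
  have yM: "keys y \<subseteq> M" and yd: "\<And>v. v \<in> keys y \<Longrightarrow> lookup v n = int e"
  proof -
    have ka: "v \<in> M \<and> lookup v n = int (e + d)" if "v \<in> keys ?a" for v
    proof -
      have "s \<otimes> a \<in> G (e + d)" "?a = \<Psi> (s \<otimes> a)" using s ab c by (auto intro: G_mult simp: \<Psi>_mult)
      thus ?thesis using that \<Psi>_keys[of "s \<otimes> a"] by (auto simp: G_iff)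
    qed
    have kb: "v \<in> M \<and> lookup v n = int d" if "v \<in> keys (\<Psi> b)" for v
      using that ab \<Psi>_keys[of b] by (auto simp: G_iff)
    have yn0: "y \<noteq> 0" if "v \<in> keys y" for v using that by auto
    have ya: "y * \<Psi> b = ?a" using y by (simp add: mult.commute)
    have low: "lookup v t = 0" if v: "v \<in> keys y" and t: "t > n" for v t
    proof -
      have out: "lookup x t = 0" if "x \<in> M" for x
        using M_keys[OF that] t by (auto simp: in_keys_iff)
      have "lookup v t = 0 - 0"
        by (rule factor_constant_weight[of "\<lambda>v. lookup v t" y "\<Psi> b"])
          (use ka kb out yn0[OF v] nz v ya in \<open>auto simp: additive_def lookup_add\<close>)
      thus ?thesis by simp
    qed
    show deg: "lookup v n = int e" if v: "v \<in> keys y" for v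
    proof -
      have "lookup v n = int (e + d) - int d"
        by (rule factor_constant_weight[of "\<lambda>v. lookup v n" y "\<Psi> b"])
          (use ka kb yn0[OF v] nz v ya in \<open>auto simp: additive_def lookup_add\<close>)
      thus ?thesis by simp
    qed
    have "0 \<le> ell j v" if v: "v \<in> keys y" and j: "j \<in> J" for v j
      by (rule integral_weight[OF ell_additive[OF j] yint _ v])
        (use \<Psi>_keys[OF qc] j in \<open>auto simp: cone_def\<close>)
    moreover have "keys v \<subseteq> {..n}" if v: "v \<in> keys y" for v
      using low[OF v] by (auto simp: in_keys_iff) (meson not_le)
    ultimately show "keys y \<subseteq> M"
      using deg by (auto simp: cone_def)
  qed
  have "el y \<in> G e" using yd by (auto simp: G_iff el_carr[OF yM] \<Psi>_el[OF yM])
  moreover have "X = to_fract (\<Psi> (el y)) / to_fract (\<Psi> s)"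
  proof -
    have "to_fract (\<Psi> s) * to_fract (\<Psi> a) = to_fract (\<Psi> b) * to_fract y" using y by (metis to_fract_simps(2))
    thus ?thesis
      using nz' unfolding X \<Psi>_el[OF yM] by (simp add: field_simps)
  qed
  ultimately show ?thesis by blast
qed

text \<open>
  The coefficients of an integral equation have a common homogeneous denominator outside \<open>p\<close>;
  then the equation is read in the field of fractions of the Laurent polynomials.
\<close>

lemma stalk_integrally_closed:
  assumes p: "p \<in> Proj_pts B G"
  shows "integrally_closed (frac_ring B (Proj_fracs G p) (Proj_mult G p))"
proof -
  interpret p: primeideal p B using p Proj_pts_iff by blast
  interpret S: fraction_data B "Proj_fracs G p" "Proj_mult G p"
    by (rule fraction_data[OF p.primeideal_axioms])
  have "\<zero> \<notin> Proj_mult G p" by (simp add: Proj_mult_def p.zero_closed)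
  then obtain \<theta> where \<theta>: "field_embedding S.FR \<theta>"
    and \<theta>_cls: "\<And>a s. (a, s) \<in> Proj_fracs G p \<Longrightarrow> \<theta> (S.cls a s) = to_fract (\<Psi> a) / to_fract (\<Psi> s)"
    using S.embed_fractions[OF embed_B] by blast
  interpret T: field_embedding S.FR \<theta> by (rule \<theta>)
  interpret Dm: domain S.FR by (rule T.domain_R)
  interpret Q: fraction_data S.FR "carrier S.FR \<times> (carrier S.FR - {\<zero>\<^bsub>S.FR\<^esub>})" "carrier S.FR - {\<zero>\<^bsub>S.FR\<^esub>}"
    by (rule Dm.fraction_data_domain)
  obtain \<Theta> where \<Theta>: "field_embedding Q.FR \<Theta>"
    and \<Theta>_cls: "\<And>x y. x \<in> carrier S.FR \<Longrightarrow> y \<in> carrier S.FR \<Longrightarrow> y \<noteq> \<zero>\<^bsub>S.FR\<^esub> \<Longrightarrow>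
      \<Theta> (Q.cls x y) = \<theta> x / \<theta> y"
    using Q.embed_fractions[OF \<theta>] by auto
  interpret E: field_embedding Q.FR \<Theta> by (rule \<Theta>)
  have FF: "fraction_field S.FR = Q.FR" by (simp add: fraction_field_def)
  have tF: "to_fraction_field S.FR x = Q.cls x \<one>\<^bsub>S.FR\<^esub>" for x
    by (simp add: to_fraction_field_def)
  have tF_val: "Q.cls x \<one>\<^bsub>S.FR\<^esub> \<in> carrier Q.FR" "\<Theta> (Q.cls x \<one>\<^bsub>S.FR\<^esub>) = \<theta> x"
    if "x \<in> carrier S.FR" for x
    using that by (auto intro: Q.cls_carrier simp: \<Theta>_cls T.\<theta>_one)
  \<comment> \<open>a common denominator of finitely many germs\<close>
  have common: "\<exists>e s g. s \<in> G e \<and> s \<notin> p \<and> (\<forall>i<m. g i \<in> G e \<and> c i = S.cls (g i) s)"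
    if "\<And>i. i < m \<Longrightarrow> c i \<in> carrier S.FR" for c and m :: nat
    using that
  proof (induction m)
    case 0
    have "\<one> \<notin> p" using p.I_notcarr p.one_imp_carrier by blast
    thus ?case using G_one by (intro exI[of _ 0] exI[of _ \<one>]) auto
  next
    case (Suc m)
    then obtain e s g where IH: "s \<in> G e" "s \<notin> p" "\<And>i. i < m \<Longrightarrow> g i \<in> G e \<and> c i = S.cls (g i) s"
      by (metis less_SucI)
    have "c m \<in> carrier S.FR" using Suc.prems by simp
    then obtain a t where at: "c m = S.cls a t" "(a, t) \<in> Proj_fracs G p" by (rule S.FR_cases)
    then obtain d where d: "a \<in> G d" "t \<in> G d" "t \<notin> p" by (auto simp: Proj_fracs_def)
    have cr: "s \<in> carrier B" "a \<in> carrier B" "t \<in> carrier B" using IH d G_carr by auto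
    have st: "s \<otimes> t \<in> G (e + d)" "s \<otimes> t \<notin> p" using IH d cr G_mult p.I_prime by blast+
    define g' where "g' i = (if i = m then s \<otimes> a else g i \<otimes> t)" for i
    have "g' i \<in> G (e + d) \<and> c i = S.cls (g' i) (s \<otimes> t)" if i: "i < Suc m" for i
    proof (cases "i = m")
      case True
      have "s \<otimes> a \<in> G (e + d)" using IH d by (intro G_mult)
      moreover have "S.cls a t = S.cls (s \<otimes> a) (s \<otimes> t)"
      proof (rule S.cls_eqI[OF at(2)])
        show "(s \<otimes> a, s \<otimes> t) \<in> Proj_fracs G p"
          using \<open>s \<otimes> a \<in> G (e + d)\<close> st by (auto simp: Proj_fracs_def)
        show "a \<otimes> (s \<otimes> t) = s \<otimes> a \<otimes> t" using cr by (simp add: m_ac)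
      qed
      ultimately show ?thesis using True at(1) by (simp add: g'_def)
    next
      case False
      hence gi: "g i \<in> G e" "c i = S.cls (g i) s" using IH(3) i by auto
      have gt: "g i \<otimes> t \<in> G (e + d)" using gi d by (intro G_mult)
      have "S.cls (g i) s = S.cls (g i \<otimes> t) (s \<otimes> t)"
      proof (rule S.cls_eqI)
        show "(g i, s) \<in> Proj_fracs G p" using gi IH by (auto simp: Proj_fracs_def)
        show "(g i \<otimes> t, s \<otimes> t) \<in> Proj_fracs G p" using gt st by (auto simp: Proj_fracs_def)
        show "g i \<otimes> (s \<otimes> t) = g i \<otimes> t \<otimes> s" using cr gi G_carr by (simp add: m_ac)
      qed
      thus ?thesis using False gi gt by (simp add: g'_def)
    qed
    thus ?case using st by blast
  qed
  have main: "x \<in> to_fraction_field S.FR ` carrier S.FR"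
    if x: "x \<in> carrier Q.FR" and m: "0 < m" and c: "\<And>i. i < m \<Longrightarrow> c i \<in> carrier S.FR"
      and eq: "x [^]\<^bsub>Q.FR\<^esub> m \<oplus>\<^bsub>Q.FR\<^esub>
        finsum Q.FR (\<lambda>i. Q.cls (c i) \<one>\<^bsub>S.FR\<^esub> \<otimes>\<^bsub>Q.FR\<^esub> x [^]\<^bsub>Q.FR\<^esub> i) {..<m} = \<zero>\<^bsub>Q.FR\<^esub>"
    for x and m :: nat and c
  proof -
    obtain z w where zw: "x = Q.cls z w" "z \<in> carrier S.FR" "w \<in> carrier S.FR" "w \<noteq> \<zero>\<^bsub>S.FR\<^esub>"
      using x by (rule Q.FR_cases) auto
    obtain a1 s1 where z: "z = S.cls a1 s1" "(a1, s1) \<in> Proj_fracs G p" using zw(2) by (rule S.FR_cases)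
    obtain a2 s2 where w: "w = S.cls a2 s2" "(a2, s2) \<in> Proj_fracs G p" using zw(3) by (rule S.FR_cases)
    obtain d1 where d1: "a1 \<in> G d1" "s1 \<in> G d1" "s1 \<notin> p" using z by (auto simp: Proj_fracs_def)
    obtain d2 where d2: "a2 \<in> G d2" "s2 \<in> G d2" "s2 \<notin> p" using w by (auto simp: Proj_fracs_def)
    have cr: "a1 \<in> carrier B" "s1 \<in> carrier B" "a2 \<in> carrier B" "s2 \<in> carrier B"
      using d1 d2 G_carr by auto
    interpret eB: field_embedding B "\<lambda>x. to_fract (\<Psi> x)" by (rule embed_B)
    have s12: "s1 \<noteq> \<zero>" "s2 \<noteq> \<zero>" using d1 d2 p.zero_closed by auto
    have "\<theta> w \<noteq> 0" using T.\<theta>_eq_0_iff zw by simp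
    hence "to_fract (\<Psi> a2) \<noteq> 0" using \<theta>_cls[OF w(2)] w(1) by auto
    hence a2: "a2 \<noteq> \<zero>" using eB.\<theta>_zero by auto
    obtain e s g where sg: "s \<in> G e" "s \<notin> p" "\<And>i. i < m \<Longrightarrow> g i \<in> G e \<and> c i = S.cls (g i) s"
      using common[of m c, OF c] by blast
    have s0: "s \<noteq> \<zero>" using sg p.zero_closed by auto
    let ?X = "\<Theta> x"
    have X: "?X = to_fract (\<Psi> (a1 \<otimes> s2)) / to_fract (\<Psi> (s1 \<otimes> a2))"
      using \<Theta>_cls[OF zw(2,3,4)] zw(1) \<theta>_cls[OF z(2)] \<theta>_cls[OF w(2)] z(1) w(1) cr
      by (simp add: \<Psi>_mult to_fract_simps(2))
    have cls_c: "\<theta> (c i) = to_fract (\<Psi> (g i)) / to_fract (\<Psi> s)" if "i < m" for i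
      using sg(3)[OF that] sg(1,2) \<theta>_cls[of "g i" s] by (auto simp: Proj_fracs_def)
    have trm: "Q.cls (c i) \<one>\<^bsub>S.FR\<^esub> \<otimes>\<^bsub>Q.FR\<^esub> x [^]\<^bsub>Q.FR\<^esub> i \<in> carrier Q.FR" if "i < m" for i
      using tF_val(1)[OF c[OF that]] x by simp
    have "?X ^ m + (\<Sum>i<m. to_fract (\<Psi> (g i)) / to_fract (\<Psi> s) * ?X ^ i) = 0"
    proof -
      have "\<Theta> (finsum Q.FR (\<lambda>i. Q.cls (c i) \<one>\<^bsub>S.FR\<^esub> \<otimes>\<^bsub>Q.FR\<^esub> x [^]\<^bsub>Q.FR\<^esub> i) {..<m})
        = (\<Sum>i<m. \<Theta> (Q.cls (c i) \<one>\<^bsub>S.FR\<^esub> \<otimes>\<^bsub>Q.FR\<^esub> x [^]\<^bsub>Q.FR\<^esub> i))"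
        using trm by (intro E.\<theta>_finsum) auto
      hence "\<Theta> (x [^]\<^bsub>Q.FR\<^esub> m \<oplus>\<^bsub>Q.FR\<^esub>
        finsum Q.FR (\<lambda>i. Q.cls (c i) \<one>\<^bsub>S.FR\<^esub> \<otimes>\<^bsub>Q.FR\<^esub> x [^]\<^bsub>Q.FR\<^esub> i) {..<m})
        = ?X ^ m + (\<Sum>i<m. \<Theta> (Q.cls (c i) \<one>\<^bsub>S.FR\<^esub> \<otimes>\<^bsub>Q.FR\<^esub> x [^]\<^bsub>Q.FR\<^esub> i))"
        using trm x by (subst E.\<theta>_add) (auto simp: E.\<theta>_pow intro!: E.finsum_closed)
      also have "(\<Sum>i<m. \<Theta> (Q.cls (c i) \<one>\<^bsub>S.FR\<^esub> \<otimes>\<^bsub>Q.FR\<^esub> x [^]\<^bsub>Q.FR\<^esub> i))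
        = (\<Sum>i<m. to_fract (\<Psi> (g i)) / to_fract (\<Psi> s) * ?X ^ i)"
        by (rule sum.cong) (auto simp: E.\<theta>_mult tF_val c E.\<theta>_pow x cls_c)
      finally show ?thesis using eq E.\<theta>_zero by simp
    qed
    moreover have "a1 \<otimes> s2 \<in> G (d1 + d2)" "s1 \<otimes> a2 \<in> G (d1 + d2)" using d1 d2 by (auto intro: G_mult)
    moreover have "s1 \<otimes> a2 \<noteq> \<zero>"
    proof -
      interpret Bd: domain B by (rule eB.domain_R)
      show ?thesis using Bd.integral cr s12 a2 by blast
    qed
    ultimately obtain y where y: "y \<in> G e" "?X = to_fract (\<Psi> y) / to_fract (\<Psi> s)"
      using integral_fraction[of "a1 \<otimes> s2" "d1 + d2" "s1 \<otimes> a2" s e m g ?X] sg s0 m X by blast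
    have ys: "(y, s) \<in> Proj_fracs G p" using y sg by (auto simp: Proj_fracs_def)
    hence yc: "S.cls y s \<in> carrier S.FR" by (rule S.cls_carrier)
    have "\<Theta> (Q.cls (S.cls y s) \<one>\<^bsub>S.FR\<^esub>) = \<Theta> x"
      using tF_val(2)[OF yc] \<theta>_cls[OF ys] y(2) by simp
    hence "x = Q.cls (S.cls y s) \<one>\<^bsub>S.FR\<^esub>"
      using E.\<theta>_inj x tF_val(1)[OF yc] by metis
    thus ?thesis unfolding tF using yc by blast
  qed
  show ?thesis
    unfolding integrally_closed_def
  proof (intro conjI ballI impI)
    show "domain S.FR" by unfold_locales
    fix x assume "x \<in> carrier (fraction_field S.FR)"
      and "\<exists>m>0. \<exists>c. (\<forall>i<m. c i \<in> carrier S.FR) \<and>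
         x [^]\<^bsub>fraction_field S.FR\<^esub> (m::nat) \<oplus>\<^bsub>fraction_field S.FR\<^esub>
           finsum (fraction_field S.FR)
             (\<lambda>i. to_fraction_field S.FR (c i) \<otimes>\<^bsub>fraction_field S.FR\<^esub> x [^]\<^bsub>fraction_field S.FR\<^esub> i) {..<m}
         = \<zero>\<^bsub>fraction_field S.FR\<^esub>"
    thus "x \<in> to_fraction_field S.FR ` carrier S.FR"
      unfolding FF tF[THEN arg_cong] using main by (auto simp: tF)
  qed
qed

theorem projective_normal_toric_cone:
  assumes "standard_graded B G"
  shows "projective_normal_toric B G"
proof -
  have "integral_normal (Proj B G)"
    unfolding integral_normal_def using irreducible_Proj stalk_integrally_closed
    by (simp add: Proj_eq_hspace)
  thus ?thesis
    unfolding projective_normal_toric_def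
    using assms jmor_open_immersion is_action_act extends_mult_act by blast
qed

end

section \<open>Bonds along chains\<close>

lemma chain_gcd_single [simp]: "chain_gcd b [x] = 0"
  by (simp add: chain_gcd_def)

lemma chain_gcd_Cons: "chain_gcd b (x # y # zs) = gcd (b x y) (chain_gcd b (y # zs))"
proof -
  have "{b ((x # y # zs) ! k) ((x # y # zs) ! Suc k) | k. Suc k < length (x # y # zs)}
      = insert (b x y) {b ((y # zs) ! k) ((y # zs) ! Suc k) | k. Suc k < length (y # zs)}" (is "?L = ?R")
  proof
    show "?L \<subseteq> ?R"
    proof
      fix z assume "z \<in> ?L"
      then obtain k where k: "z = b ((x # y # zs) ! k) ((x # y # zs) ! Suc k)" "Suc k < length (x # y # zs)"
        by blast
      thus "z \<in> ?R" by (cases k) auto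
    qed
    show "?R \<subseteq> ?L"
    proof
      fix z assume "z \<in> ?R"
      then consider "z = b x y" | k where "z = b ((y # zs) ! k) ((y # zs) ! Suc k)" "Suc k < length (y # zs)"
        by blast
      thus "z \<in> ?L"
      proof cases
        case 1 thus ?thesis by (auto intro!: exI[of _ 0])
      next
        case 2 thus ?thesis by (auto intro!: exI[of _ "Suc k"])
      qed
    qed
  qed
  thus ?thesis by (simp add: chain_gcd_def)
qed

lemma chain_gcd_append:
  "xs \<noteq> [] \<Longrightarrow> ys \<noteq> [] \<Longrightarrow> last xs = hd ys \<Longrightarrow>
    chain_gcd b (xs @ tl ys) = gcd (chain_gcd b xs) (chain_gcd b ys)"
proof (induction xs rule: induct_list012)
  case (2 x) thus ?case by (cases ys) auto
next
  case (3 x y zs)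
  thus ?case by (simp add: chain_gcd_Cons gcd.assoc)
qed simp

lemma complete_chain_append:
  assumes "complete_chain \<sigma> \<rho> xs" "complete_chain \<rho> \<tau> ys"
  shows "complete_chain \<sigma> \<tau> (xs @ tl ys)"
proof -
  obtain zs where ys: "ys = \<rho> # zs" using assms(2) by (cases ys) (auto simp: complete_chain_def)
  have "last (xs @ zs) = \<tau>"
    using assms ys by (cases zs) (auto simp: complete_chain_def)
  moreover have "successively covers (xs @ zs)"
    using assms ys by (cases zs) (auto simp: complete_chain_def successively_append_iff)
  ultimately show ?thesis
    using assms(1) ys by (auto simp: complete_chain_def)
qed

lemma complete_chain_exists:
  fixes \<sigma> \<tau> :: "'s::{finite, order}"
  assumes "\<sigma> \<le> \<tau>"
  shows "\<exists>xs. complete_chain \<sigma> \<tau> xs"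
  using assms
proof (induction "card {\<sigma>..\<tau>}" arbitrary: \<sigma> \<tau> rule: less_induct)
  case less
  show ?case
  proof (cases "\<sigma> = \<tau>")
    case True
    thus ?thesis by (intro exI[of _ "[\<sigma>]"]) (simp add: complete_chain_def)
  next
    case False
    hence lt: "\<sigma> < \<tau>" using less.prems by simp
    show ?thesis
    proof (cases "covers \<sigma> \<tau>")
      case True
      thus ?thesis by (intro exI[of _ "[\<sigma>, \<tau>]"]) (simp add: complete_chain_def)
    next
      case False
      then obtain \<eta> where \<eta>: "\<sigma> < \<eta>" "\<eta> < \<tau>" using lt by (auto simp: covers_def)
      have "card {\<sigma>..\<eta>} < card {\<sigma>..\<tau>}" "card {\<eta>..\<tau>} < card {\<sigma>..\<tau>}"
        using \<eta> lt by (auto intro!: psubset_card_mono)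
      then obtain xs ys where "complete_chain \<sigma> \<eta> xs" "complete_chain \<eta> \<tau> ys"
        using less.hyps \<eta> by (meson less_imp_le)
      thus ?thesis using complete_chain_append by blast
    qed
  qed
qed

lemma bond_eq:
  assumes "poset_with_bonds b" "complete_chain \<sigma> \<tau> xs"
  shows "bond b \<sigma> \<tau> = chain_gcd b xs"
  unfolding bond_def
proof (rule the_equality)
  show "\<exists>xs'. complete_chain \<sigma> \<tau> xs' \<and> chain_gcd b xs = chain_gcd b xs'" using assms by blast
  fix g assume "\<exists>xs. complete_chain \<sigma> \<tau> xs \<and> g = chain_gcd b xs"
  thus "g = chain_gcd b xs" using assms unfolding poset_with_bonds_def by metis
qed

text \<open>Complete chains can be concatenated, and bonds are gcds along any complete chain.\<close>

lemma bond_split: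
  assumes "poset_with_bonds b" "\<sigma> \<le> \<rho>" "\<rho> \<le> \<tau>"
  shows "bond b \<sigma> \<tau> = gcd (bond b \<sigma> \<rho>) (bond b \<rho> \<tau>)"
proof -
  obtain xs ys where xy: "complete_chain \<sigma> \<rho> xs" "complete_chain \<rho> \<tau> ys"
    using complete_chain_exists assms by meson
  hence "chain_gcd b (xs @ tl ys) = gcd (chain_gcd b xs) (chain_gcd b ys)"
    by (intro chain_gcd_append) (auto simp: complete_chain_def)
  thus ?thesis
    using bond_eq[OF assms(1)] xy complete_chain_append[OF xy] by simp
qed

lemma bond_pos:
  assumes "poset_with_bonds b" "\<sigma> < \<tau>"
  shows "0 < bond b \<sigma> \<tau>"
proof -
  obtain xs where xs: "complete_chain \<sigma> \<tau> xs"
    using complete_chain_exists assms by (meson less_imp_le)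
  then obtain x y zs where "xs = x # y # zs"
    using assms(2) by (cases xs rule: remdups_adj.cases) (auto simp: complete_chain_def)
  hence "covers x y" "chain_gcd b xs = gcd (b x y) (chain_gcd b (y # zs))"
    using xs by (auto simp: complete_chain_def chain_gcd_Cons)
  thus ?thesis
    using assms bond_eq[OF assms(1) xs] by (auto simp: poset_with_bonds_def gcd_pos_nat)
qed

lemma bond_dvd:
  assumes "poset_with_bonds b" "\<sigma> \<le> \<sigma>'" "\<sigma>' \<le> \<tau>'" "\<tau>' \<le> \<tau>"
  shows "bond b \<sigma> \<tau> dvd bond b \<sigma>' \<tau>'"
proof -
  have "bond b \<sigma> \<tau> dvd bond b \<sigma>' \<tau>"
    using bond_split[OF assms(1,2), of \<tau>] assms by auto
  also have "\<dots> dvd bond b \<sigma>' \<tau>'"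
    using bond_split[OF assms(1,3,4)] by simp
  finally show ?thesis .
qed

lemma gcd_mult_Nats:
  fixes c :: rat
  assumes "of_nat x * c \<in> \<nat>" "of_nat y * c \<in> \<nat>" "0 \<le> c"
  shows "of_nat (gcd x y) * c \<in> \<nat>"
proof -
  obtain u v where uv: "u * int x + v * int y = int (gcd x y)"
    using bezout_int[of "int x" "int y"] by (auto simp: gcd_int_int_eq)
  have "of_nat (gcd x y) * c = of_int u * (of_nat x * c) + of_int v * (of_nat y * c)"
    using arg_cong[OF uv, of "\<lambda>z. of_int z * c :: rat"] by (simp add: algebra_simps)
  also have "\<dots> \<in> \<int>"
  proof -
    have "of_nat x * c \<in> \<int>" "of_nat y * c \<in> \<int>" using assms(1,2) Nats_subset_Ints by blast+
    thus ?thesis by (intro Ints_add Ints_mult[OF Ints_of_int])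
  qed
  finally show ?thesis
    using assms(3) by (metis Ints_cases Nats_cases mult_nonneg_nonneg of_int_0_le_iff of_int_of_nat_eq of_nat_0_le_iff of_nat_in_Nats nonneg_int_cases)
qed

lemma chain_list:
  fixes C :: "'s::order set"
  assumes "finite C" "is_chain C"
  shows "\<exists>xs. sorted_wrt (<) xs \<and> set xs = C"
  using assms
proof (induction "card C" arbitrary: C)
  case 0
  thus ?case by (intro exI[of _ "[]"]) auto
next
  case (Suc k)
  hence "C \<noteq> {}" by auto
  then obtain m where m: "m \<in> C" "\<And>x. x \<in> C \<Longrightarrow> m \<le> x \<Longrightarrow> m = x"
    using finite_has_maximal[OF Suc.prems(1)] by blast
  have lt: "x < m" if "x \<in> C - {m}" for x
    using that m Suc.prems(2) by (auto simp: Complete_Partial_Order.chain_def less_le)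
  have "k = card (C - {m})" "finite (C - {m})" "is_chain (C - {m})"
    using Suc m by (auto simp: Complete_Partial_Order.chain_def)
  then obtain xs where xs: "sorted_wrt (<) xs" "set xs = C - {m}"
    using Suc.hyps(1) by blast
  thus ?case
    using lt m by (intro exI[of _ "xs @ [m]"]) (auto simp: sorted_wrt_append)
qed

section \<open>LS-paths supported on a chain\<close>

text \<open>The chain is listed in increasing order, indexed from 0 to \<open>n\<close>.\<close>

locale ls_chain =
  fixes b :: "'s::{finite, order} \<Rightarrow> 's \<Rightarrow> nat" and es :: "'s list" and n :: nat
  assumes pwb: "poset_with_bonds b" and srt: "sorted_wrt (<) es" and len: "length es = Suc n"
begin

abbreviation E where "E \<equiv> set es"

text \<open>The value 1 at \<open>n\<close> expresses that the total mass of a path is an integer.\<close>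

definition \<beta> :: "nat \<Rightarrow> nat" where
  "\<beta> j = (if j < n then bond b (es ! j) (es ! Suc j) else 1)"

definition cum :: "('s \<Rightarrow> rat) \<Rightarrow> nat \<Rightarrow> rat" where
  "cum \<pi> j = (\<Sum>i\<le>j. \<pi> (es ! i))"

lemma es_less: "i < j \<Longrightarrow> j \<le> n \<Longrightarrow> es ! i < es ! j"
  using srt len by (auto simp: sorted_wrt_iff_nth_less)

lemma es_le: "i \<le> j \<Longrightarrow> j \<le> n \<Longrightarrow> es ! i \<le> es ! j"
  using es_less[of i j] by (cases "i = j") auto

lemma es_le_iff: "i \<le> n \<Longrightarrow> j \<le> n \<Longrightarrow> es ! i \<le> es ! j \<longleftrightarrow> i \<le> j"
  using es_less[of j i] es_le[of i j] by (meson leD leI)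

lemma es_eq_iff: "i \<le> n \<Longrightarrow> j \<le> n \<Longrightarrow> es ! i = es ! j \<longleftrightarrow> i = j"
  by (metis es_le_iff order_antisym order_refl)

lemma E_cases: "\<sigma> \<in> E \<Longrightarrow> \<exists>j\<le>n. \<sigma> = es ! j"
  using len by (metis in_set_conv_nth less_Suc_eq_le)

lemma es_E [simp]: "j \<le> n \<Longrightarrow> es ! j \<in> E"
  using len by simp

lemma \<beta>_pos: "0 < \<beta> j"
  using bond_pos[OF pwb es_less[of j "Suc j"]] by (simp add: \<beta>_def)

lemma E_chain: "is_chain E"
  unfolding Complete_Partial_Order.chain_def
proof (intro ballI)
  fix x y assume "x \<in> E" "y \<in> E"
  then obtain i j where "i \<le> n" "x = es ! i" "j \<le> n" "y = es ! j" using E_cases by meson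
  thus "x \<le> y \<or> y \<le> x" using es_le_iff by (metis nat_le_linear)
qed

text \<open>
  The bond of an interval is the gcd of the bonds of its parts, and by Bezout the numbers that make
  \<open>c\<close> integral are closed under gcds.
\<close>

lemma bond_range:
  fixes c :: rat
  assumes "p < q" "q \<le> n" "0 \<le> c" "\<And>i. p \<le> i \<Longrightarrow> i < q \<Longrightarrow> of_nat (\<beta> i) * c \<in> \<nat>"
  shows "of_nat (bond b (es ! p) (es ! q)) * c \<in> \<nat>"
  using assms
proof (induction q)
  case (Suc q)
  show ?case
  proof (cases "p = q")
    case True
    thus ?thesis using Suc.prems(4)[of p] Suc.prems(2) by (simp add: \<beta>_def)
  next
    case False
    hence pq: "p < q" using Suc.prems by simp
    have "of_nat (bond b (es ! p) (es ! q)) * c \<in> \<nat>" using Suc pq by simp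
    moreover have "of_nat (bond b (es ! q) (es ! Suc q)) * c \<in> \<nat>"
      using Suc.prems(4)[of q] Suc.prems(2) pq by (simp add: \<beta>_def)
    moreover have "bond b (es ! p) (es ! Suc q) = gcd (bond b (es ! p) (es ! q)) (bond b (es ! q) (es ! Suc q))"
      using pq Suc.prems(2) by (intro bond_split[OF pwb] es_le) auto
    ultimately show ?thesis using gcd_mult_Nats Suc.prems(3) by simp
  qed
qed simp

end

text \<open>
  Describes partial sums independently of a list, so that those along the support of a path and those along
  a larger chain can be compared.
\<close>

definition mass_below :: "('s::order \<Rightarrow> rat) \<Rightarrow> 's \<Rightarrow> rat" where
  "mass_below \<pi> \<sigma> = (\<Sum>\<rho> | \<rho> \<in> supp \<pi> \<and> \<rho> \<le> \<sigma>. \<pi> \<rho>)"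

lemma sorted_nth_inj:
  "sorted_wrt (<) (ys :: 's::order list) \<Longrightarrow> inj_on ((!) ys) {..<length ys}"
  by (rule inj_onI) (metis lessThan_iff linorder_neqE_nat order_less_irrefl sorted_wrt_iff_nth_less)

lemma sorted_prefix_mass:
  fixes ys :: "'s::{finite, order} list"
  assumes "sorted_wrt (<) ys" "supp \<pi> \<subseteq> set ys" "j < length ys"
  shows "(\<Sum>i\<le>j. \<pi> (ys ! i)) = mass_below \<pi> (ys ! j)"
proof -
  have inj: "inj_on ((!) ys) {..j}"
    by (rule inj_on_subset[OF sorted_nth_inj[OF assms(1)]]) (use assms(3) in auto)
  have "(\<Sum>i\<le>j. \<pi> (ys ! i)) = (\<Sum>\<rho>\<in>(!) ys ` {..j}. \<pi> \<rho>)"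
    by (simp add: sum.reindex[OF inj])
  also have "\<dots> = mass_below \<pi> (ys ! j)"
    unfolding mass_below_def
  proof (rule sum.mono_neutral_right)
    have le: "ys ! i \<le> ys ! j" if "i \<le> j" for i
      using that assms(1,3) by (cases "i = j") (auto simp: sorted_wrt_iff_nth_less less_imp_le)
    show "{\<rho>. \<rho> \<in> supp \<pi> \<and> \<rho> \<le> ys ! j} \<subseteq> (!) ys ` {..j}"
    proof
      fix \<rho> assume \<rho>: "\<rho> \<in> {\<rho>. \<rho> \<in> supp \<pi> \<and> \<rho> \<le> ys ! j}"
      then obtain i where i: "i < length ys" "\<rho> = ys ! i" using assms(2) by (metis CollectD in_set_conv_nth subsetD)
      have "i \<le> j"
      proof (rule ccontr)
        assume "\<not> i \<le> j"
        hence "ys ! j < \<rho>" using i assms(1) by (simp add: sorted_wrt_iff_nth_less)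
        thus False using \<rho> by auto
      qed
      thus "\<rho> \<in> (!) ys ` {..j}" using i by blast
    qed
    show "\<forall>i\<in>(!) ys ` {..j} - {\<rho>. \<rho> \<in> supp \<pi> \<and> \<rho> \<le> ys ! j}. \<pi> i = 0"
      using le by (auto simp: supp_def)
  qed simp
  finally show ?thesis .
qed

lemma sorted_total:
  fixes ys :: "'s::{finite, order} list"
  assumes "sorted_wrt (<) ys" "supp \<pi> \<subseteq> set ys"
  shows "(\<Sum>i<length ys. \<pi> (ys ! i)) = (\<Sum>\<rho>\<in>supp \<pi>. \<pi> \<rho>)"
proof -
  have "(\<Sum>i<length ys. \<pi> (ys ! i)) = (\<Sum>\<rho>\<in>(!) ys ` {..<length ys}. \<pi> \<rho>)"
    by (simp add: sum.reindex[OF sorted_nth_inj[OF assms(1)]])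
  also have "(!) ys ` {..<length ys} = set ys" by (auto simp: set_conv_nth)
  also have "(\<Sum>\<rho>\<in>set ys. \<pi> \<rho>) = (\<Sum>\<rho>\<in>supp \<pi>. \<pi> \<rho>)"
    using assms(2) by (intro sum.mono_neutral_right) (auto simp: supp_def)
  finally show ?thesis .
qed

context ls_chain begin

lemma cum_mass: "supp \<pi> \<subseteq> E \<Longrightarrow> j \<le> n \<Longrightarrow> cum \<pi> j = mass_below \<pi> (es ! j)"
  unfolding cum_def using sorted_prefix_mass[OF srt] len by simp

lemma cum_total: "supp \<pi> \<subseteq> E \<Longrightarrow> cum \<pi> n = (\<Sum>\<rho>\<in>supp \<pi>. \<pi> \<rho>)"
  using sorted_total[OF srt, of \<pi>] len by (simp add: cum_def lessThan_Suc_atMost)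

lemma cum_Suc: "cum \<pi> (Suc j) = cum \<pi> j + \<pi> (es ! Suc j)"
  by (simp add: cum_def)

text \<open>
  The bond conditions can be stated along \<open>E\<close> instead of the support. A bond between
  consecutive elements of the support divides the bonds of the intervals of \<open>E\<close> within it, and
  is their gcd.
\<close>

lemma LS_path_iff:
  assumes sE: "supp \<pi> \<subseteq> E"
  shows "LS_path b r \<pi> \<longleftrightarrow>
    (\<forall>\<sigma>. 0 \<le> \<pi> \<sigma>) \<and> (\<forall>j<n. of_nat (\<beta> j) * cum \<pi> j \<in> \<nat>) \<and> cum \<pi> n = of_nat r"
proof
  assume "LS_path b r \<pi>"
  then obtain xs where pos: "\<And>\<sigma>. 0 \<le> \<pi> \<sigma>" and xs: "sorted_wrt (<) xs" "set xs = supp \<pi>"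
    and bd: "\<And>j. Suc j < length xs \<Longrightarrow> of_nat (bond b (xs ! j) (xs ! Suc j)) * (\<Sum>i\<le>j. \<pi> (xs ! i)) \<in> \<nat>"
    and tot: "(\<Sum>i<length xs. \<pi> (xs ! i)) = of_nat r"
    unfolding LS_path_def by blast
  have sx: "\<exists>k<length xs. \<rho> = xs ! k" if "\<rho> \<in> supp \<pi>" for \<rho>
  proof -
    have "\<rho> \<in> set xs" using that xs(2) by simp
    thus ?thesis by (metis in_set_conv_nth)
  qed
  have r: "cum \<pi> n = of_nat r"
    using cum_total[OF sE] sorted_total[OF xs(1), of \<pi>] xs(2) tot by simp
  have xs_le: "xs ! k \<le> xs ! i" if "k \<le> i" "i < length xs" for k i
    using that xs(1) by (cases "k = i") (auto simp: sorted_wrt_iff_nth_less less_imp_le)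
  have "of_nat (\<beta> j) * cum \<pi> j \<in> \<nat>" if j: "j < n" for j
  proof -
    let ?K = "{i. i < length xs \<and> xs ! i \<le> es ! j}"
    have cm: "cum \<pi> j = mass_below \<pi> (es ! j)" using cum_mass[OF sE] j by simp
    show ?thesis
    proof (cases "?K = {}")
      case True
      hence "{\<rho>. \<rho> \<in> supp \<pi> \<and> \<rho> \<le> es ! j} = {}"
        using sx by blast
      thus ?thesis unfolding cm mass_below_def by (simp only: sum.empty) simp
    next
      case False
      define i where "i = Max ?K"
      have "i \<in> ?K" unfolding i_def using False by (intro Max_in) auto
      hence i: "i < length xs" "xs ! i \<le> es ! j" by auto
      have imax: "k \<le> i" if "k < length xs" "xs ! k \<le> es ! j" for k
        unfolding i_def using that by (intro Max_ge) auto
      have "{\<rho>. \<rho> \<in> supp \<pi> \<and> \<rho> \<le> es ! j} = {\<rho>. \<rho> \<in> supp \<pi> \<and> \<rho> \<le> xs ! i}"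
      proof (intro Set.set_eqI iffI)
        fix \<rho> assume \<rho>: "\<rho> \<in> {\<rho>. \<rho> \<in> supp \<pi> \<and> \<rho> \<le> es ! j}"
        then obtain k where "k < length xs" "\<rho> = xs ! k" using sx by blast
        thus "\<rho> \<in> {\<rho>. \<rho> \<in> supp \<pi> \<and> \<rho> \<le> xs ! i}" using \<rho> imax xs_le i by auto
      next
        fix \<rho> assume "\<rho> \<in> {\<rho>. \<rho> \<in> supp \<pi> \<and> \<rho> \<le> xs ! i}"
        thus "\<rho> \<in> {\<rho>. \<rho> \<in> supp \<pi> \<and> \<rho> \<le> es ! j}" using i by auto
      qed
      hence c: "cum \<pi> j = (\<Sum>k\<le>i. \<pi> (xs ! k))"
        using cm sorted_prefix_mass[OF xs(1), of \<pi> i] xs(2) i by (simp add: mass_below_def)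
      show ?thesis
      proof (cases "Suc i < length xs")
        case True
        hence notle: "\<not> xs ! Suc i \<le> es ! j" using imax by (metis Suc_n_not_le_n)
        obtain q where q: "q \<le> n" "xs ! Suc i = es ! q"
          using True xs(2) sE E_cases by (metis nth_mem subsetD)
        hence "Suc j \<le> q" using notle es_le_iff[of q j] j by simp
        hence "es ! Suc j \<le> xs ! Suc i" using q es_le by simp
        hence "bond b (xs ! i) (xs ! Suc i) dvd \<beta> j"
          using bond_dvd[OF pwb i(2), of "es ! Suc j"] es_le[of j "Suc j"] j by (simp add: \<beta>_def)
        then obtain l where "\<beta> j = bond b (xs ! i) (xs ! Suc i) * l" by (rule dvdE)
        hence "of_nat (\<beta> j) * cum \<pi> j
            = of_nat l * (of_nat (bond b (xs ! i) (xs ! Suc i)) * (\<Sum>k\<le>i. \<pi> (xs ! k)))"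
          by (simp add: c)
        thus ?thesis using bd[OF True] Nats_mult[OF of_nat_in_Nats] by metis
      next
        case False
        hence "{..i} = {..<length xs}" using i by auto
        hence "cum \<pi> j = of_nat r" using c tot by simp
        thus ?thesis by (simp flip: of_nat_mult)
      qed
    qed
  qed
  thus "(\<forall>\<sigma>. 0 \<le> \<pi> \<sigma>) \<and> (\<forall>j<n. of_nat (\<beta> j) * cum \<pi> j \<in> \<nat>) \<and> cum \<pi> n = of_nat r"
    using pos r by blast
next
  assume R: "(\<forall>\<sigma>. 0 \<le> \<pi> \<sigma>) \<and> (\<forall>j<n. of_nat (\<beta> j) * cum \<pi> j \<in> \<nat>) \<and> cum \<pi> n = of_nat r"
  have ch: "is_chain (supp \<pi>)" using E_chain sE by (auto simp: Complete_Partial_Order.chain_def)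
  obtain xs where xs: "sorted_wrt (<) xs" "set xs = supp \<pi>"
    using chain_list[OF _ ch] by auto
  have sx: "\<exists>k<length xs. \<rho> = xs ! k" if "\<rho> \<in> supp \<pi>" for \<rho>
  proof -
    have "\<rho> \<in> set xs" using that xs(2) by simp
    thus ?thesis by (metis in_set_conv_nth)
  qed
  have xs_le: "xs ! k \<le> xs ! i" if "k \<le> i" "i < length xs" for k i
    using that xs(1) by (cases "k = i") (auto simp: sorted_wrt_iff_nth_less less_imp_le)
  have "of_nat (bond b (xs ! j) (xs ! Suc j)) * (\<Sum>i\<le>j. \<pi> (xs ! i)) \<in> \<nat>" if j: "Suc j < length xs" for j
  proof -
    obtain p where p: "p \<le> n" "xs ! j = es ! p" using j xs(2) sE E_cases by (metis Suc_lessD nth_mem subsetD)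
    obtain q where q: "q \<le> n" "xs ! Suc j = es ! q" using j xs(2) sE E_cases by (metis nth_mem subsetD)
    have lt: "xs ! j < xs ! Suc j" using xs(1) j by (simp add: sorted_wrt_iff_nth_less)
    hence pq: "p < q" using p q es_le_iff by (metis leD leI)
    let ?c = "\<Sum>i\<le>j. \<pi> (xs ! i)"
    have c: "?c = mass_below \<pi> (xs ! j)" using sorted_prefix_mass[OF xs(1), of \<pi> j] xs(2) j by simp
    have "of_nat (\<beta> i) * ?c \<in> \<nat>" if i: "p \<le> i" "i < q" for i
    proof -
      have "{\<rho>. \<rho> \<in> supp \<pi> \<and> \<rho> \<le> es ! i} = {\<rho>. \<rho> \<in> supp \<pi> \<and> \<rho> \<le> xs ! j}"
      proof (intro Set.set_eqI iffI)
        fix \<rho> assume \<rho>: "\<rho> \<in> {\<rho>. \<rho> \<in> supp \<pi> \<and> \<rho> \<le> es ! i}"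
        then obtain k where k: "k < length xs" "\<rho> = xs ! k" using sx by blast
        have "es ! i < es ! q" using es_less i q by blast
        hence "xs ! k < xs ! Suc j" using \<rho> k q by auto
        hence "k \<le> j" using xs_le[of "Suc j" k] k(1) by (metis leD not_less_eq_eq)
        thus "\<rho> \<in> {\<rho>. \<rho> \<in> supp \<pi> \<and> \<rho> \<le> xs ! j}" using \<rho> k xs_le j by auto
      next
        fix \<rho> assume "\<rho> \<in> {\<rho>. \<rho> \<in> supp \<pi> \<and> \<rho> \<le> xs ! j}"
        moreover have "xs ! j \<le> es ! i" using p i q es_le by simp
        ultimately show "\<rho> \<in> {\<rho>. \<rho> \<in> supp \<pi> \<and> \<rho> \<le> es ! i}" by auto
      qed
      hence "cum \<pi> i = ?c" using cum_mass[OF sE, of i] i q c by (simp add: mass_below_def)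
      moreover have "i < n" using i q by simp
      ultimately show ?thesis using R by metis
    qed
    moreover have "0 \<le> ?c" using R by (intro sum_nonneg) auto
    ultimately show ?thesis using bond_range[OF pq q(1)] p q by simp
  qed
  moreover have "(\<Sum>i<length xs. \<pi> (xs ! i)) = of_nat r"
    using cum_total[OF sE] sorted_total[OF xs(1), of \<pi>] xs(2) R by simp
  ultimately show "LS_path b r \<pi>"
    unfolding LS_path_def using R ch xs by blast
qed

end

lemma Nats_of_int: "0 \<le> z \<Longrightarrow> (of_int z :: rat) \<in> \<nat>"
  by (metis nonneg_int_cases of_int_of_nat_eq of_nat_in_Nats)

context ls_chain begin

definition P1 :: "('s \<Rightarrow> rat) set" where
  "P1 = {\<pi> \<in> LS1 b. supp \<pi> \<subseteq> E}"

lemma P1_D: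
  assumes "\<pi> \<in> P1"
  shows "supp \<pi> \<subseteq> E" "\<And>\<sigma>. 0 \<le> \<pi> \<sigma>" "\<And>j. j \<le> n \<Longrightarrow> of_nat (\<beta> j) * cum \<pi> j \<in> \<nat>" "cum \<pi> n = 1" "\<pi> \<in> LS1 b"
proof -
  show s: "supp \<pi> \<subseteq> E" "\<pi> \<in> LS1 b" using assms by (auto simp: P1_def)
  have L: "(\<forall>\<sigma>. 0 \<le> \<pi> \<sigma>) \<and> (\<forall>j<n. of_nat (\<beta> j) * cum \<pi> j \<in> \<nat>) \<and> cum \<pi> n = of_nat 1"
    using LS_path_iff[OF s(1), of 1] s(2) by (simp add: LS1_def)
  thus "\<And>\<sigma>. 0 \<le> \<pi> \<sigma>" "cum \<pi> n = 1" by auto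
  show "of_nat (\<beta> j) * cum \<pi> j \<in> \<nat>" if "j \<le> n" for j
    using L that by (cases "j = n") (auto simp: \<beta>_def)
qed

text \<open>
  A path \<open>\<pi>\<close> is encoded by its partial sums \<open>cum \<pi> j\<close>, each multiplied by the bond that makes it an integer;
  \<open>av v\<close> and \<open>ell j v\<close> recover the partial sums and the values of the path from its code \<open>v\<close>.
\<close>

definition av :: "(nat \<Rightarrow>\<^sub>0 int) \<Rightarrow> nat \<Rightarrow> rat" where
  "av v j = of_int (lookup v j) / of_nat (\<beta> j)"

definition ell :: "nat \<Rightarrow> (nat \<Rightarrow>\<^sub>0 int) \<Rightarrow> rat" where
  "ell j v = av v j - (if j = 0 then 0 else av v (j - 1))"

abbreviation K where "K \<equiv> cone n {..n} ell"

lemma av_add: "av (u + v) j = av u j + av v j" and av_diff: "av (u - v) j = av u j - av v j"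
  by (simp_all add: av_def lookup_add lookup_minus add_divide_distrib diff_divide_distrib)

lemma ell_additive: "additive (ell j)"
  by (simp add: additive_def ell_def av_add)

lemma av_n: "av v n = of_int (lookup v n)"
  by (simp add: av_def \<beta>_def)

lemma av_lookup: "of_nat (\<beta> j) * av v j = of_int (lookup v j)"
  using \<beta>_pos[of j] by (simp add: av_def)

lemma K_iff: "v \<in> K \<longleftrightarrow> keys v \<subseteq> {..n} \<and> 0 \<le> av v 0 \<and> (\<forall>j<n. av v j \<le> av v (Suc j))"
proof
  assume v: "v \<in> K"
  hence l: "0 \<le> ell j v" if "j \<le> n" for j using that by (auto simp: cone_def)
  show "keys v \<subseteq> {..n} \<and> 0 \<le> av v 0 \<and> (\<forall>j<n. av v j \<le> av v (Suc j))"
    using v l[of 0] l[of "Suc _"] by (auto simp: cone_def ell_def)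
next
  assume v: "keys v \<subseteq> {..n} \<and> 0 \<le> av v 0 \<and> (\<forall>j<n. av v j \<le> av v (Suc j))"
  have "0 \<le> av v j" if "j \<le> n" for j
    using that v by (induction j) (auto intro: order_trans)
  hence "0 \<le> (of_int (lookup v n) :: rat)" by (metis av_n order_refl)
  moreover have "0 \<le> ell j v" if "j \<le> n" for j
    using that v by (cases j) (auto simp: ell_def)
  ultimately show "v \<in> K" using v by (auto simp: cone_def)
qed

lemma K_keys: "v \<in> K \<Longrightarrow> keys v \<subseteq> {..n}"
  by (simp add: cone_def)

lemma av_mono: "v \<in> K \<Longrightarrow> i \<le> j \<Longrightarrow> j \<le> n \<Longrightarrow> av v i \<le> av v j"
proof (induction j)
  case (Suc j)
  thus ?case by (cases "i = Suc j") (auto simp: K_iff intro: order_trans)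
qed simp

lemma av_nonneg: "v \<in> K \<Longrightarrow> j \<le> n \<Longrightarrow> 0 \<le> av v j"
  using av_mono[of v 0 j] by (auto simp: K_iff)

lemma K_add: "u \<in> K \<Longrightarrow> v \<in> K \<Longrightarrow> u + v \<in> K"
  using keys_add[of u v] by (auto simp: K_iff av_add intro: add_mono)

lemma K_zero: "0 \<in> K"
  by (simp add: K_iff av_def)

lemma av_eqI:
  assumes "keys u \<subseteq> {..n}" "keys v \<subseteq> {..n}" "\<And>j. j \<le> n \<Longrightarrow> av u j = av v j"
  shows "u = v"
proof (rule poly_mapping_eqI)
  fix j show "lookup u j = lookup v j"
  proof (cases "j \<le> n")
    case True
    hence "(of_int (lookup u j) :: rat) = of_int (lookup v j)"
      using assms(3) by (metis av_lookup)
    thus ?thesis by simp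
  next
    case False
    hence "j \<notin> keys u" "j \<notin> keys v" using assms(1,2) by auto
    thus ?thesis by (simp add: in_keys_iff)
  qed
qed

definition expo :: "('s \<Rightarrow> rat) \<Rightarrow> (nat \<Rightarrow>\<^sub>0 int)" where
  "expo \<pi> = vec n (\<lambda>j. \<lfloor>of_nat (\<beta> j) * cum \<pi> j\<rfloor>) \<lfloor>cum \<pi> n\<rfloor>"

lemma keys_expo: "keys (expo \<pi>) \<subseteq> {..n}"
  unfolding expo_def by (rule keys_vec)

lemma av_expo_gen:
  assumes "\<And>j. j \<le> n \<Longrightarrow> of_nat (\<beta> j) * cum \<pi> j \<in> \<nat>" "j \<le> n"
  shows "av (expo \<pi>) j = cum \<pi> j"
proof -
  have fl: "(of_int \<lfloor>of_nat (\<beta> j) * cum \<pi> j\<rfloor> :: rat) = of_nat (\<beta> j) * cum \<pi> j"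
    using assms(1)[OF assms(2)] by (metis Nats_cases floor_of_nat of_int_of_nat_eq)
  have "lookup (expo \<pi>) j = \<lfloor>of_nat (\<beta> j) * cum \<pi> j\<rfloor>"
    using assms(2) by (auto simp: expo_def lookup_vec \<beta>_def)
  hence "av (expo \<pi>) j = of_nat (\<beta> j) * cum \<pi> j / of_nat (\<beta> j)"
    unfolding av_def by (simp only: fl)
  also have "\<dots> = cum \<pi> j" using \<beta>_pos[of j] by simp
  finally show ?thesis .
qed

lemma av_expo: "\<pi> \<in> P1 \<Longrightarrow> j \<le> n \<Longrightarrow> av (expo \<pi>) j = cum \<pi> j"
  by (rule av_expo_gen) (auto dest: P1_D)

lemma expo_K:
  assumes "\<pi> \<in> P1" shows "expo \<pi> \<in> K" "lookup (expo \<pi>) n = 1"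
proof -
  show "expo \<pi> \<in> K"
    unfolding K_iff using keys_expo av_expo[OF assms] P1_D(2)[OF assms]
    by (auto simp: cum_Suc) (simp add: cum_def)
  have "(of_int (lookup (expo \<pi>) n) :: rat) = 1"
    using av_expo[OF assms, of n] P1_D(4)[OF assms] av_n by simp
  thus "lookup (expo \<pi>) n = 1" by simp
qed

lemma ell_expo:
  assumes "\<pi> \<in> P1" "j \<le> n" shows "ell j (expo \<pi>) = \<pi> (es ! j)"
  using assms av_expo[OF assms(1)] by (cases j) (auto simp: ell_def cum_Suc, simp add: cum_def)

definition path :: "(nat \<Rightarrow>\<^sub>0 int) \<Rightarrow> 's \<Rightarrow> rat" where
  "path v \<sigma> = (if \<sigma> \<in> E then ell (THE j. j \<le> n \<and> es ! j = \<sigma>) v else 0)"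

lemma path_es: "j \<le> n \<Longrightarrow> path v (es ! j) = ell j v"
proof -
  assume j: "j \<le> n"
  hence "(THE i. i \<le> n \<and> es ! i = es ! j) = j"
    by (intro the_equality) (auto simp: es_eq_iff)
  thus ?thesis using j by (simp add: path_def)
qed

lemma supp_path: "supp (path v) \<subseteq> E"
  by (auto simp: supp_def path_def)

lemma cum_path: "j \<le> n \<Longrightarrow> cum (path v) j = av v j"
  by (induction j) (simp_all add: cum_Suc path_es ell_def, simp add: cum_def path_es ell_def)

lemma path_P1:
  assumes v: "v \<in> K" "lookup v n = 1"
  shows "path v \<in> P1"
proof -
  have "0 \<le> path v \<sigma>" for \<sigma>
  proof (cases "\<sigma> \<in> E")
    case True
    then obtain j where j: "j \<le> n" "\<sigma> = es ! j" using E_cases by blast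
    thus ?thesis using v(1) path_es[OF j(1)] by (auto simp: cone_def)
  qed (simp add: path_def)
  moreover have "of_nat (\<beta> j) * cum (path v) j \<in> \<nat>" if "j < n" for j
  proof -
    have "(0 :: rat) \<le> of_int (lookup v j)"
      using av_nonneg[OF v(1), of j] that by (simp flip: av_lookup)
    hence "0 \<le> lookup v j" by simp
    thus ?thesis using that by (simp add: cum_path av_lookup Nats_of_int)
  qed
  moreover have "cum (path v) n = of_nat 1" using v(2) by (simp add: cum_path av_n)
  ultimately show ?thesis
    using LS_path_iff[OF supp_path, of 1 v] supp_path by (simp add: P1_def LS1_def)
qed

lemma expo_path: "v \<in> K \<Longrightarrow> lookup v n = 1 \<Longrightarrow> expo (path v) = v"
  by (rule av_eqI) (auto simp: keys_expo K_keys av_expo path_P1 cum_path dest: subsetD[OF K_keys] subsetD[OF keys_expo])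

lemma path_expo: "\<pi> \<in> P1 \<Longrightarrow> path (expo \<pi>) = \<pi>"
proof
  fix \<sigma> assume p: "\<pi> \<in> P1"
  show "path (expo \<pi>) \<sigma> = \<pi> \<sigma>"
  proof (cases "\<sigma> \<in> E")
    case True
    then obtain j where "j \<le> n" "\<sigma> = es ! j" using E_cases by blast
    thus ?thesis using ell_expo[OF p] path_es by simp
  next
    case False
    thus ?thesis using P1_D(1)[OF p] by (auto simp: path_def supp_def)
  qed
qed

text \<open>The first piece of a path of degree \<open>r\<close> collects the initial part of mass 1.\<close>

definition slice :: "(nat \<Rightarrow>\<^sub>0 int) \<Rightarrow> (nat \<Rightarrow>\<^sub>0 int)" where
  "slice v = vec n (\<lambda>j. min (lookup v j) (int (\<beta> j))) 1"

lemma av_slice: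
  assumes "1 \<le> lookup v n" "j \<le> n"
  shows "av (slice v) j = min (av v j) 1"
proof -
  have "lookup (slice v) j = min (lookup v j) (int (\<beta> j))"
    using assms by (cases "j = n") (auto simp: slice_def lookup_vec \<beta>_def)
  hence "av (slice v) j = min (of_int (lookup v j)) (of_nat (\<beta> j)) / of_nat (\<beta> j)"
    by (simp add: av_def min_def)
  also have "\<dots> = min (av v j) 1"
    using \<beta>_pos[of j] by (auto simp: av_def min_def field_simps)
  finally show ?thesis .
qed

lemma keys_slice: "keys (slice v) \<subseteq> {..n}"
  unfolding slice_def by (rule keys_vec)

lemma slice_K:
  assumes v: "v \<in> K" "1 \<le> lookup v n"
  shows "slice v \<in> K" "lookup (slice v) n = 1" "v - slice v \<in> K" "lookup (v - slice v) n = lookup v n - 1"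
proof -
  show "lookup (slice v) n = 1" by (simp add: slice_def lookup_vec)
  thus "lookup (v - slice v) n = lookup v n - 1" by (simp add: lookup_minus)
  have m: "av v j \<le> av v (Suc j)" if "j < n" for j using v(1) that by (simp add: K_iff)
  show "slice v \<in> K"
    unfolding K_iff
  proof (intro conjI allI impI)
    show "keys (slice v) \<subseteq> {..n}" by (rule keys_slice)
    show "0 \<le> av (slice v) 0" using av_slice[OF v(2), of 0] av_nonneg[OF v(1), of 0] by simp
    fix j assume "j < n"
    thus "av (slice v) j \<le> av (slice v) (Suc j)"
      using m[of j] av_slice[OF v(2), of j] av_slice[OF v(2), of "Suc j"] by (auto simp: min_def)
  qed
  show "v - slice v \<in> K"
    unfolding K_iff av_diff
  proof (intro conjI allI impI)
    show "keys (v - slice v) \<subseteq> {..n}"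
    proof
      fix t assume "t \<in> keys (v - slice v)"
      hence "t \<in> keys v \<or> t \<in> keys (slice v)"
        by (auto simp: in_keys_iff lookup_minus)
      thus "t \<in> {..n}" using K_keys[OF v(1)] keys_slice[of v] by blast
    qed
    show "0 \<le> av v 0 - av (slice v) 0" using av_slice[OF v(2)] by simp
    fix j assume "j < n"
    thus "av v j - av (slice v) j \<le> av v (Suc j) - av (slice v) (Suc j)"
      using m[of j] av_slice[OF v(2)] by (auto simp: min_def)
  qed
qed

lemma slice_deg1: "v \<in> K \<Longrightarrow> lookup v n = 1 \<Longrightarrow> slice v = v"
proof (rule av_eqI)
  assume v: "v \<in> K" "lookup v n = 1"
  show "av (slice v) j = av v j" if "j \<le> n" for j
    using av_slice[of v j] v av_mono[OF v(1) that order_refl] that by (simp add: av_n)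
qed (auto dest: subsetD[OF K_keys] subsetD[OF keys_slice])

text \<open>The first piece of a sum is determined by the first pieces of the summands.\<close>

lemma slice_add_slice:
  assumes u: "u \<in> K" and v: "v \<in> K" "1 \<le> lookup v n"
  shows "slice (u + slice v) = slice (u + v)"
proof (rule av_eqI)
  have u0: "0 \<le> lookup u n" using u by (simp add: cone_def)
  have d: "1 \<le> lookup (u + slice v) n" "1 \<le> lookup (u + v) n"
    using u0 slice_K(2)[OF v] v(2) by (simp_all add: lookup_add)
  fix j assume j: "j \<le> n"
  show "av (slice (u + slice v)) j = av (slice (u + v)) j"
    using av_slice[OF d(1) j] av_slice[OF d(2) j] av_slice[OF v(2) j] av_nonneg[OF u j]
    by (auto simp: av_add min_def)
qed (auto dest: subsetD[OF keys_slice])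

text \<open>
  Partial sums of \<open>\<pi>1 + \<pi>2\<close> reach 1 exactly where \<open>\<pi>1\<close> is exhausted,
  and \<open>\<pi>2\<close> starts only there.
\<close>

lemma standard_imp_slice:
  assumes p: "\<pi>1 \<in> P1" "\<pi>2 \<in> P1" and le: "\<forall>\<sigma>\<in>supp \<pi>1. \<forall>\<tau>\<in>supp \<pi>2. \<sigma> \<le> \<tau>"
  shows "slice (expo \<pi>1 + expo \<pi>2) = expo \<pi>1"
proof (rule av_eqI)
  have d: "1 \<le> lookup (expo \<pi>1 + expo \<pi>2) n" using expo_K(2) p by (simp add: lookup_add)
  fix j assume j: "j \<le> n"
  have c1: "cum \<pi>1 j \<le> 1"
    using av_mono[OF expo_K(1)[OF p(1)] j order_refl] av_expo[OF p(1)] P1_D(4)[OF p(1)] j by simp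
  have "min (cum \<pi>1 j + cum \<pi>2 j) 1 = cum \<pi>1 j"
  proof (cases "cum \<pi>2 j = 0")
    case True thus ?thesis using c1 by simp
  next
    case False
    have c2: "0 \<le> cum \<pi>2 j" unfolding cum_def using P1_D(2)[OF p(2)] by (intro sum_nonneg) auto
    obtain i where i: "i \<le> j" "\<pi>2 (es ! i) \<noteq> 0"
      using False unfolding cum_def by (metis atMost_iff sum.neutral)
    have z: "\<pi>1 (es ! k) = 0" if k: "j < k" "k \<le> n" for k
    proof (rule ccontr)
      assume "\<pi>1 (es ! k) \<noteq> 0"
      hence "es ! k \<le> es ! i" using le i(2) by (auto simp: supp_def)
      thus False using es_le_iff[of k i] i(1) k j by simp
    qed
    have "cum \<pi>1 n = cum \<pi>1 j"
      unfolding cum_def using j z by (intro sum.mono_neutral_right) auto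
    thus ?thesis using P1_D(4)[OF p(1)] c2 by simp
  qed
  thus "av (slice (expo \<pi>1 + expo \<pi>2)) j = av (expo \<pi>1) j"
    using av_slice[OF d j] av_expo[OF p(1) j] av_expo[OF p(2) j] by (simp add: av_add)
qed (auto dest: subsetD[OF keys_slice] subsetD[OF keys_expo])

text \<open>
  The remainder contributes only after the partial sums have reached 1, and from there on the first piece is
  constant.
\<close>

lemma slice_standard:
  assumes v: "v \<in> K" "lookup v n = 2"
  shows "\<forall>\<sigma>\<in>supp (path (slice v)). \<forall>\<tau>\<in>supp (path (v - slice v)). \<sigma> \<le> \<tau>"
proof (intro ballI)
  have v1: "1 \<le> lookup v n" using v by simp
  note S = slice_K[OF v(1) v1]
  fix \<sigma> \<tau> assume s: "\<sigma> \<in> supp (path (slice v))" and t: "\<tau> \<in> supp (path (v - slice v))"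
  obtain i where i: "i \<le> n" "\<sigma> = es ! i" using s supp_path E_cases by blast
  obtain j where j: "j \<le> n" "\<tau> = es ! j" using t supp_path E_cases by blast
  have "i \<le> j"
  proof (rule ccontr)
    assume "\<not> i \<le> j"
    hence ji: "j < i" by simp
    have ej: "0 < ell j (v - slice v)"
      using t j S(3) by (auto simp: supp_def path_es cone_def less_le)
    have ei: "0 < ell i (slice v)"
      using s i S(1) by (auto simp: supp_def path_es cone_def less_le)
    have "0 < av (v - slice v) j"
    proof (cases j)
      case 0 thus ?thesis using ej by (simp add: ell_def)
    next
      case (Suc k)
      thus ?thesis using ej av_nonneg[OF S(3), of k] j(1) by (simp add: ell_def)
    qed
    hence "av (slice v) j = 1"
      using av_slice[OF v1 j(1)] by (auto simp: av_diff min_def split: if_splits)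
    moreover have "av (slice v) j \<le> av (slice v) (i - 1)"
      using ji i(1) by (intro av_mono[OF S(1)]) auto
    moreover have "av (slice v) i \<le> 1" using av_slice[OF v1 i(1)] by simp
    ultimately show False using ei ji by (simp add: ell_def split: if_splits)
  qed
  thus "\<sigma> \<le> \<tau>" using i j es_le by simp
qed

text \<open>
  The function with value 1 on the whole chain, a path of degree \<open>n + 1\<close>: an interior point of
  the cone.
\<close>

definition hvec :: "nat \<Rightarrow>\<^sub>0 int" where
  "hvec = vec n (\<lambda>j. int (\<beta> j) * (int j + 1)) (int n + 1)"

lemma av_hvec: "j \<le> n \<Longrightarrow> av hvec j = of_nat j + 1"
  using \<beta>_pos[of j] by (cases "j = n") (auto simp: av_def hvec_def lookup_vec \<beta>_def)

lemma ell_hvec: "j \<le> n \<Longrightarrow> ell j hvec = 1"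
  by (cases j) (simp_all add: ell_def av_hvec)

end

section \<open>The polynomial ring in the LS-paths of degree 1\<close>

lemma LS_ring_simps [simp]:
  "f \<in> carrier (LS_ring b) \<longleftrightarrow> (\<forall>m\<in>keys f. keys m \<subseteq> LS1 b)"
  "f \<otimes>\<^bsub>LS_ring b\<^esub> g = f * g" "f \<oplus>\<^bsub>LS_ring b\<^esub> g = f + g" "\<one>\<^bsub>LS_ring b\<^esub> = 1" "\<zero>\<^bsub>LS_ring b\<^esub> = 0"
  "cst (LS_ring b) c = single 0 c"
  by (simp_all add: LS_ring_def)

lemma LS_ring_closed:
  assumes "f \<in> carrier (LS_ring b)" "g \<in> carrier (LS_ring b)"
  shows "f + g \<in> carrier (LS_ring b)" "f * g \<in> carrier (LS_ring b)" "- f \<in> carrier (LS_ring b)"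
proof -
  show "f + g \<in> carrier (LS_ring b)" using assms keys_add[of f g] by (auto simp: LS_ring_def)
  show "- f \<in> carrier (LS_ring b)" using assms by (auto simp: LS_ring_def in_keys_iff)
  show "f * g \<in> carrier (LS_ring b)"
    unfolding LS_ring_simps
  proof
    fix m assume "m \<in> keys (f * g)"
    then obtain a c where m: "a \<in> keys f" "c \<in> keys g" "m = a + c" using keys_mult[of f g] by blast
    thus "keys m \<subseteq> LS1 b" using assms[unfolded LS_ring_simps] keys_add[of a c] by blast
  qed
qed

lemma kalgebra_LS_ring: "kalgebra (LS_ring b :: (('s::order, 'k::field) lspoly, 'k) kalg)"
proof -
  let ?R = "LS_ring b :: (('s, 'k) lspoly, 'k) kalg"
  note C = LS_ring_closed[of _ b]
  have "cring ?R"
  proof (rule cringI)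
    show "abelian_group ?R"
    proof (rule abelian_groupI)
      fix f assume "f \<in> carrier ?R"
      hence "- f \<in> carrier ?R" "- f \<oplus>\<^bsub>?R\<^esub> f = \<zero>\<^bsub>?R\<^esub>" using C(3) by auto
      thus "\<exists>y\<in>carrier ?R. y \<oplus>\<^bsub>?R\<^esub> f = \<zero>\<^bsub>?R\<^esub>" by blast
    qed (use C(1) in \<open>auto simp: add_ac simp del: LS_ring_simps(1)\<close>, simp)
    show "comm_monoid ?R"
      by (rule comm_monoidI) (use C(2) in \<open>auto simp: mult_ac simp del: LS_ring_simps(1)\<close>, simp)
  qed (auto simp: algebra_simps)
  then interpret cring ?R .
  show ?thesis
    by unfold_locales (auto simp: ring_hom_def single_add mult_single split: if_splits)
qed

lemma LS_ring_minus:
  assumes "f \<in> carrier (LS_ring b)"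
  shows "\<ominus>\<^bsub>LS_ring b\<^esub> f = - f"
proof -
  interpret kalgebra "LS_ring b" by (rule kalgebra_LS_ring)
  show ?thesis
    by (rule minus_equality) (use assms LS_ring_closed(3)[OF assms assms] in \<open>auto simp del: LS_ring_simps(1)\<close>)
qed

lemma ideal_LS_ring:
  assumes "ideal I (LS_ring b)"
  shows "f \<in> I \<Longrightarrow> f \<in> carrier (LS_ring b)" "0 \<in> I" "f \<in> I \<Longrightarrow> g \<in> I \<Longrightarrow> f + g \<in> I"
    "f \<in> I \<Longrightarrow> g \<in> carrier (LS_ring b) \<Longrightarrow> g * f \<in> I" "f \<in> I \<Longrightarrow> - f \<in> I" "f \<in> I \<Longrightarrow> g \<in> I \<Longrightarrow> f - g \<in> I"
proof -
  interpret I: ideal I "LS_ring b" by fact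
  show c: "f \<in> I \<Longrightarrow> f \<in> carrier (LS_ring b)" for f using I.Icarr by blast
  show "0 \<in> I" using additive_subgroup.zero_closed[OF I.is_additive_subgroup] by (simp only: LS_ring_simps)
  show a: "f \<in> I \<Longrightarrow> g \<in> I \<Longrightarrow> f + g \<in> I" for f g
    using additive_subgroup.a_closed[OF I.is_additive_subgroup, of f g] by (simp only: LS_ring_simps)
  show "f \<in> I \<Longrightarrow> g \<in> carrier (LS_ring b) \<Longrightarrow> g * f \<in> I" using I.I_l_closed[of f g] by (simp only: LS_ring_simps(2))
  show m: "- f \<in> I" if "f \<in> I" for f 
    using additive_subgroup.a_inv_closed[OF I.is_additive_subgroup that] by (simp only: LS_ring_minus[OF c[OF that]])
  show "f \<in> I \<Longrightarrow> g \<in> I \<Longrightarrow> f - g \<in> I" using a[of f "- g"] m[of g] by simp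
qed

lemma ideal_sum_LS_ring:
  assumes "ideal I (LS_ring b)" "\<And>i. i \<in> A \<Longrightarrow> f i \<in> I"
  shows "(\<Sum>i\<in>A. f i) \<in> I"
  using assms(2)
  by (induction A rule: infinite_finite_induct) (auto intro: ideal_LS_ring(2,3)[OF assms(1)])

lemma LS_var_carrier: "\<pi> \<in> LS1 b \<Longrightarrow> LS_var \<pi> \<in> carrier (LS_ring b)"
  by (auto simp: LS_var_def)

definition LS_gens :: "('s::order \<Rightarrow> 's \<Rightarrow> nat) \<Rightarrow> ('s, 'k::field) lspoly set" where
  "LS_gens b =
     {LS_var \<pi>1 * LS_var \<pi>2 - LS_var \<rho>1 * LS_var \<rho>2 | \<pi>1 \<pi>2 \<rho>1 \<rho>2.
         \<pi>1 \<in> LS1 b \<and> \<pi>2 \<in> LS1 b \<and> \<not> standard {#\<pi>1, \<pi>2#} \<and> comparable_supports {#\<pi>1, \<pi>2#} \<and>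
         canonical_form b {#\<pi>1, \<pi>2#} {#\<rho>1, \<rho>2#}} \<union>
      {LS_var \<pi>1 * LS_var \<pi>2 | \<pi>1 \<pi>2.
         \<pi>1 \<in> LS1 b \<and> \<pi>2 \<in> LS1 b \<and> \<not> standard {#\<pi>1, \<pi>2#} \<and> \<not> comparable_supports {#\<pi>1, \<pi>2#}}"

lemma LS_ideal_eq: "LS_ideal b = genideal (LS_ring b) (LS_gens b)"
  by (simp add: LS_ideal_def LS_gens_def)

lemma LS_gens_carrier: "LS_gens b \<subseteq> carrier (LS_ring b)"
proof -
  have m: "LS_var x * LS_var y \<in> carrier (LS_ring b)" if "x \<in> LS1 b" "y \<in> LS1 b" for x y
    by (rule LS_ring_closed(2)[OF LS_var_carrier[OF that(1)] LS_var_carrier[OF that(2)]])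
  have d: "f - g \<in> carrier (LS_ring b)" if "f \<in> carrier (LS_ring b)" "g \<in> carrier (LS_ring b)" for f g
    using LS_ring_closed(1)[OF that(1) LS_ring_closed(3)[OF that(2) that(2)]] by simp
  show ?thesis
    unfolding LS_gens_def canonical_form_def
    by (auto intro!: m d simp del: LS_ring_simps(1))
qed

lemma LS_ideal_ideal: "ideal (LS_ideal b) (LS_ring b)"
proof -
  interpret kalgebra "LS_ring b" by (rule kalgebra_LS_ring)
  show ?thesis unfolding LS_ideal_eq by (rule genideal_ideal[OF LS_gens_carrier])
qed

lemma chain_gens_carrier: "LS_ideal b \<union> {LS_var \<pi> | \<pi>. \<pi> \<in> LS1 b \<and> \<not> supp \<pi> \<subseteq> C} \<subseteq> carrier (LS_ring b)"
  using ideal_LS_ring(1)[OF LS_ideal_ideal] LS_var_carrier by (auto simp del: LS_ring_simps(1))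

lemma chain_ideal_ideal: "ideal (chain_ideal b C) (LS_ring b)"
proof -
  interpret kalgebra "LS_ring b" by (rule kalgebra_LS_ring)
  show ?thesis unfolding chain_ideal_def by (rule genideal_ideal[OF chain_gens_carrier])
qed

lemma chain_ideal_contains:
  "LS_gens b \<subseteq> LS_ideal b" "LS_ideal b \<subseteq> chain_ideal b C"
  "\<pi> \<in> LS1 b \<Longrightarrow> \<not> supp \<pi> \<subseteq> C \<Longrightarrow> LS_var \<pi> \<in> chain_ideal b C"
proof -
  interpret kalgebra "LS_ring b" by (rule kalgebra_LS_ring)
  show "LS_gens b \<subseteq> LS_ideal b" unfolding LS_ideal_eq by (rule genideal_self[OF LS_gens_carrier])
  show "LS_ideal b \<subseteq> chain_ideal b C" "\<pi> \<in> LS1 b \<Longrightarrow> \<not> supp \<pi> \<subseteq> C \<Longrightarrow> LS_var \<pi> \<in> chain_ideal b C"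
    using genideal_self[OF chain_gens_carrier] unfolding chain_ideal_def by blast+
qed

text \<open>The linear extension of a map on monomials.\<close>

definition lin :: "('m \<Rightarrow> 'k::field lpoly) \<Rightarrow> ('m \<Rightarrow>\<^sub>0 'k) \<Rightarrow> 'k lpoly" where
  "lin \<chi> f = (\<Sum>m\<in>keys f. single 0 (lookup f m) * \<chi> m)"

lemma lin_superset:
  "finite A \<Longrightarrow> keys f \<subseteq> A \<Longrightarrow> lin \<chi> f = (\<Sum>m\<in>A. single 0 (lookup f m) * \<chi> m)"
  unfolding lin_def by (rule sum.mono_neutral_left) (auto simp: in_keys_iff)

lemma lin_add: "lin \<chi> (f + g) = lin \<chi> f + lin \<chi> g"
proof -
  let ?A = "keys f \<union> keys g"
  have "lin \<chi> (f + g) = (\<Sum>m\<in>?A. single 0 (lookup (f + g) m) * \<chi> m)"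
    by (rule lin_superset) (use keys_add[of f g] in auto)
  also have "\<dots> = (\<Sum>m\<in>?A. single 0 (lookup f m) * \<chi> m) + (\<Sum>m\<in>?A. single 0 (lookup g m) * \<chi> m)"
    by (simp add: lookup_add single_add distrib_right sum.distrib)
  also have "\<dots> = lin \<chi> f + lin \<chi> g"
    using lin_superset[of ?A f \<chi>] lin_superset[of ?A g \<chi>] by simp
  finally show ?thesis .
qed

lemma lin_zero [simp]: "lin \<chi> 0 = 0" and lin_single: "lin \<chi> (single m c) = single 0 c * \<chi> m"
  by (simp_all add: lin_def)

lemma lin_sum: "lin \<chi> (\<Sum>i\<in>I. f i) = (\<Sum>i\<in>I. lin \<chi> (f i))"
  by (induction I rule: infinite_finite_induct) (simp_all add: lin_add)

lemma lin_uminus: "lin \<chi> (- f) = - lin \<chi> f"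
  using lin_add[of \<chi> f "- f"] by (simp add: eq_neg_iff_add_eq_0 add.commute)

lemma lin_diff: "lin \<chi> (f - g) = lin \<chi> f - lin \<chi> g"
  using lin_add[of \<chi> f "- g"] by (simp add: lin_uminus)

lemma lin_mult:
  fixes \<chi> :: "'m::comm_monoid_add \<Rightarrow> 'k::field lpoly"
  assumes "\<And>m m'. \<chi> (m + m') = \<chi> m * \<chi> m'"
  shows "lin \<chi> (f * g) = lin \<chi> f * lin \<chi> g"
proof -
  have "lin \<chi> (f * g) = (\<Sum>u\<in>keys f. \<Sum>v\<in>keys g.
      single 0 (lookup f u * lookup g v) * (\<chi> u * \<chi> v))"
    by (subst mult_sum_single) (simp add: lin_sum lin_single assms)
  also have "\<dots> = (\<Sum>u\<in>keys f. \<Sum>v\<in>keys g.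
      (single 0 (lookup f u) * \<chi> u) * (single 0 (lookup g v) * \<chi> v))"
  proof (intro sum.cong refl)
    fix u v
    have "single (0 :: nat \<Rightarrow>\<^sub>0 int) (lookup f u * lookup g v)
        = single 0 (lookup f u) * single 0 (lookup g v)"
      by (simp add: mult_single)
    thus "single 0 (lookup f u * lookup g v) * (\<chi> u * \<chi> v)
      = (single 0 (lookup f u) * \<chi> u) * (single 0 (lookup g v) * \<chi> v)"
      by (simp only: mult_ac)
  qed
  also have "\<dots> = lin \<chi> f * lin \<chi> g" by (simp add: lin_def sum_product)
  finally show ?thesis .
qed

section \<open>Straightening\<close>

locale ls_chain_algebra = ls_chain b es n
  for b :: "'s::{finite, order} \<Rightarrow> 's \<Rightarrow> nat" and es n +
  fixes field_type :: "'k::field itself"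
begin

abbreviation R where "R \<equiv> (LS_ring b :: (('s, 'k) lspoly, 'k) kalg)"
abbreviation I where "I \<equiv> (chain_ideal b E :: ('s, 'k) lspoly set)"

abbreviation mon :: "(('s \<Rightarrow> rat) \<Rightarrow>\<^sub>0 nat) \<Rightarrow> ('s, 'k) lspoly" where
  "mon m \<equiv> single m 1"

abbreviation var :: "('s \<Rightarrow> rat) \<Rightarrow> (('s \<Rightarrow> rat) \<Rightarrow>\<^sub>0 nat)" where
  "var \<pi> \<equiv> single \<pi> (Suc 0)"

abbreviation good :: "(('s \<Rightarrow> rat) \<Rightarrow>\<^sub>0 nat) \<Rightarrow> bool" where "good m \<equiv> keys m \<subseteq> P1"

definition expoM :: "(('s \<Rightarrow> rat) \<Rightarrow>\<^sub>0 nat) \<Rightarrow> (nat \<Rightarrow>\<^sub>0 int)" where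
  "expoM m = (\<Sum>\<pi>\<in>keys m. of_nat (lookup m \<pi>) * expo \<pi>)"

lemma expoM_add: "expoM (m + m') = expoM m + expoM m'"
proof -
  let ?A = "keys m \<union> keys m'"
  have sup: "expoM x = (\<Sum>\<pi>\<in>?A. of_nat (lookup x \<pi>) * expo \<pi>)" if "keys x \<subseteq> ?A" for x
    unfolding expoM_def using that by (intro sum.mono_neutral_left) (auto simp: in_keys_iff)
  show ?thesis
    using sup[of "m + m'"] sup[of m] sup[of m'] keys_add[of m m']
    by (simp add: lookup_add distrib_right sum.distrib)
qed

lemma expoM_var [simp]: "expoM (var \<pi>) = expo \<pi>" and expoM_zero [simp]: "expoM 0 = 0"
  by (simp_all add: expoM_def)

lemma keys_add_nat: "keys (m + m' :: 'x \<Rightarrow>\<^sub>0 nat) = keys m \<union> keys m'"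
  by (auto simp: in_keys_iff lookup_add)

lemma split_var:
  assumes "\<pi> \<in> keys m"
  obtains m' where "m = var \<pi> + m'"
proof -
  have "m = var \<pi> + (m - var \<pi>)"
    using assms by (intro poly_mapping_eqI) (auto simp: lookup_add lookup_minus lookup_single when_def in_keys_iff)
  thus thesis using that by blast
qed

definition mass :: "(('s \<Rightarrow> rat) \<Rightarrow>\<^sub>0 nat) \<Rightarrow> nat" where
  "mass m = (\<Sum>\<pi>\<in>keys m. lookup m \<pi>)"

lemma mass_add: "mass (m + m') = mass m + mass m'"
proof -
  have sup: "mass x = (\<Sum>\<pi>\<in>keys m \<union> keys m'. lookup x \<pi>)" if "keys x \<subseteq> keys m \<union> keys m'" for x
    unfolding mass_def using that by (intro sum.mono_neutral_left) (auto simp: in_keys_iff)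
  show ?thesis
    using sup[of "m + m'"] sup[of m] sup[of m'] by (simp add: keys_add_nat lookup_add sum.distrib)
qed

lemma mass_var [simp]: "mass (var \<pi>) = 1" and mass_zero [simp]: "mass 0 = 0"
  by (simp_all add: mass_def)

lemma keys_eq_empty_nat: "keys (m :: 'x \<Rightarrow>\<^sub>0 nat) = {} \<longleftrightarrow> m = 0"
proof
  assume "keys m = {}"
  hence "lookup m x = 0" for x by (metis in_keys_iff empty_iff)
  thus "m = 0" by (metis lookup_zero poly_mapping_eqI)
qed simp

lemma mass_eq_0: "mass m = 0 \<longleftrightarrow> m = 0"
proof
  assume "mass m = 0"
  hence "lookup m x = 0" if "x \<in> keys m" for x using that unfolding mass_def by simp
  hence "keys m = {}" by (metis in_keys_iff ex_in_conv)
  thus "m = 0" by (metis keys_eq_empty_nat)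
qed simp

lemma good_expoM:
  assumes "good m"
  shows "expoM m \<in> K \<and> lookup (expoM m) n = int (mass m)"
  using assms
proof (induction "mass m" arbitrary: m)
  case 0
  hence "m = 0" using mass_eq_0 by metis
  thus ?case by (simp add: K_zero)
next
  case (Suc k)
  hence "m \<noteq> 0" by auto
  then obtain \<pi> where \<pi>: "\<pi> \<in> keys m" by (metis keys_eq_empty_nat ex_in_conv)
  then obtain m' where m': "m = var \<pi> + m'" by (rule split_var)
  have p: "\<pi> \<in> P1" using \<pi> Suc.prems by blast
  have "good m'" "mass m' = k" using Suc m' by (auto simp: keys_add_nat mass_add)
  thus ?case
    using Suc.hyps(1)[of m'] m' expo_K[OF p] K_add by (simp add: expoM_add lookup_add mass_add)
qed

lemma mon_add: "mon (m + m') = mon m * mon m'"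
  by (simp add: mult_single)

lemma LS_var_mon: "LS_var \<pi> = mon (var \<pi>)"
  by (simp add: LS_var_def)

lemma good_carrier: "good m \<Longrightarrow> mon m \<in> carrier R"
  by (auto simp: P1_def)

definition eqI :: "('s, 'k) lspoly \<Rightarrow> ('s, 'k) lspoly \<Rightarrow> bool" where
  "eqI f g \<longleftrightarrow> f - g \<in> I"

lemma eqI_refl: "eqI f f"
  unfolding eqI_def using ideal_LS_ring(2)[OF chain_ideal_ideal] by simp

lemma eqI_trans: "eqI f g \<Longrightarrow> eqI g h \<Longrightarrow> eqI f h"
  unfolding eqI_def using ideal_LS_ring(3)[OF chain_ideal_ideal, of "f - g" b E "g - h"] by simp

lemma eqI_sym: "eqI f g \<Longrightarrow> eqI g f"
  unfolding eqI_def using ideal_LS_ring(5)[OF chain_ideal_ideal, of "f - g" b E] by simp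

lemma eqI_mult: "eqI f g \<Longrightarrow> h \<in> carrier R \<Longrightarrow> eqI (h * f) (h * g)"
  unfolding eqI_def using ideal_LS_ring(4)[OF chain_ideal_ideal, of "f - g" b E h]
  by (simp add: right_diff_distrib)

text \<open>
  For a product that is not standard this is a defining relation; a standard product is equal to the
  right-hand side.
\<close>

lemma straighten_pair:
  assumes p: "\<pi>1 \<in> P1" "\<pi>2 \<in> P1"
  defines "v \<equiv> expo \<pi>1 + expo \<pi>2"
  shows "eqI (mon (var \<pi>1 + var \<pi>2)) (mon (var (path (slice v)) + var (path (v - slice v))))"
proof -
  let ?\<rho>1 = "path (slice v)" and ?\<rho>2 = "path (v - slice v)"
  have v: "v \<in> K" "lookup v n = 2"
    using K_add[OF expo_K(1)[OF p(1)] expo_K(1)[OF p(2)]] expo_K(2)[OF p(1)] expo_K(2)[OF p(2)]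
    by (simp_all add: v_def lookup_add)
  hence v1: "1 \<le> lookup v n" by simp
  note S = slice_K[OF v(1) v1]
  have r: "?\<rho>1 \<in> P1" "?\<rho>2 \<in> P1" using S v path_P1 by auto
  show ?thesis
  proof (cases "standard {#\<pi>1, \<pi>2#}")
    case True
    then obtain xs where xs: "mset xs = {#\<pi>1, \<pi>2#}"
      "successively (\<lambda>\<pi> \<rho>. \<forall>\<sigma>\<in>supp \<pi>. \<forall>\<tau>\<in>supp \<rho>. \<sigma> \<le> \<tau>) xs" unfolding standard_def by blast
    have "xs = [\<pi>1, \<pi>2] \<or> xs = [\<pi>2, \<pi>1]"
    proof -
      have "length xs = 2" using arg_cong[OF xs(1), of size] by simp
      then obtain a c where "xs = [a, c]" by (auto simp: numeral_2_eq_2 length_Suc_conv)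
      thus ?thesis using xs(1) by (auto simp: add_eq_conv_ex)
    qed
    thus ?thesis
    proof
      assume "xs = [\<pi>1, \<pi>2]"
      hence "slice v = expo \<pi>1" using xs(2) standard_imp_slice[OF p] by (simp add: v_def)
      hence "?\<rho>1 = \<pi>1" "?\<rho>2 = \<pi>2" using path_expo p by (simp_all add: v_def)
      thus ?thesis using eqI_refl by simp
    next
      assume "xs = [\<pi>2, \<pi>1]"
      hence "slice v = expo \<pi>2" using xs(2) standard_imp_slice[OF p(2,1)] by (simp add: v_def add.commute)
      hence "?\<rho>1 = \<pi>2" "?\<rho>2 = \<pi>1" using path_expo p by (simp_all add: v_def)
      thus ?thesis using eqI_refl by (simp add: add.commute)
    qed
  next
    case False
    have "comparable_supports {#\<pi>1, \<pi>2#}"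
      using P1_D(1)[OF p(1)] P1_D(1)[OF p(2)] E_chain
      unfolding comparable_supports_def Complete_Partial_Order.chain_def by (simp, blast)
    moreover have "canonical_form b {#\<pi>1, \<pi>2#} {#?\<rho>1, ?\<rho>2#}"
      unfolding canonical_form_def
    proof (intro conjI allI)
      show "set_mset {#?\<rho>1, ?\<rho>2#} \<subseteq> LS1 b" using r P1_D(5) by auto
      show "standard {#?\<rho>1, ?\<rho>2#}"
        unfolding standard_def using slice_standard[OF v] by (intro exI[of _ "[?\<rho>1, ?\<rho>2]"]) simp
      fix \<sigma>
      show "(\<Sum>\<pi>\<in>#{#?\<rho>1, ?\<rho>2#}. \<pi> \<sigma>) = (\<Sum>\<pi>\<in>#{#\<pi>1, \<pi>2#}. \<pi> \<sigma>)"
      proof (cases "\<sigma> \<in> E")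
        case True
        then obtain j where j: "j \<le> n" "\<sigma> = es ! j" using E_cases by blast
        have "ell j (slice v) + ell j (v - slice v) = ell j (expo \<pi>1) + ell j (expo \<pi>2)"
        proof -
          have ad: "ell j (x + y) = ell j x + ell j y" for x y using ell_additive[of j] by (simp add: additive_def)
          have "ell j (slice v) + ell j (v - slice v) = ell j v" by (simp flip: ad)
          thus ?thesis by (simp add: v_def ad)
        qed
        thus ?thesis using j p by (simp add: path_es ell_expo)
      next
        case False
        hence "\<pi>1 \<sigma> = 0" "\<pi>2 \<sigma> = 0" using P1_D(1)[OF p(1)] P1_D(1)[OF p(2)] by (auto simp: supp_def)
        thus ?thesis using False by (simp add: path_def)
      qed
    qed simp
    ultimately have "LS_var \<pi>1 * LS_var \<pi>2 - LS_var ?\<rho>1 * LS_var ?\<rho>2 \<in> (LS_gens b :: ('s, 'k) lspoly set)"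
      unfolding LS_gens_def using False P1_D(5) p by blast
    hence "LS_var \<pi>1 * LS_var \<pi>2 - LS_var ?\<rho>1 * LS_var ?\<rho>2 \<in> I"
      using chain_ideal_contains(1,2) by blast
    thus ?thesis by (simp only: eqI_def LS_var_mon mon_add)
  qed
qed

text \<open>
  A monomial is congruent to one whose first factor is the first piece of the sum of its factors: this holds
  for the product of all factors but one by induction, and straightening the two factors \<open>\<pi>\<close> and \<open>\<rho>1\<close>
  then produces that piece.
\<close>

lemma split_first:
  assumes "good m" "mass m = Suc d"
  shows "\<exists>m'. good m' \<and> eqI (mon m) (mon (var (path (slice (expoM m))) + m'))
    \<and> expoM m' = expoM m - slice (expoM m) \<and> mass m' = d"
  using assms
proof (induction d arbitrary: m)
  case 0
  hence "m \<noteq> 0" by auto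
  then obtain \<pi> where \<pi>: "\<pi> \<in> keys m" by (metis keys_eq_empty_nat ex_in_conv)
  then obtain m' where m': "m = var \<pi> + m'" by (rule split_var)
  hence "m' = 0" using 0 by (simp add: mass_add mass_eq_0)
  moreover have p: "\<pi> \<in> P1" using \<pi> 0 by blast
  ultimately have "expoM m = expo \<pi>" "slice (expo \<pi>) = expo \<pi>" "path (expo \<pi>) = \<pi>" "m = var \<pi>"
    using m' slice_deg1 expo_K path_expo by auto
  thus ?case using eqI_refl by (intro exI[of _ 0]) simp
next
  case (Suc d)
  hence "m \<noteq> 0" by auto
  then obtain \<pi> where \<pi>: "\<pi> \<in> keys m" by (metis keys_eq_empty_nat ex_in_conv)
  then obtain m1 where m1: "m = var \<pi> + m1" by (rule split_var)
  have p: "\<pi> \<in> P1" using \<pi> Suc.prems by blast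
  have g1: "good m1" "mass m1 = Suc d" using Suc.prems m1 by (auto simp: keys_add_nat mass_add)
  let ?w = "expoM m1"
  have w: "?w \<in> K" "1 \<le> lookup ?w n" using good_expoM[OF g1(1)] g1(2) by auto
  define \<rho> where "\<rho> = path (slice ?w)"
  have \<rho>: "\<rho> \<in> P1" "expo \<rho> = slice ?w"
    using slice_K[OF w] path_P1 expo_path by (auto simp: \<rho>_def)
  obtain m' where m': "good m'" "eqI (mon m1) (mon (var \<rho> + m'))" "expoM m' = ?w - slice ?w" "mass m' = d"
    using Suc.IH[OF g1] \<rho>_def by blast
  let ?v = "expo \<pi> + expo \<rho>"
  have v: "?v \<in> K" "lookup ?v n = 2"
    using K_add[OF expo_K(1)[OF p] expo_K(1)[OF \<rho>(1)]] expo_K(2)[OF p] expo_K(2)[OF \<rho>(1)]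
    by (simp_all add: lookup_add)
  have sv: "slice ?v = slice (expoM m)"
    using slice_add_slice[OF expo_K(1)[OF p] w] by (simp add: \<rho>(2) m1 expoM_add)
  define \<rho>2 where "\<rho>2 = path (?v - slice ?v)"
  have \<rho>2: "\<rho>2 \<in> P1" "expo \<rho>2 = ?v - slice ?v"
    using slice_K[OF v(1)] v(2) path_P1 expo_path by (auto simp: \<rho>2_def)
  have e1: "eqI (mon m) (mon (var \<pi>) * mon (var \<rho> + m'))"
    unfolding m1 mon_add[of "var \<pi>" m1] by (rule eqI_mult[OF m'(2) good_carrier]) (use p in simp)
  have e2: "mon (var \<pi>) * mon (var \<rho> + m') = mon m' * mon (var \<pi> + var \<rho>)"
    by (simp add: mult_single add_ac)
  have e3: "eqI (mon m' * mon (var \<pi> + var \<rho>)) (mon m' * mon (var (path (slice ?v)) + var \<rho>2))"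
    unfolding \<rho>2_def by (rule eqI_mult[OF straighten_pair[OF p \<rho>(1)] good_carrier[OF m'(1)]])
  have e4: "mon m' * mon (var (path (slice ?v)) + var \<rho>2) = mon (var (path (slice (expoM m))) + (var \<rho>2 + m'))"
    unfolding sv by (simp add: mult_single add_ac)
  have "eqI (mon m) (mon (var (path (slice (expoM m))) + (var \<rho>2 + m')))"
    by (rule eqI_trans[OF e1[unfolded e2] e3[unfolded e4]])
  moreover have "good (var \<rho>2 + m')" using \<rho>2 m' by (simp add: keys_add_nat)
  moreover have "expoM (var \<rho>2 + m') = expoM m - slice (expoM m)"
    using m'(3) \<rho>2(2) \<rho>(2) sv by (simp add: expoM_add m1)
  ultimately show ?case using m'(4) by (intro exI[of _ "var \<rho>2 + m'"]) (simp add: mass_add)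
qed

text \<open>
  By \<open>split_first\<close>, both monomials are congruent to products with the same first factor, and
  the other factors have equal exponents again.
\<close>

lemma equal_exponents:
  assumes "good m" "good m'" "expoM m = expoM m'"
  shows "eqI (mon m) (mon m')"
  using assms
proof (induction "mass m" arbitrary: m m')
  case 0
  hence "mass m' = 0" using good_expoM[of m] good_expoM[of m'] by simp
  hence "m = 0" "m' = 0" using 0 mass_eq_0 by auto
  thus ?case using eqI_refl by simp
next
  case (Suc d)
  have d': "mass m' = Suc d" using Suc good_expoM[of m] good_expoM[of m'] by simp
  obtain x where x: "good x" "eqI (mon m) (mon (var (path (slice (expoM m))) + x))"
    "expoM x = expoM m - slice (expoM m)" "mass x = d"
    using split_first[OF Suc.prems(1) Suc.hyps(2)[symmetric]] by blast
  obtain y where y: "good y" "eqI (mon m') (mon (var (path (slice (expoM m'))) + y))"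
    "expoM y = expoM m' - slice (expoM m')" "mass y = d"
    using split_first[OF Suc.prems(2) d'] by blast
  have k: "1 \<le> lookup (expoM m) n" "expoM m \<in> K" using good_expoM[OF Suc.prems(1)] Suc.hyps(2) by auto
  have "path (slice (expoM m)) \<in> P1" using slice_K[OF k(2,1)] path_P1 by blast
  hence c: "mon (var (path (slice (expoM m)))) \<in> carrier R" by (intro good_carrier) simp
  have "eqI (mon x) (mon y)" using Suc.hyps(1)[of x y] x y Suc.prems by simp
  hence "eqI (mon (var (path (slice (expoM m))) + x)) (mon (var (path (slice (expoM m))) + y))"
    unfolding mon_add by (rule eqI_mult[OF _ c])
  thus ?case using x(2) y(2) Suc.prems(3) eqI_trans eqI_sym by metis
qed

lemma monomial_of_exponent:
  assumes "v \<in> K"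
  shows "\<exists>m. good m \<and> expoM m = v"
  using assms
proof (induction "nat (lookup v n)" arbitrary: v)
  case 0
  hence z: "lookup v n = 0" by (simp add: cone_def)
  have "v = 0"
  proof (rule av_eqI)
    fix j assume "j \<le> n"
    thus "av v j = av 0 j"
      using av_nonneg[OF 0(2), of j] av_mono[OF 0(2), of j n] z by (simp add: av_n) (simp add: av_def[of 0])
  qed (use K_keys[OF 0(2)] in auto)
  thus ?case by (intro exI[of _ 0]) simp
next
  case (Suc d)
  hence k: "1 \<le> lookup v n" by simp
  note S = slice_K[OF Suc.prems k]
  have "d = nat (lookup (v - slice v) n)" using S(4) Suc.hyps(2) by simp
  then obtain m where m: "good m" "expoM m = v - slice v" using Suc.hyps(1) S(3) by blast
  have "path (slice v) \<in> P1" "expo (path (slice v)) = slice v" using S path_P1 expo_path by auto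
  thus ?case
    using m by (intro exI[of _ "var (path (slice v)) + m"]) (simp add: keys_add_nat expoM_add)
qed

subsection \<open>The ideal of a chain as a kernel\<close>

definition \<chi> :: "(('s \<Rightarrow> rat) \<Rightarrow>\<^sub>0 nat) \<Rightarrow> 'k lpoly" where
  "\<chi> m = (if good m then lmonom (expoM m) else 0)"

lemma \<chi>_add: "\<chi> (m + m') = \<chi> m * \<chi> m'"
  by (auto simp: \<chi>_def keys_add_nat expoM_add lmonom_def mult_single)

definition \<Psi>0 :: "('s, 'k) lspoly \<Rightarrow> 'k lpoly" where
  "\<Psi>0 = lin \<chi>"

lemma \<Psi>0_simps:
  "\<Psi>0 (f + g) = \<Psi>0 f + \<Psi>0 g" "\<Psi>0 (f * g) = \<Psi>0 f * \<Psi>0 g" "\<Psi>0 (f - g) = \<Psi>0 f - \<Psi>0 g"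
  "\<Psi>0 0 = 0" "\<Psi>0 (single 0 c) = single 0 c" "\<Psi>0 1 = 1"
  "\<Psi>0 (mon m) = \<chi> m"
proof -
  show "\<Psi>0 (f + g) = \<Psi>0 f + \<Psi>0 g" "\<Psi>0 (f - g) = \<Psi>0 f - \<Psi>0 g" "\<Psi>0 0 = 0" "\<Psi>0 (mon m) = \<chi> m"
    by (simp_all add: \<Psi>0_def lin_add lin_diff lin_single)
  show "\<Psi>0 (f * g) = \<Psi>0 f * \<Psi>0 g" unfolding \<Psi>0_def by (rule lin_mult[OF \<chi>_add])
  show s: "\<Psi>0 (single 0 c) = single 0 c" for c
    by (simp add: \<Psi>0_def lin_single \<chi>_def lmonom_def)
  show "\<Psi>0 1 = 1" using s[of 1] by simp
qed

lemma \<Psi>0_sum: "\<Psi>0 (\<Sum>i\<in>A. f i) = (\<Sum>i\<in>A. \<Psi>0 (f i))"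
  by (simp add: \<Psi>0_def lin_sum)

lemma \<Psi>0_var: "\<pi> \<in> LS1 b \<Longrightarrow> \<Psi>0 (LS_var \<pi>) = (if supp \<pi> \<subseteq> E then lmonom (expo \<pi>) else 0)"
  by (simp add: LS_var_mon \<Psi>0_simps \<chi>_def P1_def)

lemma \<Psi>0_gens:
  assumes "f \<in> LS_gens b"
  shows "\<Psi>0 f = 0"
proof -
  consider \<pi>1 \<pi>2 \<rho>1 \<rho>2 where "f = LS_var \<pi>1 * LS_var \<pi>2 - LS_var \<rho>1 * LS_var \<rho>2"
      "\<pi>1 \<in> LS1 b" "\<pi>2 \<in> LS1 b" "canonical_form b {#\<pi>1, \<pi>2#} {#\<rho>1, \<rho>2#}"
    | \<pi>1 \<pi>2 where "f = LS_var \<pi>1 * LS_var \<pi>2" "\<pi>1 \<in> LS1 b" "\<pi>2 \<in> LS1 b" "\<not> comparable_supports {#\<pi>1, \<pi>2#}"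
    using assms unfolding LS_gens_def by blast
  thus ?thesis
  proof cases
    case 1
    have r: "\<rho>1 \<in> LS1 b" "\<rho>2 \<in> LS1 b" and s: "\<rho>1 \<sigma> + \<rho>2 \<sigma> = \<pi>1 \<sigma> + \<pi>2 \<sigma>" for \<sigma>
      using 1(4) by (auto simp: canonical_form_def)
    have nn: "0 \<le> x \<sigma>" if "x \<in> LS1 b" for x :: "'s \<Rightarrow> rat" and \<sigma> using that by (auto simp: LS1_def LS_path_def)
    have supp_un: "supp x \<union> supp y = {\<sigma>. x \<sigma> + y \<sigma> \<noteq> 0}" if "x \<in> LS1 b" "y \<in> LS1 b" for x y
      using nn[OF that(1)] nn[OF that(2)] by (auto simp: supp_def add_nonneg_eq_0_iff)
    have "supp \<rho>1 \<union> supp \<rho>2 = supp \<pi>1 \<union> supp \<pi>2"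
      using supp_un[OF r] supp_un[OF 1(2,3)] s by simp
    hence iff: "supp \<pi>1 \<subseteq> E \<and> supp \<pi>2 \<subseteq> E \<longleftrightarrow> supp \<rho>1 \<subseteq> E \<and> supp \<rho>2 \<subseteq> E" by blast
    show ?thesis
    proof (cases "supp \<pi>1 \<subseteq> E \<and> supp \<pi>2 \<subseteq> E")
      case True
      hence P: "\<pi>1 \<in> P1" "\<pi>2 \<in> P1" "\<rho>1 \<in> P1" "\<rho>2 \<in> P1"
        using iff 1 r by (auto simp: P1_def)
      have "expo \<pi>1 + expo \<pi>2 = expo \<rho>1 + expo \<rho>2"
      proof (rule av_eqI)
        fix j assume j: "j \<le> n"
        have "cum \<pi>1 j + cum \<pi>2 j = cum \<rho>1 j + cum \<rho>2 j"
          unfolding cum_def by (simp add: s flip: sum.distrib)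
        thus "av (expo \<pi>1 + expo \<pi>2) j = av (expo \<rho>1 + expo \<rho>2) j"
          using av_expo P j by (simp add: av_add)
      next
        have "keys (expo x + expo y) \<subseteq> {..n}" for x y
          using keys_add[of "expo x" "expo y"] keys_expo[of x] keys_expo[of y] by blast
        thus "keys (expo \<pi>1 + expo \<pi>2) \<subseteq> {..n}" "keys (expo \<rho>1 + expo \<rho>2) \<subseteq> {..n}"
          by auto
      qed
      thus ?thesis
        using True iff 1 r by (simp add: \<Psi>0_simps \<Psi>0_var lmonom_def mult_single)
    next
      case False
      thus ?thesis using iff 1 r by (auto simp: \<Psi>0_simps \<Psi>0_var)
    qed
  next
    case 2
    have "\<not> (supp \<pi>1 \<subseteq> E \<and> supp \<pi>2 \<subseteq> E)"
      using 2(4) E_chain by (auto simp: comparable_supports_def Complete_Partial_Order.chain_def)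
    thus ?thesis using 2 by (auto simp: \<Psi>0_simps \<Psi>0_var)
  qed
qed

lemma kernel_ideal: "ideal {f \<in> carrier R. \<Psi>0 f = 0} R"
proof -
  interpret R: kalgebra R by (rule kalgebra_LS_ring)
  show ?thesis
  proof (rule idealI)
    show "ring R" by unfold_locales
    show "subgroup {f \<in> carrier R. \<Psi>0 f = 0} (add_monoid R)"
    proof (rule R.add.subgroupI)
      show "{f \<in> carrier R. \<Psi>0 f = 0} \<noteq> {}"
      proof -
        have "0 \<in> carrier R" by simp
        thus ?thesis using \<Psi>0_simps(4) by blast
      qed
    next
      fix f assume "f \<in> {f \<in> carrier R. \<Psi>0 f = 0}"
      thus "\<ominus>\<^bsub>R\<^esub> f \<in> {f \<in> carrier R. \<Psi>0 f = 0}"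
        using LS_ring_minus[of f b] LS_ring_closed(3)[of f b f] \<Psi>0_simps(3)[of 0 f]
        by (auto simp: \<Psi>0_simps(4) simp del: LS_ring_simps(1))
    next
      fix f g assume "f \<in> {f \<in> carrier R. \<Psi>0 f = 0}" "g \<in> {f \<in> carrier R. \<Psi>0 f = 0}"
      thus "f \<oplus>\<^bsub>R\<^esub> g \<in> {f \<in> carrier R. \<Psi>0 f = 0}"
        using LS_ring_closed(1)[of f b g] by (auto simp: \<Psi>0_simps simp del: LS_ring_simps(1))
    next
      show "{f \<in> carrier R. \<Psi>0 f = 0} \<subseteq> carrier R" by blast
    qed
  next
    fix f g assume fg: "f \<in> {f \<in> carrier R. \<Psi>0 f = 0}" "g \<in> carrier R"
    thus "g \<otimes>\<^bsub>R\<^esub> f \<in> {f \<in> carrier R. \<Psi>0 f = 0}" "f \<otimes>\<^bsub>R\<^esub> g \<in> {f \<in> carrier R. \<Psi>0 f = 0}"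
      using LS_ring_closed(2)[of f b g] by (auto simp: \<Psi>0_simps mult.commute[of g f] simp del: LS_ring_simps(1))
  qed
qed

lemma bad_in_I:
  assumes "keys m \<subseteq> LS1 b" "\<not> good m"
  shows "mon m \<in> I"
proof -
  obtain \<pi> where \<pi>: "\<pi> \<in> keys m" "\<pi> \<notin> P1" using assms(2) by blast
  hence "\<pi> \<in> LS1 b" "\<not> supp \<pi> \<subseteq> E" using assms(1) by (auto simp: P1_def)
  hence "LS_var \<pi> \<in> I" by (rule chain_ideal_contains(3))
  hence v: "mon (var \<pi>) \<in> I" by (simp add: LS_var_mon)
  obtain m' where m': "m = var \<pi> + m'" using \<pi>(1) by (rule split_var)
  have "mon m' \<in> carrier R" using assms(1) m' by (auto simp: keys_add_nat)
  hence "mon m' * mon (var \<pi>) \<in> I" by (rule ideal_LS_ring(4)[OF chain_ideal_ideal v])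
  thus ?thesis by (simp add: m' mult_single add.commute)
qed

text \<open>
  Modulo the ideal every polynomial is a combination of monomials chosen once for every exponent, and these
  have linearly independent images.
\<close>

theorem chain_ideal_eq_kernel: "I = {f \<in> carrier R. \<Psi>0 f = 0}"
proof
  interpret R: kalgebra R by (rule kalgebra_LS_ring)
  have "LS_ideal b \<subseteq> {f \<in> carrier R. \<Psi>0 f = 0}"
    unfolding LS_ideal_eq using LS_gens_carrier \<Psi>0_gens
    by (intro R.genideal_minimal[OF kernel_ideal]) (auto simp del: LS_ring_simps(1))
  thus "I \<subseteq> {f \<in> carrier R. \<Psi>0 f = 0}"
    unfolding chain_ideal_def using LS_var_carrier \<Psi>0_var
    by (intro R.genideal_minimal[OF kernel_ideal]) (auto simp del: LS_ring_simps(1))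
  show "{f \<in> carrier R. \<Psi>0 f = 0} \<subseteq> I"
  proof
    fix f assume f: "f \<in> {f \<in> carrier R. \<Psi>0 f = 0}"
    define rep where "rep v = (SOME m. good m \<and> expoM m = v)" for v
    have rep: "good (rep v)" "expoM (rep v) = v" if "v \<in> K" for v
      using someI_ex[OF monomial_of_exponent[OF that]] by (auto simp: rep_def)
    have cK: "c * mon m \<in> carrier R" if "c = single 0 d" "mon m \<in> carrier R" for c d m
      using that by (auto simp: mult_single split: if_splits)
    let ?c = "\<lambda>m. single 0 (lookup f m) :: ('s, 'k) lspoly"
    let ?G = "{m \<in> keys f. good m}"
    define g where "g = (\<Sum>m\<in>?G. ?c m * mon (rep (expoM m)))"
    have "f = (\<Sum>m\<in>keys f. ?c m * mon m)" by (subst sum_single) (simp add: mult_single)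
    also have "\<dots> = (\<Sum>m\<in>?G. ?c m * mon m) + (\<Sum>m\<in>keys f - ?G. ?c m * mon m)"
      by (subst sum.subset_diff[of ?G]) (auto simp: add.commute)
    finally have fs: "f - g = (\<Sum>m\<in>?G. ?c m * (mon m - mon (rep (expoM m)))) + (\<Sum>m\<in>keys f - ?G. ?c m * mon m)"
      by (simp add: g_def right_diff_distrib sum_subtractf)
    have "f - g \<in> I"
      unfolding fs
    proof (intro ideal_LS_ring(3)[OF chain_ideal_ideal] ideal_sum_LS_ring[OF chain_ideal_ideal]
        ideal_LS_ring(4)[OF chain_ideal_ideal])
      fix m assume "m \<in> ?G"
      hence "good m" "good (rep (expoM m))" "expoM m = expoM (rep (expoM m))"
        using rep good_expoM by auto
      hence "eqI (mon m) (mon (rep (expoM m)))" by (rule equal_exponents)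
      thus "mon m - mon (rep (expoM m)) \<in> I" by (simp add: eqI_def)
      show "?c m \<in> carrier R" by simp
    next
      fix m assume "m \<in> keys f - ?G"
      thus "mon m \<in> I" using f by (intro bad_in_I) auto
      show "?c m \<in> carrier R" by simp
    qed
    moreover have "g = 0"
    proof -
      have "\<Psi>0 g = \<Psi>0 f - \<Psi>0 (f - g)" by (simp add: \<Psi>0_simps)
      also have "\<Psi>0 (f - g) = 0"
        using \<open>f - g \<in> I\<close> \<open>I \<subseteq> {f \<in> carrier R. \<Psi>0 f = 0}\<close> by blast
      finally have z: "\<Psi>0 g = 0" using f by simp
      have "\<Psi>0 g = (\<Sum>m\<in>?G. single (expoM m) (lookup f m))"
        unfolding g_def \<Psi>0_sum
      proof (rule sum.cong[OF refl])
        fix m assume "m \<in> ?G"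
        hence "good (rep (expoM m))" "expoM (rep (expoM m)) = expoM m" using rep good_expoM by auto
        thus "\<Psi>0 (?c m * mon (rep (expoM m))) = single (expoM m) (lookup f m)"
          unfolding \<Psi>0_simps(2,5,7) by (simp add: \<chi>_def lmonom_def mult_single)
      qed
      hence co: "(\<Sum>m\<in>?G. if expoM m = v then lookup f m else 0) = 0" for v
        using arg_cong[OF z, of "\<lambda>x. lookup x v"] by (simp add: lookup_sum lookup_single when_def)
      have "lookup g x = 0" for x
      proof -
        have "lookup g x = (\<Sum>m\<in>?G. if rep (expoM m) = x then lookup f m else 0)"
          by (simp add: g_def lookup_sum mult_single lookup_single when_def)
        also have "\<dots> = (\<Sum>m\<in>?G. if expoM m = expoM x \<and> rep (expoM x) = x then lookup f m else 0)"
          by (intro sum.cong refl) (metis (mono_tags, lifting) good_expoM mem_Collect_eq rep(2))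
        also have "\<dots> = 0" using co[of "expoM x"] by (cases "rep (expoM x) = x") auto
        finally show ?thesis .
      qed
      thus ?thesis by (intro poly_mapping_eqI) simp
    qed
    ultimately show "f \<in> I" by simp
  qed
qed

lemma keys_\<Psi>0: "keys (\<Psi>0 f) \<subseteq> K"
proof -
  have "keys (\<Psi>0 f) \<subseteq> (\<Union>m\<in>keys f. keys (single 0 (lookup f m) * \<chi> m))"
    unfolding \<Psi>0_def lin_def by (rule keys_sum)
  also have "\<dots> \<subseteq> K"
    using good_expoM by (auto simp: \<chi>_def lmonom_def mult_single split: if_splits)
  finally show ?thesis .
qed

end

section \<open>Quotient algebras\<close>

text \<open>
  Homogeneity of ideals passes along a graded epimorphism with homogeneous kernel, because both notions say
  that an ideal has homogeneous generators.
\<close>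

locale graded_epi = R: cring R + B: cring B
  for R :: "('a, 'k) kalg" and B :: "('b, 'l) kalg" +
  fixes \<phi> :: "'a \<Rightarrow> 'b" and G :: "nat \<Rightarrow> 'a set"
  assumes hom: "\<phi> \<in> ring_hom R B" and surj: "carrier B = \<phi> ` carrier R" and G_sub: "G d \<subseteq> carrier R"
    and ker_hom: "{f \<in> carrier R. \<phi> f = \<zero>\<^bsub>B\<^esub>} \<subseteq> genideal R ({f \<in> carrier R. \<phi> f = \<zero>\<^bsub>B\<^esub>} \<inter> (\<Union>d. G d))"
begin

sublocale h: ring_hom_ring R B \<phi>
  by unfold_locales (rule hom)

abbreviation ker where "ker \<equiv> {f \<in> carrier R. \<phi> f = \<zero>\<^bsub>B\<^esub>}"
abbreviation H where "H d \<equiv> \<phi> ` G d"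

lemma eq_imp_ker: "f \<in> carrier R \<Longrightarrow> g \<in> carrier R \<Longrightarrow> \<phi> f = \<phi> g \<Longrightarrow> f \<ominus>\<^bsub>R\<^esub> g \<in> ker"
  by (simp add: R.minus_eq B.r_neg)

lemma mem_ideal_if_ker:
  assumes N: "ideal N R" "ker \<subseteq> N" and f: "f \<in> carrier R" and g: "g \<in> N" and eq: "\<phi> f = \<phi> g"
  shows "f \<in> N"
proof -
  interpret N: ideal N R by fact
  have gc: "g \<in> carrier R" by (rule N.a_Hcarr[OF g])
  have "f \<ominus>\<^bsub>R\<^esub> g \<in> N" using eq_imp_ker[OF f gc eq] N(2) by blast
  hence "(f \<ominus>\<^bsub>R\<^esub> g) \<oplus>\<^bsub>R\<^esub> g \<in> N" using g by (rule N.a_closed)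
  moreover have "(f \<ominus>\<^bsub>R\<^esub> g) \<oplus>\<^bsub>R\<^esub> g = f" using f gc by (simp add: R.minus_eq R.a_assoc R.l_neg)
  ultimately show ?thesis by simp
qed

lemma image_ideal:
  assumes "ideal N R"
  shows "ideal (\<phi> ` N) B"
proof (rule idealI)
  interpret N: ideal N R by fact
  show "ring B" by unfold_locales
  show "subgroup (\<phi> ` N) (add_monoid B)" by (rule h.img_is_add_subgroup[OF N.a_subgroup])
  fix a x assume "a \<in> \<phi> ` N" "x \<in> carrier B"
  then obtain g f where g: "g \<in> N" "a = \<phi> g" and f: "f \<in> carrier R" "x = \<phi> f" using surj by blast
  have "x \<otimes>\<^bsub>B\<^esub> a = \<phi> (f \<otimes>\<^bsub>R\<^esub> g)" "a \<otimes>\<^bsub>B\<^esub> x = \<phi> (g \<otimes>\<^bsub>R\<^esub> f)"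
    using f g N.a_Hcarr[OF g(1)] by simp_all
  thus "x \<otimes>\<^bsub>B\<^esub> a \<in> \<phi> ` N" "a \<otimes>\<^bsub>B\<^esub> x \<in> \<phi> ` N"
    using N.I_l_closed[OF g(1) f(1)] N.I_r_closed[OF g(1) f(1)] by blast+
qed

lemma vimage_Proj_pts:
  assumes p: "p \<in> Proj_pts B H"
  shows "{f \<in> carrier R. \<phi> f \<in> p} \<in> Proj_pts R G" "ker \<subseteq> {f \<in> carrier R. \<phi> f \<in> p}" "\<phi> ` {f \<in> carrier R. \<phi> f \<in> p} = p"
proof -
  have pp: "primeideal p B" using p by (simp add: Proj_pts_def)
  note pid = primeideal.axioms(1)[OF pp]
  let ?P = "{f \<in> carrier R. \<phi> f \<in> p}"
  have prime: "primeideal ?P R" by (rule h.primeideal_vimage[OF R.is_cring pp])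
  note Pid = primeideal.axioms(1)[OF prime]
  have "\<zero>\<^bsub>B\<^esub> \<in> p" by (rule additive_subgroup.zero_closed[OF ideal.axioms(1)[OF pid]])
  thus kP: "ker \<subseteq> ?P" by auto
  show im: "\<phi> ` ?P = p"
  proof (rule equalityI)
    show "p \<subseteq> \<phi> ` ?P"
    proof
      fix y assume y: "y \<in> p"
      hence "y \<in> \<phi> ` carrier R" using ideal.Icarr[OF pid y] by (simp only: surj)
      thus "y \<in> \<phi> ` ?P" using y by blast
    qed
  qed blast
  let ?N = "genideal R (?P \<inter> (\<Union>d. G d))"
  have sub: "?P \<inter> (\<Union>d. G d) \<subseteq> carrier R" by blast
  have N: "ideal ?N R" by (rule R.genideal_ideal[OF sub])
  have self: "?P \<inter> (\<Union>d. G d) \<subseteq> ?N" by (rule R.genideal_self[OF sub])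
  have "ker \<inter> (\<Union>d. G d) \<subseteq> ?P \<inter> (\<Union>d. G d)" using kP by blast
  hence "genideal R (ker \<inter> (\<Union>d. G d)) \<subseteq> ?N"
    using self by (intro R.genideal_minimal[OF N]) (rule subset_trans)
  hence kN: "ker \<subseteq> ?N" using ker_hom by (rule subset_trans[rotated])
  have pN: "p \<subseteq> \<phi> ` ?N"
  proof -
    have "p \<inter> (\<Union>d. H d) \<subseteq> \<phi> ` ?N"
    proof
      fix y assume "y \<in> p \<inter> (\<Union>d. H d)"
      then obtain g d where g: "y = \<phi> g" "g \<in> G d" "\<phi> g \<in> p" by blast
      hence "g \<in> ?N" using self G_sub by blast
      thus "y \<in> \<phi> ` ?N" using g(1) by blast
    qed
    hence "genideal B (p \<inter> (\<Union>d. H d)) \<subseteq> \<phi> ` ?N" by (rule B.genideal_minimal[OF image_ideal[OF N]])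
    thus ?thesis using p by (simp add: Proj_pts_def homogeneous_ideal_def)
  qed
  have "?P \<subseteq> ?N"
  proof
    fix f assume f: "f \<in> ?P"
    then obtain g where g: "g \<in> ?N" "\<phi> f = \<phi> g" using pN by blast
    show "f \<in> ?N" by (rule mem_ideal_if_ker[OF N kN _ g]) (use f in simp)
  qed
  moreover have "?N \<subseteq> ?P" by (rule R.genideal_minimal[OF Pid Int_lower1])
  ultimately have "homogeneous_ideal R G ?P" unfolding homogeneous_ideal_def by (rule equalityI)
  moreover have "\<not> (\<Union>d\<in>{0<..}. G d) \<subseteq> ?P"
  proof
    assume "(\<Union>d\<in>{0<..}. G d) \<subseteq> ?P"
    hence "(\<Union>d\<in>{0<..}. H d) \<subseteq> p" by blast
    thus False using p by (simp add: Proj_pts_def)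
  qed
  ultimately show "?P \<in> Proj_pts R G" using prime by (simp add: Proj_pts_def)
qed

lemma image_Proj_pts:
  assumes P: "P \<in> Proj_pts R G" "ker \<subseteq> P"
  shows "\<phi> ` P \<in> Proj_pts B H" "{f \<in> carrier R. \<phi> f \<in> \<phi> ` P} = P"
proof -
  interpret P: primeideal P R using P by (simp add: Proj_pts_def)
  have mem: "\<phi> f \<in> \<phi> ` P \<longleftrightarrow> f \<in> P" if "f \<in> carrier R" for f
    using mem_ideal_if_ker[OF P.ideal_axioms P(2) that] by blast
  thus "{f \<in> carrier R. \<phi> f \<in> \<phi> ` P} = P" using P.a_Hcarr by blast
  have idl: "ideal (\<phi> ` P) B" by (rule image_ideal[OF P.ideal_axioms])
  have "primeideal (\<phi> ` P) B"
  proof (rule primeidealI[OF idl B.is_cring])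
    show "carrier B \<noteq> \<phi> ` P"
    proof
      assume c: "carrier B = \<phi> ` P"
      have "f \<in> P" if "f \<in> carrier R" for f using mem[OF that] h.hom_closed[OF that] c by simp
      thus False using P.I_notcarr P.a_Hcarr by blast
    qed
  next
    fix x y assume x: "x \<in> carrier B" and y: "y \<in> carrier B" and xy: "x \<otimes>\<^bsub>B\<^esub> y \<in> \<phi> ` P"
    obtain f where f: "f \<in> carrier R" "x = \<phi> f" using x surj by blast
    obtain g where g: "g \<in> carrier R" "y = \<phi> g" using y surj by blast
    have "f \<otimes>\<^bsub>R\<^esub> g \<in> P" using xy mem[of "f \<otimes>\<^bsub>R\<^esub> g"] f g by simp
    thus "x \<in> \<phi> ` P \<or> y \<in> \<phi> ` P" using P.I_prime[OF f(1) g(1)] f(2) g(2) by blast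
  qed
  moreover have "homogeneous_ideal B H (\<phi> ` P)"
    unfolding homogeneous_ideal_def
  proof (rule equalityI)
    let ?N = "genideal B (\<phi> ` P \<inter> (\<Union>d. H d))"
    have "\<phi> ` P \<subseteq> carrier B" using P.a_Hcarr h.hom_closed by blast
    hence sub: "\<phi> ` P \<inter> (\<Union>d. H d) \<subseteq> carrier B" by blast
    show "?N \<subseteq> \<phi> ` P" by (rule B.genideal_minimal[OF idl]) blast
    have "P = genideal R (P \<inter> (\<Union>d. G d))" using P(1) by (simp add: Proj_pts_def homogeneous_ideal_def)
    also have "\<dots> \<subseteq> {f \<in> carrier R. \<phi> f \<in> ?N}"
    proof (rule R.genideal_minimal[OF h.ideal_vimage[OF B.genideal_ideal[OF sub]]])
      show "P \<inter> (\<Union>d. G d) \<subseteq> {f \<in> carrier R. \<phi> f \<in> ?N}"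
      proof
        fix f assume f: "f \<in> P \<inter> (\<Union>d. G d)"
        hence "\<phi> f \<in> \<phi> ` P \<inter> (\<Union>d. H d)" by blast
        hence "\<phi> f \<in> ?N" using B.genideal_self[OF sub] by blast
        thus "f \<in> {f \<in> carrier R. \<phi> f \<in> ?N}" using f P.a_Hcarr by blast
      qed
    qed
    finally show "\<phi> ` P \<subseteq> ?N" by blast
  qed
  moreover have "\<not> (\<Union>d\<in>{0<..}. H d) \<subseteq> \<phi> ` P"
  proof
    assume H: "(\<Union>d\<in>{0<..}. H d) \<subseteq> \<phi> ` P"
    have "(\<Union>d\<in>{0<..}. G d) \<subseteq> P"
    proof
      fix f assume "f \<in> (\<Union>d\<in>{0<..}. G d)"
      hence "\<phi> f \<in> \<phi> ` P" "f \<in> carrier R" using H G_sub by blast+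
      thus "f \<in> P" using mem by blast
    qed
    thus False using P(1) by (simp add: Proj_pts_def)
  qed
  ultimately show "\<phi> ` P \<in> Proj_pts B H" by (simp add: Proj_pts_def)
qed

end

lemma cring_cong_ops:
  assumes "cring S" "carrier B = carrier S" "\<And>x y. x \<otimes>\<^bsub>B\<^esub> y = x \<otimes>\<^bsub>S\<^esub> y" "\<And>x y. x \<oplus>\<^bsub>B\<^esub> y = x \<oplus>\<^bsub>S\<^esub> y"
    "\<one>\<^bsub>B\<^esub> = \<one>\<^bsub>S\<^esub>" "\<zero>\<^bsub>B\<^esub> = \<zero>\<^bsub>S\<^esub>"
  shows "cring B"
proof -
  interpret S: cring S by fact
  show ?thesis
  proof (rule cringI)
    show "abelian_group B"
    proof (rule abelian_groupI)
      fix x assume "x \<in> carrier B"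
      hence "\<ominus>\<^bsub>S\<^esub> x \<in> carrier B" "(\<ominus>\<^bsub>S\<^esub> x) \<oplus>\<^bsub>B\<^esub> x = \<zero>\<^bsub>B\<^esub>"
        unfolding assms(2-6) by (auto intro: S.l_neg)
      thus "\<exists>y\<in>carrier B. y \<oplus>\<^bsub>B\<^esub> x = \<zero>\<^bsub>B\<^esub>" by blast
    qed (auto simp: assms(2-6) S.a_ac)
    show "comm_monoid B"
      by (rule comm_monoidI) (auto simp: assms(2-6) S.m_ac)
  qed (simp add: assms(2-6) S.l_distr)
qed

locale quotient_algebra = kalgebra R + J: ideal J R
  for R :: "('a, 'k::field) kalg" (structure) and J :: "'a set"
begin

abbreviation Q where "Q \<equiv> quot_alg R J"
abbreviation \<phi> where "\<phi> \<equiv> a_r_coset R J"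

lemma quot_simps:
  "carrier Q = carrier (R Quot J)" "x \<otimes>\<^bsub>Q\<^esub> y = x \<otimes>\<^bsub>R Quot J\<^esub> y" "x \<oplus>\<^bsub>Q\<^esub> y = x \<oplus>\<^bsub>R Quot J\<^esub> y"
  "\<one>\<^bsub>Q\<^esub> = \<one>\<^bsub>R Quot J\<^esub>" "\<zero>\<^bsub>Q\<^esub> = \<zero>\<^bsub>R Quot J\<^esub>" "cst Q c = \<phi> (cst R c)"
  by (simp_all add: quot_alg_def ring.extend_def kalg.fields_def)

lemma proj_hom: "\<phi> \<in> ring_hom R Q"
proof -
  have "\<phi> \<in> ring_hom R (R Quot J)" by (rule J.rcos_ring_hom)
  thus ?thesis unfolding ring_hom_def quot_simps by simp
qed

lemma proj_simps:
  "f \<in> carrier R \<Longrightarrow> \<phi> f \<in> carrier Q" "f \<in> carrier R \<Longrightarrow> g \<in> carrier R \<Longrightarrow> \<phi> (f \<oplus> g) = \<phi> f \<oplus>\<^bsub>Q\<^esub> \<phi> g"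
  "f \<in> carrier R \<Longrightarrow> g \<in> carrier R \<Longrightarrow> \<phi> (f \<otimes> g) = \<phi> f \<otimes>\<^bsub>Q\<^esub> \<phi> g" "\<phi> \<one> = \<one>\<^bsub>Q\<^esub>"
  using ring_hom_closed[OF proj_hom] ring_hom_add[OF proj_hom] ring_hom_mult[OF proj_hom] ring_hom_one[OF proj_hom]
  by simp_all

lemma proj_surj: "x \<in> carrier Q \<Longrightarrow> \<exists>f\<in>carrier R. x = \<phi> f"
  unfolding quot_simps FactRing_def A_RCOSETS_def' by auto

lemma carrier_quot: "carrier Q = \<phi> ` carrier R"
  using proj_surj proj_simps(1) by blast

lemma proj_eq_iff: "f \<in> carrier R \<Longrightarrow> g \<in> carrier R \<Longrightarrow> \<phi> f = \<phi> g \<longleftrightarrow> f \<ominus> g \<in> J"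
  by (rule quotient_eq_iff_same_a_r_cos[OF J.ideal_axioms, symmetric])

lemma proj_zero_iff: "f \<in> carrier R \<Longrightarrow> \<phi> f = \<zero>\<^bsub>Q\<^esub> \<longleftrightarrow> f \<in> J"
  using a_rcos_zero[OF J.ideal_axioms, of f] J.rcos_const_imp_mem[of f] by (auto simp: quot_simps(5) FactRing_def)

lemma cring_quot: "cring Q"
  by (rule cring_cong_ops[OF J.quotient_is_cring[OF is_cring]]) (rule quot_simps)+

lemma kalgebra_quot: "kalgebra Q"
proof -
  interpret S: cring Q by (rule cring_quot)
  have "(\<lambda>c. \<phi> (cst R c)) \<in> ring_hom base_alg Q"
    using ring_hom_trans[OF cst_hom proj_hom] by (simp add: comp_def)
  moreover have "cst Q = (\<lambda>c. \<phi> (cst R c))" by (rule ext) (rule quot_simps)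
  ultimately show ?thesis by unfold_locales simp
qed

lemma graded_epi_quot:
  assumes "\<And>d. G d \<subseteq> carrier R" "J \<subseteq> genideal R (J \<inter> (\<Union>d. G d))"
  shows "graded_epi R Q \<phi> G"
proof -
  interpret S: cring Q by (rule cring_quot)
  have k: "{f \<in> carrier R. \<phi> f = \<zero>\<^bsub>Q\<^esub>} = J" using proj_zero_iff J.a_Hcarr by blast
  show ?thesis by unfold_locales (use k assms proj_hom carrier_quot in simp_all)
qed

end

section \<open>The algebra of a chain is toric\<close>

context ls_chain_algebra
begin

lemma \<Psi>0_surj_graded:
  assumes "keys F \<subseteq> K"
  shows "\<exists>f\<in>carrier R. \<Psi>0 f = F \<and> (\<forall>m\<in>keys f. good m \<and> expoM m \<in> keys F)"
proof -
  have "\<forall>v\<in>keys F. \<exists>m. good m \<and> expoM m = v" using monomial_of_exponent assms by blast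
  then obtain r where r: "\<And>v. v \<in> keys F \<Longrightarrow> good (r v) \<and> expoM (r v) = v" by metis
  let ?f = "\<Sum>v\<in>keys F. single (r v) (lookup F v)"
  have k: "m \<in> r ` keys F" if "m \<in> keys ?f" for m
    using that keys_sum[of "\<lambda>v. single (r v) (lookup F v)" "keys F"] by (auto split: if_splits)
  hence g: "good m \<and> expoM m \<in> keys F" if "m \<in> keys ?f" for m using that r by fastforce
  moreover have "?f \<in> carrier R" using g by (auto simp: P1_def)
  moreover have "\<Psi>0 ?f = F"
  proof -
    have "\<Psi>0 ?f = (\<Sum>v\<in>keys F. single v (lookup F v))"
      unfolding \<Psi>0_sum
    proof (rule sum.cong[OF refl])
      fix v assume "v \<in> keys F"
      thus "\<Psi>0 (single (r v) (lookup F v)) = single v (lookup F v)"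
        using r[of v] by (simp add: \<Psi>0_def lin_single \<chi>_def lmonom_def mult_single)
    qed
    thus ?thesis using sum_single[of F] by simp
  qed
  ultimately show ?thesis by blast
qed

sublocale quot: quotient_algebra R I
  by (intro quotient_algebra.intro kalgebra_LS_ring chain_ideal_ideal)

lemma LS_ring_a_minus:
  assumes "f \<in> carrier R" "g \<in> carrier R"
  shows "f \<ominus>\<^bsub>R\<^esub> g = f - g"
  unfolding a_minus_def LS_ring_minus[OF assms(2)] by simp

lemma proj_eq_iff_\<Psi>0:
  assumes "f \<in> carrier R" "g \<in> carrier R"
  shows "quot.\<phi> f = quot.\<phi> g \<longleftrightarrow> \<Psi>0 f = \<Psi>0 g"
proof -
  have "f - g \<in> carrier R" using LS_ring_closed(1)[OF assms(1) LS_ring_closed(3)[OF assms(2,2)]] by simp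
  hence "f - g \<in> I \<longleftrightarrow> \<Psi>0 f = \<Psi>0 g" unfolding chain_ideal_eq_kernel by (simp add: \<Psi>0_simps del: LS_ring_simps(1))
  thus ?thesis unfolding quot.proj_eq_iff[OF assms] LS_ring_a_minus[OF assms] .
qed

definition \<Psi> :: "('s, 'k) lspoly set \<Rightarrow> 'k lpoly" where
  "\<Psi> x = \<Psi>0 (SOME f. f \<in> carrier R \<and> quot.\<phi> f = x)"

lemma \<Psi>_proj: "f \<in> carrier R \<Longrightarrow> \<Psi> (quot.\<phi> f) = \<Psi>0 f"
proof -
  assume f: "f \<in> carrier R"
  define g where "g = (SOME g. g \<in> carrier R \<and> quot.\<phi> g = quot.\<phi> f)"
  have "g \<in> carrier R \<and> quot.\<phi> g = quot.\<phi> f" unfolding g_def by (rule someI) (use f in blast)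
  hence "\<Psi>0 g = \<Psi>0 f" using proj_eq_iff_\<Psi>0[of g f] f by blast
  thus ?thesis by (simp only: \<Psi>_def g_def)
qed

lemma LS_grading_iff: "f \<in> LS_grading b d \<longleftrightarrow> f \<in> carrier R \<and> (\<forall>m\<in>keys f. mass m = d)"
  by (simp add: LS_grading_def mass_def del: LS_ring_simps(1))

lemma keys_\<Psi>0_good: "v \<in> keys (\<Psi>0 f) \<Longrightarrow> \<exists>m\<in>keys f. good m \<and> v = expoM m"
proof -
  assume v: "v \<in> keys (\<Psi>0 f)"
  have "keys (\<Psi>0 f) \<subseteq> (\<Union>m\<in>keys f. keys (single 0 (lookup f m) * \<chi> m))"
    unfolding \<Psi>0_def lin_def by (rule keys_sum)
  then obtain m where "m \<in> keys f" "v \<in> keys (single 0 (lookup f m) * \<chi> m)" using v by blast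
  thus ?thesis by (intro bexI[of _ m]) (auto simp: \<chi>_def lmonom_def mult_single split: if_splits)
qed

theorem toric_algebra_quot:
  "toric_algebra (LS_quot b I) (LS_quot_grading b I) \<Psi> n {..n} ell hvec"
  unfolding LS_quot_def
proof (intro toric_algebra.intro toric_algebra_axioms.intro)
  show "kalgebra (quot_alg R I)" by (rule quot.kalgebra_quot)
  have one: "1 \<in> carrier R" using quot.one_closed by (simp only: LS_ring_simps)
  show "\<Psi> \<one>\<^bsub>quot_alg R I\<^esub> = 1"
    using \<Psi>_proj[OF one] quot.proj_simps(4) \<Psi>0_simps(6) by (simp only: LS_ring_simps)
  fix x y assume xy: "x \<in> carrier (quot_alg R I)" "y \<in> carrier (quot_alg R I)"
  then obtain f g where fg: "f \<in> carrier R" "x = quot.\<phi> f" "g \<in> carrier R" "y = quot.\<phi> g"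
    using quot.proj_surj by meson
  show "\<Psi> (x \<oplus>\<^bsub>quot_alg R I\<^esub> y) = \<Psi> x + \<Psi> y"
    using \<Psi>_proj[OF LS_ring_closed(1)[OF fg(1,3)]] quot.proj_simps(2)[OF fg(1,3)] \<Psi>_proj[OF fg(1)] \<Psi>_proj[OF fg(3)]
    by (simp only: LS_ring_simps fg(2,4) \<Psi>0_simps)
  show "\<Psi> (x \<otimes>\<^bsub>quot_alg R I\<^esub> y) = \<Psi> x * \<Psi> y"
    using \<Psi>_proj[OF LS_ring_closed(2)[OF fg(1,3)]] quot.proj_simps(3)[OF fg(1,3)] \<Psi>_proj[OF fg(1)] \<Psi>_proj[OF fg(3)]
    by (simp only: LS_ring_simps fg(2,4) \<Psi>0_simps)
next
  fix c
  show "\<Psi> (cst (quot_alg R I) c) = single 0 c"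
    unfolding quot.quot_simps using \<Psi>_proj[OF quot.cst_simps(1), of c] by (simp only: LS_ring_simps \<Psi>0_simps)
next
  show "inj_on \<Psi> (carrier (quot_alg R I))"
  proof (rule inj_onI)
    fix x y assume "x \<in> carrier (quot_alg R I)" "y \<in> carrier (quot_alg R I)" and eq: "\<Psi> x = \<Psi> y"
    then obtain f g where fg: "f \<in> carrier R" "x = quot.\<phi> f" "g \<in> carrier R" "y = quot.\<phi> g"
      using quot.proj_surj by meson
    thus "x = y" using eq \<Psi>_proj[OF fg(1)] \<Psi>_proj[OF fg(3)] proj_eq_iff_\<Psi>0[OF fg(1,3)] by simp
  qed
next
  have "\<Psi> ` carrier (quot_alg R I) = \<Psi>0 ` carrier R"
    unfolding quot.carrier_quot image_image by (rule image_cong[OF refl \<Psi>_proj])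
  also have "\<dots> = {f. keys f \<subseteq> K}"
  proof
    show "\<Psi>0 ` carrier R \<subseteq> {f. keys f \<subseteq> K}" using keys_\<Psi>0 by blast
    show "{f. keys f \<subseteq> K} \<subseteq> \<Psi>0 ` carrier R"
    proof
      fix F :: "'k lpoly" assume "F \<in> {f. keys f \<subseteq> K}"
      then obtain f where "f \<in> carrier R" "\<Psi>0 f = F" using \<Psi>0_surj_graded[of F] by blast
      thus "F \<in> \<Psi>0 ` carrier R" by blast
    qed
  qed
  finally show "\<Psi> ` carrier (quot_alg R I) = {f. keys f \<subseteq> K}" .
next
  fix d
  show "LS_quot_grading b I d = {x \<in> carrier (quot_alg R I). \<forall>v\<in>keys (\<Psi> x). lookup v n = int d}"
  proof (intro Set.set_eqI iffI)
    fix x assume "x \<in> LS_quot_grading b I d"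
    then obtain f where f: "f \<in> LS_grading b d" "x = quot.\<phi> f" by (auto simp: LS_quot_grading_def quot_grading_def)
    hence fR: "f \<in> carrier R" and m: "\<And>m. m \<in> keys f \<Longrightarrow> mass m = d" using LS_grading_iff[of f d] by blast+
    have "lookup v n = int d" if "v \<in> keys (\<Psi>0 f)" for v
      using keys_\<Psi>0_good[OF that] good_expoM m by blast
    thus "x \<in> {x \<in> carrier (quot_alg R I). \<forall>v\<in>keys (\<Psi> x). lookup v n = int d}"
      using quot.proj_simps(1)[OF fR] f(2) \<Psi>_proj[OF fR] by simp
  next
    fix x assume "x \<in> {x \<in> carrier (quot_alg R I). \<forall>v\<in>keys (\<Psi> x). lookup v n = int d}"
    then obtain f where f: "f \<in> carrier R" "x = quot.\<phi> f" and v: "\<And>v. v \<in> keys (\<Psi> x) \<Longrightarrow> lookup v n = int d"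
      using quot.proj_surj by blast
    obtain g where g: "g \<in> carrier R" "\<Psi>0 g = \<Psi>0 f" and k: "\<And>m. m \<in> keys g \<Longrightarrow> good m \<and> expoM m \<in> keys (\<Psi>0 f)"
      using \<Psi>0_surj_graded[OF keys_\<Psi>0[of f]] by blast
    have "mass m = d" if "m \<in> keys g" for m
      using k[OF that] good_expoM[of m] v[of "expoM m"] f(2) \<Psi>_proj[OF f(1)] by simp
    hence "g \<in> LS_grading b d" using g(1) LS_grading_iff[of g d] by blast
    moreover have "x = quot.\<phi> g" using g proj_eq_iff_\<Psi>0[OF g(1) f(1)] f(2) by simp
    ultimately show "x \<in> LS_quot_grading b I d" by (auto simp: LS_quot_grading_def quot_grading_def)
  qed
next
  show "finite {..n}" by simp
  show "additive (ell j)" for j by (rule ell_additive)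
  show "keys hvec \<subseteq> {..n}" unfolding hvec_def by (rule keys_vec)
  show "0 < lookup hvec n" by (simp add: hvec_def lookup_vec)
  show "0 < ell j hvec" if "j \<in> {..n}" for j using that ell_hvec by simp
qed

text \<open>The code of a path of degree 1 consists of integers between 0 and the bonds.\<close>

lemma finite_P1: "finite P1"
proof (rule inj_on_finite)
  let ?code = "\<lambda>\<pi>. restrict (lookup (expo \<pi>)) {..n}"
  show "finite (\<Pi>\<^sub>E j\<in>{..n}. {0..int (\<beta> j)})" by (intro finite_PiE) auto
  show "?code ` P1 \<subseteq> (\<Pi>\<^sub>E j\<in>{..n}. {0..int (\<beta> j)})"
  proof
    fix c assume "c \<in> ?code ` P1"
    then obtain \<pi> where \<pi>: "\<pi> \<in> P1" "c = ?code \<pi>" by blast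
    have "lookup (expo \<pi>) j \<in> {0..int (\<beta> j)}" if j: "j \<le> n" for j
    proof -
      have "0 \<le> av (expo \<pi>) j" "av (expo \<pi>) j \<le> 1"
        using av_nonneg[OF expo_K(1)[OF \<pi>(1)] j] av_mono[OF expo_K(1)[OF \<pi>(1)] j order_refl] expo_K(2)[OF \<pi>(1)]
        by (simp_all add: av_n)
      hence "0 \<le> of_nat (\<beta> j) * av (expo \<pi>) j" "of_nat (\<beta> j) * av (expo \<pi>) j \<le> of_nat (\<beta> j)"
        by (auto intro: mult_left_le)
      hence "(0 :: rat) \<le> of_int (lookup (expo \<pi>) j)" "(of_int (lookup (expo \<pi>) j) :: rat) \<le> of_int (int (\<beta> j))"
        by (simp_all add: av_lookup)
      thus ?thesis unfolding of_int_le_iff of_int_0_le_iff by simp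
    qed
    thus "c \<in> (\<Pi>\<^sub>E j\<in>{..n}. {0..int (\<beta> j)})" using \<pi>(2) by auto
  qed
  show "inj_on ?code P1"
  proof (rule inj_onI)
    fix \<pi> \<rho> assume p: "\<pi> \<in> P1" "\<rho> \<in> P1" and eq: "?code \<pi> = ?code \<rho>"
    have "expo \<pi> = expo \<rho>"
    proof (rule av_eqI[OF keys_expo keys_expo])
      fix j assume "j \<le> n"
      thus "av (expo \<pi>) j = av (expo \<rho>) j" using fun_cong[OF eq, of j] by (simp add: av_def)
    qed
    thus "\<pi> = \<rho>" using path_expo p by metis
  qed
qed

theorem standard_graded_quot: "standard_graded (LS_quot b I) (LS_quot_grading b I)"
proof -
  let ?Q = "quot_alg R I" and ?E0 = "quot.\<phi> ` LS_var ` P1"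
  let ?gen = "generate_ring ?Q (range (cst ?Q) \<union> ?E0)"
  interpret Q: kalgebra ?Q by (rule quot.kalgebra_quot)
  have P1_carr: "LS_var \<pi> \<in> carrier R" if "\<pi> \<in> P1" for \<pi> using LS_var_carrier P1_D(5)[OF that] by blast
  have "range (cst ?Q) \<union> ?E0 \<subseteq> carrier ?Q" using P1_carr quot.proj_simps(1) Q.cst_simps(1) by blast
  hence sub: "?gen \<subseteq> carrier ?Q" using Q.generate_ring_in_carrier by blast
  have add: "quot.\<phi> (f + g) \<in> ?gen" if "f \<in> carrier R" "g \<in> carrier R" "quot.\<phi> f \<in> ?gen" "quot.\<phi> g \<in> ?gen" for f g
    using generate_ring.eng_add[OF that(3,4)] quot.proj_simps(2)[OF that(1,2)] by (simp only: LS_ring_simps)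
  have mult: "quot.\<phi> (f * g) \<in> ?gen" if "f \<in> carrier R" "g \<in> carrier R" "quot.\<phi> f \<in> ?gen" "quot.\<phi> g \<in> ?gen" for f g
    using generate_ring.eng_mult[OF that(3,4)] quot.proj_simps(3)[OF that(1,2)] by (simp only: LS_ring_simps)
  have const: "quot.\<phi> (single 0 c) \<in> ?gen" for c
    using generate_ring.incl[of "cst ?Q c" "range (cst ?Q) \<union> ?E0" ?Q] quot.quot_simps(6)[of c] by (simp only: LS_ring_simps) blast
  have var: "quot.\<phi> (LS_var \<pi>) \<in> ?gen" if p: "\<pi> \<in> LS1 b" for \<pi>
  proof (cases "supp \<pi> \<subseteq> E")
    case True
    hence "\<pi> \<in> P1" using p by (simp add: P1_def)
    thus ?thesis by (intro generate_ring.incl) blast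
  next
    case False
    have "0 \<in> carrier R" by simp
    hence "quot.\<phi> (LS_var \<pi>) = quot.\<phi> (single 0 0)"
      using proj_eq_iff_\<Psi>0[of "LS_var \<pi>" 0] LS_var_carrier[OF p] \<Psi>0_var[OF p] False \<Psi>0_simps(4) by simp
    thus ?thesis using const[of 0] by simp
  qed
  have mon: "quot.\<phi> (mon m) \<in> ?gen" if "keys m \<subseteq> LS1 b" for m
    using that
  proof (induction "mass m" arbitrary: m)
    case 0
    hence "m = 0" using mass_eq_0 by metis
    thus ?case using const[of 1] by simp
  next
    case (Suc k)
    hence "m \<noteq> 0" by auto
    then obtain \<pi> where \<pi>: "\<pi> \<in> keys m" by (metis keys_eq_empty_nat ex_in_conv)
    then obtain m' where m': "m = var \<pi> + m'" by (rule split_var)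
    have p: "\<pi> \<in> LS1 b" using \<pi> Suc.prems by blast
    have "keys m' \<subseteq> LS1 b" "mass m' = k" using Suc m' by (auto simp: keys_add_nat mass_add)
    moreover from this have "mon m' \<in> carrier R" by simp
    ultimately have "quot.\<phi> (LS_var \<pi> * mon m') \<in> ?gen"
      using Suc.hyps(1)[of m'] by (intro mult LS_var_carrier[OF p] var[OF p]) auto
    thus ?case unfolding m' mon_add LS_var_mon .
  qed
  have all: "quot.\<phi> f \<in> ?gen \<and> f \<in> carrier R" if "f \<in> carrier R" for f
  proof -
    have "quot.\<phi> (\<Sum>m\<in>A. single 0 (lookup f m) * mon m) \<in> ?gen \<and>
        (\<Sum>m\<in>A. single 0 (lookup f m) * mon m) \<in> carrier R" if "finite A" "A \<subseteq> keys f" for A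
      using that
    proof (induction A rule: finite_induct)
      case empty
      thus ?case using const[of 0] by simp
    next
      case (insert m A)
      have k: "keys m \<subseteq> LS1 b" using insert.prems \<open>f \<in> carrier R\<close> by simp
      have c: "single 0 (lookup f m) \<in> carrier R" "mon m \<in> carrier R" using k by auto
      have t: "quot.\<phi> (single 0 (lookup f m) * mon m) \<in> ?gen"
        by (rule mult[OF c const mon[OF k]])
      have "(\<Sum>m\<in>A. single 0 (lookup f m) * mon m) \<in> carrier R"
        "quot.\<phi> (\<Sum>m\<in>A. single 0 (lookup f m) * mon m) \<in> ?gen" using insert by blast+
      thus ?case
        unfolding sum.insert[OF insert.hyps]
        using add[OF LS_ring_closed(2)[OF c] _ t] LS_ring_closed(1)[OF LS_ring_closed(2)[OF c]] by blast
    qed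
    from this[OF finite_keys order_refl] show ?thesis
      using sum_single[of f] by (simp add: mult_single del: LS_ring_simps(1))
  qed
  have "carrier ?Q = ?gen" using sub all quot.proj_surj by blast
  moreover have "?E0 \<subseteq> LS_quot_grading b I 1"
  proof
    fix x assume "x \<in> ?E0"
    then obtain \<pi> where \<pi>: "\<pi> \<in> P1" "x = quot.\<phi> (LS_var \<pi>)" by blast
    have "LS_var \<pi> \<in> (LS_grading b 1 :: ('s, 'k) lspoly set)"
      using P1_carr[OF \<pi>(1)] unfolding LS_grading_iff by (simp add: LS_var_def del: LS_ring_simps(1))
    thus "x \<in> LS_quot_grading b I 1" using \<pi>(2) by (auto simp: LS_quot_grading_def quot_grading_def)
  qed
  moreover have "finite ?E0" using finite_P1 by simp
  ultimately show ?thesis unfolding standard_graded_def LS_quot_def by blast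
qed

theorem projective_normal_toric_quot: "projective_normal_toric (LS_quot b I) (LS_quot_grading b I)"
  by (rule toric_algebra.projective_normal_toric_cone[OF toric_algebra_quot standard_graded_quot])

end

lemma ls_chain_exists:
  fixes b :: "'s::{finite, order} \<Rightarrow> 's \<Rightarrow> nat"
  assumes "poset_with_bonds b" "is_chain C" "C \<noteq> {}"
  obtains es n where "ls_chain b es n" "set es = C"
proof -
  obtain es where es: "sorted_wrt (<) es" "set es = C" using chain_list[OF _ assms(2)] by auto
  hence "length es = Suc (length es - 1)" using assms(3) by (cases es) auto
  hence "ls_chain b es (length es - 1)" using es assms(1) by (simp add: ls_chain_def)
  thus thesis using es(2) that by blast
qed

theorem chain_ideal_normal_toric:
  fixes b :: "'s::{finite, order} \<Rightarrow> 's \<Rightarrow> nat"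
  assumes "poset_with_bonds b" "is_chain C" "C \<noteq> {}"
  shows "projective_normal_toric (LS_quot b (chain_ideal b C :: ('s, 'k::field) lspoly set)) (LS_quot_grading b (chain_ideal b C))"
proof -
  obtain es n where es: "ls_chain b es n" "set es = C" by (rule ls_chain_exists[OF assms])
  interpret ls_chain_algebra b es n "TYPE('k)" using es(1) by (simp add: ls_chain_algebra_def)
  show ?thesis using projective_normal_toric_quot es(2) by simp
qed

section \<open>Ideals of chains\<close>

lemma indicator_LS1: "(\<lambda>\<tau>. if \<tau> = \<sigma> then 1 else 0) \<in> LS1 b" and supp_indicator: "supp (\<lambda>\<tau>. if \<tau> = \<sigma> then 1 else (0 :: rat)) = {\<sigma>}"
proof -
  show s: "supp (\<lambda>\<tau>. if \<tau> = \<sigma> then 1 else (0 :: rat)) = {\<sigma>}" for \<sigma> :: 'c by (auto simp: supp_def)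
  show "(\<lambda>\<tau>. if \<tau> = \<sigma> then 1 else 0) \<in> LS1 b"
    unfolding LS1_def LS_path_def mem_Collect_eq s
    by (intro conjI exI[of _ "[\<sigma>]"]) (auto simp: Complete_Partial_Order.chain_def)
qed

lemma chain_ideal_least:
  assumes N: "ideal N (LS_ring b)" "LS_ideal b \<subseteq> N" and v: "\<And>\<pi>. \<pi> \<in> LS1 b \<Longrightarrow> \<not> supp \<pi> \<subseteq> C \<Longrightarrow> LS_var \<pi> \<in> N"
  shows "chain_ideal b C \<subseteq> N"
proof -
  interpret kalgebra "LS_ring b" by (rule kalgebra_LS_ring)
  show ?thesis unfolding chain_ideal_def by (rule genideal_minimal[OF N(1)]) (use N(2) v in blast)
qed

lemma chain_ideal_sum:
  "chain_ideal b C <+>\<^bsub>LS_ring b\<^esub> chain_ideal b D = (chain_ideal b (C \<inter> D) :: ('s::order, 'k::field) lspoly set)"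
proof (rule equalityI)
  let ?R = "LS_ring b :: (('s, 'k) lspoly, 'k) kalg"
  interpret kalgebra ?R by (rule kalgebra_LS_ring)
  note I = chain_ideal_ideal[of b]
  have mono: "chain_ideal b C' \<subseteq> (chain_ideal b (C \<inter> D) :: ('s, 'k) lspoly set)" if "C \<inter> D \<subseteq> C'" for C'
    by (rule chain_ideal_least[OF I chain_ideal_contains(2)], rule chain_ideal_contains(3)) (use that in auto)
  show "chain_ideal b C <+>\<^bsub>?R\<^esub> chain_ideal b D \<subseteq> chain_ideal b (C \<inter> D)"
  proof
    fix f assume "f \<in> chain_ideal b C <+>\<^bsub>?R\<^esub> chain_ideal b D"
    then obtain g h where gh: "g \<in> chain_ideal b C" "h \<in> chain_ideal b D" "f = g + h"
      unfolding set_add_def' LS_ring_simps by blast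
    have "g \<in> chain_ideal b (C \<inter> D)" "h \<in> chain_ideal b (C \<inter> D)" using mono[of C] mono[of D] gh(1,2) by blast+
    thus "f \<in> chain_ideal b (C \<inter> D)" unfolding gh(3) by (rule ideal_LS_ring(3)[OF I])
  qed
  have "0 \<in> chain_ideal b C'" for C' :: "'s set" by (rule ideal_LS_ring(2)[OF I])
  hence l: "f \<in> chain_ideal b C \<Longrightarrow> f \<in> chain_ideal b C <+>\<^bsub>?R\<^esub> chain_ideal b D"
    and r: "f \<in> chain_ideal b D \<Longrightarrow> f \<in> chain_ideal b C <+>\<^bsub>?R\<^esub> chain_ideal b D" for f
    unfolding set_add_def' LS_ring_simps by (force, force)
  show "chain_ideal b (C \<inter> D) \<subseteq> chain_ideal b C <+>\<^bsub>?R\<^esub> chain_ideal b D"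
  proof (rule chain_ideal_least[OF add_ideals[OF I I]])
    show "LS_ideal b \<subseteq> chain_ideal b C <+>\<^bsub>?R\<^esub> chain_ideal b D" using l chain_ideal_contains(2) by blast
    show "LS_var \<pi> \<in> chain_ideal b C <+>\<^bsub>?R\<^esub> chain_ideal b D" if "\<pi> \<in> LS1 b" "\<not> supp \<pi> \<subseteq> C \<inter> D" for \<pi>
      using l[OF chain_ideal_contains(3)[OF that(1)]] r[OF chain_ideal_contains(3)[OF that(1)]] that(2) by blast
  qed
qed

definition hom_generated where
  "hom_generated b J \<longleftrightarrow> ideal J (LS_ring b) \<and> J \<subseteq> genideal (LS_ring b) (J \<inter> (\<Union>d. LS_grading b d))"

lemma LS_grading_simps:
  "\<pi> \<in> LS1 b \<Longrightarrow> LS_var \<pi> \<in> LS_grading b 1"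
  "f \<in> LS_grading b d \<Longrightarrow> f \<in> carrier (LS_ring b)"
proof -
  show "\<pi> \<in> LS1 b \<Longrightarrow> LS_var \<pi> \<in> LS_grading b 1" by (simp add: LS_grading_def LS_var_def)
qed (simp add: LS_grading_def del: LS_ring_simps(1))

lemma LS_var_mult_homogeneous:
  "\<pi> \<in> LS1 b \<Longrightarrow> \<rho> \<in> LS1 b \<Longrightarrow> LS_var \<pi> * LS_var \<rho> \<in> LS_grading b 2"
proof -
  assume p: "\<pi> \<in> LS1 b" "\<rho> \<in> LS1 b"
  let ?m = "single \<pi> (Suc 0) + single \<rho> (Suc 0)"
  have "(\<Sum>x\<in>keys ?m. lookup ?m x) = 2 \<and> keys ?m \<subseteq> LS1 b"
  proof (cases "\<pi> = \<rho>")
    case True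
    hence "?m = single \<pi> 2" by (simp add: numeral_2_eq_2 flip: single_add)
    thus ?thesis using p by simp
  next
    case False
    hence "keys ?m = {\<pi>, \<rho>}" by (auto simp: in_keys_iff lookup_add lookup_single when_def)
    thus ?thesis using p False by (simp add: lookup_add lookup_single when_def)
  qed
  thus ?thesis by (simp add: LS_grading_def LS_var_def mult_single)
qed

lemma LS_grading_diff:
  assumes "f \<in> LS_grading b d" "g \<in> LS_grading b d"
  shows "f - g \<in> LS_grading b d"
proof -
  have "m \<in> keys f \<or> m \<in> keys g" if "m \<in> keys (f - g)" for m using that by (auto simp: in_keys_iff lookup_minus)
  thus ?thesis using assms unfolding LS_grading_def LS_ring_simps by blast
qed

lemma hom_generated_genideal:
  assumes X: "X \<subseteq> (\<Union>d. LS_grading b d)"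
  shows "hom_generated b (genideal (LS_ring b) X)"
proof -
  interpret kalgebra "LS_ring b" by (rule kalgebra_LS_ring)
  have c: "X \<subseteq> carrier (LS_ring b)" using X LS_grading_simps(2) by blast
  note I = genideal_ideal[OF c]
  have "genideal (LS_ring b) X \<inter> (\<Union>d. LS_grading b d) \<subseteq> carrier (LS_ring b)" using LS_grading_simps(2) by blast
  note J = genideal_ideal[OF this] genideal_self[OF this]
  have "X \<subseteq> genideal (LS_ring b) (genideal (LS_ring b) X \<inter> (\<Union>d. LS_grading b d))"
    using J(2) genideal_self[OF c] X by blast
  thus ?thesis using I genideal_minimal[OF J(1)] by (simp add: hom_generated_def)
qed

lemma LS_gens_homogeneous: "LS_gens b \<subseteq> (\<Union>d. LS_grading b d)"
proof
  fix f assume f: "f \<in> LS_gens b"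
  have "f \<in> LS_grading b 2"
    using f unfolding LS_gens_def canonical_form_def
    by (auto intro!: LS_grading_diff LS_var_mult_homogeneous)
  thus "f \<in> (\<Union>d. LS_grading b d)" by blast
qed

lemma hom_generated_LS_ideal: "hom_generated b (LS_ideal b)"
  unfolding LS_ideal_eq by (rule hom_generated_genideal[OF LS_gens_homogeneous])

lemma hom_generated_chain_ideal: "hom_generated b (chain_ideal b C :: ('s::order, 'k::field) lspoly set)"
proof -
  interpret kalgebra "LS_ring b :: (('s, 'k) lspoly, 'k) kalg" by (rule kalgebra_LS_ring)
  let ?V = "{LS_var \<pi> | \<pi>. \<pi> \<in> LS1 b \<and> \<not> supp \<pi> \<subseteq> C} :: ('s, 'k) lspoly set"
  have X: "LS_gens b \<union> ?V \<subseteq> (\<Union>d. LS_grading b d)" using LS_gens_homogeneous LS_grading_simps(1) by blast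
  hence c: "LS_gens b \<union> ?V \<subseteq> carrier (LS_ring b)" using LS_grading_simps(2) by blast
  note N = genideal_ideal[OF c] genideal_self[OF c]
  have "chain_ideal b C = genideal (LS_ring b) (LS_gens b \<union> ?V)"
  proof (rule equalityI)
    show "chain_ideal b C \<subseteq> genideal (LS_ring b) (LS_gens b \<union> ?V)"
    proof (rule chain_ideal_least[OF N(1)])
      show "LS_ideal b \<subseteq> genideal (LS_ring b) (LS_gens b \<union> ?V)"
        unfolding LS_ideal_eq by (rule genideal_minimal[OF N(1)]) (use N(2) in blast)
      show "LS_var \<pi> \<in> genideal (LS_ring b) (LS_gens b \<union> ?V)" if "\<pi> \<in> LS1 b" "\<not> supp \<pi> \<subseteq> C" for \<pi>
        using N(2) that by blast
    qed
    have "LS_gens b \<subseteq> chain_ideal b C" using chain_ideal_contains(1,2) by (rule subset_trans)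
    thus "genideal (LS_ring b) (LS_gens b \<union> ?V) \<subseteq> chain_ideal b C"
      using chain_ideal_contains(3)[of _ b C] by (intro genideal_minimal[OF chain_ideal_ideal]) blast
  qed
  thus ?thesis using hom_generated_genideal[OF X] by simp
qed

section \<open>Closed subschemes of the Proj of the discrete LS algebra\<close>

abbreviation hom_primes where
  "hom_primes b \<equiv> Proj_pts (LS_ring b) (LS_grading b)"

lemma graded_epi_LS_quot:
  assumes "hom_generated b J"
  shows "graded_epi (LS_ring b) (LS_quot b J) (a_r_coset (LS_ring b) J) (LS_grading b)"
    "f \<in> carrier (LS_ring b) \<Longrightarrow> a_r_coset (LS_ring b) J f = \<zero>\<^bsub>LS_quot b J\<^esub> \<longleftrightarrow> f \<in> J"
proof -
  have "ideal J (LS_ring b)" using assms by (simp add: hom_generated_def)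
  then interpret quotient_algebra "LS_ring b" J by (intro quotient_algebra.intro kalgebra_LS_ring)
  show "graded_epi (LS_ring b) (LS_quot b J) (a_r_coset (LS_ring b) J) (LS_grading b)"
    unfolding LS_quot_def by (rule graded_epi_quot) (use assms LS_grading_simps(2) in \<open>auto simp: hom_generated_def simp del: LS_ring_simps(1)\<close>)
  show "f \<in> carrier (LS_ring b) \<Longrightarrow> a_r_coset (LS_ring b) J f = \<zero>\<^bsub>LS_quot b J\<^esub> \<longleftrightarrow> f \<in> J"
    unfolding LS_quot_def by (rule proj_zero_iff)
qed

lemma LS_quot_grading_eq: "LS_quot_grading b J = (\<lambda>d. a_r_coset (LS_ring b) J ` LS_grading b d)"
  by (rule ext) (simp add: LS_quot_grading_def quot_grading_def)

abbreviation quot_primes where "quot_primes b J \<equiv> Proj_pts (LS_quot b J) (LS_quot_grading b J)"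

lemma primes_of_quotient:
  assumes J: "hom_generated b J"
  defines "\<phi> \<equiv> a_r_coset (LS_ring b) J"
  shows "p \<in> quot_primes b J \<Longrightarrow>
      {f \<in> carrier (LS_ring b). \<phi> f \<in> p} \<in> hom_primes b \<and> J \<subseteq> {f \<in> carrier (LS_ring b). \<phi> f \<in> p} \<and>
      \<phi> ` {f \<in> carrier (LS_ring b). \<phi> f \<in> p} = p"
    "P \<in> hom_primes b \<Longrightarrow> J \<subseteq> P \<Longrightarrow>
      \<phi> ` P \<in> quot_primes b J \<and> {f \<in> carrier (LS_ring b). \<phi> f \<in> \<phi> ` P} = P"
proof -
  interpret graded_epi "LS_ring b" "LS_quot b J" \<phi> "LS_grading b"
    unfolding \<phi>_def by (rule graded_epi_LS_quot[OF J])
  have Ji: "ideal J (LS_ring b)" using J by (simp add: hom_generated_def)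
  have k: "ker = J"
  proof (rule equalityI)
    show "ker \<subseteq> J"
    proof
      fix f assume "f \<in> ker"
      hence f: "f \<in> carrier (LS_ring b)" "\<phi> f = \<zero>\<^bsub>LS_quot b J\<^esub>" by blast+
      thus "f \<in> J" unfolding \<phi>_def graded_epi_LS_quot(2)[OF J f(1)] by simp
    qed
    show "J \<subseteq> ker"
    proof
      fix f assume f: "f \<in> J"
      note c = ideal_LS_ring(1)[OF Ji f]
      have "\<phi> f = \<zero>\<^bsub>LS_quot b J\<^esub>" unfolding \<phi>_def graded_epi_LS_quot(2)[OF J c] by (rule f)
      thus "f \<in> ker" using c by blast
    qed
  qed
  have H: "LS_quot_grading b J = H" unfolding LS_quot_grading_eq \<phi>_def ..
  show "p \<in> quot_primes b J \<Longrightarrow>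
      {f \<in> carrier (LS_ring b). \<phi> f \<in> p} \<in> hom_primes b \<and> J \<subseteq> {f \<in> carrier (LS_ring b). \<phi> f \<in> p} \<and>
      \<phi> ` {f \<in> carrier (LS_ring b). \<phi> f \<in> p} = p"
    using vimage_Proj_pts[of p] unfolding H k by blast
  show "P \<in> hom_primes b \<Longrightarrow> J \<subseteq> P \<Longrightarrow>
      \<phi> ` P \<in> quot_primes b J \<and> {f \<in> carrier (LS_ring b). \<phi> f \<in> \<phi> ` P} = P"
    using image_Proj_pts[of P] unfolding H k by blast
qed

lemma closedin_Proj:
  assumes "cring (B :: ('a, 'k) kalg)"
  shows "closedin (pts (Proj B G)) V \<longleftrightarrow> (\<exists>E\<subseteq>carrier B. V = {p \<in> Proj_pts B G. E \<subseteq> p})"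
    "topspace (pts (Proj B G)) = Proj_pts B G"
proof -
  have prime: "p \<in> Proj_pts B G \<Longrightarrow> primeideal p B" for p by (simp add: Proj_pts_def)
  have op: "openin (zariski B (Proj_pts B G)) U \<longleftrightarrow> (\<exists>E\<subseteq>carrier B. U = {p \<in> Proj_pts B G. \<not> E \<subseteq> p})" for U
    unfolding zariski_def using topology_inverse'[OF istopology_zariski[OF prime]] by simp
  have pts: "pts (Proj B G) = zariski B (Proj_pts B G)" by (simp add: Proj_def fraction_space_def)
  have "\<not> carrier B \<subseteq> p" if "p \<in> Proj_pts B G" for p
    using primeideal.I_notcarr[OF prime[OF that]] ideal.Icarr[OF primeideal.axioms(1)[OF prime[OF that]]] by blast
  hence "Proj_pts B G = {p \<in> Proj_pts B G. \<not> carrier B \<subseteq> p}" by blast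
  hence "openin (zariski B (Proj_pts B G)) (Proj_pts B G)" unfolding op by blast
  moreover have "topspace (zariski B (Proj_pts B G)) \<subseteq> Proj_pts B G"
    using openin_topspace[of "zariski B (Proj_pts B G)"] unfolding op by blast
  ultimately show t: "topspace (pts (Proj B G)) = Proj_pts B G"
    unfolding pts using openin_subset by blast
  have eq: "Proj_pts B G - {p \<in> Proj_pts B G. E \<subseteq> p} = {p \<in> Proj_pts B G. \<not> E \<subseteq> p}"
    "Proj_pts B G - {p \<in> Proj_pts B G. \<not> E \<subseteq> p} = {p \<in> Proj_pts B G. E \<subseteq> p}" for E by blast+
  have "V \<subseteq> Proj_pts B G \<and> (\<exists>E\<subseteq>carrier B. Proj_pts B G - V = {p \<in> Proj_pts B G. \<not> E \<subseteq> p})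
      \<longleftrightarrow> (\<exists>E\<subseteq>carrier B. V = {p \<in> Proj_pts B G. E \<subseteq> p})"
    by (metis (no_types, lifting) double_diff eq mem_Collect_eq order_refl subsetI)
  thus "closedin (pts (Proj B G)) V \<longleftrightarrow> (\<exists>E\<subseteq>carrier B. V = {p \<in> Proj_pts B G. E \<subseteq> p})"
    unfolding closedin_def t unfolding pts op .
qed

lemma cring_LS_quot: "ideal J (LS_ring b) \<Longrightarrow> cring (LS_quot b J)"
  unfolding LS_quot_def by (intro quotient_algebra.cring_quot quotient_algebra.intro kalgebra_LS_ring)

text \<open>All closed subschemes are compared in the polynomial ring: \<open>point b\<close> identifies the homogeneous primes there that contain
  \<open>LS_ideal b\<close> with the points of the Proj of the discrete LS algebra.\<close>

abbreviation point where "point b P \<equiv> a_r_coset (LS_ring b) (LS_ideal b) ` P"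

lemma closed_subset_eq:
  assumes J: "hom_generated b J" "LS_ideal b \<subseteq> J"
  shows "closed_subset b J = point b ` {P \<in> hom_primes b. J \<subseteq> P}"
proof -
  let ?R = "LS_ring b" and ?I = "LS_ideal b"
  let ?\<phi> = "a_r_coset ?R ?I" and ?\<psi> = "a_r_coset ?R J"
  interpret I: quotient_algebra ?R ?I by (intro quotient_algebra.intro kalgebra_LS_ring LS_ideal_ideal)
  have Ji: "ideal J ?R" using J by (simp add: hom_generated_def)
  interpret J: quotient_algebra ?R J by (intro quotient_algebra.intro kalgebra_LS_ring Ji)
  have un: "(\<Union>g\<in>?\<phi> f. ?\<psi> g) = ?\<psi> f" if f: "f \<in> carrier ?R" for f
  proof -
    have self: "f \<in> ?\<phi> f" 
      by (rule abelian_subgroup.a_rcos_self[OF abelian_subgroupI3[OF ideal.axioms(1)[OF LS_ideal_ideal] I.is_abelian_group] f])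
    have "?\<psi> g = ?\<psi> f" if g: "g \<in> ?\<phi> f" for g
    proof -
      obtain i where i: "i \<in> ?I" "g = i \<oplus>\<^bsub>?R\<^esub> f" using g unfolding a_r_coset_def' by blast
      have ic: "i \<in> carrier ?R" by (rule ideal.Icarr[OF LS_ideal_ideal i(1)])
      have gc: "g \<in> carrier ?R" unfolding i(2) by (rule I.a_closed[OF ic f])
      have "g \<ominus>\<^bsub>?R\<^esub> f = i" unfolding i(2) using ic f by (simp add: I.minus_eq I.a_assoc I.r_neg del: LS_ring_simps)
      thus ?thesis using J.proj_eq_iff[OF gc f] i(1) J(2) by blast
    qed
    thus ?thesis using self by blast
  qed
  have fst: "fst (closed_incl b J) q = point b {f \<in> carrier ?R. ?\<psi> f \<in> q}" for q
  proof -
    have "fst (closed_incl b J) q = {x \<in> carrier (quot_alg ?R ?I). (\<Union>f\<in>x. ?\<psi> f) \<in> q}"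
      by (simp add: closed_incl_def Proj_induced_def induced_def LS_quot_def)
    also have "\<dots> = point b {f \<in> carrier ?R. ?\<psi> f \<in> q}"
      unfolding I.carrier_quot
    proof (intro Set.set_eqI iffI)
      fix x assume "x \<in> {x \<in> ?\<phi> ` carrier ?R. (\<Union>f\<in>x. ?\<psi> f) \<in> q}"
      then obtain f where f: "f \<in> carrier ?R" "x = ?\<phi> f" "(\<Union>f\<in>x. ?\<psi> f) \<in> q" by blast
      hence "?\<psi> f \<in> q" using un[OF f(1)] by simp
      thus "x \<in> point b {f \<in> carrier ?R. ?\<psi> f \<in> q}" using f(1,2) by blast
    next
      fix x assume "x \<in> point b {f \<in> carrier ?R. ?\<psi> f \<in> q}"
      then obtain f where f: "f \<in> carrier ?R" "x = ?\<phi> f" "?\<psi> f \<in> q" by blast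
      hence "(\<Union>f\<in>x. ?\<psi> f) \<in> q" using un[OF f(1)] by simp
      thus "x \<in> {x \<in> ?\<phi> ` carrier ?R. (\<Union>f\<in>x. ?\<psi> f) \<in> q}" using f(1,2) by blast
    qed
    finally show ?thesis .
  qed
  have "(\<lambda>q. {f \<in> carrier ?R. ?\<psi> f \<in> q}) ` quot_primes b J = {P \<in> hom_primes b. J \<subseteq> P}"
  proof (rule equalityI)
    show "(\<lambda>q. {f \<in> carrier ?R. ?\<psi> f \<in> q}) ` quot_primes b J \<subseteq> {P \<in> hom_primes b. J \<subseteq> P}"
      using primes_of_quotient(1)[OF J(1)] by blast
    show "{P \<in> hom_primes b. J \<subseteq> P} \<subseteq> (\<lambda>q. {f \<in> carrier ?R. ?\<psi> f \<in> q}) ` quot_primes b J"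
    proof
      fix P assume "P \<in> {P \<in> hom_primes b. J \<subseteq> P}"
      hence "?\<psi> ` P \<in> quot_primes b J" "{f \<in> carrier ?R. ?\<psi> f \<in> ?\<psi> ` P} = P"
        using primes_of_quotient(2)[OF J(1), of P] by blast+
      thus "P \<in> (\<lambda>q. {f \<in> carrier ?R. ?\<psi> f \<in> q}) ` quot_primes b J"
        by (intro image_eqI[of _ _ "?\<psi> ` P"]) (rule sym)
    qed
  qed
  thus ?thesis
    unfolding closed_subset_def closedin_Proj(2)[OF cring_LS_quot[OF Ji]] fst
    by (metis (no_types, lifting) image_cong image_image)
qed

lemma point_inj:
  assumes "P \<in> hom_primes b" "LS_ideal b \<subseteq> P" "P' \<in> hom_primes b" "LS_ideal b \<subseteq> P'" "point b P = point b P'"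
  shows "P = P'"
  using primes_of_quotient(2)[OF hom_generated_LS_ideal assms(1,2)]
    primes_of_quotient(2)[OF hom_generated_LS_ideal assms(3,4)] assms(5) by simp

lemma points_eq:
  "topspace (pts (LS_Proj b (LS_ideal b))) = point b ` {P \<in> hom_primes b. LS_ideal b \<subseteq> P}"
proof -
  note h = primes_of_quotient[OF hom_generated_LS_ideal[of b]]
  have "quot_primes b (LS_ideal b) = point b ` {P \<in> hom_primes b. LS_ideal b \<subseteq> P}"
  proof (rule equalityI)
    show "quot_primes b (LS_ideal b) \<subseteq> point b ` {P \<in> hom_primes b. LS_ideal b \<subseteq> P}"
    proof
      fix p assume p: "p \<in> quot_primes b (LS_ideal b)"
      let ?P = "{f \<in> carrier (LS_ring b). a_r_coset (LS_ring b) (LS_ideal b) f \<in> p}"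
      have "?P \<in> {P \<in> hom_primes b. LS_ideal b \<subseteq> P}" using h(1)[OF p] by blast
      moreover have "p = point b ?P" using h(1)[OF p] by simp
      ultimately show "p \<in> point b ` {P \<in> hom_primes b. LS_ideal b \<subseteq> P}" by (rule image_eqI[rotated])
    qed
    show "point b ` {P \<in> hom_primes b. LS_ideal b \<subseteq> P} \<subseteq> quot_primes b (LS_ideal b)"
      using h(2) by blast
  qed
  thus ?thesis unfolding closedin_Proj(2)[OF cring_LS_quot[OF LS_ideal_ideal]] .
qed

lemma closed_subset_Int:
  assumes J: "hom_generated b J" "LS_ideal b \<subseteq> J" and J': "hom_generated b J'" "LS_ideal b \<subseteq> J'"
    and N: "hom_generated b N" "LS_ideal b \<subseteq> N"
    and iff: "\<And>P. P \<in> hom_primes b \<Longrightarrow> N \<subseteq> P \<longleftrightarrow> J \<subseteq> P \<and> J' \<subseteq> P"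
  shows "closed_subset b J \<inter> closed_subset b J' = closed_subset b N"
  unfolding closed_subset_eq[OF J] closed_subset_eq[OF J'] closed_subset_eq[OF N]
proof (rule equalityI)
  show "point b ` {P \<in> hom_primes b. J \<subseteq> P} \<inter> point b ` {P \<in> hom_primes b. J' \<subseteq> P}
    \<subseteq> point b ` {P \<in> hom_primes b. N \<subseteq> P}"
  proof
    fix x assume "x \<in> point b ` {P \<in> hom_primes b. J \<subseteq> P} \<inter> point b ` {P \<in> hom_primes b. J' \<subseteq> P}"
    then obtain P P' where P: "x = point b P" "P \<in> hom_primes b" "J \<subseteq> P"
      and P': "x = point b P'" "P' \<in> hom_primes b" "J' \<subseteq> P'" by blast
    have "P = P'"
      by (rule point_inj[OF P(2) _ P'(2)]) (use P P' J(2) J'(2) in auto)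
    hence "N \<subseteq> P" using iff[OF P(2)] P(3) P'(3) by simp
    thus "x \<in> point b ` {P \<in> hom_primes b. N \<subseteq> P}" using P(1,2) by blast
  qed
qed (use iff in blast)

section \<open>Irreducible components\<close>

lemma irreducible_subset_of_Union:
  assumes Z: "irreducible_set T Z" and F: "finite F" "\<And>V. V \<in> F \<Longrightarrow> closedin T V" "Z \<subseteq> \<Union>F"
  shows "\<exists>V\<in>F. Z \<subseteq> V"
  using F
proof (induction F rule: finite_induct)
  case empty
  thus ?case using Z by (simp add: irreducible_set_def)
next
  case (insert V F)
  have "closedin T (\<Union>F)" using insert by (intro closedin_Union) auto
  moreover have "Z \<subseteq> V \<union> \<Union>F" using insert.prems by simp
  ultimately have "Z \<subseteq> V \<or> Z \<subseteq> \<Union>F" using Z insert.prems(1)[of V] unfolding irreducible_set_def by blast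
  thus ?case using insert by blast
qed

lemma irreducible_components_eqI:
  assumes F: "finite F" and closed: "\<And>V. V \<in> F \<Longrightarrow> closedin T V" and irr: "\<And>V. V \<in> F \<Longrightarrow> irreducible_set T V"
    and cover: "topspace T \<subseteq> \<Union>F" and anti: "\<And>V W. V \<in> F \<Longrightarrow> W \<in> F \<Longrightarrow> V \<subseteq> W \<Longrightarrow> V = W"
  shows "irreducible_components T = F"
proof -
  have below: "\<exists>V\<in>F. Z \<subseteq> V" if "irreducible_set T Z" for Z
    using irreducible_subset_of_Union[OF that F closed] that cover unfolding irreducible_set_def by blast
  show ?thesis
    unfolding irreducible_components_def
  proof (intro Set.set_eqI iffI)
    fix Z assume Z: "Z \<in> {Z. irreducible_set T Z \<and> (\<forall>Z'. irreducible_set T Z' \<and> Z \<subseteq> Z' \<longrightarrow> Z' = Z)}"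
    have iZ: "irreducible_set T Z" and max: "\<And>Z'. irreducible_set T Z' \<Longrightarrow> Z \<subseteq> Z' \<Longrightarrow> Z' = Z" using Z by simp_all
    obtain V where V: "V \<in> F" "Z \<subseteq> V" using below[OF iZ] by (elim bexE)
    have "V = Z" by (rule max[OF irr[OF V(1)] V(2)])
    thus "Z \<in> F" using V(1) by simp
  next
    fix V assume V: "V \<in> F"
    have "Z' = V" if Z': "irreducible_set T Z'" "V \<subseteq> Z'" for Z'
    proof -
      obtain W where "W \<in> F" "Z' \<subseteq> W" using below[OF Z'(1)] by blast
      thus ?thesis using anti[OF V, of W] Z'(2) by blast
    qed
    thus "V \<in> {Z. irreducible_set T Z \<and> (\<forall>Z'. irreducible_set T Z' \<and> Z \<subseteq> Z' \<longrightarrow> Z' = Z)}" using irr[OF V] by blast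
  qed
qed

context
  fixes b :: "'s::{finite, order} \<Rightarrow> 's \<Rightarrow> nat" and field_type :: "'k::field itself"
  assumes pwb: "poset_with_bonds b"
begin

abbreviation R\<^sub>b where "R\<^sub>b \<equiv> (LS_ring b :: (('s, 'k) lspoly, 'k) kalg)"
abbreviation I\<^sub>b where "I\<^sub>b C \<equiv> (chain_ideal b C :: ('s, 'k) lspoly set)"

lemma chain_ideal_prime:
  assumes C: "is_chain C" "C \<noteq> {}"
  shows "I\<^sub>b C \<in> hom_primes b" "\<And>\<sigma>. \<sigma> \<in> C \<Longrightarrow> LS_var (\<lambda>\<tau>. if \<tau> = \<sigma> then 1 else 0) \<notin> I\<^sub>b C"
proof -
  obtain es n where es: "ls_chain b es n" "set es = C" by (rule ls_chain_exists[OF pwb C])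
  interpret ls_chain_algebra b es n "TYPE('k)" using es(1) by (simp add: ls_chain_algebra_def)
  let ?P = "{f \<in> carrier R. a_r_coset R I f \<in> {\<zero>\<^bsub>LS_quot b I\<^esub>}}"
  have "?P \<in> hom_primes b"
    using primes_of_quotient(1)[OF hom_generated_chain_ideal toric_algebra.zero_prime[OF toric_algebra_quot]] by blast
  moreover have "?P = I"
    using graded_epi_LS_quot(2)[OF hom_generated_chain_ideal[of b E]] ideal_LS_ring(1)[OF chain_ideal_ideal[of b E]] by blast
  ultimately show "I\<^sub>b C \<in> hom_primes b" using es(2) by simp
  fix \<sigma> assume "\<sigma> \<in> C"
  moreover have "single v (1 :: 'k) \<noteq> 0" for v :: "nat \<Rightarrow>\<^sub>0 int"
    by (metis lookup_single_eq lookup_zero zero_neq_one)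
  ultimately have "\<Psi>0 (LS_var (\<lambda>\<tau>. if \<tau> = \<sigma> then 1 else 0)) \<noteq> 0"
    using \<Psi>0_var[OF indicator_LS1[of \<sigma> b]] es(2) unfolding supp_indicator by (simp add: lmonom_def)
  thus "LS_var (\<lambda>\<tau>. if \<tau> = \<sigma> then 1 else 0) \<notin> I\<^sub>b C" using chain_ideal_eq_kernel es(2) by blast
qed

text \<open>
  For \<open>\<sigma>\<close> in \<open>C\<close> but not in \<open>D\<close>, the variable of the path
  concentrated in \<open>\<sigma>\<close> lies in \<open>I\<^sub>b D\<close> but not in \<open>I\<^sub>b
  C\<close>.
\<close>

lemma chain_ideal_antimono:
  assumes C: "is_chain C" "C \<noteq> {}" and sub: "I\<^sub>b D \<subseteq> I\<^sub>b C"
  shows "C \<subseteq> D"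
proof
  fix \<sigma> assume s: "\<sigma> \<in> C"
  show "\<sigma> \<in> D"
  proof (rule ccontr)
    assume "\<sigma> \<notin> D"
    hence "\<not> supp (\<lambda>\<tau>. if \<tau> = \<sigma> then 1 else (0::rat)) \<subseteq> D" unfolding supp_indicator by simp
    hence "LS_var (\<lambda>\<tau>. if \<tau> = \<sigma> then 1 else 0) \<in> I\<^sub>b D" by (rule chain_ideal_contains(3)[OF indicator_LS1])
    thus False using chain_ideal_prime(2)[OF C s] sub by blast
  qed
qed

lemma chain_extends_to_maximal:
  fixes C :: "'s set"
  assumes "is_chain C"
  shows "\<exists>D. maximal_chain D \<and> C \<subseteq> D"
proof -
  let ?A = "{D. is_chain D \<and> C \<subseteq> D}"
  have fin: "finite ?A" by (rule finite_subset[of _ "Pow UNIV"]) auto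
  have "?A \<noteq> {}" using assms by blast
  from finite_has_maximal[OF fin this] obtain D where D: "D \<in> ?A" "\<forall>D'\<in>?A. D \<subseteq> D' \<longrightarrow> D = D'" by (elim bexE)
  hence "maximal_chain D" unfolding maximal_chain_def by blast
  thus ?thesis using D(1) by blast
qed

text \<open>
  Ensures that the intersection of two maximal chains is not empty, so that it is a chain to which the toric
  description applies.
\<close>

lemma least_in_maximal_chains: "\<exists>\<sigma>. \<forall>C. maximal_chain C \<longrightarrow> \<sigma> \<in> (C :: 's set)"
proof -
  have ex1: "\<exists>!\<sigma>::'s. \<forall>\<tau>. \<not> \<tau> < \<sigma>" using pwb unfolding poset_with_bonds_def by (rule conjunct1)
  define \<sigma> :: 's where "\<sigma> = (THE \<sigma>. \<forall>\<tau>. \<not> \<tau> < \<sigma>)"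
  have \<sigma>: "x = \<sigma>" if "\<forall>\<tau>. \<not> \<tau> < x" for x :: 's
    unfolding \<sigma>_def by (rule the1_equality[OF ex1 that, symmetric])
  have least: "\<sigma> \<le> \<tau>" for \<tau>
  proof -
    obtain m where m: "m \<in> {x. x \<le> \<tau>}" "\<And>x. x \<in> {x. x \<le> \<tau>} \<Longrightarrow> x \<le> m \<Longrightarrow> m = x"
      using finite_has_minimal[of "{x. x \<le> \<tau>}"] by auto
    have "\<not> x < m" for x using m by (metis less_le_not_le mem_Collect_eq order_trans)
    hence "m = \<sigma>" using \<sigma>[of m] by blast
    thus ?thesis using m(1) by simp
  qed
  have "\<sigma> \<in> C" if C: "maximal_chain C" for C
  proof -
    have "is_chain (insert \<sigma> C)"
      using C least unfolding maximal_chain_def Complete_Partial_Order.chain_def by blast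
    hence "insert \<sigma> C = C" using C unfolding maximal_chain_def by blast
    thus ?thesis by blast
  qed
  thus ?thesis by blast
qed

lemma standard_imp_comparable:
  assumes p: "\<pi> \<in> LS1 b" "\<rho> \<in> LS1 b" and std: "standard {#\<pi>, \<rho>#}"
  shows "comparable_supports {#\<pi>, \<rho>#}"
proof -
  obtain xs where xs: "mset xs = {#\<pi>, \<rho>#}"
    "successively (\<lambda>\<pi> \<rho>. \<forall>\<sigma>\<in>supp \<pi>. \<forall>\<tau>\<in>supp \<rho>. \<sigma> \<le> \<tau>) xs" using std unfolding standard_def by blast
  have "length xs = 2" using arg_cong[OF xs(1), of size] by simp
  then obtain a c where "xs = [a, c]" by (auto simp: numeral_2_eq_2 length_Suc_conv)
  hence "xs = [\<pi>, \<rho>] \<or> xs = [\<rho>, \<pi>]" using xs(1) by (auto simp: add_eq_conv_ex)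
  hence cr: "\<sigma> \<le> \<tau> \<or> \<tau> \<le> \<sigma>" if "\<sigma> \<in> supp \<pi>" "\<tau> \<in> supp \<rho>" for \<sigma> \<tau> using xs(2) that by auto
  have "is_chain (supp \<pi>)" "is_chain (supp \<rho>)" using p by (auto simp: LS1_def LS_path_def)
  hence "is_chain (supp \<pi> \<union> supp \<rho>)" using cr unfolding Complete_Partial_Order.chain_def by blast
  thus ?thesis by (simp add: comparable_supports_def)
qed

text \<open>
  Modulo a prime, the variables that do not vanish have pairwise comparable supports, since products of
  two variables with incomparable supports are relations.
\<close>

lemma prime_contains_chain_ideal:
  assumes P: "P \<in> hom_primes b" "LS_ideal b \<subseteq> P"
  shows "\<exists>C. maximal_chain C \<and> I\<^sub>b C \<subseteq> P"
proof -
  have pr: "primeideal P R\<^sub>b" using P by (simp add: Proj_pts_def)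
  define N where "N = {\<pi> \<in> LS1 b. LS_var \<pi> \<notin> P}"
  have cmp: "comparable_supports {#\<pi>, \<rho>#}" if "\<pi> \<in> N" "\<rho> \<in> N" for \<pi> \<rho>
  proof (rule ccontr)
    assume n: "\<not> comparable_supports {#\<pi>, \<rho>#}"
    have p: "\<pi> \<in> LS1 b" "\<rho> \<in> LS1 b" using that by (auto simp: N_def)
    hence "\<not> standard {#\<pi>, \<rho>#}" using n standard_imp_comparable by blast
    hence "LS_var \<pi> * LS_var \<rho> \<in> LS_gens b" using p n unfolding LS_gens_def by blast
    hence "LS_var \<pi> * LS_var \<rho> \<in> P" using chain_ideal_contains(1)[of b] P(2) by blast
    thus False
      using primeideal.I_prime[OF pr LS_var_carrier[OF p(1)] LS_var_carrier[OF p(2)]] that unfolding LS_ring_simps N_def by blast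
  qed
  have "is_chain (\<Union>\<pi>\<in>N. supp \<pi>)"
    unfolding Complete_Partial_Order.chain_def
  proof (intro ballI)
    fix \<sigma> \<tau> assume "\<sigma> \<in> (\<Union>\<pi>\<in>N. supp \<pi>)" "\<tau> \<in> (\<Union>\<pi>\<in>N. supp \<pi>)"
    then obtain \<pi> \<rho> where s: "\<pi> \<in> N" "\<sigma> \<in> supp \<pi>" "\<rho> \<in> N" "\<tau> \<in> supp \<rho>" by blast
    have "is_chain (supp \<pi> \<union> supp \<rho>)" using cmp[OF s(1,3)] by (simp add: comparable_supports_def)
    thus "\<sigma> \<le> \<tau> \<or> \<tau> \<le> \<sigma>" using s(2,4) unfolding Complete_Partial_Order.chain_def by blast
  qed
  then obtain C where C: "maximal_chain C" "(\<Union>\<pi>\<in>N. supp \<pi>) \<subseteq> C" using chain_extends_to_maximal by blast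
  have "I\<^sub>b C \<subseteq> P"
    by (rule chain_ideal_least[OF primeideal.axioms(1)[OF pr] P(2)]) (use C(2) in \<open>auto simp: N_def\<close>)
  thus ?thesis using C(1) by blast
qed

abbreviation X\<^sub>b where "X\<^sub>b C \<equiv> closed_subset b (I\<^sub>b C)"

lemma closed_subset_chain_ideal:
  "X\<^sub>b C = point b ` {P \<in> hom_primes b. I\<^sub>b C \<subseteq> P}"
  by (rule closed_subset_eq[OF hom_generated_chain_ideal chain_ideal_contains(2)])

lemma closedin_chain_ideal:
  "closedin (pts (LS_Proj b (LS_ideal b))) (X\<^sub>b C)"
proof -
  let ?B = "LS_quot b (LS_ideal b :: ('s, 'k) lspoly set)" and ?H = "LS_quot_grading b (LS_ideal b :: ('s, 'k) lspoly set)"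
  note h = primes_of_quotient[OF hom_generated_LS_ideal[of b]]
  interpret I: quotient_algebra R\<^sub>b "LS_ideal b" by (intro quotient_algebra.intro kalgebra_LS_ring LS_ideal_ideal)
  have ic: "I\<^sub>b C \<subseteq> carrier R\<^sub>b" using ideal_LS_ring(1)[OF chain_ideal_ideal] by blast
  have c: "point b (I\<^sub>b C) \<subseteq> carrier ?B" using ic I.proj_simps(1) unfolding LS_quot_def by blast
  have "X\<^sub>b C = {p \<in> Proj_pts ?B ?H. point b (I\<^sub>b C) \<subseteq> p}"
    unfolding closed_subset_chain_ideal
  proof (rule equalityI)
    show "point b ` {P \<in> hom_primes b. I\<^sub>b C \<subseteq> P} \<subseteq> {p \<in> Proj_pts ?B ?H. point b (I\<^sub>b C) \<subseteq> p}"
    proof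
      fix p assume "p \<in> point b ` {P \<in> hom_primes b. I\<^sub>b C \<subseteq> P}"
      then obtain P where P: "p = point b P" "P \<in> hom_primes b" "I\<^sub>b C \<subseteq> P" by blast
      have "LS_ideal b \<subseteq> P" using chain_ideal_contains(2) P(3) by blast
      hence "p \<in> Proj_pts ?B ?H" using h(2)[OF P(2)] P(1) by blast
      moreover have "point b (I\<^sub>b C) \<subseteq> p" unfolding P(1) by (rule image_mono[OF P(3)])
      ultimately show "p \<in> {p \<in> Proj_pts ?B ?H. point b (I\<^sub>b C) \<subseteq> p}" by simp
    qed
    show "{p \<in> Proj_pts ?B ?H. point b (I\<^sub>b C) \<subseteq> p} \<subseteq> point b ` {P \<in> hom_primes b. I\<^sub>b C \<subseteq> P}"
    proof
      fix p assume "p \<in> {p \<in> Proj_pts ?B ?H. point b (I\<^sub>b C) \<subseteq> p}"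
      hence p: "p \<in> Proj_pts ?B ?H" "point b (I\<^sub>b C) \<subseteq> p" by blast+
      let ?P = "{f \<in> carrier R\<^sub>b. a_r_coset R\<^sub>b (LS_ideal b) f \<in> p}"
      have "I\<^sub>b C \<subseteq> ?P" using p(2) ic by blast
      hence "?P \<in> {P \<in> hom_primes b. I\<^sub>b C \<subseteq> P}" using h(1)[OF p(1)] by blast
      moreover have "p = point b ?P" using h(1)[OF p(1)] by simp
      ultimately show "p \<in> point b ` {P \<in> hom_primes b. I\<^sub>b C \<subseteq> P}" by (rule image_eqI[rotated])
    qed
  qed
  thus ?thesis unfolding closedin_Proj(1)[OF cring_LS_quot[OF LS_ideal_ideal]] using c by blast
qed

text \<open>The prime \<open>I\<^sub>b C\<close> is a generic point.\<close>

lemma irreducible_chain_ideal: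
  assumes C: "is_chain C" "C \<noteq> {}"
  shows "irreducible_set (pts (LS_Proj b (LS_ideal b))) (X\<^sub>b C)"
proof -
  let ?T = "pts (LS_Proj b (LS_ideal b :: ('s, 'k) lspoly set))"
  let ?p = "point b (I\<^sub>b C)"
  have pX: "?p \<in> X\<^sub>b C" unfolding closed_subset_chain_ideal using chain_ideal_prime(1)[OF C] by blast
  have gen: "X\<^sub>b C \<subseteq> V" if V: "closedin ?T V" "?p \<in> V" for V
  proof
    fix q assume q: "q \<in> X\<^sub>b C"
    obtain E where E: "V = {p \<in> quot_primes b (LS_ideal b). E \<subseteq> p}"
      using V(1) unfolding closedin_Proj(1)[OF cring_LS_quot[OF LS_ideal_ideal]] by blast
    have "?p \<subseteq> q" using q unfolding closed_subset_chain_ideal by blast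
    hence "E \<subseteq> q" using V(2) E by blast
    moreover have "q \<in> topspace ?T" using closedin_subset[OF closedin_chain_ideal] q by blast
    ultimately show "q \<in> V" unfolding E closedin_Proj(2)[OF cring_LS_quot[OF LS_ideal_ideal]] by simp
  qed
  show ?thesis
    unfolding irreducible_set_def
  proof (intro conjI allI impI)
    show "X\<^sub>b C \<subseteq> topspace ?T" by (rule closedin_subset[OF closedin_chain_ideal])
    show "X\<^sub>b C \<noteq> {}" using pX by blast
    fix V W assume VW: "closedin ?T V \<and> closedin ?T W \<and> X\<^sub>b C \<subseteq> V \<union> W"
    hence "?p \<in> V \<or> ?p \<in> W" using pX by blast
    thus "X\<^sub>b C \<subseteq> V \<or> X\<^sub>b C \<subseteq> W" using gen VW by blast
  qed
qed

lemma irreducible_components_LS_Proj: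
  "{X\<^sub>b C | C. maximal_chain C} = irreducible_components (pts (LS_Proj b (LS_ideal b)))"
proof -
  have mc: "is_chain C" "C \<noteq> {}" if "maximal_chain C" for C :: "'s set"
    using that least_in_maximal_chains unfolding maximal_chain_def by blast+
  have sub: "D = C" if C: "maximal_chain C" and D: "maximal_chain D" and s: "X\<^sub>b C \<subseteq> X\<^sub>b D" for C D
  proof -
    have pC: "I\<^sub>b C \<in> hom_primes b" by (rule chain_ideal_prime(1)[OF mc[OF C]])
    hence "point b (I\<^sub>b C) \<in> X\<^sub>b D" using s unfolding closed_subset_chain_ideal by blast
    then obtain P where P: "point b (I\<^sub>b C) = point b P" "P \<in> hom_primes b" "I\<^sub>b D \<subseteq> P"
      unfolding closed_subset_chain_ideal by blast
    have "I\<^sub>b C = P"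
      by (rule point_inj[OF pC chain_ideal_contains(2) P(2) subset_trans[OF chain_ideal_contains(2) P(3)] P(1)])
    hence "C \<subseteq> D" using chain_ideal_antimono[OF mc[OF C]] P(3) by blast
    thus ?thesis using C mc(1)[OF D] unfolding maximal_chain_def by blast
  qed
  have fin: "finite {X\<^sub>b C | C. maximal_chain C}"
  proof -
    have "finite {C :: 's set. maximal_chain C}" by (rule finite_subset[of _ "Pow UNIV"]) auto
    hence "finite (X\<^sub>b ` {C. maximal_chain C})" by (rule finite_imageI)
    moreover have "{X\<^sub>b C | C. maximal_chain C} = X\<^sub>b ` {C. maximal_chain C}" by blast
    ultimately show ?thesis by simp
  qed
  have "irreducible_components (pts (LS_Proj b (LS_ideal b))) = {X\<^sub>b C | C. maximal_chain C}"
  proof (rule irreducible_components_eqI[OF fin])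
    fix V assume "V \<in> {X\<^sub>b C | C. maximal_chain C}"
    then obtain C where C: "V = X\<^sub>b C" "maximal_chain C" by blast
    show "closedin (pts (LS_Proj b (LS_ideal b))) V" unfolding C(1) by (rule closedin_chain_ideal)
    show "irreducible_set (pts (LS_Proj b (LS_ideal b))) V" unfolding C(1) by (rule irreducible_chain_ideal[OF mc[OF C(2)]])
  next
    show "topspace (pts (LS_Proj b (LS_ideal b))) \<subseteq> \<Union>{X\<^sub>b C | C. maximal_chain C}"
    proof
      fix p assume "p \<in> topspace (pts (LS_Proj b (LS_ideal b :: ('s, 'k) lspoly set)))"
      then obtain P where P: "p = point b P" "P \<in> hom_primes b" "LS_ideal b \<subseteq> P" unfolding points_eq by blast
      obtain C where "maximal_chain C" "I\<^sub>b C \<subseteq> P" using prime_contains_chain_ideal[OF P(2,3)] by blast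
      hence "p \<in> X\<^sub>b C" "maximal_chain C" using P unfolding closed_subset_chain_ideal by blast+
      thus "p \<in> \<Union>{X\<^sub>b C | C. maximal_chain C}" by blast
    qed
    fix V W assume "V \<in> {X\<^sub>b C | C. maximal_chain C}" "W \<in> {X\<^sub>b C | C. maximal_chain C}" and s: "V \<subseteq> W"
    then obtain C D where "V = X\<^sub>b C" "maximal_chain C" "W = X\<^sub>b D" "maximal_chain D" by blast
    thus "V = W" using sub[of C D] s by simp
  qed
  thus ?thesis by (rule sym)
qed

lemma closed_subset_chain_Int:
  "X\<^sub>b C \<inter> X\<^sub>b D = closed_subset b (I\<^sub>b C <+>\<^bsub>R\<^sub>b\<^esub> I\<^sub>b D)"
  unfolding chain_ideal_sum
proof (rule closed_subset_Int; (rule hom_generated_chain_ideal chain_ideal_contains(2))?)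
  fix P assume "P \<in> (hom_primes b :: ('s, 'k) lspoly set set)"
  hence "ideal P R\<^sub>b" by (simp add: Proj_pts_def primeideal.axioms(1))
  note P = ideal_LS_ring(2,3)[OF this]
  note z = ideal_LS_ring(2)[OF chain_ideal_ideal[of b]]
  have elem: "f \<in> I\<^sub>b (C \<inter> D) \<longleftrightarrow> (\<exists>g\<in>I\<^sub>b C. \<exists>h\<in>I\<^sub>b D. f = g + h)" for f
    unfolding chain_ideal_sum[symmetric] set_add_def' LS_ring_simps by blast
  show "I\<^sub>b (C \<inter> D) \<subseteq> P \<longleftrightarrow> I\<^sub>b C \<subseteq> P \<and> I\<^sub>b D \<subseteq> P"
  proof
    assume sub: "I\<^sub>b (C \<inter> D) \<subseteq> P"
    have "f \<in> P" if f: "f \<in> I\<^sub>b C \<or> f \<in> I\<^sub>b D" for f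
    proof -
      have "f = f + 0" "f = 0 + f" by simp_all
      thus ?thesis using elem[of f] z sub f by blast
    qed
    thus "I\<^sub>b C \<subseteq> P \<and> I\<^sub>b D \<subseteq> P" by blast
  next
    assume sub: "I\<^sub>b C \<subseteq> P \<and> I\<^sub>b D \<subseteq> P"
    show "I\<^sub>b (C \<inter> D) \<subseteq> P"
    proof
      fix f assume "f \<in> I\<^sub>b (C \<inter> D)"
      then obtain g h where "g \<in> I\<^sub>b C" "h \<in> I\<^sub>b D" "f = g + h" unfolding elem by blast
      thus "f \<in> P" using sub P(2)[of g h] by blast
    qed
  qed
qed

end

theorem theorem0p5p2:
  fixes b :: "'s::{finite, order} \<Rightarrow> 's \<Rightarrow> nat"
  assumes "poset_with_bonds b"
  shows "let R = (LS_ring b :: (('s, 'k::field) lspoly, 'k) kalg);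
             I = LS_ideal b;
             I\<^sub>C = chain_ideal b;
             normal_toric = (\<lambda>J. projective_normal_toric (LS_quot b J) (LS_quot_grading b J))
         in {closed_subset b (I\<^sub>C C) | C. maximal_chain C} = irreducible_components (pts (LS_Proj b I)) \<and>
            (\<forall>C. maximal_chain C \<longrightarrow> normal_toric (I\<^sub>C C)) \<and>
            (\<forall>C D. maximal_chain C \<and> maximal_chain D \<longrightarrow>
               closed_subset b (I\<^sub>C C) \<inter> closed_subset b (I\<^sub>C D)
                 = closed_subset b (I\<^sub>C C <+>\<^bsub>R\<^esub> I\<^sub>C D) \<and>
               normal_toric (I\<^sub>C C <+>\<^bsub>R\<^esub> I\<^sub>C D))"
proof -
  have nt: "projective_normal_toric (LS_quot b (chain_ideal b (C \<inter> D) :: ('s, 'k) lspoly set)) (LS_quot_grading b (chain_ideal b (C \<inter> D)))"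
    if CD: "maximal_chain C" "maximal_chain D" for C D
  proof (rule chain_ideal_normal_toric[OF assms])
    show "is_chain (C \<inter> D)" using CD(1) unfolding maximal_chain_def Complete_Partial_Order.chain_def by blast
    show "C \<inter> D \<noteq> {}" using least_in_maximal_chains[OF assms] CD by blast
  qed
  show ?thesis
    unfolding Let_def
  proof (intro conjI allI impI)
    show "{closed_subset b (chain_ideal b C :: ('s, 'k) lspoly set) | C. maximal_chain C}
      = irreducible_components (pts (LS_Proj b (LS_ideal b)))" by (rule irreducible_components_LS_Proj[OF assms])
    show "projective_normal_toric (LS_quot b (chain_ideal b C :: ('s, 'k) lspoly set)) (LS_quot_grading b (chain_ideal b C))"
      if "maximal_chain C" for C using nt[OF that that] by simp
    fix C D :: "'s set" assume "maximal_chain C \<and> maximal_chain D"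
    hence CD: "maximal_chain C" "maximal_chain D" by blast+
    show "closed_subset b (chain_ideal b C) \<inter> closed_subset b (chain_ideal b D)
        = closed_subset b (chain_ideal b C <+>\<^bsub>(LS_ring b :: (('s, 'k) lspoly, 'k) kalg)\<^esub> chain_ideal b D)"
      by (rule closed_subset_chain_Int[OF assms])
    show "projective_normal_toric
        (LS_quot b (chain_ideal b C <+>\<^bsub>(LS_ring b :: (('s, 'k) lspoly, 'k) kalg)\<^esub> chain_ideal b D))
        (LS_quot_grading b (chain_ideal b C <+>\<^bsub>(LS_ring b :: (('s, 'k) lspoly, 'k) kalg)\<^esub> chain_ideal b D))"
      unfolding chain_ideal_sum by (rule nt[OF CD])
  qed
qed

end
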